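(* Let $F=\mathbb{Q}(\sqrt d)$ with $d<0$ square-free and $d\neq-1,-3$, and let $I$ be a fractional ideal of $F$. Write $C_n(S)=\sum_{n\ge1}$-coefficients as follows: for a subset $S\subseteq\mathrm{Cl}_F$ put $A_S(s)=\sum_{n=1}^\infty\#\{[J]\in S:|I:J|=n\}\,n^{-s}$, and $B(s)=\sum_{n=1}^\infty\#\{[J]:|I:J|=n,\ [J]=[\overline J]\}\,n^{-s}$, with $J$ ranging over $\mathcal{O}_F$-ideals contained in $I$. Let $P(s)=\prod_{r\text{ ramified in }F}(1+r^{-s})$. (1) If $d\equiv1\pmod4$: $\mathrm{Refl}_I(s)=\dfrac{(1-2^{-s}+2\cdot2^{-2s})\zeta(s)^2}{2\zeta(2s)P(s)}B(s)$. (2) If $d\equiv2\pmod4$: $\mathrm{Refl}_I(s)=\dfrac{(1-2^{-s}+2\cdot2^{-2s})\zeta(s)^2}{2\zeta(2s)P(s)}B(s)+\dfrac{(2^{-s}-2^{-2s})\zeta(s)^2}{\zeta(2s)P(s)}A_{[\mathscr I_{\mathrm{ram}}]}(s)$. (3) If $d\equiv3\pmod4$: $\mathrm{Refl}_I(s)=\dfrac{(1-2^{-s}+2\cdot2^{-2s})\zeta(s)^2}{2\zeta(2s)P(s)}B(s)+\dfrac{2^{-s}\zeta(s)^2}{\zeta(2s)P(s)}A_{[\mathscr I_{\mathrm{ortho}}]}(s)-\dfrac{2^{-2s}\zeta(s)^2}{\zeta(2s)P(s)}A_{[\mathscr I_{\mathrm{ram}}]\setminus[\mathscr I_{\mathr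m{ortho}}]}(s)$.
   Context: $F$ is viewed as a quadratic space over $\mathbb{Q}$ with quadratic form $N_{F/\mathbb{Q}}$, orthogonal group $O(F)$, $O^+(F)=O(F)\cap\mathrm{SL}(F)$, $O^-(F)=O(F)\setminus O^+(F)$. For a $\mathbb{Z}$-lattice $L$ on $F$ and $\rho\in O(F)$ of finite order, $Z_{L,\rho}(s)=\sum_{K\subseteq L,\,|L:K|<\infty,\,\rho(K)=K}|L:K|^{-s}/\#\{\sigma\in O(F):\sigma(K)\subseteq L\}$, and $\mathrm{Refl}_I(s)=\sum_{\rho\in O^-(F)}Z_{I,\rho}(s)$. $\mathrm{Cl}_F$ is the class group, $[J]$ the class of $J$, $\overline J$ the complex conjugate ideal. $[\mathscr I_{\mathrm{ram}}]\le\mathrm{Cl}_F$ is the subgroup generated by the classes of all prime ideals of $\mathcal{O}_F$ lying over ramified primes; $[\mathscr I_{\mathrm{ortho}}]\le\mathrm{Cl}_F$ is the subgroup generated by the classes of all those ramified prime ideals except the one above $2$. $\zeta$ is the Riemann zeta function. *)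

theory Defs
  imports
    "HOL-Analysis.Infinite_Sum"
    "HOL-Analysis.Complex_Transcendental"
    "HOL-Algebra.Coset"
    "HOL-Algebra.Generated_Groups"
    "HOL-Algebra.Ideal"
    "HOL-Computational_Algebra.Polynomial"
    "HOL-Computational_Algebra.Squarefree"
    "HOL-Computational_Algebra.Group_Closure"
begin

section \<open>The imaginary quadratic field\<close>

text \<open>
  The field is realised inside the complex numbers.  All definitions are meant for
  square-free \<open>d < 0\<close>; then the non-trivial Galois automorphism is complex conjugation.
\<close>

definition quad_field :: "int \<Rightarrow> complex set" where
  "quad_field d = {of_rat x + of_rat y * csqrt (of_int d) | x y. True}"

definition field_norm :: "complex \<Rightarrow> complex" where
  "field_norm z = z * cnj z"

definition ring_of_ints :: "int \<Rightarrow> complex set" where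
  "ring_of_ints d = {x \<in> quad_field d. algebraic_int x}"

definition ring_of_ints_ring :: "int \<Rightarrow> complex ring" where
  "ring_of_ints_ring d =
     \<lparr>carrier = ring_of_ints d, mult = (*), one = 1, zero = 0, add = (+)\<rparr>"


section \<open>The orthogonal group\<close>

text \<open>
  Maps are required to be extensional (\<open>undefined\<close> outside the field), so that distinct
  functions represent distinct linear maps and cardinalities are the intended ones.
\<close>

definition GL_field :: "int \<Rightarrow> (complex \<Rightarrow> complex) set" where
  "GL_field d =
     {\<sigma> \<in> extensional (quad_field d).
        bij_betw \<sigma> (quad_field d) (quad_field d) \<and>
        (\<forall>x \<in> quad_field d. \<forall>y \<in> quad_field d. \<sigma> (x + y) = \<sigma> x + \<sigma> y) \<and>
        (\<forall>q. \<forall>x \<in> quad_field d. \<sigma> (of_rat q * x) = of_rat q * \<sigma> x)}"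

text \<open>The determinant is computed in the rational basis \<open>1\<close>, \<open>\<surd>d\<close>.\<close>

definition SL_field :: "int \<Rightarrow> (complex \<Rightarrow> complex) set" where
  "SL_field d =
     {\<sigma> \<in> GL_field d. \<exists>a b c e :: rat.
        \<sigma> 1 = of_rat a + of_rat b * csqrt (of_int d) \<and>
        \<sigma> (csqrt (of_int d)) = of_rat c + of_rat e * csqrt (of_int d) \<and>
        a * e - b * c = 1}"

definition O_field :: "int \<Rightarrow> (complex \<Rightarrow> complex) set" where
  "O_field d = {\<sigma> \<in> GL_field d. \<forall>x \<in> quad_field d. field_norm (\<sigma> x) = field_norm x}"

definition O_plus :: "int \<Rightarrow> (complex \<Rightarrow> complex) set" where
  "O_plus d = O_field d \<inter> SL_field d"

definition O_minus :: "int \<Rightarrow> (complex \<Rightarrow> complex) set" where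
  "O_minus d = O_field d - O_plus d"


section \<open>Sublattices and the zeta functions\<close>

definition additive_group :: "complex set \<Rightarrow> complex monoid" where
  "additive_group L = \<lparr>carrier = L, mult = (+), one = 0\<rparr>"

text \<open>Note that \<open>lattice_index\<close> is \<open>0\<close> if the index is infinite.\<close>

definition lattice_index :: "complex set \<Rightarrow> complex set \<Rightarrow> nat" where
  "lattice_index L K = card (rcosets\<^bsub>additive_group L\<^esub> K)"

definition finite_index_sublattice :: "complex set \<Rightarrow> complex set \<Rightarrow> bool" where
  "finite_index_sublattice L K \<longleftrightarrow>
     subgroup K (additive_group L) \<and> finite (rcosets\<^bsub>additive_group L\<^esub> K)"

definition stable_sublattices :: "complex set \<Rightarrow> (complex \<Rightarrow> complex) \<Rightarrow> complex set set" where
  "stable_sublattices L \<rho> = {K. finite_index_sublattice L K \<and> \<rho> ` K = K}"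

definition lattice_zeta_term :: "int \<Rightarrow> complex set \<Rightarrow> complex \<Rightarrow> complex set \<Rightarrow> complex" where
  "lattice_zeta_term d L s K =
     of_nat (lattice_index L K) powr (- s) / of_nat (card {\<sigma> \<in> O_field d. \<sigma> ` K \<subseteq> L})"

definition lattice_zeta ::
    "int \<Rightarrow> complex set \<Rightarrow> (complex \<Rightarrow> complex) \<Rightarrow> complex \<Rightarrow> complex" where
  "lattice_zeta d L \<rho> s = (\<Sum>\<^sub>\<infinity>K\<in>stable_sublattices L \<rho>. lattice_zeta_term d L s K)"

definition Refl_zeta :: "int \<Rightarrow> complex set \<Rightarrow> complex \<Rightarrow> complex" where
  "Refl_zeta d L s = (\<Sum>\<^sub>\<infinity>\<rho>\<in>O_minus d. lattice_zeta d L \<rho> s)"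

text \<open>
  \<open>infsum\<close> is \<open>0\<close> for families that are not summable, so convergence is stated separately.
\<close>

definition Refl_converges :: "int \<Rightarrow> complex set \<Rightarrow> complex \<Rightarrow> bool" where
  "Refl_converges d L s \<longleftrightarrow>
     (\<forall>\<rho>\<in>O_minus d. lattice_zeta_term d L s summable_on stable_sublattices L \<rho>) \<and>
     (\<lambda>\<rho>. lattice_zeta d L \<rho> s) summable_on O_minus d"


section \<open>Fractional ideals and the class group\<close>

definition fractional_ideal :: "int \<Rightarrow> complex set \<Rightarrow> bool" where
  "fractional_ideal d J \<longleftrightarrow>
     subgroup J (additive_group (quad_field d)) \<and> J \<noteq> {0} \<and>
     (\<forall>a \<in> ring_of_ints d. \<forall>x \<in> J. a * x \<in> J) \<and>
     (\<exists>c \<in> ring_of_ints d. c \<noteq> 0 \<and> (\<forall>x \<in> J. c * x \<in> ring_of_ints d))"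

definition ideal_mult :: "complex set \<Rightarrow> complex set \<Rightarrow> complex set" where
  "ideal_mult A B = group_closure {a * b | a b. a \<in> A \<and> b \<in> B}"

definition principal_ideal :: "int \<Rightarrow> complex \<Rightarrow> complex set" where
  "principal_ideal d \<alpha> = (\<lambda>x. \<alpha> * x) ` ring_of_ints d"

definition ideal_group :: "int \<Rightarrow> complex set monoid" where
  "ideal_group d =
     \<lparr>carrier = {J. fractional_ideal d J}, mult = ideal_mult, one = ring_of_ints d\<rparr>"

definition principal_ideals :: "int \<Rightarrow> complex set set" where
  "principal_ideals d = {principal_ideal d \<alpha> | \<alpha>. \<alpha> \<in> quad_field d \<and> \<alpha> \<noteq> 0}"

definition class_group :: "int \<Rightarrow> complex set set monoid" where
  "class_group d = ideal_group d Mod principal_ideals d"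

definition ideal_class :: "int \<Rightarrow> complex set \<Rightarrow> complex set set" where
  "ideal_class d J = principal_ideals d #>\<^bsub>ideal_group d\<^esub> J"


section \<open>Ramification\<close>

definition prime_ideal_over :: "int \<Rightarrow> nat \<Rightarrow> complex set \<Rightarrow> bool" where
  "prime_ideal_over d r \<pp> \<longleftrightarrow>
     primeideal \<pp> (ring_of_ints_ring d) \<and> \<pp> \<inter> \<int> = {of_int (int r * k) | k. True}"

text \<open>A prime number ramifies if it is divisible by the square of some prime ideal over it.\<close>

definition ramified :: "int \<Rightarrow> nat \<Rightarrow> bool" where
  "ramified d r \<longleftrightarrow>
     prime r \<and>
     (\<exists>\<pp> \<aa>. prime_ideal_over d r \<pp> \<and> ideal \<aa> (ring_of_ints_ring d) \<and>
        principal_ideal d (of_nat r) = ideal_mult (ideal_mult \<pp> \<pp>) \<aa>)"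

definition ram_classes :: "int \<Rightarrow> complex set set set" where
  "ram_classes d =
     generate (class_group d)
       {ideal_class d \<pp> | \<pp> r. ramified d r \<and> prime_ideal_over d r \<pp>}"

definition ortho_classes :: "int \<Rightarrow> complex set set set" where
  "ortho_classes d =
     generate (class_group d)
       {ideal_class d \<pp> | \<pp> r. ramified d r \<and> r \<noteq> 2 \<and> prime_ideal_over d r \<pp>}"


section \<open>Dirichlet series\<close>

definition dirichlet_series :: "(nat \<Rightarrow> nat) \<Rightarrow> complex \<Rightarrow> complex" where
  "dirichlet_series a s = (\<Sum>\<^sub>\<infinity>n\<in>{1..}. of_nat (a n) * of_nat n powr (- s))"

definition dirichlet_converges :: "(nat \<Rightarrow> nat) \<Rightarrow> complex \<Rightarrow> bool" where
  "dirichlet_converges a s \<longleftrightarrow> (\<lambda>n. of_nat (a n) * of_nat n powr (- s)) summable_on {1..}"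

text \<open>The Riemann zeta function on the half-plane \<open>Re s > 1\<close>, the only region where it is used.\<close>

definition riemann_zeta :: "complex \<Rightarrow> complex" where
  "riemann_zeta s = dirichlet_series (\<lambda>_. 1) s"

text \<open>
  The next two coefficients count ideal classes, not ideals: several ideals of the same index in
  the same class contribute only once.
\<close>

definition class_count :: "int \<Rightarrow> complex set \<Rightarrow> complex set set set \<Rightarrow> nat \<Rightarrow> nat" where
  "class_count d I S n =
     card {ideal_class d J | J.
             fractional_ideal d J \<and> J \<subseteq> I \<and> lattice_index I J = n \<and> ideal_class d J \<in> S}"

definition ambiguous_class_count :: "int \<Rightarrow> complex set \<Rightarrow> nat \<Rightarrow> nat" where
  "ambiguous_class_count d I n =
     card {ideal_class d J | J.
             fractional_ideal d J \<and> J \<subseteq> I \<and> lattice_index I J = n \<and>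
             ideal_class d J = ideal_class d (cnj ` J)}"

definition ram_prod :: "int \<Rightarrow> complex \<Rightarrow> complex" where
  "ram_prod d s = (\<Prod>r | ramified d r. 1 + of_nat r powr (- s))"

end

theory Submission
  imports Defs
begin

text \<open>
  Every element of \<open>O\<^sup>-(F)\<close> is a map \<open>z \<mapsto> u z*\<close> with \<open>u u* = 1\<close>, where \<open>*\<close> is complex conjugation.
  Group the sublattices \<open>K\<close> of \<open>I\<close> by the ideal \<open>J = O\<^sub>F K\<close> they generate. Since the only units are
  \<open>1\<close> and \<open>-1\<close>, an ideal that is stable under one such map is stable under exactly two,
  and the number of isometries from \<open>K\<close> into \<open>I\<close> is the number of those from \<open>J\<close> into \<open>I\<close>,
  namely four times the number of ideals in the class of \<open>J\<close> with the same index in \<open>I\<close>.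
  Hence \<open>Refl\<^sub>I(s)\<close> is half the sum of \<open>n\<^sup>-\<^sup>s W(C)\<close> over all \<open>n\<close> and all ambiguous classes \<open>C\<close> containing
  an ideal of index \<open>n\<close> in \<open>I\<close>; here \<open>W(C)\<close> is the sum of \<open>|J:K|\<^sup>-\<^sup>s\<close> over the lattices \<open>K\<close> that generate
  a fixed \<open>J\<close> in \<open>C\<close> and are stable under its reflection.

  By Hilbert 90 the reflection may be taken to be complex conjugation. Then, up to scaling, \<open>J\<close> is
  the rectangular lattice \<open>\<int> m + \<int> \<surd>d\<close> or its centred sublattice, with \<open>m\<close> dividing \<open>d\<close>, and \<open>K\<close> is again rectangular
  or centred, with coprime parameters \<open>X\<close>, \<open>Y\<close> prime to \<open>d/m\<close> and \<open>m\<close> (up to conditions at 2). As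
  \<open>\<zeta>(s)\<^sup>2/\<zeta>(2s)\<close> is the sum of \<open>(XY)\<^sup>-\<^sup>s\<close> over coprime pairs, \<open>W(C)\<close> is explicit.
  Finally the ambiguous classes are exactly those generated by ramified primes, and for \<open>d \<equiv> 3\<close> modulo 4
  the rectangular ideals are the ones whose class lies in \<open>[I\<^sub>o\<^sub>r\<^sub>t\<^sub>h\<^sub>o]\<close>.
\<close>

section \<open>The orthogonal group and the ring of integers\<close>

text \<open>How many ideals of a given index a class contains is not controlled. This number enters
  twice, as the multiplicity of the class in the sum and, times four, in the denominator; it
  cancels, so each class counts once per index.

  Put t = 2^-s. Divided by zeta(s)^2/(zeta(2s) P(s)), the weight W(C) is 1 - t + 2t^2 for d = 1 mod
  4, it is 1 + t for d = 2, and for d = 3 it is 1 + t + 2t^2 on rectangular and 1 - t on centred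
  classes. The first summand common to the three formulas is the baseline 1 - t + 2t^2; the other
  summands are corrections to it. Since the ambiguous classes make up the subgroup of the ramified
  primes, B and the A-series of that subgroup are the same series.

  The prime 2 is the obstacle throughout: it separates the two shapes, and for d = 3 it ramifies
  without dividing d, so its factor in P(s) comes from splitting coprime pairs by parity and not
  from a coprimality condition.

  Absolute convergence follows from the same evaluation at a real point, because the absolute value
  of a term at s is the term at Re s.\<close>

locale imag_quad =
  fixes d :: int
  assumes d_neg: "d < 0" and d_sqf: "squarefree d"
begin

section \<open>The field and its arithmetic inside the complex numbers\<close>

definition w :: complex where "w = csqrt (of_int d)"

definition sqrt_abs_d :: real where "sqrt_abs_d = sqrt (- of_int d)"

lemma sqrt_abs_d_pos: "sqrt_abs_d > 0" and sqrt_abs_d_sq: "sqrt_abs_d * sqrt_abs_d = - of_int d"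
  using d_neg by (auto simp: sqrt_abs_d_def)

lemma w_eq: "w = Complex 0 sqrt_abs_d"
proof -
  have "csqrt (of_int d) = \<i> * complex_of_real (sqrt \<bar>of_int d\<bar>)"
    using d_neg csqrt_of_real_nonpos[of "of_int d"] by simp
  thus ?thesis using d_neg by (simp add: w_def sqrt_abs_d_def complex_eq_iff)
qed

lemma Re_w [simp]: "Re w = 0" and Im_w [simp]: "Im w = sqrt_abs_d" and cnj_w [simp]: "cnj w = - w"
  by (simp_all add: w_eq complex_eq_iff)

lemma w_sq: "w * w = of_int d"
  using sqrt_abs_d_sq by (simp add: complex_eq_iff)

lemma w_nz [simp]: "w \<noteq> 0"
  using sqrt_abs_d_pos by (auto simp: complex_eq_iff)

abbreviation F :: "complex set" where "F \<equiv> quad_field d"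

lemma Re_of_rat [simp]: "Re (of_rat q) = of_rat q" and Im_of_rat [simp]: "Im (of_rat q) = 0"
  by (cases q; simp add: of_rat_rat)+

lemma cnj_of_rat [simp]: "cnj (of_rat q) = of_rat q"
  by (simp add: complex_eq_iff)

lemma FI [intro]: "of_rat x + of_rat y * w \<in> F"
  by (auto simp: quad_field_def w_def)

lemma FE [elim?]:
  assumes "z \<in> F" obtains x y :: rat where "z = of_rat x + of_rat y * w"
  using assms by (auto simp: quad_field_def w_def)

lemma F_of_rat [simp]: "of_rat x \<in> F"
  using FI[of x 0] by simp

lemma F_of_int [simp]: "of_int x \<in> F"
  using F_of_rat[of "of_int x"] by (simp only: of_rat_of_int_eq)

lemma F_of_nat [simp]: "of_nat x \<in> F"
  using F_of_int[of "int x"] by simp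

lemma F_0 [simp]: "0 \<in> F" and F_1 [simp]: "1 \<in> F"
  using F_of_int[of 0] F_of_int[of 1] by auto

lemma F_numeral [simp]: "numeral n \<in> F"
  using F_of_nat[of "numeral n"] by simp

lemma F_w [simp]: "w \<in> F"
  using FI[of 0 1] by simp

lemma F_add [simp, intro]: "a \<in> F \<Longrightarrow> b \<in> F \<Longrightarrow> a + b \<in> F"
proof -
  assume "a \<in> F" "b \<in> F"
  then obtain x y x' y' where *: "a = of_rat x + of_rat y * w" "b = of_rat x' + of_rat y' * w"
    by (meson FE)
  have "a + b = of_rat (x + x') + of_rat (y + y') * w"
    by (simp add: * of_rat_add algebra_simps)
  thus ?thesis by auto
qed

lemma F_uminus [simp, intro]: "a \<in> F \<Longrightarrow> - a \<in> F"
proof -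
  assume "a \<in> F"
  then obtain x y where *: "a = of_rat x + of_rat y * w" by (meson FE)
  have "- a = of_rat (- x) + of_rat (- y) * w"
    by (simp add: * of_rat_minus algebra_simps)
  thus ?thesis by (metis FI)
qed

lemma F_diff [simp, intro]: "a \<in> F \<Longrightarrow> b \<in> F \<Longrightarrow> a - b \<in> F"
  using F_add[of a "- b"] F_uminus[of b] by simp

lemma F_mult [simp, intro]: "a \<in> F \<Longrightarrow> b \<in> F \<Longrightarrow> a * b \<in> F"
proof -
  assume "a \<in> F" "b \<in> F"
  then obtain x y x' y' where *: "a = of_rat x + of_rat y * w" "b = of_rat x' + of_rat y' * w"
    by (meson FE)
  have "a * b = of_rat x * of_rat x' + of_rat y * of_rat y' * (w * w)
      + (of_rat x * of_rat y' + of_rat y * of_rat x') * w"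
    by (simp add: * algebra_simps)
  also have "\<dots> = of_rat (x * x' + y * y' * of_int d) + of_rat (x * y' + y * x') * w"
    by (simp add: w_sq of_rat_add of_rat_mult)
  finally show ?thesis by auto
qed

lemma F_cnj [simp, intro]: "a \<in> F \<Longrightarrow> cnj a \<in> F"
proof -
  assume "a \<in> F"
  then obtain x y where *: "a = of_rat x + of_rat y * w" by (meson FE)
  have "cnj a = of_rat x + of_rat (- y) * w"
    by (simp add: * of_rat_minus)
  thus ?thesis by (metis FI)
qed

lemma norm_rat:
  assumes "a \<in> F" obtains q where "a * cnj a = of_rat q"
proof -
  obtain x y where *: "a = of_rat x + of_rat y * w" using assms by (meson FE)
  have "a * cnj a = of_rat x * of_rat x - of_rat y * of_rat y * (w * w)"
    by (simp add: * algebra_simps)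
  also have "\<dots> = of_rat (x * x - y * y * of_int d)"
    by (simp add: w_sq of_rat_diff of_rat_mult)
  finally show ?thesis using that by blast
qed

lemma F_inverse [simp, intro]: "a \<in> F \<Longrightarrow> inverse a \<in> F"
proof (cases "a = 0")
  case False
  assume a: "a \<in> F"
  obtain q where q: "a * cnj a = of_rat q" using norm_rat[OF a] by blast
  have "q \<noteq> 0" using q False by auto
  have "a * (of_rat (inverse q) * cnj a) = of_rat q * of_rat (inverse q)"
    using q by (simp add: algebra_simps)
  also have "\<dots> = 1" using \<open>q \<noteq> 0\<close> by (simp flip: of_rat_mult)
  finally have "inverse a = of_rat (inverse q) * cnj a" by (rule inverse_unique)
  thus ?thesis using a by auto
qed simp

lemma F_divide [simp, intro]: "a \<in> F \<Longrightarrow> b \<in> F \<Longrightarrow> a / b \<in> F"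
  using F_mult[of a "inverse b"] F_inverse[of b] by (simp add: divide_inverse)

lemma coord_unique:
  assumes "of_rat x + of_rat y * w = of_rat x' + of_rat y' * w"
  shows "x = x' \<and> y = y'"
  using assms sqrt_abs_d_pos by (auto simp: complex_eq_iff)

lemma coord_unique_int:
  assumes "of_int x + of_int y * w = of_int x' + of_int y' * w"
  shows "x = x' \<and> y = y'"
  using assms sqrt_abs_d_pos by (auto simp: complex_eq_iff)

text \<open>If q = a/b in lowest terms, then b^k divides D for every k, which is possible only for b
  = 1. This is the integrality criterion for traces and norms below.\<close>

lemma int_root_bound:
  fixes q :: rat and D :: int
  assumes "D > 0" and "\<And>k. \<exists>n::int. of_int D * q ^ k = of_int n"
  shows "q \<in> \<int>"
proof -
  obtain a b where ab: "quotient_of q = (a, b)" by fastforce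
  have b: "b > 0" "coprime a b" "q = of_int a / of_int b"
    using quotient_of_denom_pos[OF ab] quotient_of_coprime[OF ab] quotient_of_div[OF ab] by auto
  have "b ^ k dvd D" for k
  proof -
    obtain n :: int where "of_int D * q ^ k = of_int n" using assms(2) by blast
    hence "of_int D * (of_int a :: rat) ^ k = of_int n * of_int b ^ k"
      using b by (simp add: field_simps power_divide)
    hence "(of_int (D * a ^ k) :: rat) = of_int (n * b ^ k)" by simp
    hence "D * a ^ k = n * b ^ k" by (simp only: of_int_eq_iff)
    hence "b ^ k dvd D * a ^ k" by simp
    moreover have "coprime (b ^ k) (a ^ k)" using b by (simp add: coprime_commute)
    ultimately show ?thesis by (simp add: coprime_dvd_mult_left_iff)
  qed
  have "b = 1"
  proof (rule ccontr)
    assume "b \<noteq> 1"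
    hence "b \<ge> 2" using b by simp
    \<comment> \<open>The exponent D is large enough for a contradiction, as D < 2^D.\<close>
    have "2 ^ nat D \<le> b ^ nat D" using \<open>b \<ge> 2\<close> by (intro power_mono) auto
    also have "\<dots> \<le> D" using \<open>b ^ nat D dvd D\<close> assms(1) by (intro zdvd_imp_le)
    finally have "2 ^ nat D \<le> D" .
    moreover have "D < 2 ^ nat D" using assms(1) of_nat_less_two_power[of "nat D", where 'a=int] by simp
    ultimately show False by simp
  qed
  thus ?thesis using b by simp
qed

section \<open>Isometries as rotations and reflections\<close>

definition rot :: "complex \<Rightarrow> complex \<Rightarrow> complex" where "rot u = restrict (\<lambda>z. u * z) F"
definition refl :: "complex \<Rightarrow> complex \<Rightarrow> complex" where "refl u = restrict (\<lambda>z. u * cnj z) F"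

definition U1 :: "complex set" where "U1 = {u \<in> F. u * cnj u = 1}"

lemma U1_F: "u \<in> U1 \<Longrightarrow> u \<in> F" and U1_nz: "u \<in> U1 \<Longrightarrow> u \<noteq> 0"
  and U1_cnj: "u \<in> U1 \<Longrightarrow> u * cnj u = 1"
  by (auto simp: U1_def)

lemma U1_norm: "u \<in> U1 \<Longrightarrow> cmod u = 1"
  using U1_cnj[of u] by (simp add: complex_mod_sqrt_Re_mult_cnj)

lemma U1I: "u \<in> F \<Longrightarrow> cmod u = 1 \<Longrightarrow> u \<in> U1"
  by (simp add: U1_def complex_norm_square[symmetric])

lemma U1_mult: "u \<in> U1 \<Longrightarrow> v \<in> U1 \<Longrightarrow> u * v \<in> U1"
  by (intro U1I) (auto simp: U1_F norm_mult U1_norm)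

lemma U1_conj: "u \<in> U1 \<Longrightarrow> cnj u \<in> U1"
  by (intro U1I) (auto simp: U1_F U1_norm)

lemma U1_uminus: "u \<in> U1 \<Longrightarrow> - u \<in> U1"
  by (intro U1I) (auto simp: U1_F U1_norm)

lemma rot_GL: assumes "u \<in> U1" shows "rot u \<in> GL_field d"
proof -
  have "bij_betw (rot u) F F"
  proof (rule bij_betwI[where g = "\<lambda>z. cnj u * z"])
    fix z
    have "u * (cnj u * z) = (u * cnj u) * z" "cnj u * (u * z) = (u * cnj u) * z" by simp_all
    thus "z \<in> F \<Longrightarrow> cnj u * rot u z = z" "z \<in> F \<Longrightarrow> rot u (cnj u * z) = z"
      using U1_cnj[OF assms] U1_F[OF assms] by (simp_all add: rot_def)
  qed (auto simp: rot_def U1_F[OF assms])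
  thus ?thesis using U1_F[OF assms]
    by (auto simp: GL_field_def rot_def algebra_simps)
qed

lemma refl_GL: assumes "u \<in> U1" shows "refl u \<in> GL_field d"
proof -
  have "bij_betw (refl u) F F"
  proof (rule bij_betwI[where g = "\<lambda>z. u * cnj z"])
    fix z
    have "u * cnj (u * cnj z) = (u * cnj u) * z" by simp
    thus "z \<in> F \<Longrightarrow> u * cnj (refl u z) = z" "z \<in> F \<Longrightarrow> refl u (u * cnj z) = z"
      using U1_cnj[OF assms] U1_F[OF assms] by (simp_all add: refl_def)
  qed (auto simp: refl_def U1_F[OF assms])
  thus ?thesis using U1_F[OF assms]
    by (auto simp: GL_field_def refl_def algebra_simps)
qed

lemma rot_O: assumes "u \<in> U1" shows "rot u \<in> O_field d"
proof -
  have "(u * x) * cnj (u * x) = x * cnj x" for x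
  proof -
    have "(u * x) * cnj (u * x) = (u * cnj u) * (x * cnj x)" by simp
    thus ?thesis using U1_cnj[OF assms] by simp
  qed
  thus ?thesis using rot_GL[OF assms] by (auto simp: O_field_def field_norm_def rot_def)
qed

lemma refl_O: assumes "u \<in> U1" shows "refl u \<in> O_field d"
proof -
  have "(u * cnj x) * cnj (u * cnj x) = x * cnj x" for x
  proof -
    have "(u * cnj x) * cnj (u * cnj x) = (u * cnj u) * (x * cnj x)" by simp
    thus ?thesis using U1_cnj[OF assms] by simp
  qed
  thus ?thesis using refl_GL[OF assms] by (auto simp: O_field_def field_norm_def refl_def)
qed

text \<open>An isometry is determined by u = \<open>\<sigma> 1\<close> and v =
  \<open>\<sigma> w\<close>. Preserving the norms of 1, w and 1 + w makes v/u purely imaginary of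
  norm -d, so v = w u or v = -w u; the sign decides between rotation and reflection.\<close>

lemma O_field_cases:
  assumes "\<sigma> \<in> O_field d"
  obtains u where "u \<in> U1" "\<sigma> = rot u \<or> \<sigma> = refl u"
proof -
  have GL: "\<sigma> \<in> GL_field d" and N: "\<And>x. x \<in> F \<Longrightarrow> \<sigma> x * cnj (\<sigma> x) = x * cnj x"
    using assms by (auto simp: O_field_def field_norm_def)
  have Ok_span: "\<sigma> \<in> extensional F" and add: "\<And>x y. x \<in> F \<Longrightarrow> y \<in> F \<Longrightarrow> \<sigma> (x + y) = \<sigma> x + \<sigma> y"
    and scal: "\<And>q x. x \<in> F \<Longrightarrow> \<sigma> (of_rat q * x) = of_rat q * \<sigma> x"
    and mem: "\<And>x. x \<in> F \<Longrightarrow> \<sigma> x \<in> F"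
    using GL by (auto simp: GL_field_def bij_betw_def)
  define u where "u = \<sigma> 1"
  define v where "v = \<sigma> w"
  have u: "u \<in> U1" using N[of 1] mem[of 1] by (simp add: u_def U1_def)
  have v: "v * cnj v = - of_int d" using N[of w] w_sq by (simp add: v_def)
  have "(u + v) * cnj (u + v) = (1 + w) * cnj (1 + w)"
    using N[of "1 + w"] add[of 1 w] by (simp add: u_def v_def)
  hence s: "u * cnj v + v * cnj u = 0"
    using U1_cnj[OF u] v w_sq by (simp add: algebra_simps)
  \<comment> \<open>This is the quotient v/u, since u has norm 1.\<close>
  define r where "r = v * cnj u"
  have v_r: "v = r * u"
  proof -
    have "r * u = v * (u * cnj u)" by (simp add: r_def)
    thus ?thesis using U1_cnj[OF u] by simp
  qed
  have Rer: "Re r = 0" using s by (simp add: r_def complex_eq_iff algebra_simps)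
  have "r * cnj r = - of_int d"
  proof -
    have "r * cnj r = (v * cnj v) * (u * cnj u)" by (simp add: r_def)
    thus ?thesis using v U1_cnj[OF u] by simp
  qed
  hence "r * r = of_int d" using Rer by (simp add: complex_eq_iff)
  hence "(r - w) * (r + w) = 0" using w_sq by (simp add: algebra_simps)
  hence rw: "r = w \<or> r = - w" by (auto simp: add_eq_0_iff2)
  have val: "\<sigma> (of_rat x + of_rat y * w) = of_rat x * u + of_rat y * v" for x y
    using add[of "of_rat x * 1" "of_rat y * w"] scal[of 1 x] scal[of w y] by (simp add: u_def v_def)
  from rw show ?thesis
  proof
    assume r: "r = w"
    have "\<sigma> z = rot u z" for z
    proof (cases "z \<in> F")
      case True
      then obtain x y where z: "z = of_rat x + of_rat y * w" by (meson FE)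
      have "\<sigma> z = u * z" unfolding z val v_r r by (simp add: algebra_simps)
      thus ?thesis using True by (simp add: rot_def)
    next
      case False thus ?thesis using Ok_span by (simp add: rot_def extensional_def)
    qed
    thus ?thesis using that u by blast
  next
    assume r: "r = - w"
    have "\<sigma> z = refl u z" for z
    proof (cases "z \<in> F")
      case True
      then obtain x y where z: "z = of_rat x + of_rat y * w" by (meson FE)
      have "\<sigma> z = u * cnj z" unfolding z val v_r r by (simp add: algebra_simps)
      thus ?thesis using True by (simp add: refl_def)
    next
      case False thus ?thesis using Ok_span by (simp add: refl_def extensional_def)
    qed
    thus ?thesis using that u by blast
  qed
qed

text \<open>In the basis 1, w the determinant of multiplication by u is the norm of u.\<close>

lemma rot_SL: assumes "u \<in> U1" shows "rot u \<in> SL_field d"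
proof -
  obtain a b where ab: "u = of_rat a + of_rat b * w" using U1_F[OF assms] by (meson FE)
  have "of_rat (a * a - b * b * of_int d) = (of_rat a * of_rat a - of_rat b * of_rat b * (w * w))"
    by (simp add: of_rat_diff of_rat_mult w_sq)
  also have "\<dots> = u * cnj u" by (simp add: ab algebra_simps)
  finally have 1: "a * a - b * (b * of_int d) = 1" using U1_cnj[OF assms]
    by (metis mult.assoc of_rat_eq_1_iff)
  have "rot u w = of_rat (b * of_int d) + of_rat a * w"
    by (simp add: rot_def ab algebra_simps w_sq of_rat_mult)
  moreover have "rot u 1 = of_rat a + of_rat b * w" by (simp add: rot_def ab)
  ultimately show ?thesis using rot_GL[OF assms] 1 unfolding SL_field_def w_def by blast
qed

text \<open>Composing with conjugation negates the determinant, which becomes -1.\<close>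

lemma refl_not_SL: assumes "u \<in> U1" shows "refl u \<notin> SL_field d"
proof
  assume "refl u \<in> SL_field d"
  then obtain a b c e where *: "refl u 1 = of_rat a + of_rat b * w"
    "refl u w = of_rat c + of_rat e * w" "a * e - b * c = 1"
    unfolding SL_field_def w_def by blast
  have ab: "u = of_rat a + of_rat b * w" using *(1) by (simp add: refl_def)
  have "refl u w = of_rat (- b * of_int d) + of_rat (- a) * w"
    by (simp add: refl_def ab algebra_simps w_sq of_rat_mult of_rat_minus)
  hence ce: "c = - b * of_int d" "e = - a" using coord_unique *(2) by metis+
  have "of_rat (a * a - b * b * of_int d) = (of_rat a * of_rat a - of_rat b * of_rat b * (w * w))"
    by (simp add: of_rat_diff of_rat_mult w_sq)
  also have "\<dots> = u * cnj u" by (simp add: ab algebra_simps)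
  finally have 1: "a * a - b * (b * of_int d) = 1" using U1_cnj[OF assms]
    by (metis mult.assoc of_rat_eq_1_iff)
  show False using *(3) 1 unfolding ce by (simp add: algebra_simps)
qed

lemma O_field_eq: "O_field d = rot ` U1 \<union> refl ` U1"
proof
  show "O_field d \<subseteq> rot ` U1 \<union> refl ` U1"
  proof
    fix \<sigma> assume "\<sigma> \<in> O_field d"
    then obtain u where "u \<in> U1" "\<sigma> = rot u \<or> \<sigma> = refl u" by (rule O_field_cases)
    thus "\<sigma> \<in> rot ` U1 \<union> refl ` U1" by auto
  qed
qed (auto intro: rot_O refl_O)

lemma O_minus_eq: "O_minus d = refl ` U1"
  using rot_SL refl_not_SL by (auto simp: O_minus_def O_plus_def O_field_eq)

lemma rot_1 [simp]: "rot u 1 = u" and refl_1 [simp]: "refl u 1 = u"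
  by (simp_all add: rot_def refl_def)

lemma rot_inj: "rot u = rot v \<Longrightarrow> u = v" and refl_inj: "refl u = refl v \<Longrightarrow> u = v"
  using rot_1 refl_1 by metis+

lemma rot_ne_refl: "u \<in> U1 \<Longrightarrow> v \<in> U1 \<Longrightarrow> rot u \<noteq> refl v"
  using rot_SL refl_not_SL by metis

lemma rot_image: "K \<subseteq> F \<Longrightarrow> rot u ` K = (\<lambda>z. u * z) ` K"
  and refl_image: "K \<subseteq> F \<Longrightarrow> refl u ` K = (\<lambda>z. u * cnj z) ` K"
  by (auto simp: rot_def refl_def image_def subset_iff)

text \<open>\<open>theta\<close> generates the ring of integers; \<open>theta_trace\<close> and \<open>theta_norm\<close> are its trace and norm.\<close>
definition theta_trace :: int where "theta_trace = (if d mod 4 = 1 then 1 else 0)"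
definition theta_norm :: int where "theta_norm = (if d mod 4 = 1 then (1 - d) div 4 else - d)"
definition theta :: complex where "theta = (if d mod 4 = 1 then (1 + w) / 2 else w)"

lemma theta_F [simp]: "theta \<in> F"
  by (auto simp: theta_def)

lemma cnj_theta: "cnj theta = of_int theta_trace - theta"
  by (simp add: theta_def theta_trace_def field_simps)

lemma theta_sq: "theta * theta = of_int theta_trace * theta - of_int theta_norm"
proof (cases "d mod 4 = 1")
  case True
  hence "4 * theta_norm = 1 - d" unfolding theta_norm_def by presburger
  hence "d = 1 - 4 * theta_norm" by simp
  hence "(of_int d :: complex) = of_int (1 - 4 * theta_norm)" by (rule arg_cong)
  hence dn: "(of_int d :: complex) = 1 - 4 * of_int theta_norm" by simp
  have "(1 + w) * (1 + w) = 1 + 2 * w + of_int d" using w_sq by (simp add: algebra_simps)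
  hence e: "(1 + w) * (1 + w) = 2 * (1 + w) - 4 * of_int theta_norm" using dn by (simp add: algebra_simps)
  have "4 * (theta * theta) = (1 + w) * (1 + w)" using True by (simp add: theta_def)
  also have "\<dots> = 4 * (of_int theta_trace * theta - of_int theta_norm)"
    unfolding e using True by (simp add: theta_def theta_trace_def right_diff_distrib)
  finally show ?thesis by (subst (asm) mult_left_cancel) auto
qed (simp add: theta_def theta_trace_def theta_norm_def w_sq)

lemma Im_theta: "Im theta > 0"
  using sqrt_abs_d_pos by (simp add: theta_def)

lemma coord_theta:
  assumes "of_int x + of_int y * theta = of_int x' + of_int y' * theta"
  shows "x = x' \<and> y = y'"
proof -
  have "Im (of_int x + of_int y * theta) = Im (of_int x' + of_int y' * theta)" using assms by simp
  hence "y = y'" using Im_theta by simp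
  thus ?thesis using assms by simp
qed

lemma theta_mult:
  "(of_int x + of_int y * theta) * (of_int x' + of_int y' * theta) =
    of_int (x * x' - y * y' * theta_norm) + of_int (x * y' + y * x' + y * y' * theta_trace) * theta"
proof -
  have "(of_int x + of_int y * theta) * (of_int x' + of_int y' * theta) =
     of_int x * of_int x' + (of_int x * of_int y' + of_int y * of_int x') * theta
      + of_int y * of_int y' * (theta * theta)" by (simp add: algebra_simps)
  thus ?thesis by (simp add: theta_sq algebra_simps)
qed

section \<open>Integral elements via bounded denominators in the order Z[w]\<close>

definition Zw :: "complex set" where "Zw = {of_int x + of_int y * w | x y. True}"

lemma ZwI: "of_int x + of_int y * w \<in> Zw" by (auto simp: Zw_def)

lemma Zw_of_int: "of_int x \<in> Zw" using ZwI[of x 0] by simp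

lemma Zw_add: assumes "a \<in> Zw" "b \<in> Zw" shows "a + b \<in> Zw"
proof -
  obtain x y x' y' where "a = of_int x + of_int y * w" "b = of_int x' + of_int y' * w"
    using assms by (auto simp: Zw_def)
  hence "a + b = of_int (x + x') + of_int (y + y') * w" by (simp add: algebra_simps)
  thus ?thesis by (metis ZwI)
qed

lemma Zw_mult: assumes "a \<in> Zw" "b \<in> Zw" shows "a * b \<in> Zw"
proof -
  obtain x y x' y' where *: "a = of_int x + of_int y * w" "b = of_int x' + of_int y' * w"
    using assms by (auto simp: Zw_def)
  have "a * b = of_int x * of_int x' + of_int y * of_int y' * (w * w)
      + (of_int x * of_int y' + of_int y * of_int x') * w" by (simp add: * algebra_simps)
  also have "\<dots> = of_int (x * x' + y * y' * d) + of_int (x * y' + y * x') * w"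
    by (simp add: w_sq)
  finally show ?thesis by (metis ZwI)
qed

lemma Zw_cnj: assumes "a \<in> Zw" shows "cnj a \<in> Zw"
proof -
  obtain x y where *: "a = of_int x + of_int y * w" using assms by (auto simp: Zw_def)
  have "cnj a = of_int x + of_int (- y) * w" by (simp add: *)
  thus ?thesis by (metis ZwI)
qed

lemma Zw_sum: "(\<And>i. i \<in> A \<Longrightarrow> f i \<in> Zw) \<Longrightarrow> sum f A \<in> Zw"
  by (induction A rule: infinite_finite_induct) (auto intro: Zw_add Zw_of_int[of 0, simplified])

lemma Zw_rat: assumes "of_rat q \<in> Zw" shows "q \<in> \<int>"
proof -
  obtain x y where "of_rat q + of_rat 0 * w = of_rat (of_int x) + of_rat (of_int y) * w"
    using assms by (auto simp: Zw_def)
  from coord_unique[OF this] show ?thesis by simp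
qed

lemma denominator:
  assumes "a \<in> F" obtains D :: int where "D > 0" "of_int D * a \<in> Zw"
proof -
  obtain x y where a: "a = of_rat x + of_rat y * w" using assms by (meson FE)
  obtain p q where pq: "quotient_of x = (p, q)" by fastforce
  obtain r s where rs: "quotient_of y = (r, s)" by fastforce
  have q: "q > 0" "x = of_int p / of_int q" and s: "s > 0" "y = of_int r / of_int s"
    using quotient_of_denom_pos[OF pq] quotient_of_div[OF pq]
      quotient_of_denom_pos[OF rs] quotient_of_div[OF rs] by auto
  have "of_rat (x * of_int q) = (of_rat (of_int p) :: complex)"
    "of_rat (y * of_int s) = (of_rat (of_int r) :: complex)" using q s by simp_all
  hence *: "of_rat x * of_int q = (of_int p :: complex)" "of_rat y * of_int s = (of_int r :: complex)"
    by (simp_all add: of_rat_mult)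
  have "of_int (q * s) * a = (of_rat x * of_int q) * of_int s + (of_rat y * of_int s) * of_int q * w"
    by (simp add: a algebra_simps)
  hence "of_int (q * s) * a = of_int (p * s) + of_int (r * q) * w" by (simp add: *)
  hence "of_int (q * s) * a \<in> Zw" by (metis ZwI)
  thus ?thesis using that[of "q * s"] q s by simp
qed

lemma common_denominator:
  fixes f :: "nat \<Rightarrow> complex"
  assumes "\<And>i. f i \<in> F"
  shows "\<exists>D::int. D > 0 \<and> (\<forall>i<n. of_int D * f i \<in> Zw)"
proof (induction n)
  case 0 show ?case by (intro exI[of _ 1]) simp
next
  case (Suc n)
  then obtain D :: int where D: "D > 0" "\<forall>i<n. of_int D * f i \<in> Zw" by auto
  obtain E :: int where E: "E > 0" "of_int E * f n \<in> Zw" using denominator assms by metis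
  have "of_int (D * E) * f i \<in> Zw" if "i < Suc n" for i
  proof (cases "i = n")
    case True
    have "of_int D * (of_int E * f n) \<in> Zw" using E Zw_mult Zw_of_int by blast
    thus ?thesis using True by (simp add: mult.assoc)
  next
    case False
    hence "of_int E * (of_int D * f i) \<in> Zw" using D that Zw_mult Zw_of_int by simp
    thus ?thesis by (simp add: ac_simps)
  qed
  thus ?case using D E by (intro exI[of _ "D * E"]) auto
qed

lemma F_power: "a \<in> F \<Longrightarrow> a ^ k \<in> F"
  by (induction k) auto

text \<open>A common denominator of the powers below the degree serves for all powers, because the
  monic integral equation rewrites higher powers by lower ones.\<close>

lemma power_denominator:
  assumes "z \<in> F" "algebraic_int z"
  obtains D :: int where "D > 0" "\<And>k. of_int D * z ^ k \<in> Zw"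
proof -
  obtain p where p: "lead_coeff p = 1" "\<forall>i. coeff p i \<in> \<int>" "poly p z = 0"
    using assms(2) by (auto simp: algebraic_int.simps)
  define n where "n = degree p"
  obtain D :: int where D: "D > 0" "\<forall>i<n. of_int D * z ^ i \<in> Zw"
    using common_denominator[of "\<lambda>i. z ^ i" n] F_power[OF assms(1)] by blast
  have 0: "z ^ n = - (\<Sum>i<n. coeff p i * z ^ i)"
    using p(1,3) by (simp add: poly_altdef n_def lessThan_Suc_atMost[symmetric] add_eq_0_iff)
  have "of_int D * z ^ k \<in> Zw" for k
  proof (induction k rule: less_induct)
    case (less k)
    show ?case
    proof (cases "k < n")
      case True thus ?thesis using D by simp
    next
      case False
      have "z ^ k = z ^ (k - n) * z ^ n" using False by (simp flip: power_add)
      also have "\<dots> = (\<Sum>i<n. - (coeff p i) * z ^ (k - n + i))"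
        by (simp add: 0 sum_distrib_left sum_negf power_add algebra_simps)
      finally have "of_int D * z ^ k = (\<Sum>i<n. - (coeff p i) * (of_int D * z ^ (k - n + i)))"
        by (simp add: sum_distrib_left algebra_simps)
      moreover have "- (coeff p i) * (of_int D * z ^ (k - n + i)) \<in> Zw" if "i < n" for i
      proof -
        obtain c where "coeff p i = of_int c" using p(2) by (meson Ints_cases)
        hence "- (coeff p i) \<in> Zw" using Zw_of_int[of "- c"] by simp
        thus ?thesis using less[of "k - n + i"] that False
          by (intro Zw_mult[of "- coeff p i" "of_int D * z ^ (k - n + i)"]) auto
      qed
      ultimately show ?thesis by (auto intro: Zw_sum)
    qed
  qed
  thus ?thesis using D(1) that by blast
qed

text \<open>The square of the common denominator clears all products of powers of z and its
  conjugate, hence all powers of the trace and of the norm. Rational numbers whose powers have a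
  common denominator are integers.\<close>

lemma integral_trace_norm:
  assumes "z \<in> F" "algebraic_int z"
  obtains t n :: int where "z + cnj z = of_int t" "z * cnj z = of_int n"
proof -
  obtain D :: int where D: "D > 0" "\<And>k. of_int D * z ^ k \<in> Zw"
    using power_denominator assms by blast
  have cD: "of_int D * cnj z ^ k \<in> Zw" for k
    using Zw_cnj[OF D(2)[of k]] by simp
  have DD: "of_int (D * D) * (z ^ j * cnj z ^ k) \<in> Zw" for j k
    using Zw_mult[OF D(2) cD, of j k] by (simp add: ac_simps)
  obtain x y where xy: "z = of_rat x + of_rat y * w" using assms by (meson FE)
  have to_pair: "z + cnj z = of_rat (2 * x)" by (simp add: xy of_rat_mult)
  obtain q where nm: "z * cnj z = of_rat q" using norm_rat assms by blast
  have "\<exists>n::int. of_int (D * D) * (2 * x) ^ k = of_int n" for k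
  proof -
    have "of_rat (of_int (D * D) * (2 * x) ^ k) = of_int (D * D) * (z + cnj z) ^ k"
      by (simp add: to_pair of_rat_mult of_rat_power)
    also have "\<dots> = (\<Sum>j\<le>k. of_int (int (k choose j)) * (of_int (D * D) * (z ^ j * cnj z ^ (k - j))))"
      by (simp add: binomial_ring sum_distrib_left algebra_simps)
    also have "\<dots> \<in> Zw" by (intro Zw_sum Zw_mult DD Zw_of_int)
    finally show ?thesis using Zw_rat by (meson Ints_cases)
  qed
  hence "2 * x \<in> \<int>" using D(1) by (intro int_root_bound[of "D * D"]) auto
  moreover have "\<exists>n::int. of_int (D * D) * q ^ k = of_int n" for k
  proof -
    have "of_rat (of_int (D * D) * q ^ k) = of_int (D * D) * (z ^ k * cnj z ^ k)"
      by (simp add: nm[symmetric] of_rat_mult of_rat_power flip: power_mult_distrib)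
    thus ?thesis using Zw_rat DD by (metis Ints_cases)
  qed
  hence "q \<in> \<int>" using D(1) by (intro int_root_bound[of "D * D"]) auto
  ultimately show ?thesis using that to_pair nm by (metis Ints_cases of_rat_of_int_eq)
qed

lemma d_mod4: "d mod 4 = 1 \<or> d mod 4 = 2 \<or> d mod 4 = 3"
proof -
  have "d mod 4 \<noteq> 0"
  proof
    assume "d mod 4 = 0"
    hence "2 ^ 2 dvd d" by (simp add: dvd_eq_mod_eq_0)
    hence "is_unit (2::int)" using d_sqf by (rule squarefreeD[rotated])
    thus False by simp
  qed
  moreover have "0 \<le> d mod 4" "d mod 4 < 4" by auto
  ultimately show ?thesis by presburger
qed

text \<open>In lowest terms the square of the denominator of r divides d.\<close>

lemma sqfree_square:
  fixes r :: rat assumes "of_int d * (r * r) = of_int k" shows "r \<in> \<int>"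
proof -
  obtain p q where pq: "quotient_of r = (p, q)" by fastforce
  have q: "q > 0" "coprime p q" "r = of_int p / of_int q"
    using quotient_of_denom_pos[OF pq] quotient_of_coprime[OF pq] quotient_of_div[OF pq] by auto
  have "(of_int (d * (p * p)) :: rat) = of_int (k * (q * q))"
    using assms q by (simp add: field_simps)
  hence "d * (p * p) = k * (q * q)" by (simp only: of_int_eq_iff)
  hence "q ^ 2 dvd d * p ^ 2" by (simp add: power2_eq_square)
  moreover have "coprime (q ^ 2) (p ^ 2)" using q by (simp add: coprime_commute)
  ultimately have "q ^ 2 dvd d" by (simp add: coprime_dvd_mult_left_iff)
  hence "is_unit q" using d_sqf by (rule squarefreeD[rotated])
  thus ?thesis using q by auto
qed

text \<open>Elements x + y theta satisfy their characteristic polynomial. Conversely trace and norm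
  are integers, so the doubled coordinates t and b are integers with d b^2 = t^2 - 4n, and this
  equation modulo 4 settles their parities.\<close>

lemma ring_of_ints_eq: "ring_of_ints d = {of_int x + of_int y * theta | x y. True}" (is "_ = ?R")
proof
  show "?R \<subseteq> ring_of_ints d"
  proof
    fix z assume "z \<in> ?R"
    then obtain x y where z: "z = of_int x + of_int y * theta" by auto
    define T where "T = 2 * x + y * theta_trace"
    define N where "N = x * x + x * y * theta_trace + y * y * theta_norm"
    have "z * z = of_int (x * x - y * y * theta_norm) + of_int (x * y + y * x + y * y * theta_trace) * theta"
      unfolding z theta_mult by simp
    hence zz: "z * z = of_int T * z - of_int N"
      by (simp add: z T_def N_def algebra_simps)
    have "poly [:of_int N, - of_int T, 1:] z = 0" using zz by (simp add: algebra_simps)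
    moreover have "\<forall>i. coeff [:of_int N, - of_int T, 1 :: complex:] i \<in> \<int>"
      by (auto simp: coeff_pCons split: nat.split)
    ultimately have "algebraic_int z" by (intro algebraic_int.intros[of "[:of_int N, - of_int T, 1:]"]) auto
    moreover have "z \<in> F" by (auto simp: z)
    ultimately show "z \<in> ring_of_ints d" by (simp add: ring_of_ints_def)
  qed
  show "ring_of_ints d \<subseteq> ?R"
  proof
    fix z assume "z \<in> ring_of_ints d"
    hence z: "z \<in> F" "algebraic_int z" by (auto simp: ring_of_ints_def)
    obtain t n where tn: "z + cnj z = of_int t" "z * cnj z = of_int n"
      using integral_trace_norm z by blast
    obtain x y where xy: "z = of_rat x + of_rat y * w" using z by (meson FE)
    have "of_rat (2 * x) + of_rat 0 * w = of_rat (of_int t) + of_rat 0 * w"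
      using tn(1) by (simp add: xy of_rat_mult)
    hence t: "2 * x = of_int t" using coord_unique by blast
    have "z * cnj z = of_rat x * of_rat x - of_rat y * of_rat y * (w * w)"
      by (simp add: xy algebra_simps)
    also have "\<dots> = of_rat (x * x - y * y * of_int d)" by (simp add: w_sq of_rat_diff of_rat_mult)
    finally have "of_rat (x * x - y * y * of_int d) + of_rat 0 * w = of_rat (of_int n) + of_rat 0 * w"
      using tn(2) by simp
    hence n: "x * x - y * y * of_int d = of_int n" using coord_unique by blast
    \<comment> \<open>The right side is an integer, so squarefreeness of d makes 2y
      integral.\<close>
    have dyy: "of_int d * (2 * y * (2 * y)) = (2 * x) * (2 * x) - 4 * of_int n"
      using n by (simp add: algebra_simps)
    also have "\<dots> = of_int (t * t - 4 * n)" by (simp add: t)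
    finally have "2 * y \<in> \<int>" by (rule sqfree_square)
    then obtain b where b: "2 * y = of_int b" by (auto elim: Ints_cases)
    have "(of_int (d * (b * b)) :: rat) = of_int (t * t - 4 * n)" using dyy by (simp add: t b)
    hence eq: "d * (b * b) = t * t - 4 * n" by (simp only: of_int_eq_iff)
    have z2: "2 * z = of_int t + of_int b * w"
    proof -
      have "2 * z = of_rat (2 * x) + of_rat (2 * y) * w" by (simp add: xy of_rat_mult algebra_simps)
      thus ?thesis by (simp add: t b)
    qed
    show "z \<in> ?R"
    proof (cases "d mod 4 = 1")
      case True
      have "even (d * (b * b)) = even (t * t)" unfolding eq by simp
      moreover have "odd d" using True by presburger
      ultimately have "even (t - b)" by simp
      then obtain c where "t - b = 2 * c" by blast
      hence "t = 2 * c + b" by simp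
      hence "2 * z = 2 * (of_int c + of_int b * theta)" using z2 True by (simp add: theta_def field_simps)
      hence "z = of_int c + of_int b * theta" by (subst (asm) mult_left_cancel) auto
      thus ?thesis by auto
    next
      case False
      \<comment> \<open>Squares are 0 or 1 modulo 4; with d congruent to 2 or 3 only even t and b
        are left.\<close>
      have "even t \<and> even b"
      proof (rule ccontr)
        have sq: "k * k mod 4 = (if even k then 0 else 1)" for k :: int
        proof -
          have "k mod 4 = 0 \<or> k mod 4 = 1 \<or> k mod 4 = 2 \<or> k mod 4 = 3" by presburger
          moreover have "k * k mod 4 = (k mod 4) * (k mod 4) mod 4" by (simp add: mod_mult_eq)
          moreover have "even k = even (k mod 4)" by presburger
          ultimately show ?thesis by auto
        qed
        assume *: "\<not> (even t \<and> even b)"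
        have "(d mod 4) * (b * b mod 4) mod 4 = t * t mod 4"
          using eq by (simp add: mod_mult_eq) (metis diff_add_cancel mod_mult_self2)
        thus False using * False d_mod4 by (auto simp: sq split: if_splits)
      qed
      then obtain c e where "t = 2 * c" "b = 2 * e" by blast
      hence "2 * z = 2 * (of_int c + of_int e * theta)" using z2 False by (simp add: theta_def algebra_simps)
      hence "z = of_int c + of_int e * theta" by (subst (asm) mult_left_cancel) auto
      thus ?thesis by auto
    qed
  qed
qed

abbreviation Ok :: "complex set" where "Ok \<equiv> ring_of_ints d"

lemma OkI: "of_int x + of_int y * theta \<in> Ok" by (auto simp: ring_of_ints_eq)

lemma OkE: assumes "z \<in> Ok" obtains x y where "z = of_int x + of_int y * theta"
  using assms by (auto simp: ring_of_ints_eq)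

lemma Ok_of_int [simp]: "of_int x \<in> Ok" using OkI[of x 0] by simp
lemma Ok_0 [simp]: "0 \<in> Ok" and Ok_1 [simp]: "1 \<in> Ok" using Ok_of_int[of 0] Ok_of_int[of 1] by auto
lemma Ok_theta [simp]: "theta \<in> Ok" using OkI[of 0 1] by simp

lemma Ok_F: "z \<in> Ok \<Longrightarrow> z \<in> F" by (simp add: ring_of_ints_def)

lemma Ok_add: assumes "a \<in> Ok" "b \<in> Ok" shows "a + b \<in> Ok"
proof -
  obtain x y x' y' where "a = of_int x + of_int y * theta" "b = of_int x' + of_int y' * theta"
    using assms by (meson OkE)
  hence "a + b = of_int (x + x') + of_int (y + y') * theta" by (simp add: algebra_simps)
  thus ?thesis by (metis OkI)
qed

lemma Ok_mult: assumes "a \<in> Ok" "b \<in> Ok" shows "a * b \<in> Ok"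
proof -
  obtain x y x' y' where "a = of_int x + of_int y * theta" "b = of_int x' + of_int y' * theta"
    using assms by (meson OkE)
  thus ?thesis by (simp only: theta_mult OkI)
qed

lemma Ok_uminus: "a \<in> Ok \<Longrightarrow> - a \<in> Ok"
  using Ok_mult[of "- 1" a] Ok_of_int[of "- 1"] by simp

lemma Ok_diff: "a \<in> Ok \<Longrightarrow> b \<in> Ok \<Longrightarrow> a - b \<in> Ok"
  using Ok_add[of a "- b"] Ok_uminus[of b] by simp

lemma Ok_cnj: assumes "a \<in> Ok" shows "cnj a \<in> Ok"
proof -
  obtain x y where a: "a = of_int x + of_int y * theta" using assms by (meson OkE)
  have "cnj a = of_int (x + y * theta_trace) + of_int (- y) * theta" by (simp add: a cnj_theta algebra_simps)
  thus ?thesis by (metis OkI)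
qed

lemma w_in_Ok: "w \<in> Ok"
proof (cases "d mod 4 = 1")
  case True
  hence "w = of_int (- 1) + of_int 2 * theta" by (simp add: theta_def add_divide_distrib ring_distribs)
  thus ?thesis by (metis OkI)
next
  case False
  hence "w = theta" by (simp add: theta_def)
  thus ?thesis by simp
qed

end

section \<open>Planar lattices\<close>

text \<open>An additive subgroup without reference to an ambient group, so that the same fact can be
  used inside I, F or an ideal; \<open>subgroup_additive\<close> translates.\<close>

definition addsub :: "complex set \<Rightarrow> bool" where
  "addsub K \<longleftrightarrow> 0 \<in> K \<and> (\<forall>x\<in>K. \<forall>y\<in>K. x - y \<in> K)"

lemma addsub_0: "addsub K \<Longrightarrow> 0 \<in> K"
  and addsub_diff: "addsub K \<Longrightarrow> x \<in> K \<Longrightarrow> y \<in> K \<Longrightarrow> x - y \<in> K"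
  by (auto simp: addsub_def)

lemma addsub_uminus: "addsub K \<Longrightarrow> x \<in> K \<Longrightarrow> - x \<in> K"
  using addsub_diff[of K 0 x] addsub_0[of K] by simp

lemma addsub_add: "addsub K \<Longrightarrow> x \<in> K \<Longrightarrow> y \<in> K \<Longrightarrow> x + y \<in> K"
  using addsub_diff[of K x "- y"] addsub_uminus[of K y] by simp

lemma addsub_of_nat: "addsub K \<Longrightarrow> x \<in> K \<Longrightarrow> of_nat n * x \<in> K"
  by (induction n) (auto simp: addsub_0 addsub_add algebra_simps)

lemma addsub_of_int: "addsub K \<Longrightarrow> x \<in> K \<Longrightarrow> of_int n * x \<in> K"
proof (cases "n \<ge> 0")
  case True
  assume "addsub K" "x \<in> K"
  thus ?thesis using True addsub_of_nat[of K x "nat n"] by simp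
next
  case False
  assume K: "addsub K" "x \<in> K"
  have "- (of_nat (nat (- n)) * x) \<in> K" using K by (intro addsub_uminus addsub_of_nat)
  thus ?thesis using False by simp
qed

lemma addsub_comb: "addsub K \<Longrightarrow> a \<in> K \<Longrightarrow> b \<in> K \<Longrightarrow> of_int x * a + of_int y * b \<in> K"
  by (intro addsub_add addsub_of_int)

lemma addsub_image_mult: "addsub K \<Longrightarrow> addsub ((\<lambda>z. c * z) ` K)"
  by (auto simp: addsub_def image_iff right_diff_distrib[symmetric] intro: bexI[of _ 0])

lemma addsub_image_cnj: "addsub K \<Longrightarrow> addsub (cnj ` K)"
  by (auto simp: addsub_def image_iff complex_cnj_diff[symmetric] simp del: complex_cnj_diff intro: bexI[of _ 0])

lemma group_additive: assumes "addsub L" shows "group (additive_group L)"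
proof (rule groupI)
  fix x assume "x \<in> carrier (additive_group L)"
  thus "\<exists>y\<in>carrier (additive_group L). y \<otimes>\<^bsub>additive_group L\<^esub> x = \<one>\<^bsub>additive_group L\<^esub>"
    using assms by (intro bexI[of _ "- x"]) (auto simp: additive_group_def addsub_uminus)
qed (use assms in \<open>auto simp: additive_group_def addsub_add addsub_0\<close>)

lemma inv_additive: assumes "addsub L" "x \<in> L" shows "inv\<^bsub>additive_group L\<^esub> x = - x"
  using assms group.inv_equality[OF group_additive[OF assms(1)], of "- x" x]
  by (auto simp: additive_group_def addsub_uminus)

lemma subgroup_additive:
  assumes "addsub L"
  shows "subgroup K (additive_group L) \<longleftrightarrow> K \<subseteq> L \<and> addsub K"
proof
  assume s: "subgroup K (additive_group L)"
  hence KL: "K \<subseteq> L" by (auto simp: subgroup_def additive_group_def)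
  have "- x \<in> K" if "x \<in> K" for x
    using subgroup.m_inv_closed[OF s that] inv_additive[OF assms] KL that by auto
  moreover have "x + y \<in> K" if "x \<in> K" "y \<in> K" for x y
    using subgroup.m_closed[OF s that] by (simp add: additive_group_def)
  moreover have "0 \<in> K" using subgroup.one_closed[OF s] by (simp add: additive_group_def)
  ultimately show "K \<subseteq> L \<and> addsub K" using KL
    by (simp add: addsub_def) (metis add.commute uminus_add_conv_diff)
next
  assume K: "K \<subseteq> L \<and> addsub K"
  hence "inv\<^bsub>additive_group L\<^esub> x \<in> K" if "x \<in> K" for x
    using inv_additive[OF assms] addsub_uminus that by (metis subsetD)
  thus "subgroup K (additive_group L)" using K
    by (auto simp: subgroup_def additive_group_def addsub_0 addsub_add)
qed

definition coset :: "complex set \<Rightarrow> complex \<Rightarrow> complex set" where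
  "coset K a = (\<lambda>h. h + a) ` K"

lemma rcosets_additive: "rcosets\<^bsub>additive_group L\<^esub> K = coset K ` L"
  by (auto simp: RCOSETS_def r_coset_def additive_group_def coset_def)

lemma coset_eq: assumes "addsub K" shows "coset K u = coset K v \<longleftrightarrow> u - v \<in> K"
proof
  assume "coset K u = coset K v"
  moreover have "u \<in> coset K u" using addsub_0[OF assms] by (auto simp: coset_def)
  ultimately show "u - v \<in> K" by (auto simp: coset_def)
next
  have *: "coset K u \<subseteq> coset K v" if "u - v \<in> K" for u v
  proof
    fix z assume "z \<in> coset K u"
    then obtain h where "h \<in> K" "z = (h + (u - v)) + v" by (auto simp: coset_def)
    thus "z \<in> coset K v" unfolding coset_def using addsub_add[OF assms _ that] by blast
  qed
  assume uv: "u - v \<in> K"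
  hence "v - u \<in> K" using addsub_uminus[OF assms uv] by simp
  thus "coset K u = coset K v" using * uv by blast
qed

section \<open>Lattices with a basis, their index and covolume\<close>

definition lat :: "complex \<Rightarrow> complex \<Rightarrow> complex set" where
  "lat a b = {of_int x * a + of_int y * b | x y. True}"

text \<open>The determinant of a and b as vectors of the real plane.\<close>

definition area :: "complex \<Rightarrow> complex \<Rightarrow> real" where "area a b = Im (cnj a * b)"

lemma latI: "of_int x * a + of_int y * b \<in> lat a b" by (auto simp: lat_def)

lemma latE: assumes "z \<in> lat a b" obtains x y where "z = of_int x * a + of_int y * b"
  using assms by (auto simp: lat_def)

lemma lat_gen: "a \<in> lat a b" "b \<in> lat a b"
  using latI[of 1 a 0 b] latI[of 0 a 1 b] by auto

lemma addsub_lat: "addsub (lat a b)"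
proof -
  have "(of_int x * a + of_int y * b) - (of_int x' * a + of_int y' * b) \<in> lat a b" for x y x' y'
  proof -
    have "(of_int x * a + of_int y * b) - (of_int x' * a + of_int y' * b)
      = of_int (x - x') * a + of_int (y - y') * b" by (simp add: algebra_simps)
    thus ?thesis by (metis latI)
  qed
  thus ?thesis using latI[of 0 a 0 b] by (auto simp: addsub_def elim!: latE)
qed

lemma lat_least: "addsub K \<Longrightarrow> a \<in> K \<Longrightarrow> b \<in> K \<Longrightarrow> lat a b \<subseteq> K"
  by (auto elim!: latE intro: addsub_comb)

lemma area_comb:
  "area (of_int x * a + of_int y * b) (of_int x' * a + of_int y' * b) = of_int (x * y' - y * x') * area a b"
  by (simp add: area_def algebra_simps)

text \<open>Cramer's rule: the coordinates are areas against the basis vectors.\<close>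

lemma lat_coord_unique:
  assumes "area a b \<noteq> 0" "of_int x * a + of_int y * b = of_int x' * a + of_int y' * b"
  shows "x = x' \<and> y = y'"
proof -
  have 1: "area a (of_int x * a + of_int y * b) = of_int y * area a b" for x y
    using area_comb[of 1 a 0 b x y] by simp
  have 2: "area (of_int x * a + of_int y * b) b = of_int x * area a b" for x y
    using area_comb[of x a y b 0 1] by simp
  show ?thesis using 1 2 assms by (metis mult_right_cancel of_int_eq_iff)
qed

lemma int_subgroup:
  fixes S :: "int set" assumes "0 \<in> S" "\<And>x y. x \<in> S \<Longrightarrow> y \<in> S \<Longrightarrow> x - y \<in> S"
  obtains g where "g \<ge> 0" "S = range ((*) g)"
proof -
  have "x \<in> S" if "x \<in> group_closure S" for x
    using that by induction (use assms in auto)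
  hence "group_closure S = S" by (auto intro: group_closure.base)
  thus ?thesis using that[of "Gcd S"] group_closure_eq[of S] by simp
qed

text \<open>A triangular basis: p generates the ideal of first coordinates, r the ideal of second
  coordinates of elements with first coordinate 0. Two independent vectors in K keep both from being
  0.\<close>

lemma hermite_basis:
  assumes K: "addsub K" "K \<subseteq> lat a b" and nd: "u \<in> K" "v \<in> K" "area u v \<noteq> 0"
  obtains p q r :: int where "p > 0" "r > 0" "K = lat (of_int p * a + of_int q * b) (of_int r * b)"
proof -
  define S where "S = {y::int. of_int y * b \<in> K}"
  define T where "T = {x::int. \<exists>y::int. of_int x * a + of_int y * b \<in> K}"
  obtain r where r: "r \<ge> 0" "S = range ((*) r)"
  proof (rule int_subgroup[of S])
    show "0 \<in> S" using addsub_0[OF K(1)] by (simp add: S_def)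
    show "x - y \<in> S" if "x \<in> S" "y \<in> S" for x y
      using that addsub_diff[OF K(1)] by (simp add: S_def left_diff_distrib)
  qed blast
  obtain p where p: "p \<ge> 0" "T = range ((*) p)"
  proof (rule int_subgroup[of T])
    show "0 \<in> T" using addsub_0[OF K(1)] by (auto simp: T_def intro: exI[of _ 0])
    show "x - y \<in> T" if xy: "x \<in> T" "y \<in> T" for x y
    proof -
      obtain k l where kl: "of_int x * a + of_int k * b \<in> K" "of_int y * a + of_int l * b \<in> K"
        using xy unfolding T_def by blast
      have "of_int (x - y) * a + of_int (k - l) * b \<in> K"
        using addsub_diff[OF K(1) kl] by (simp add: algebra_simps)
      thus ?thesis unfolding T_def by blast
    qed
  qed blast
  have "p \<in> T" using p(2) by (metis mult.right_neutral rangeI)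
  then obtain q where q: "of_int p * a + of_int q * b \<in> K" by (auto simp: T_def)
  have "r \<in> S" using r(2) by (metis mult.right_neutral rangeI)
  hence rb: "of_int r * b \<in> K" by (simp add: S_def)
  let ?A = "of_int p * a + of_int q * b" and ?B = "of_int r * b"
  have eq: "K = lat ?A ?B"
  proof
    show "lat ?A ?B \<subseteq> K" using K(1) q rb by (rule lat_least)
    show "K \<subseteq> lat ?A ?B"
    proof
      fix z assume z: "z \<in> K"
      then obtain x y where xy: "z = of_int x * a + of_int y * b" using K(2) by (meson latE subsetD)
      hence "x \<in> T" using z by (auto simp: T_def)
      then obtain k where k: "x = p * k" using p by auto
      have "z - of_int k * ?A \<in> K" using K(1) z q addsub_of_int addsub_diff by blast
      moreover have "z - of_int k * ?A = of_int (y - k * q) * b" by (simp add: xy k algebra_simps)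
      ultimately have "y - k * q \<in> S" by (simp add: S_def)
      then obtain l where l: "y - k * q = r * l" using r by auto
      hence "y = k * q + r * l" by simp
      hence "z = of_int k * ?A + of_int l * ?B" by (simp add: xy k algebra_simps)
      thus "z \<in> lat ?A ?B" by (metis latI)
    qed
  qed
  have "area ?A ?B = of_int (p * r) * area a b"
    using area_comb[of p a q b 0 r] by simp
  moreover obtain x y x' y' where "u = of_int x * ?A + of_int y * ?B" "v = of_int x' * ?A + of_int y' * ?B"
    using nd(1,2) unfolding eq by (meson latE)
  ultimately have "p * r \<noteq> 0" using nd(3) area_comb[of x ?A y ?B x' y'] by auto
  thus ?thesis using that[OF _ _ eq] p r by auto
qed

text \<open>For a triangular basis division with remainder yields the p r representatives 0 <= x <
  p, 0 <= y < r.\<close>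

lemma index_hermite:
  fixes p q r :: int
  assumes nd: "area a b \<noteq> 0" and p: "p > 0" and r: "r > 0"
    and K: "K = lat (of_int p * a + of_int q * b) (of_int r * b)"
  shows "finite (coset K ` lat a b)" "card (coset K ` lat a b) = nat (p * r)"
proof -
  let ?A = "of_int p * a + of_int q * b" and ?B = "of_int r * b"
  let ?f = "\<lambda>(x, y). coset K (of_int x * a + of_int y * b)"
  let ?R = "{0..<p} \<times> {0..<r}"
  have aK: "addsub K" unfolding K by (rule addsub_lat)
  have "coset K ` lat a b = ?f ` ?R"
  proof
    show "?f ` ?R \<subseteq> coset K ` lat a b" by (auto intro: latI)
    show "coset K ` lat a b \<subseteq> ?f ` ?R"
    proof (clarify elim!: latE)
      fix x y
      \<comment> \<open>Reducing x by k multiples of p changes y by k q, so y has to be reduced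
        after that correction.\<close>
      define k l where "k = x div p" and "l = (y - k * q) div r"
      have x: "x = p * k + x mod p" by (simp add: k_def)
      have y: "y = k * q + r * l + (y - k * q) mod r" by (simp add: l_def)
      have "(of_int x * a + of_int y * b) - (of_int (x mod p) * a + of_int ((y - k * q) mod r) * b)
        = of_int (x - x mod p) * a + of_int (y - (y - k * q) mod r) * b" by (simp add: algebra_simps)
      also have "x - x mod p = p * k" using x by linarith
      also have "y - (y - k * q) mod r = k * q + r * l" using y by linarith
      also have "of_int (p * k) * a + of_int (k * q + r * l) * b = of_int k * ?A + of_int l * ?B"
        by (simp add: algebra_simps)
      also have "\<dots> \<in> K" unfolding K by (rule latI)
      finally have "coset K (of_int x * a + of_int y * b) = ?f (x mod p, (y - k * q) mod r)"
        by (simp add: coset_eq[OF aK])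
      moreover have "(x mod p, (y - k * q) mod r) \<in> ?R" using p r by auto
      ultimately show "coset K (of_int x * a + of_int y * b) \<in> ?f ` ?R" by (rule image_eqI)
    qed
  qed
  moreover have "inj_on ?f ?R"
  proof (rule inj_onI, clarsimp simp: coset_eq[OF aK])
    fix x y x' y' assume b: "0 \<le> x" "x < p" "0 \<le> y" "y < r" "0 \<le> x'" "x' < p" "0 \<le> y'" "y' < r"
    assume "of_int x * a + of_int y * b - (of_int x' * a + of_int y' * b) \<in> K"
    then obtain m n where "of_int x * a + of_int y * b - (of_int x' * a + of_int y' * b)
        = of_int m * ?A + of_int n * ?B" unfolding K by (meson latE)
    hence "of_int (x - x') * a + of_int (y - y') * b = of_int (m * p) * a + of_int (m * q + n * r) * b"
      by (simp add: algebra_simps)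
    hence e: "x - x' = m * p" "y - y' = m * q + n * r" using lat_coord_unique[OF nd] by blast+
    have small: "j = 0" if "\<bar>j * c\<bar> < c" for j c :: int
    proof (rule ccontr)
      assume "j \<noteq> 0" hence "\<bar>j\<bar> \<ge> 1" by simp
      hence "1 * \<bar>c\<bar> \<le> \<bar>j\<bar> * \<bar>c\<bar>" by (intro mult_right_mono) auto
      hence "\<bar>c\<bar> \<le> \<bar>j * c\<bar>" by (simp add: abs_mult)
      thus False using that by linarith
    qed
    have m: "m = 0" using e(1) b by (intro small[of m p]) auto
    have "n = 0" using e(2) b m by (intro small[of n r]) auto
    thus "x = x' \<and> y = y'" using e m by simp
  qed
  ultimately show "finite (coset K ` lat a b)" "card (coset K ` lat a b) = nat (p * r)"
    using p r by (auto simp: card_image card_cartesian_product nat_mult_distrib)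
qed

definition is_lat :: "complex set \<Rightarrow> bool" where
  "is_lat K \<longleftrightarrow> (\<exists>a b. K = lat a b \<and> area a b \<noteq> 0)"

definition covol :: "complex set \<Rightarrow> real" where
  "covol K = (THE c. \<exists>a b. K = lat a b \<and> c = \<bar>area a b\<bar>)"

lemma is_latI: "area a b \<noteq> 0 \<Longrightarrow> is_lat (lat a b)" by (auto simp: is_lat_def)

lemma is_lat_addsub: "is_lat K \<Longrightarrow> addsub K" by (auto simp: is_lat_def addsub_lat)

lemma area_sub:
  assumes "lat a' b' \<subseteq> lat a b" obtains k :: int where "area a' b' = of_int k * area a b"
proof -
  have "a' \<in> lat a b" "b' \<in> lat a b" using assms lat_gen by auto
  then obtain x y x' y' where "a' = of_int x * a + of_int y * b" "b' = of_int x' * a + of_int y' * b"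
    by (meson latE)
  thus ?thesis using that area_comb by metis
qed

lemma area_le: assumes "lat a' b' \<subseteq> lat a b" "area a' b' \<noteq> 0" shows "\<bar>area a b\<bar> \<le> \<bar>area a' b'\<bar>"
proof -
  obtain k where k: "area a' b' = of_int k * area a b" using area_sub assms by blast
  hence "1 \<le> \<bar>k\<bar>" using assms(2) by auto
  hence "1 * \<bar>area a b\<bar> \<le> \<bar>of_int k\<bar> * \<bar>area a b\<bar>" by (intro mult_right_mono) auto
  thus ?thesis by (simp add: k abs_mult)
qed

text \<open>Each of the two areas is an integer multiple of the other. This makes
  \<open>covol\<close> well defined.\<close>

lemma lat_eq_area: assumes "lat a' b' = lat a b" shows "\<bar>area a' b'\<bar> = \<bar>area a b\<bar>"
proof -
  obtain k where k: "area a' b' = of_int k * area a b" using area_sub[of a' b' a b] assms by blast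
  obtain l where l: "area a b = of_int l * area a' b'" using area_sub[of a b a' b'] assms by blast
  show ?thesis
  proof (cases "area a b = 0")
    case False
    hence "area a' b' \<noteq> 0" using l by auto
    hence "\<bar>area a b\<bar> \<le> \<bar>area a' b'\<bar>" "\<bar>area a' b'\<bar> \<le> \<bar>area a b\<bar>"
      using False assms by (auto intro!: area_le)
    thus ?thesis by linarith
  next
    case True thus ?thesis unfolding k by simp
  qed
qed

lemma covol_lat: "covol (lat a b) = \<bar>area a b\<bar>"
  unfolding covol_def
proof (rule the_equality)
  fix c assume "\<exists>a' b'. lat a b = lat a' b' \<and> c = \<bar>area a' b'\<bar>"
  thus "c = \<bar>area a b\<bar>" using lat_eq_area by blast
qed blast

lemma covol_pos: "is_lat K \<Longrightarrow> covol K > 0"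
  by (auto simp: is_lat_def covol_lat)

text \<open>Expressing the index as a ratio of covolumes makes it multiplicative in towers and
  invariant under scaling and conjugation without further work on cosets.\<close>

lemma lattice_index_covol:
  assumes "is_lat L" "is_lat K" "K \<subseteq> L"
  shows "finite_index_sublattice L K" "real (lattice_index L K) = covol K / covol L"
proof -
  obtain a b where L: "L = lat a b" and nd: "area a b \<noteq> 0" using assms(1) by (auto simp: is_lat_def)
  obtain a' b' where K: "K = lat a' b'" and nd': "area a' b' \<noteq> 0" using assms(2) by (auto simp: is_lat_def)
  have aK: "addsub K" and aL: "addsub L" using assms is_lat_addsub by auto
  have "a' \<in> K" "b' \<in> K" unfolding K by (rule lat_gen)+
  then obtain p q r :: int where pqr: "p > 0" "r > 0" "K = lat (of_int p * a + of_int q * b) (of_int r * b)"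
    using hermite_basis[OF aK _ _ _ nd'] assms(3) unfolding L by metis
  note i = index_hermite[OF nd pqr]
  show "finite_index_sublattice L K"
    unfolding finite_index_sublattice_def subgroup_additive[OF aL] rcosets_additive
    using aK assms(3) i(1) L by auto
  have "covol K = \<bar>of_int (p * r) * area a b\<bar>"
    unfolding pqr(3) covol_lat using area_comb[of p a q b 0 r] by simp
  moreover have "lattice_index L K = nat (p * r)"
    unfolding lattice_index_def rcosets_additive using i(2) L by simp
  ultimately show "real (lattice_index L K) = covol K / covol L"
    using pqr nd by (simp add: L covol_lat abs_mult)
qed

lemma lattice_index_pos: "is_lat L \<Longrightarrow> is_lat K \<Longrightarrow> K \<subseteq> L \<Longrightarrow> lattice_index L K > 0"
proof -
  assume *: "is_lat L" "is_lat K" "K \<subseteq> L"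
  have "real (lattice_index L K) > 0"
    unfolding lattice_index_covol(2)[OF *] using covol_pos * by simp
  thus ?thesis by simp
qed

lemma lattice_index_mult:
  assumes "is_lat L" "is_lat J" "is_lat K" "K \<subseteq> J" "J \<subseteq> L"
  shows "lattice_index L K = lattice_index L J * lattice_index J K"
proof -
  have "real (lattice_index L K) = real (lattice_index L J * lattice_index J K)"
    using assms lattice_index_covol(2)[of L K] lattice_index_covol(2)[of L J] lattice_index_covol(2)[of J K]
      covol_pos[of J] by (simp add: order_trans[of K J L])
  thus ?thesis by (simp only: of_nat_eq_iff)
qed

lemma is_lat_sub:
  assumes "addsub K" "K \<subseteq> L" "is_lat L" "u \<in> K" "v \<in> K" "area u v \<noteq> 0"
  shows "is_lat K"
proof -
  obtain a b where L: "L = lat a b" and nd: "area a b \<noteq> 0" using assms(3) by (auto simp: is_lat_def)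
  obtain p q r :: int where pqr: "p > 0" "r > 0" "K = lat (of_int p * a + of_int q * b) (of_int r * b)"
    using hermite_basis[OF assms(1) _ assms(4-6)] assms(2) unfolding L by metis
  show ?thesis unfolding pqr(3)
    using pqr(1,2) nd area_comb[of p a q b 0 r] by (intro is_latI) auto
qed

text \<open>Finitely many cosets force two multiples of any z in L into the same coset, so a nonzero
  multiple of each basis vector lies in K and K has rank two.\<close>

lemma finite_index_is_lat:
  assumes L: "is_lat L" and K: "finite_index_sublattice L K"
  shows "is_lat K" "K \<subseteq> L" "addsub K"
proof -
  obtain a b where L': "L = lat a b" and nd: "area a b \<noteq> 0" using assms(1) by (auto simp: is_lat_def)
  show aK: "addsub K" and KL: "K \<subseteq> L"
    using K subgroup_additive[OF is_lat_addsub[OF L]] by (auto simp: finite_index_sublattice_def)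
  have fin: "finite (coset K ` L)" using K by (simp add: finite_index_sublattice_def rcosets_additive)
  have mult: "\<exists>n::int. n \<noteq> 0 \<and> of_int n * z \<in> K" if "z \<in> L" for z
  proof -
    have "range (\<lambda>n::nat. coset K (of_nat n * z)) \<subseteq> coset K ` L"
      using addsub_of_nat[OF is_lat_addsub[OF L] that] by auto
    hence "finite (range (\<lambda>n::nat. coset K (of_nat n * z)))" using fin finite_subset by blast
    hence "\<not> inj (\<lambda>n::nat. coset K (of_nat n * z))" using finite_imageD infinite_UNIV_nat by blast
    then obtain m n :: nat where "m \<noteq> n" "coset K (of_nat m * z) = coset K (of_nat n * z)"
      by (auto simp: inj_on_def)
    hence "of_nat m * z - of_nat n * z \<in> K" using coset_eq[OF aK] by blast
    hence "of_int (int m - int n) * z \<in> K" by (simp add: algebra_simps)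
    thus ?thesis using \<open>m \<noteq> n\<close> by (intro exI[of _ "int m - int n"]) auto
  qed
  obtain m n :: int where mn: "m \<noteq> 0" "of_int m * a \<in> K" "n \<noteq> 0" "of_int n * b \<in> K"
    using mult lat_gen L' by metis
  have "area (of_int m * a) (of_int n * b) \<noteq> 0" using area_comb[of m a 0 b 0 n] mn nd by simp
  thus "is_lat K" using is_lat_sub[OF aK KL L mn(2,4)] by blast
qed

lemma lat_image_mult: "(\<lambda>z. c * z) ` lat a b = lat (c * a) (c * b)"
proof -
  have "c * (of_int x * a + of_int y * b) = of_int x * (c * a) + of_int y * (c * b)" for x y
    by (simp add: algebra_simps)
  thus ?thesis by (force simp: lat_def image_iff)
qed

lemma lat_image_cnj: "cnj ` lat a b = lat (cnj a) (cnj b)"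
  by (force simp: lat_def image_iff)

lemma area_mult: "area (c * a) (c * b) = (cmod c)\<^sup>2 * area a b"
proof -
  have e: "complex_of_real ((cmod c)\<^sup>2) = c * cnj c" by (rule complex_norm_square)
  have 1: "cnj (c * a) * (c * b) = complex_of_real ((cmod c)\<^sup>2) * (cnj a * b)"
    unfolding e by (simp add: algebra_simps)
  have "Im (complex_of_real r * z) = r * Im z" for r z by simp
  thus ?thesis unfolding area_def 1 by blast
qed

lemma area_cnj: "area (cnj a) (cnj b) = - area a b"
  by (simp add: area_def algebra_simps)

lemma is_lat_mult: "c \<noteq> 0 \<Longrightarrow> is_lat K \<Longrightarrow> is_lat ((\<lambda>z. c * z) ` K)"
  using area_mult[of c] by (auto simp: is_lat_def lat_image_mult intro!: is_latI[unfolded is_lat_def])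

lemma covol_mult: "is_lat K \<Longrightarrow> covol ((\<lambda>z. c * z) ` K) = (cmod c)\<^sup>2 * covol K"
  by (auto simp: is_lat_def lat_image_mult covol_lat area_mult abs_mult)

lemma is_lat_cnj: "is_lat K \<Longrightarrow> is_lat (cnj ` K)"
  using area_cnj by (auto simp: is_lat_def lat_image_cnj intro!: is_latI[unfolded is_lat_def])

lemma covol_cnj: "is_lat K \<Longrightarrow> covol (cnj ` K) = covol K"
  by (auto simp: is_lat_def lat_image_cnj covol_lat area_cnj)

text \<open>By Cramer's rule the coordinates of z are areas divided by the area of the basis, and an
  area is at most the product of the lengths.\<close>

lemma finite_lat_ball: assumes "is_lat L" shows "finite {z \<in> L. cmod z \<le> R}"
proof -
  obtain a b where L: "L = lat a b" and nd: "area a b \<noteq> 0" using assms(1) by (auto simp: is_lat_def)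
  define M where "M = (cmod a + cmod b) * R / \<bar>area a b\<bar>"
  let ?B = "{- \<lceil>M\<rceil>..\<lceil>M\<rceil>}"
  have "{z \<in> L. cmod z \<le> R} \<subseteq> (\<lambda>(x, y). of_int x * a + of_int y * b) ` (?B \<times> ?B)"
  proof
    fix z assume "z \<in> {z \<in> L. cmod z \<le> R}"
    then obtain x y where z: "z = of_int x * a + of_int y * b" "cmod z \<le> R" unfolding L by (auto elim: latE)
    have ar: "\<bar>area u v\<bar> \<le> cmod u * cmod v" for u v
      using abs_Im_le_cmod[of "cnj u * v"] unfolding area_def norm_mult complex_mod_cnj .
    have bnd: "k \<in> ?B" if "\<bar>of_int k * area a b\<bar> \<le> (cmod a + cmod b) * R" for k :: int
    proof -
      have "\<bar>of_int k\<bar> \<le> M" using that nd by (simp add: M_def abs_mult field_simps)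
      thus ?thesis by (simp add: abs_le_iff) linarith
    qed
    have R: "R \<ge> 0" using z(2) norm_ge_zero order_trans by blast
    have "\<bar>of_int y * area a b\<bar> \<le> cmod a * cmod z"
      using ar[of a z] area_comb[of 1 a 0 b x y] z(1) by simp
    also have "\<dots> \<le> (cmod a + cmod b) * R" using z(2) R by (intro mult_mono) auto
    finally have y: "y \<in> ?B" by (rule bnd)
    have "\<bar>of_int x * area a b\<bar> \<le> cmod z * cmod b"
      using ar[of z b] area_comb[of x a y b 0 1] z(1) by simp
    also have "\<dots> \<le> R * (cmod a + cmod b)" using z(2) R by (intro mult_mono) auto
    finally have x: "x \<in> ?B" by (intro bnd) (simp add: mult.commute)
    show "z \<in> (\<lambda>(x, y). of_int x * a + of_int y * b) ` (?B \<times> ?B)"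
      using x y z(1) by (intro image_eqI[of _ _ "(x, y)"]) auto
  qed
  thus ?thesis by (rule finite_subset) auto
qed

section \<open>Fractional ideals and the class group\<close>

lemma group_closure_addsub: "addsub (group_closure S)"
  by (auto simp: addsub_def intro: group_closure.diff)

lemma group_closure_base: "x \<in> S \<Longrightarrow> x \<in> group_closure S"
  by (auto intro: group_closure.base)

lemma group_closure_least: assumes "addsub K" "S \<subseteq> K" shows "group_closure S \<subseteq> K"
proof
  fix x assume "x \<in> group_closure S"
  thus "x \<in> K" by induction (use assms addsub_0 addsub_diff in auto)
qed

lemma ideal_mult_addsub: "addsub (ideal_mult A B)"
  unfolding ideal_mult_def by (rule group_closure_addsub)

lemma ideal_multI: "a \<in> A \<Longrightarrow> b \<in> B \<Longrightarrow> a * b \<in> ideal_mult A B"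
  unfolding ideal_mult_def by (rule group_closure_base) auto

lemma ideal_mult_least:
  "addsub K \<Longrightarrow> (\<And>a b. a \<in> A \<Longrightarrow> b \<in> B \<Longrightarrow> a * b \<in> K) \<Longrightarrow> ideal_mult A B \<subseteq> K"
  unfolding ideal_mult_def by (rule group_closure_least) auto

lemma ideal_mult_comm: "ideal_mult A B = ideal_mult B A"
proof -
  have "{a * b | a b. a \<in> A \<and> b \<in> B} = {a * b | a b. a \<in> B \<and> b \<in> A}" by (auto; metis mult.commute)
  thus ?thesis by (simp add: ideal_mult_def)
qed

lemma addsub_vimage_mult: "addsub K \<Longrightarrow> addsub {x. x * c \<in> K}" "addsub K \<Longrightarrow> addsub {x. c * x \<in> K}"
  by (auto simp: addsub_def algebra_simps)

text \<open>For fixed c the x with x c in the right side form an additive subgroup; it contains all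
  products a b and hence the whole ideal product. The same device recurs for every closure property
  of \<open>ideal_mult\<close>.\<close>

lemma ideal_mult_assoc_sub: "ideal_mult (ideal_mult A B) C \<subseteq> ideal_mult A (ideal_mult B C)"
proof (rule ideal_mult_least)
  fix x c assume x: "x \<in> ideal_mult A B" and c: "c \<in> C"
  have "ideal_mult A B \<subseteq> {x. x * c \<in> ideal_mult A (ideal_mult B C)}"
  proof (rule ideal_mult_least)
    fix a b assume "a \<in> A" "b \<in> B"
    hence "a * (b * c) \<in> ideal_mult A (ideal_mult B C)" using c by (intro ideal_multI)
    thus "a * b \<in> {x. x * c \<in> ideal_mult A (ideal_mult B C)}" by (simp add: mult.assoc)
  qed (intro addsub_vimage_mult ideal_mult_addsub)
  thus "x * c \<in> ideal_mult A (ideal_mult B C)" using x by auto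
qed (rule ideal_mult_addsub)

lemma ideal_mult_assoc: "ideal_mult (ideal_mult A B) C = ideal_mult A (ideal_mult B C)"
proof
  have "ideal_mult A (ideal_mult B C) = ideal_mult (ideal_mult C B) A"
    by (metis ideal_mult_comm)
  also have "\<dots> \<subseteq> ideal_mult C (ideal_mult B A)" by (rule ideal_mult_assoc_sub)
  also have "\<dots> = ideal_mult (ideal_mult A B) C" by (metis ideal_mult_comm)
  finally show "ideal_mult A (ideal_mult B C) \<subseteq> ideal_mult (ideal_mult A B) C" .
qed (rule ideal_mult_assoc_sub)

abbreviation scl :: "complex \<Rightarrow> complex set \<Rightarrow> complex set" where
  "scl c K \<equiv> (\<lambda>z. c * z) ` K"

lemma scale_scale: "scl a (scl b K) = scl (a * b) K"
  by (simp add: image_image mult.assoc)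

lemma scale_mono: "K \<subseteq> L \<Longrightarrow> scl c K \<subseteq> scl c L" by auto

lemma scale_inj: assumes "c \<noteq> 0" "scl c K = scl c L" shows "K = L"
proof -
  have "scl (inverse c) (scl c K) = scl (inverse c) (scl c L)" using assms by simp
  thus ?thesis using assms(1) by (simp add: scale_scale)
qed

lemma cnj_scale: "cnj ` scl c K = scl (cnj c) (cnj ` K)"
  by (simp add: image_image)

lemma ideal_mult_scale: "ideal_mult (scl c A) B = scl c (ideal_mult A B)"
proof -
  have "{a * b | a b. a \<in> scl c A \<and> b \<in> B} = (*) c ` {a * b | a b. a \<in> A \<and> b \<in> B}"
  proof (intro equalityI subsetI)
    fix x assume "x \<in> {a * b | a b. a \<in> scl c A \<and> b \<in> B}"
    then obtain a b where "a \<in> A" "b \<in> B" "x = c * (a * b)" by (auto simp: mult.assoc)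
    thus "x \<in> (*) c ` {a * b | a b. a \<in> A \<and> b \<in> B}" by blast
  next
    fix x assume "x \<in> (*) c ` {a * b | a b. a \<in> A \<and> b \<in> B}"
    then obtain a b where "a \<in> A" "b \<in> B" "x = (c * a) * b" by (auto simp: mult.assoc)
    thus "x \<in> {a * b | a b. a \<in> scl c A \<and> b \<in> B}" by blast
  qed
  thus ?thesis by (simp add: ideal_mult_def group_closure_mult_all_eq)
qed

lemma ideal_mult_scale2: "ideal_mult (scl a A) (scl b B) = scl (a * b) (ideal_mult A B)"
  by (metis ideal_mult_scale ideal_mult_comm scale_scale)

lemma ideal_mult_cnj: "cnj ` ideal_mult A B = ideal_mult (cnj ` A) (cnj ` B)"
proof -
  have 1: "ideal_mult (cnj ` A) (cnj ` B) \<subseteq> cnj ` ideal_mult A B" for A B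
    by (rule ideal_mult_least[OF addsub_image_cnj[OF ideal_mult_addsub]])
      (auto simp flip: complex_cnj_mult intro!: imageI ideal_multI)
  have "cnj ` (cnj ` ideal_mult A B) \<subseteq> cnj ` ideal_mult (cnj ` A) (cnj ` B)"
    using 1[of "cnj ` A" "cnj ` B"] by (simp add: image_image)
  hence "cnj ` ideal_mult A B \<subseteq> ideal_mult (cnj ` A) (cnj ` B)"
    by (simp add: inj_image_subset_iff inj_def)
  thus ?thesis using 1 by blast
qed

context imag_quad
begin

lemma addsub_F: "addsub F" by (auto simp: addsub_def)

text \<open>The working form of \<open>fractional_ideal\<close>: a plane lattice in F, where
  stability under the single generator theta replaces stability under all integers.\<close>

definition frac_ideal :: "complex set \<Rightarrow> bool" where
  "frac_ideal J \<longleftrightarrow> is_lat J \<and> J \<subseteq> F \<and> (\<forall>x\<in>J. theta * x \<in> J)"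

lemma frac_ideal_lat: "frac_ideal J \<Longrightarrow> is_lat J" and frac_ideal_F: "frac_ideal J \<Longrightarrow> J \<subseteq> F"
  and frac_ideal_theta: "frac_ideal J \<Longrightarrow> x \<in> J \<Longrightarrow> theta * x \<in> J"
  and frac_ideal_addsub: "frac_ideal J \<Longrightarrow> addsub J"
  by (auto simp: frac_ideal_def is_lat_addsub)

lemma theta_Ok_closed:
  assumes "addsub J" "\<And>x. x \<in> J \<Longrightarrow> theta * x \<in> J" "a \<in> Ok" "x \<in> J"
  shows "a * x \<in> J"
proof -
  obtain k l where "a = of_int k + of_int l * theta" using assms(3) by (meson OkE)
  hence "a * x = of_int k * x + of_int l * (theta * x)" by (simp add: algebra_simps)
  thus ?thesis using addsub_comb[OF assms(1)] assms by simp
qed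

lemma frac_ideal_Ok: "frac_ideal J \<Longrightarrow> a \<in> Ok \<Longrightarrow> x \<in> J \<Longrightarrow> a * x \<in> J"
  using theta_Ok_closed frac_ideal_addsub frac_ideal_theta by metis

lemma Ok_lat: "Ok = lat 1 theta"
  by (simp add: ring_of_ints_eq lat_def)

lemma is_lat_Ok: "is_lat Ok"
  unfolding Ok_lat using Im_theta by (intro is_latI) (simp add: area_def)

lemma area_theta: "x \<noteq> 0 \<Longrightarrow> area x (theta * x) \<noteq> 0"
  using area_mult[of x 1 theta] Im_theta by (simp add: area_def mult.commute)

text \<open>A bounded denominator puts J inside a scaled copy of the ring of integers, and x, theta
  x are independent for any nonzero x in J, so J is a lattice. Conversely the denominators of a
  basis of J can be cleared.\<close>

lemma fractional_ideal_iff_frac_ideal: "fractional_ideal d J \<longleftrightarrow> frac_ideal J"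
proof
  assume J: "fractional_ideal d J"
  hence J': "J \<subseteq> F" "addsub J" "J \<noteq> {0}" "\<And>a x. a \<in> Ok \<Longrightarrow> x \<in> J \<Longrightarrow> a * x \<in> J"
    using subgroup_additive[OF addsub_F] by (auto simp: fractional_ideal_def)
  obtain c where c: "c \<in> Ok" "c \<noteq> 0" "\<And>x. x \<in> J \<Longrightarrow> c * x \<in> Ok"
    using J by (auto simp: fractional_ideal_def)
  obtain x where x: "x \<in> J" "x \<noteq> 0" using J' addsub_0 by blast
  have "J \<subseteq> scl (inverse c) Ok"
  proof
    fix x assume "x \<in> J"
    thus "x \<in> scl (inverse c) Ok" using c by (intro image_eqI[of _ _ "c * x"]) auto
  qed
  moreover have "is_lat (scl (inverse c) Ok)" using c is_lat_mult is_lat_Ok by simp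
  ultimately have "is_lat J"
    using is_lat_sub[OF J'(2) _ _ x(1) _ area_theta[OF x(2)]] J'(4)[OF Ok_theta x(1)] by blast
  thus "frac_ideal J" using J' by (auto simp: frac_ideal_def)
next
  assume J: "frac_ideal J"
  then obtain a b where ab: "J = lat a b" "area a b \<noteq> 0" by (auto simp: frac_ideal_def is_lat_def)
  have "a \<in> F" "b \<in> F" using ab lat_gen frac_ideal_F[OF J] by auto
  then obtain D E :: int where DE: "D > 0" "of_int D * a \<in> Zw" "E > 0" "of_int E * b \<in> Zw"
    using denominator by metis
  have Zw_Ok: "z \<in> Ok" if z: "z \<in> Zw" for z
  proof -
    obtain x y where "z = of_int x + of_int y * w" using z by (auto simp: Zw_def)
    thus ?thesis by (simp add: Ok_add Ok_mult w_in_Ok)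
  qed
  have "of_int (D * E) * x \<in> Ok" if x: "x \<in> J" for x
  proof -
    obtain k l where "x = of_int k * a + of_int l * b" using x ab by (meson latE)
    hence "of_int (D * E) * x = of_int (E * k) * (of_int D * a) + of_int (D * l) * (of_int E * b)"
      by (simp add: algebra_simps)
    also have "\<dots> \<in> Ok" by (rule Ok_add) (rule Ok_mult[OF Ok_of_int Zw_Ok], fact DE)+
    finally show ?thesis .
  qed
  moreover have "of_int (D * E) \<noteq> (0::complex)" using DE by simp
  moreover have "J \<noteq> {0}"
  proof
    assume "J = {0}"
    hence "a = 0" using lat_gen(1)[of a b] unfolding ab(1) by blast
    thus False using ab(2) by (simp add: area_def)
  qed
  ultimately show "fractional_ideal d J"
    unfolding fractional_ideal_def subgroup_additive[OF addsub_F]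
    using frac_ideal_addsub[OF J] frac_ideal_Ok[OF J] frac_ideal_F[OF J] Ok_of_int[of "D * E"] by (intro conjI bexI[of _ "of_int (D * E)"] ballI) blast+
qed

lemma frac_ideal_scale: assumes "frac_ideal J" "a \<in> F" "a \<noteq> 0" shows "frac_ideal (scl a J)"
  unfolding frac_ideal_def
proof (intro conjI ballI)
  show "is_lat (scl a J)" using assms is_lat_mult frac_ideal_lat by blast
  show "scl a J \<subseteq> F" using assms frac_ideal_F by auto
  fix x assume "x \<in> scl a J"
  then obtain y where y: "y \<in> J" "x = a * y" by auto
  hence "theta * x = a * (theta * y)" by simp
  thus "theta * x \<in> scl a J" using frac_ideal_theta[OF assms(1) y(1)] by blast
qed

lemma frac_ideal_cnj: assumes "frac_ideal J" shows "frac_ideal (cnj ` J)"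
  unfolding frac_ideal_def
proof (intro conjI ballI)
  show "is_lat (cnj ` J)" using assms is_lat_cnj frac_ideal_lat by blast
  show "cnj ` J \<subseteq> F" using assms frac_ideal_F by auto
  fix x assume "x \<in> cnj ` J"
  then obtain y where y: "y \<in> J" "x = cnj y" by auto
  have "cnj theta * y \<in> J" using frac_ideal_Ok[OF assms Ok_cnj[OF Ok_theta] y(1)] .
  moreover have "theta * x = cnj (cnj theta * y)" by (simp add: y)
  ultimately show "theta * x \<in> cnj ` J" by blast
qed

lemma frac_ideal_OkF: "frac_ideal Ok"
  by (auto simp: frac_ideal_def is_lat_Ok Ok_F Ok_mult)

lemma frac_ideal_nonzero: assumes "frac_ideal J" obtains x where "x \<in> J" "x \<noteq> 0"
proof -
  obtain a b where "J = lat a b" "area a b \<noteq> 0" using assms by (auto simp: frac_ideal_def is_lat_def)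
  moreover from this have "a \<noteq> 0" by (auto simp: area_def)
  ultimately show ?thesis using that[of a] lat_gen(1) by blast
qed

lemma frac_ideal_ideal_mult: assumes A: "frac_ideal A" and B: "frac_ideal B" shows "frac_ideal (ideal_mult A B)"
proof -
  obtain c where c: "c \<in> Ok" "c \<noteq> 0" "\<And>x. x \<in> A \<Longrightarrow> c * x \<in> Ok"
    using A unfolding fractional_ideal_iff_frac_ideal[symmetric] fractional_ideal_def by blast
  obtain e where e: "e \<in> Ok" "e \<noteq> 0" "\<And>x. x \<in> B \<Longrightarrow> e * x \<in> Ok"
    using B unfolding fractional_ideal_iff_frac_ideal[symmetric] fractional_ideal_def by blast
  obtain x y where xy: "x \<in> A" "x \<noteq> 0" "y \<in> B" "y \<noteq> 0" using frac_ideal_nonzero A B by metis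
  have aOk: "addsub Ok" by (rule is_lat_addsub[OF is_lat_Ok])
  have "ideal_mult A B \<subseteq> F"
    using frac_ideal_F[OF A] frac_ideal_F[OF B] by (intro ideal_mult_least addsub_F F_mult) blast+
  moreover have "ideal_mult A B \<noteq> {0}"
  proof
    assume "ideal_mult A B = {0}"
    hence "x * y = 0" using ideal_multI[OF xy(1,3)] by blast
    thus False using xy by simp
  qed
  moreover have "a * z \<in> ideal_mult A B" if "a \<in> Ok" "z \<in> ideal_mult A B" for a z
  proof -
    have "ideal_mult A B \<subseteq> {z. a * z \<in> ideal_mult A B}"
    proof (rule ideal_mult_least)
      fix x y assume "x \<in> A" "y \<in> B"
      hence "(a * x) * y \<in> ideal_mult A B" using frac_ideal_Ok[OF A that(1)] by (intro ideal_multI)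
      thus "x * y \<in> {z. a * z \<in> ideal_mult A B}" by (simp add: mult.assoc)
    qed (intro addsub_vimage_mult ideal_mult_addsub)
    thus ?thesis using that by auto
  qed
  moreover have "(c * e) * z \<in> Ok" if "z \<in> ideal_mult A B" for z
  proof -
    have "ideal_mult A B \<subseteq> {z. (c * e) * z \<in> Ok}"
    proof (rule ideal_mult_least)
      fix x y assume "x \<in> A" "y \<in> B"
      hence "(c * x) * (e * y) \<in> Ok" using Ok_mult[OF c(3) e(3)] by blast
      thus "x * y \<in> {z. (c * e) * z \<in> Ok}" by (simp add: ac_simps)
    qed (intro addsub_vimage_mult aOk)
    thus ?thesis using that by auto
  qed
  moreover have "c * e \<in> Ok" "c * e \<noteq> 0" using c e Ok_mult by auto
  ultimately have "fractional_ideal d (ideal_mult A B)"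
    unfolding fractional_ideal_def subgroup_additive[OF addsub_F] using ideal_mult_addsub
    by (intro conjI bexI[of _ "c * e"] ballI) blast+
  thus ?thesis by (simp add: fractional_ideal_iff_frac_ideal)
qed

lemma ideal_mult_Ok: assumes "frac_ideal J" shows "ideal_mult Ok J = J"
proof
  show "ideal_mult Ok J \<subseteq> J" using frac_ideal_addsub[OF assms] frac_ideal_Ok[OF assms] by (rule ideal_mult_least)
  show "J \<subseteq> ideal_mult Ok J" using ideal_multI[of 1 Ok _ J] by auto
qed

section \<open>Ideal classes as sets of nonzero multiples of one ideal\<close>

lemma ideal_class_eq: assumes "frac_ideal J" shows "ideal_class d J = {scl a J | a. a \<in> F \<and> a \<noteq> 0}"
proof -
  have "ideal_mult (principal_ideal d a) J = scl a J" for a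
    unfolding principal_ideal_def by (simp add: ideal_mult_scale ideal_mult_Ok[OF assms])
  thus ?thesis
    by (auto simp: ideal_class_def r_coset_def ideal_group_def principal_ideals_def)
qed

lemma ideal_class_self: "frac_ideal J \<Longrightarrow> J \<in> ideal_class d J"
  by (auto simp: ideal_class_eq intro!: exI[of _ 1])

lemma ideal_class_scale: assumes "frac_ideal J" "a \<in> F" "a \<noteq> 0" shows "ideal_class d (scl a J) = ideal_class d J"
  unfolding ideal_class_eq[OF assms(1)] ideal_class_eq[OF frac_ideal_scale[OF assms]]
proof (intro equalityI subsetI)
  fix X assume "X \<in> {scl b J | b. b \<in> F \<and> b \<noteq> 0}"
  then obtain b where b: "X = scl b J" "b \<in> F" "b \<noteq> 0" by blast
  have "X = scl (b / a) (scl a J)" unfolding b(1) scale_scale using assms by simp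
  moreover have "b / a \<in> F" "b / a \<noteq> 0" using b assms by simp_all
  ultimately show "X \<in> {scl b (scl a J) | b. b \<in> F \<and> b \<noteq> 0}" by blast
next
  fix X assume "X \<in> {scl b (scl a J) | b. b \<in> F \<and> b \<noteq> 0}"
  then obtain b where b: "X = scl b (scl a J)" "b \<in> F" "b \<noteq> 0" by blast
  have "X = scl (b * a) J" unfolding b(1) scale_scale ..
  moreover have "b * a \<in> F" "b * a \<noteq> 0" using b assms by simp_all
  ultimately show "X \<in> {scl b J | b. b \<in> F \<and> b \<noteq> 0}" by blast
qed

lemma ideal_class_eq_iff:
  assumes "frac_ideal J" "frac_ideal J'"
  shows "ideal_class d J = ideal_class d J' \<longleftrightarrow> (\<exists>a\<in>F. a \<noteq> 0 \<and> J' = scl a J)"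
proof
  assume "ideal_class d J = ideal_class d J'"
  hence "J' \<in> ideal_class d J" using ideal_class_self[OF assms(2)] by simp
  thus "\<exists>a\<in>F. a \<noteq> 0 \<and> J' = scl a J" unfolding ideal_class_eq[OF assms(1)] by blast
next
  assume "\<exists>a\<in>F. a \<noteq> 0 \<and> J' = scl a J"
  then obtain a where a: "a \<in> F" "a \<noteq> 0" "J' = scl a J" by blast
  show "ideal_class d J = ideal_class d J'" unfolding a(3) ideal_class_scale[OF assms(1) a(1,2)] ..
qed

lemma carrier_class_group: "carrier (class_group d) = {ideal_class d J | J. frac_ideal J}"
  by (auto simp: class_group_def FactGroup_def RCOSETS_def ideal_class_def ideal_group_def fractional_ideal_iff_frac_ideal)

lemma one_class_group: "\<one>\<^bsub>class_group d\<^esub> = ideal_class d Ok"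
  by (auto simp: class_group_def FactGroup_def ideal_class_eq[OF frac_ideal_OkF] principal_ideals_def principal_ideal_def)

lemma mult_class_group:
  assumes "frac_ideal A" "frac_ideal B"
  shows "ideal_class d A \<otimes>\<^bsub>class_group d\<^esub> ideal_class d B = ideal_class d (ideal_mult A B)"
proof -
  have "ideal_class d A \<otimes>\<^bsub>class_group d\<^esub> ideal_class d B
      = {ideal_mult X Y | X Y. X \<in> ideal_class d A \<and> Y \<in> ideal_class d B}"
    by (auto simp: class_group_def FactGroup_def set_mult_def ideal_group_def)
  also have "\<dots> = ideal_class d (ideal_mult A B)"
    unfolding ideal_class_eq[OF frac_ideal_ideal_mult[OF assms]]
  proof (intro equalityI subsetI)
    fix Z assume "Z \<in> {ideal_mult X Y | X Y. X \<in> ideal_class d A \<and> Y \<in> ideal_class d B}"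
    then obtain X Y where XY: "Z = ideal_mult X Y" "X \<in> ideal_class d A" "Y \<in> ideal_class d B" by blast
    obtain a where a: "X = scl a A" "a \<in> F" "a \<noteq> 0" using XY(2) ideal_class_eq[OF assms(1)] by blast
    obtain b where b: "Y = scl b B" "b \<in> F" "b \<noteq> 0" using XY(3) ideal_class_eq[OF assms(2)] by blast
    have "Z = scl (a * b) (ideal_mult A B)" unfolding XY(1) a(1) b(1) by (rule ideal_mult_scale2)
    moreover have "a * b \<in> F" "a * b \<noteq> 0" using a b by auto
    ultimately show "Z \<in> {scl c (ideal_mult A B) | c. c \<in> F \<and> c \<noteq> 0}" by blast
  next
    fix Z assume "Z \<in> {scl c (ideal_mult A B) | c. c \<in> F \<and> c \<noteq> 0}"
    then obtain c where c: "Z = scl c (ideal_mult A B)" "c \<in> F" "c \<noteq> 0" by blast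
    have "Z = ideal_mult (scl c A) B" unfolding c(1) ideal_mult_scale ..
    moreover have "scl c A \<in> ideal_class d A" unfolding ideal_class_eq[OF assms(1)] using c by blast
    ultimately show "Z \<in> {ideal_mult X Y | X Y. X \<in> ideal_class d A \<and> Y \<in> ideal_class d B}"
      using ideal_class_self[OF assms(2)] by blast
  qed
  finally show ?thesis .
qed

text \<open>The monoid laws are what the generated subgroups call on; their generators, the classes
  of ramified primes, are their own inverses by \<open>class_inv\<close>.\<close>

lemma comm_monoid_class_group: "comm_monoid (class_group d)"
proof (rule comm_monoidI)
  show "\<one>\<^bsub>class_group d\<^esub> \<in> carrier (class_group d)"
    unfolding one_class_group carrier_class_group using frac_ideal_OkF by blast
  fix x y assume x: "x \<in> carrier (class_group d)" and y: "y \<in> carrier (class_group d)"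
  obtain X where X: "frac_ideal X" "x = ideal_class d X" using x carrier_class_group by auto
  obtain Y where Y: "frac_ideal Y" "y = ideal_class d Y" using y carrier_class_group by auto
  show "x \<otimes>\<^bsub>class_group d\<^esub> y \<in> carrier (class_group d)"
    using mult_class_group[OF X(1) Y(1)] frac_ideal_ideal_mult[OF X(1) Y(1)] X Y carrier_class_group by auto
  show "x \<otimes>\<^bsub>class_group d\<^esub> y = y \<otimes>\<^bsub>class_group d\<^esub> x"
    using mult_class_group X Y ideal_mult_comm by metis
  show "\<one>\<^bsub>class_group d\<^esub> \<otimes>\<^bsub>class_group d\<^esub> x = x"
    using mult_class_group[OF frac_ideal_OkF X(1)] ideal_mult_Ok[OF X(1)] X by (simp add: one_class_group)
  fix z assume "z \<in> carrier (class_group d)"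
  then obtain Z where Z: "frac_ideal Z" "z = ideal_class d Z" using carrier_class_group by auto
  show "x \<otimes>\<^bsub>class_group d\<^esub> y \<otimes>\<^bsub>class_group d\<^esub> z = x \<otimes>\<^bsub>class_group d\<^esub> (y \<otimes>\<^bsub>class_group d\<^esub> z)"
    using X Y Z by (simp add: mult_class_group frac_ideal_ideal_mult ideal_mult_assoc)
qed

end

section \<open>Lattices stable under conjugation\<close>

text \<open>The centred sublattice, of index two in \<open>lat a b\<close> when a and b are
  independent.\<close>

definition rhomb :: "complex \<Rightarrow> complex \<Rightarrow> complex set" where
  "rhomb a b = {of_int x * a + of_int y * b | x y. even (x - y)}"

lemma rhombI: "even (x - y) \<Longrightarrow> of_int x * a + of_int y * b \<in> rhomb a b"
  by (auto simp: rhomb_def)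

lemma rhombE:
  assumes "z \<in> rhomb a b" obtains x y where "z = of_int x * a + of_int y * b" "even (x - y)"
  using assms by (auto simp: rhomb_def)

lemma rhomb_lat: "rhomb a b = lat (a + b) (2 * b)"
proof (intro equalityI subsetI)
  fix z assume "z \<in> rhomb a b"
  then obtain x y where z: "z = of_int x * a + of_int y * b" "even (x - y)" by (rule rhombE)
  then obtain k where "x - y = 2 * k" by blast
  hence yk: "y = x - 2 * k" by simp
  have "z = of_int x * (a + b) + of_int (- k) * (2 * b)" unfolding z(1) yk by (simp add: algebra_simps)
  thus "z \<in> lat (a + b) (2 * b)" by (metis latI)
next
  fix z assume "z \<in> lat (a + b) (2 * b)"
  then obtain x y where "z = of_int x * (a + b) + of_int y * (2 * b)" by (rule latE)
  hence "z = of_int x * a + of_int (x + 2 * y) * b" by (simp add: algebra_simps)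
  moreover have "even (x - (x + 2 * y))" by simp
  ultimately show "z \<in> rhomb a b" using rhombI by blast
qed

lemma area_rhomb: "area (a + b) (2 * b) = 2 * area a b"
  by (simp add: area_def algebra_simps)

lemma is_lat_rhomb: "area a b \<noteq> 0 \<Longrightarrow> is_lat (rhomb a b)"
  unfolding rhomb_lat by (rule is_latI) (simp add: area_rhomb)

lemma covol_rhomb: "covol (rhomb a b) = 2 * \<bar>area a b\<bar>"
  unfolding rhomb_lat covol_lat area_rhomb by simp

lemma scale_lat: "scl c (lat a b) = lat (c * a) (c * b)"
  by (rule lat_image_mult)

lemma scale_rhomb: "scl c (rhomb a b) = rhomb (c * a) (c * b)"
  unfolding rhomb_lat scale_lat by (simp add: algebra_simps)

lemma addsub_rhomb: "addsub (rhomb a b)"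
  unfolding rhomb_lat by (rule addsub_lat)

lemma rhomb_subset_lat: "rhomb a b \<subseteq> lat a b"
  by (auto elim!: rhombE intro: latI)

text \<open>Discreteness: K has finitely many points of length at most
  \<open>\<bar>r0\<bar>\<close>, so there is a shortest one on the line, and division with remainder
  shows that it generates.\<close>

lemma line_generator:
  assumes K: "is_lat K" and e: "cmod e = 1" and z0: "z0 \<in> K" "z0 \<noteq> 0" "z0 = of_real r0 * e"
  obtains a where "a > 0" "of_real a * e \<in> K"
    "\<And>r. of_real r * e \<in> K \<Longrightarrow> \<exists>n::int. r = of_int n * a"
proof -
  have aK: "addsub K" by (rule is_lat_addsub[OF K])
  define S where "S = {r. r > 0 \<and> r \<le> \<bar>r0\<bar> \<and> of_real r * e \<in> K}"
  have "finite ((\<lambda>r. of_real r * e) ` S)"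
    by (rule finite_subset[OF _ finite_lat_ball[OF K, of "\<bar>r0\<bar>"]]) (auto simp: S_def norm_mult e)
  moreover have "inj_on (\<lambda>r. of_real r * e) S" using e by (auto simp: inj_on_def)
  ultimately have fin: "finite S" by (rule finite_imageD)
  have "- z0 \<in> K" using addsub_uminus[OF aK z0(1)] .
  hence r0S: "\<bar>r0\<bar> \<in> S" using z0 by (cases "r0 \<ge> 0") (auto simp: S_def)
  define a where "a = Min S"
  have aS: "a \<in> S" unfolding a_def using fin r0S by (intro Min_in) auto
  hence a: "a > 0" "of_real a * e \<in> K" "a \<le> \<bar>r0\<bar>" by (auto simp: S_def)
  have "\<exists>n::int. r = of_int n * a" if "of_real r * e \<in> K" for r
  proof -
    define n where "n = \<lfloor>r / a\<rfloor>"
    have fl: "of_int n \<le> r / a" "r / a < of_int n + 1" unfolding n_def by linarith+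
    have b: "0 \<le> r - of_int n * a" "r - of_int n * a < a"
      using fl a(1) by (simp_all add: field_simps)
    have "of_real r * e - of_int n * (of_real a * e) \<in> K"
      using addsub_diff[OF aK that addsub_of_int[OF aK a(2)]] .
    hence m: "of_real (r - of_int n * a) * e \<in> K" by (simp add: algebra_simps)
    have "r - of_int n * a = 0"
    proof (rule ccontr)
      assume "r - of_int n * a \<noteq> 0"
      hence "r - of_int n * a \<in> S" using b m a by (auto simp: S_def)
      hence "a \<le> r - of_int n * a" unfolding a_def using fin by (intro Min_le)
      thus False using b by simp
    qed
    thus ?thesis by (intro exI[of _ n]) simp
  qed
  thus ?thesis using that a by blast
qed

text \<open>Let A and B generate the real and the imaginary part of K. As 2 Re z and 2 i Im z lie in
  K, K lies between the rectangular lattice on A, iB and the one on A/2, iB/2. A half coordinate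
  cannot occur on one axis alone, so the only other possibility is that both occur together.\<close>

lemma conj_stable_cases:
  assumes K: "is_lat K" and c: "cnj ` K = K"
  obtains a b where "a > 0" "b > 0" "K = lat (of_real a) (of_real b * \<i>) \<or> K = rhomb (of_real a) (of_real b * \<i>)"
proof -
  have aK: "addsub K" by (rule is_lat_addsub[OF K])
  have cK: "cnj z \<in> K" if "z \<in> K" for z using that c by blast
  obtain p q where pq: "K = lat p q" "area p q \<noteq> 0" using K by (auto simp: is_lat_def)
  have pqK: "p \<in> K" "q \<in> K" unfolding pq(1) by (rule lat_gen)+
  have sumK: "of_real (2 * Re z) * 1 \<in> K" if "z \<in> K" for z
    using addsub_add[OF aK that cK[OF that]] by (simp add: complex_add_cnj)
  have diffK: "of_real (2 * Im z) * \<i> \<in> K" if "z \<in> K" for z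
    using addsub_diff[OF aK that cK[OF that]] by (simp add: complex_diff_cnj mult.commute)
  have "Re p \<noteq> 0 \<or> Re q \<noteq> 0" "Im p \<noteq> 0 \<or> Im q \<noteq> 0" using pq(2) by (auto simp: area_def)
  then obtain u v where u: "u \<in> K" "Re u \<noteq> 0" and v: "v \<in> K" "Im v \<noteq> 0" using pqK by metis
  obtain A where A: "A > 0" "of_real A * 1 \<in> K" "\<And>r. of_real r * 1 \<in> K \<Longrightarrow> \<exists>n::int. r = of_int n * A"
    using line_generator[OF K, of 1, OF _ sumK[OF u(1)] _ refl] u(2) by auto
  obtain B where B: "B > 0" "of_real B * \<i> \<in> K" "\<And>r. of_real r * \<i> \<in> K \<Longrightarrow> \<exists>n::int. r = of_int n * B"
    using line_generator[OF K, of \<i>, OF _ diffK[OF v(1)] _ refl] v(2) by auto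
  have lK: "lat (of_real A) (of_real B * \<i>) \<subseteq> K"
    using lat_least[OF aK] A(2) B(2) by simp
  have half: "\<exists>m n::int. z = of_int m * of_real (A / 2) + of_int n * (of_real (B / 2) * \<i>) \<and> even (m - n)"
    if z: "z \<in> K" for z
  proof -
    obtain m n :: int where mn: "2 * Re z = of_int m * A" "2 * Im z = of_int n * B"
      using A(3)[OF sumK[OF z]] B(3)[OF diffK[OF z]] by blast
    have zz: "z = of_int m * of_real (A / 2) + of_int n * (of_real (B / 2) * \<i>)"
      using mn by (simp add: complex_eq_iff field_simps)
    \<comment> \<open>Removing the integral part would leave A/2 in K, contrary to the choice of
      A.\<close>
    have False if mn': "odd m" "even n"
    proof -
      obtain k l where kl: "m = 2 * k + 1" "n = 2 * l" using mn' oddE[of m] oddE[of n] unfolding dvd_def by blast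
      have "z - (of_int k * of_real A + of_int l * (of_real B * \<i>)) \<in> K"
        using addsub_diff[OF aK z] latI lK by blast
      moreover have "z - (of_int k * of_real A + of_int l * (of_real B * \<i>)) = of_real (A / 2) * 1"
        unfolding zz kl by (simp add: field_simps)
      ultimately obtain j :: int where "A / 2 = of_int j * A" using A(3) by metis
      hence "(1::real) = of_int (2 * j)" using A(1) by simp
      hence "1 = 2 * j" by linarith
      thus False by presburger
    qed
    moreover have False if mn': "even m" "odd n"
    proof -
      obtain k l where kl: "m = 2 * k" "n = 2 * l + 1" using mn' oddE[of m] oddE[of n] unfolding dvd_def by blast
      have "z - (of_int k * of_real A + of_int l * (of_real B * \<i>)) \<in> K"
        using addsub_diff[OF aK z] latI lK by blast
      moreover have "z - (of_int k * of_real A + of_int l * (of_real B * \<i>)) = of_real (B / 2) * \<i>"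
        unfolding zz kl by (simp add: field_simps)
      ultimately obtain j :: int where "B / 2 = of_int j * B" using B(3) by metis
      hence "(1::real) = of_int (2 * j)" using B(1) by simp
      hence "1 = 2 * j" by linarith
      thus False by presburger
    qed
    ultimately have "even (m - n)" by (cases "even m"; cases "even n") auto
    thus ?thesis using zz by blast
  qed
  show ?thesis
  proof (cases "K \<subseteq> lat (of_real A) (of_real B * \<i>)")
    case True
    thus ?thesis using lK that[OF A(1) B(1)] by blast
  next
    case False
    then obtain z where z: "z \<in> K" "z \<notin> lat (of_real A) (of_real B * \<i>)" by blast
    obtain m n :: int where mn: "z = of_int m * of_real (A / 2) + of_int n * (of_real (B / 2) * \<i>)" "even (m - n)"
      using half[OF z(1)] by blast
    have "odd m"
    proof
      assume "even m"
      moreover from this have "even n" using mn(2) by simp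
      ultimately obtain k l where "m = 2 * k" "n = 2 * l" unfolding dvd_def by blast
      hence "z = of_int k * of_real A + of_int l * (of_real B * \<i>)" unfolding mn by (simp add: field_simps)
      thus False using z(2) latI by blast
    qed
    have "rhomb (of_real (A / 2)) (of_real (B / 2) * \<i>) \<subseteq> K"
    proof
      fix y assume "y \<in> rhomb (of_real (A / 2)) (of_real (B / 2) * \<i>)"
      then obtain k l where kl: "y = of_int k * of_real (A / 2) + of_int l * (of_real (B / 2) * \<i>)" "even (k - l)"
        by (rule rhombE)
      show "y \<in> K"
      proof (cases "even k")
        case True
        moreover from this have "even l" using kl(2) by simp
        ultimately obtain i j where "k = 2 * i" "l = 2 * j" unfolding dvd_def by blast
        hence "y = of_int i * of_real A + of_int j * (of_real B * \<i>)" unfolding kl by (simp add: field_simps)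
        thus ?thesis using latI lK by blast
      next
        case odd: False
        have "even (k - m)" "even (l - n)" using odd \<open>odd m\<close> mn(2) kl(2) by auto
        then obtain i j where "k - m = 2 * i" "l - n = 2 * j" by blast
        hence "k = m + 2 * i" "l = n + 2 * j" by auto
        hence yz: "y = z + (of_int i * of_real A + of_int j * (of_real B * \<i>))"
          unfolding kl mn by (simp add: field_simps)
        have "of_int i * of_real A + of_int j * (of_real B * \<i>) \<in> K" using latI lK by blast
        thus ?thesis unfolding yz by (rule addsub_add[OF aK z(1)])
      qed
    qed
    moreover have "K \<subseteq> rhomb (of_real (A / 2)) (of_real (B / 2) * \<i>)"
    proof
      fix y assume "y \<in> K"
      thus "y \<in> rhomb (of_real (A / 2)) (of_real (B / 2) * \<i>)" using half rhombI by blast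
    qed
    ultimately show ?thesis using that[of "A / 2" "B / 2"] A(1) B(1) by auto
  qed
qed

context imag_quad
begin

abbreviation rect :: "int \<Rightarrow> complex set" where "rect m \<equiv> lat (of_int m) w"
abbreviation cent :: "int \<Rightarrow> complex set" where "cent m \<equiv> rhomb (of_int m) w"

lemma area_mw: "area (of_int m) w = of_int m * sqrt_abs_d"
  by (simp add: area_def)

lemma imag_eq_w: "of_real b * \<i> = of_real (b / sqrt_abs_d) * w"
  using sqrt_abs_d_pos by (simp add: complex_eq_iff)

lemma frac_ideal_w: "frac_ideal J \<Longrightarrow> x \<in> J \<Longrightarrow> w * x \<in> J"
  using frac_ideal_Ok w_in_Ok by blast

lemma real_coords:
  assumes "of_real x + of_real y * w = of_real x' + of_real y' * w" shows "x = x'" "y = y'"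
  using assms sqrt_abs_d_pos by (auto simp: complex_eq_iff)

text \<open>Once the vertical generator is scaled to w, stability under w makes the horizontal one
  an integer m, and w^2 = d makes m a divisor of d. Stability under theta excludes the rectangle for
  d = 1 mod 4, and a parity argument excludes the centred shape for d = 2.\<close>

lemma conj_stable_ideal:
  assumes J: "frac_ideal J" and c: "cnj ` J = J"
  obtains \<beta> m where "\<beta> \<in> F" "\<beta> \<noteq> 0" "cnj \<beta> = \<beta>" "m > 0" "m dvd d"
    "J = scl \<beta> (rect m) \<and> d mod 4 \<noteq> 1 \<or> J = scl \<beta> (cent m) \<and> d mod 4 \<noteq> 2"
proof -
  obtain a b where ab: "a > 0" "b > 0" and
    "J = lat (of_real a) (of_real b * \<i>) \<or> J = rhomb (of_real a) (of_real b * \<i>)"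
    using conj_stable_cases[OF frac_ideal_lat[OF J] c] by metis
  hence Jc: "J = lat (of_real a) (of_real (b / sqrt_abs_d) * w) \<or> J = rhomb (of_real a) (of_real (b / sqrt_abs_d) * w)"
    by (simp only: imag_eq_w)
  \<comment> \<open>The real factor that normalises the vertical generator to w; the other side then
    becomes \<open>\<alpha>\<close>.\<close>
  define \<beta> where "\<beta> = complex_of_real (b / sqrt_abs_d)"
  define \<alpha> where "\<alpha> = a / (b / sqrt_abs_d)"
  have \<beta>: "\<beta> \<noteq> 0" "cnj \<beta> = \<beta>" and \<alpha>: "\<alpha> > 0" using ab sqrt_abs_d_pos by (auto simp: \<beta>_def \<alpha>_def)
  have a: "of_real a = \<beta> * of_real \<alpha>" using ab sqrt_abs_d_pos by (simp add: \<beta>_def \<alpha>_def)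
  have Jc2: "J = scl \<beta> (lat (of_real \<alpha>) w) \<or> J = scl \<beta> (rhomb (of_real \<alpha>) w)"
    using Jc unfolding scale_lat scale_rhomb a[symmetric] by (simp only: \<beta>_def)
  \<comment> \<open>The point with coordinates (0, 2) belongs to both shapes, and dividing it by 2w
    shows that the real number \<open>\<beta>\<close> lies in F.\<close>
  have "2 * (\<beta> * w) \<in> J"
  proof -
    have "of_int 0 * of_real \<alpha> + of_int 2 * w \<in> lat (of_real \<alpha>) w \<inter> rhomb (of_real \<alpha>) w"
      by (intro IntI latI rhombI) simp
    hence "2 * w \<in> lat (of_real \<alpha>) w \<inter> rhomb (of_real \<alpha>) w" by simp
    hence "\<beta> * (2 * w) \<in> J" using Jc2 by blast
    thus ?thesis by (simp add: algebra_simps)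
  qed
  hence "2 * (\<beta> * w) \<in> F" using frac_ideal_F[OF J] by blast
  hence "2 * (\<beta> * w) / (2 * w) \<in> F" by (rule F_divide) simp
  hence \<beta>F: "\<beta> \<in> F" by simp
  define J1 where "J1 = scl (inverse \<beta>) J"
  have J1: "frac_ideal J1" unfolding J1_def using J \<beta> \<beta>F by (intro frac_ideal_scale) auto
  have JJ1: "J = scl \<beta> J1" unfolding J1_def scale_scale using \<beta> by simp
  from Jc2 have "J1 = lat (of_real \<alpha>) w \<or> J1 = rhomb (of_real \<alpha>) w"
    unfolding JJ1 using scale_inj[OF \<beta>(1)] by blast
  thus ?thesis
  proof
    assume L: "J1 = lat (of_real \<alpha>) w"
    have "w * of_real \<alpha> \<in> J1" using frac_ideal_w[OF J1] lat_gen L by blast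
    then obtain x y where "w * of_real \<alpha> = of_int x * of_real \<alpha> + of_int y * w" unfolding L by (rule latE)
    hence "of_real 0 + of_real \<alpha> * w = of_real (of_int x * \<alpha>) + of_real (of_int y) * w" by (simp add: mult.commute)
    hence y: "\<alpha> = of_int y" by (rule real_coords)
    have y0: "y > 0" using \<alpha> y by simp
    have L': "J1 = rect y" using L y by simp
    have "w * w \<in> J1" using frac_ideal_w[OF J1] lat_gen L by blast
    then obtain k l where "w * w = of_int k * of_int y + of_int l * w" unfolding L' by (rule latE)
    hence "of_int d + of_int 0 * w = of_int (k * y) + of_int l * w" by (simp add: w_sq)
    hence "d = k * y" using coord_unique_int by blast
    hence dv: "y dvd d" by simp
    \<comment> \<open>Multiplication by theta would produce half-integral coordinates.\<close>
    have "d mod 4 \<noteq> 1"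
    proof
      assume d1: "d mod 4 = 1"
      have "theta * of_int y \<in> J1" using frac_ideal_theta[OF J1] lat_gen L' by blast
      then obtain k l where "theta * of_int y = of_int k * of_int y + of_int l * w" unfolding L' by (rule latE)
      hence "of_int y + of_int y * w = of_int (2 * k * y) + of_int (2 * l) * w"
        using d1 by (simp add: theta_def field_simps)
      hence "y = 2 * k * y" using coord_unique_int by blast
      hence "1 = 2 * k" using y0 by simp
      thus False by presburger
    qed
    thus ?thesis using that[OF \<beta>F \<beta> y0 dv] JJ1 L' by blast
  next
    assume L: "J1 = rhomb (of_real \<alpha>) w"
    have "of_int 2 * of_real \<alpha> + of_int 0 * w \<in> J1" unfolding L by (rule rhombI) simp
    hence "w * (of_int 2 * of_real \<alpha> + of_int 0 * w) \<in> J1" by (rule frac_ideal_w[OF J1])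
    then obtain x y where xy: "w * (of_int 2 * of_real \<alpha> + of_int 0 * w) = of_int x * of_real \<alpha> + of_int y * w" "even (x - y)"
      unfolding L by (rule rhombE)
    have "of_real 0 + of_real (2 * \<alpha>) * w = of_real (of_int x * \<alpha>) + of_real (of_int y) * w"
      using xy(1) by (simp add: mult.commute)
    hence "0 = of_int x * \<alpha>" "2 * \<alpha> = of_int y" by (rule real_coords)+
    hence x: "x = 0" and y: "2 * \<alpha> = of_int y" using \<alpha> by auto
    have "even y" using xy(2) x by simp
    then obtain n where n: "y = 2 * n" by blast
    have an: "\<alpha> = of_int n" using y n by simp
    have n0: "n > 0" using \<alpha> an by simp
    have L': "J1 = cent n" using L an by simp
    have "of_int 1 * of_int n + of_int 1 * w \<in> J1" unfolding L' by (rule rhombI) simp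
    hence "w * (of_int 1 * of_int n + of_int 1 * w) \<in> J1" by (rule frac_ideal_w[OF J1])
    then obtain k l where kl: "w * (of_int 1 * of_int n + of_int 1 * w) = of_int k * of_int n + of_int l * w" "even (k - l)"
      unfolding L' by (rule rhombE)
    have "of_int d + of_int n * w = of_int (k * n) + of_int l * w"
      using kl(1) by (simp add: distrib_left w_sq mult.commute add.commute)
    hence dk: "d = k * n" "n = l" using coord_unique_int by blast+
    hence dv: "n dvd d" by simp
    \<comment> \<open>With d = k n and k, n of the same parity, d is odd or divisible by 4.\<close>
    have "d mod 4 \<noteq> 2"
    proof
      assume d2: "d mod 4 = 2"
      hence "even d" by presburger
      hence "even k" "even n" using dk kl(2) by auto
      then obtain i j where "k = 2 * i" "n = 2 * j" by blast
      hence "d = 4 * (i * j)" using dk by simp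
      thus False using d2 by simp
    qed
    thus ?thesis using that[OF \<beta>F \<beta> n0 dv] JJ1 L' by blast
  qed
qed

text \<open>The usual witness 1 + u works because u has norm 1; it vanishes only at u = -1, where
  the purely imaginary w takes its place.\<close>

lemma hilbert90:
  assumes "u \<in> U1" obtains a where "a \<in> F" "a \<noteq> 0" "u * cnj a = a"
proof (cases "u = - 1")
  case True
  thus ?thesis using that[of w] by simp
next
  case False
  have "u * cnj (1 + u) = 1 + u" using U1_cnj[OF assms] by (simp add: distrib_left)
  moreover have "1 + u \<noteq> 0" using False by (simp add: add_eq_0_iff)
  ultimately show ?thesis using that[of "1 + u"] U1_F[OF assms] by auto
qed

text \<open>Division by the Hilbert 90 element turns the reflection of u into plain
  conjugation.\<close>

lemma reflective_straighten:
  assumes u: "u * cnj a = a" "a \<noteq> 0" and J: "scl u (cnj ` J) = J"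
  shows "cnj ` scl (inverse a) J = scl (inverse a) J"
proof -
  have u0: "u \<noteq> 0" using u by auto
  have "scl (inverse u) (scl u (cnj ` J)) = scl (inverse u) J" by (simp only: J)
  hence "cnj ` J = scl (inverse u) J" unfolding scale_scale using u0 by simp
  hence "cnj ` scl (inverse a) J = scl (inverse (cnj a)) (scl (inverse u) J)"
    by (simp only: cnj_scale complex_cnj_inverse)
  also have "\<dots> = scl (inverse (u * cnj a)) J" unfolding scale_scale by (simp add: mult.commute)
  finally show ?thesis by (simp add: u)
qed

text \<open>The ideal O_F K; since O_F = Z + Z theta, it is K + theta K.\<close>

definition Ok_span :: "complex set \<Rightarrow> complex set" where
  "Ok_span K = {x + theta * y | x y. x \<in> K \<and> y \<in> K}"

lemma extI: "x \<in> K \<Longrightarrow> y \<in> K \<Longrightarrow> x + theta * y \<in> Ok_span K"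
  by (auto simp: Ok_span_def)

lemma extE: assumes "z \<in> Ok_span K" obtains x y where "x \<in> K" "y \<in> K" "z = x + theta * y"
  using assms by (auto simp: Ok_span_def)

lemma Ok_span_addsub: assumes "addsub K" shows "addsub (Ok_span K)"
  unfolding addsub_def
proof (intro conjI ballI)
  show "0 \<in> Ok_span K" using extI[OF addsub_0[OF assms] addsub_0[OF assms]] by simp
  fix a b assume a: "a \<in> Ok_span K" and b: "b \<in> Ok_span K"
  obtain x y where xy: "x \<in> K" "y \<in> K" "a = x + theta * y" using a by (rule extE)
  obtain x' y' where xy': "x' \<in> K" "y' \<in> K" "b = x' + theta * y'" using b by (rule extE)
  have "a - b = (x - x') + theta * (y - y')" using xy xy' by (simp add: algebra_simps)
  thus "a - b \<in> Ok_span K" using xy xy' addsub_diff[OF assms] extI by metis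
qed

lemma Ok_span_theta: assumes "addsub K" "z \<in> Ok_span K" shows "theta * z \<in> Ok_span K"
proof -
  obtain x y where xy: "x \<in> K" "y \<in> K" "z = x + theta * y" using assms(2) by (rule extE)
  have "theta * z = theta * x + (theta * theta) * y" by (simp add: xy algebra_simps)
  also have "\<dots> = of_int (- theta_norm) * y + theta * (x + of_int theta_trace * y)" by (simp add: theta_sq algebra_simps)
  finally show ?thesis using xy extI[of "of_int (- theta_norm) * y" K "x + of_int theta_trace * y"]
      addsub_of_int[OF assms(1)] addsub_add[OF assms(1)] by metis
qed

lemma Ok_span_base: assumes "addsub K" shows "K \<subseteq> Ok_span K"
proof
  fix x assume "x \<in> K"
  thus "x \<in> Ok_span K" using extI[of x K 0] addsub_0[OF assms] by simp
qed

lemma Ok_span_least: assumes "addsub E" "\<And>x. x \<in> E \<Longrightarrow> theta * x \<in> E" "K \<subseteq> E" shows "Ok_span K \<subseteq> E"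
proof
  fix z assume "z \<in> Ok_span K"
  then obtain x y where xy: "x \<in> K" "y \<in> K" "z = x + theta * y" by (rule extE)
  thus "z \<in> E" using assms addsub_add[OF assms(1)] by blast
qed

lemma Ok_span_frac_ideal:
  assumes "is_lat K" "K \<subseteq> I" "frac_ideal I" shows "frac_ideal (Ok_span K)" "Ok_span K \<subseteq> I"
proof -
  have aK: "addsub K" by (rule is_lat_addsub[OF assms(1)])
  show sub: "Ok_span K \<subseteq> I" using frac_ideal_addsub[OF assms(3)] frac_ideal_theta[OF assms(3)] assms(2) by (rule Ok_span_least)
  obtain a b where ab: "K = lat a b" "area a b \<noteq> 0" using assms(1) by (auto simp: is_lat_def)
  have "a \<in> Ok_span K" "b \<in> Ok_span K" using Ok_span_base[OF aK] lat_gen ab(1) by blast+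
  hence "is_lat (Ok_span K)" using is_lat_sub[OF Ok_span_addsub[OF aK] sub frac_ideal_lat[OF assms(3)] _ _ ab(2)] by blast
  moreover have "Ok_span K \<subseteq> F" using sub frac_ideal_F[OF assms(3)] by blast
  ultimately show "frac_ideal (Ok_span K)" using Ok_span_theta[OF aK] by (simp add: frac_ideal_def)
qed

lemma Ok_span_scale: "Ok_span (scl c K) = scl c (Ok_span K)"
proof (intro equalityI subsetI)
  fix z assume "z \<in> Ok_span (scl c K)"
  then obtain x y where xy: "x \<in> K" "y \<in> K" "z = c * x + theta * (c * y)" by (auto elim!: extE)
  have "z = c * (x + theta * y)" unfolding xy(3) by (simp add: algebra_simps)
  thus "z \<in> scl c (Ok_span K)" using extI[OF xy(1,2)] by blast
next
  fix z assume "z \<in> scl c (Ok_span K)"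
  then obtain x y where xy: "x \<in> K" "y \<in> K" "z = c * (x + theta * y)" by (auto elim!: extE)
  have z: "z = c * x + theta * (c * y)" unfolding xy(3) by (simp add: algebra_simps)
  have "c * x \<in> scl c K" "c * y \<in> scl c K" using xy(1,2) by blast+
  thus "z \<in> Ok_span (scl c K)" unfolding z by (rule extI)
qed

text \<open>Conjugation sends theta to trace minus theta, which spans the same ring; the second
  inclusion is the first one applied to the conjugate lattice.\<close>

lemma Ok_span_cnj: assumes "addsub K" shows "Ok_span (cnj ` K) = cnj ` Ok_span K"
proof -
  have 1: "Ok_span (cnj ` K) \<subseteq> cnj ` Ok_span K" if K: "addsub K" for K
  proof
    fix z assume "z \<in> Ok_span (cnj ` K)"
    then obtain x y where xy: "x \<in> K" "y \<in> K" "z = cnj x + theta * cnj y" by (auto elim!: extE)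
    have "z = cnj (x + (of_int theta_trace - theta) * y)" unfolding xy(3) using cnj_theta by simp
    also have "x + (of_int theta_trace - theta) * y = (x + of_int theta_trace * y) + theta * (- y)" by (simp add: algebra_simps)
    finally have z: "z = cnj ((x + of_int theta_trace * y) + theta * (- y))" .
    have "(x + of_int theta_trace * y) + theta * (- y) \<in> Ok_span K"
      using xy K by (intro extI addsub_add addsub_of_int addsub_uminus)
    thus "z \<in> cnj ` Ok_span K" unfolding z by blast
  qed
  have "cnj ` Ok_span K = cnj ` Ok_span (cnj ` cnj ` K)" by (simp add: image_image)
  also have "\<dots> \<subseteq> cnj ` cnj ` Ok_span (cnj ` K)" using 1[OF addsub_image_cnj[OF assms]] by (rule image_mono)
  finally have "cnj ` Ok_span K \<subseteq> Ok_span (cnj ` K)" by (simp add: image_image)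
  thus ?thesis using 1[OF assms] by blast
qed

lemma Ok_span_w: assumes "addsub K" "z \<in> Ok_span K" shows "w * z \<in> Ok_span K"
  using theta_Ok_closed[OF Ok_span_addsub[OF assms(1)] Ok_span_theta[OF assms(1)] w_in_Ok assms(2)] .

end

text \<open>A factorisation \<open>-d = m e\<close> yields the two candidates \<open>rect m\<close> and \<open>cent m\<close> for a
  conjugation-stable ideal.\<close>
locale quad_split = imag_quad +
  fixes m e :: int
  assumes m_pos: "m > 0" and me: "d = - (m * e)"
begin

lemma e_pos: "e > 0"
  using m_pos me d_neg by (simp add: zero_less_mult_iff)

text \<open>Coordinates with respect to the basis m, w of \<open>rect m\<close>. Here multiplication
  by w swaps the axes with factors m and -e (\<open>w_pt\<close>).\<close>

definition pt :: "int \<Rightarrow> int \<Rightarrow> complex" where "pt x y = of_int x * of_int m + of_int y * w"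

lemma pt_eq: "pt x y = pt x' y' \<longleftrightarrow> x = x' \<and> y = y'"
proof
  assume "pt x y = pt x' y'"
  hence "of_int (x * m) + of_int y * w = of_int (x' * m) + of_int y' * w" by (simp add: pt_def)
  hence "x * m = x' * m \<and> y = y'" by (rule coord_unique_int)
  thus "x = x' \<and> y = y'" using m_pos by simp
qed simp

lemma pt_diff: "pt x y - pt x' y' = pt (x - x') (y - y')"
  and pt_add: "pt x y + pt x' y' = pt (x + x') (y + y')"
  and pt_mult: "of_int k * pt x y = pt (k * x) (k * y)"
  by (simp_all add: pt_def algebra_simps)

lemma w_pt: "w * pt x y = pt (- (e * y)) (m * x)"
proof -
  have "w * pt x y = of_int x * of_int m * w + of_int y * (w * w)" by (simp add: pt_def algebra_simps)
  also have "w * w = - (of_int m * of_int e)" unfolding w_sq by (subst me) simp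
  also have "of_int x * of_int m * w + of_int y * - (of_int m * of_int e) = pt (- (e * y)) (m * x)"
    by (simp add: pt_def algebra_simps)
  finally show ?thesis .
qed

lemma theta_pt1: "d mod 4 = 1 \<Longrightarrow> 2 * (theta * pt x y) = pt (x - e * y) (y + m * x)"
  using w_pt[of x y] pt_add[of x y "- (e * y)" "m * x"] by (simp add: theta_def algebra_simps)

lemma theta_pt2: "d mod 4 \<noteq> 1 \<Longrightarrow> theta * pt x y = pt (- (e * y)) (m * x)"
  using w_pt by (simp add: theta_def)

lemma in_rect: "z \<in> rect m \<longleftrightarrow> (\<exists>x y. z = pt x y)"
  by (auto simp: lat_def pt_def)

lemma in_cent: "z \<in> cent m \<longleftrightarrow> (\<exists>x y. z = pt x y \<and> even (x - y))"
  by (auto simp: rhomb_def pt_def)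

section \<open>Which rectangular and centred sublattices generate a given ideal\<close>

definition rect_sub :: "int \<Rightarrow> int \<Rightarrow> complex set" where
  "rect_sub X Y = lat (of_int (X * m)) (of_int Y * w)"

definition cent_sub :: "int \<Rightarrow> int \<Rightarrow> complex set" where
  "cent_sub X Y = rhomb (of_int (X * m)) (of_int Y * w)"

lemma pt11_cent: "pt 1 1 \<in> cent m"
proof -
  have "even (1 - 1 :: int)" by simp
  thus ?thesis unfolding in_cent by blast
qed

lemma addsub_rect_sub: "addsub (rect_sub X Y)" and addsub_cent_sub: "addsub (cent_sub X Y)"
  unfolding rect_sub_def cent_sub_def by (rule addsub_lat, rule addsub_rhomb)

lemma rect_sub_pt: "of_int u * of_int (X * m) + of_int v * (of_int Y * w) = pt (X * u) (Y * v)"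
  by (simp add: pt_def algebra_simps)

lemma in_rect_sub: "z \<in> rect_sub X Y \<longleftrightarrow> (\<exists>u v. z = pt (X * u) (Y * v))"
  unfolding rect_sub_def lat_def mem_Collect_eq rect_sub_pt by blast

lemma in_cent_sub: "z \<in> cent_sub X Y \<longleftrightarrow> (\<exists>u v. z = pt (X * u) (Y * v) \<and> even (u - v))"
  unfolding cent_sub_def rhomb_def mem_Collect_eq rect_sub_pt by blast

text \<open>Under w the generators (X, 0) and (0, Y) also give (0, m X) and (-e Y, 0). The two
  conditions say that X and e Y generate all horizontal, Y and m X all vertical integer
  coordinates.\<close>

definition cop :: "int \<Rightarrow> int \<Rightarrow> bool" where "cop X Y \<longleftrightarrow> coprime X (e * Y) \<and> coprime Y (m * X)"

lemma copI:
  assumes "X * p + e * Y * q = 1" "Y * p' + m * X * q' = 1" shows "cop X Y"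
  unfolding cop_def
proof
  show "coprime X (e * Y)"
  proof (rule coprimeI)
    fix c assume "c dvd X" "c dvd e * Y"
    hence "c dvd X * p + e * Y * q" by (intro dvd_add) (simp_all add: dvd_mult2)
    thus "is_unit c" using assms(1) by simp
  qed
  show "coprime Y (m * X)"
  proof (rule coprimeI)
    fix c assume "c dvd Y" "c dvd m * X"
    hence "c dvd Y * p' + m * X * q'" by (intro dvd_add) (simp_all add: dvd_mult2)
    thus "is_unit c" using assms(2) by simp
  qed
qed

lemma copE:
  assumes "cop X Y"
  obtains p q p' q' where "X * p + e * Y * q = 1" "Y * p' + m * X * q' = 1"
proof -
  have 1: "\<exists>p q. a * p + b * q = 1" if "coprime a b" for a b :: int
  proof -
    obtain u v where "u * a + v * b = gcd a b" using bezout_int by blast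
    hence "a * u + b * v = 1" using that by (simp add: mult.commute)
    thus ?thesis by blast
  qed
  show ?thesis using 1[of X "e * Y"] 1[of Y "m * X"] assms that by (auto simp: cop_def)
qed

text \<open>Bezout on each axis, with a scale s: the span may at first be known to contain only s
  times the full rectangle. The scales 1, 2 and 4 occur.\<close>

lemma combine_pt:
  assumes E: "addsub E" "\<And>z. z \<in> E \<Longrightarrow> w * z \<in> E"
    and X: "pt (s * X) 0 \<in> E" and Y: "pt 0 (s * Y) \<in> E" and "cop X Y"
  shows "pt (s * x) (s * y) \<in> E"
proof -
  obtain p q p' q' where pq: "X * p + e * Y * q = 1" "Y * p' + m * X * q' = 1"
    using assms(5) by (rule copE)
  have X': "pt 0 (s * (m * X)) \<in> E" using E(2)[OF X] by (simp add: w_pt algebra_simps)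
  have Y': "pt (- (s * (e * Y))) 0 \<in> E" using E(2)[OF Y] by (simp add: w_pt algebra_simps)
  have "of_int (x * p) * pt (s * X) 0 + of_int (- (x * q)) * pt (- (s * (e * Y))) 0 \<in> E"
    by (rule addsub_comb[OF E(1) X Y'])
  moreover have "of_int (x * p) * pt (s * X) 0 + of_int (- (x * q)) * pt (- (s * (e * Y))) 0
      = pt (s * x * (X * p + e * Y * q)) 0" unfolding pt_mult pt_add by (simp add: algebra_simps)
  ultimately have 1: "pt (s * x) 0 \<in> E" by (simp add: pq)
  have "of_int (y * p') * pt 0 (s * Y) + of_int (y * q') * pt 0 (s * (m * X)) \<in> E"
    by (rule addsub_comb[OF E(1) Y X'])
  moreover have "of_int (y * p') * pt 0 (s * Y) + of_int (y * q') * pt 0 (s * (m * X))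
      = pt 0 (s * y * (Y * p' + m * X * q'))" unfolding pt_mult pt_add by (simp add: algebra_simps)
  ultimately have 2: "pt 0 (s * y) \<in> E" by (simp add: pq)
  show ?thesis using addsub_add[OF E(1) 1 2] by (simp add: pt_add)
qed

text \<open>Once s times the rectangle is in E, membership depends only on coordinates modulo
  s.\<close>

lemma shift:
  assumes E: "addsub E" and s: "\<And>x y. pt (s * x) (s * y) \<in> E"
    and "pt x y \<in> E" "s dvd x - x'" "s dvd y - y'"
  shows "pt x' y' \<in> E"
proof -
  obtain k l where kl: "x - x' = s * k" "y - y' = s * l" using assms(4,5) by (auto elim!: dvdE)
  have "pt x y - pt (s * k) (s * l) \<in> E" by (rule addsub_diff[OF E assms(3) s])
  thus ?thesis unfolding pt_diff kl[symmetric] by simp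
qed

lemma rect_subset:
  assumes E: "addsub E" and s: "\<And>x y. pt (2 * x) (2 * y) \<in> E" and "pt 1 0 \<in> E" "pt 0 1 \<in> E"
  shows "rect m \<subseteq> E"
proof
  fix z assume "z \<in> rect m"
  then obtain x y where "z = pt x y" by (auto simp: in_rect)
  moreover have "of_int x * pt 1 0 + of_int y * pt 0 1 \<in> E" using assms by (intro addsub_comb)
  ultimately show "z \<in> E" by (simp add: pt_mult pt_add)
qed

text \<open>Modulo twice the rectangle, \<open>cent m\<close> has a single nonzero class, that of
  (1, 1).\<close>

lemma cent_subset:
  assumes E: "addsub E" and s: "\<And>x y. pt (2 * x) (2 * y) \<in> E" and "pt a b \<in> E" "odd a" "odd b"
  shows "cent m \<subseteq> E"
proof
  fix z assume "z \<in> cent m"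
  then obtain x y where z: "z = pt x y" "even (x - y)" by (auto simp: in_cent)
  show "z \<in> E"
  proof (cases "even x")
    case True
    hence "even y" using z(2) by simp
    with True obtain k l where "x = 2 * k" "y = 2 * l" unfolding dvd_def by blast
    thus ?thesis using s z by simp
  next
    case False
    hence "2 dvd a - x" "2 dvd b - y" using z(2) assms by simp_all
    thus ?thesis unfolding z(1) using shift[OF E s assms(3)] by blast
  qed
qed

lemma Ok_span_LL2: "d mod 4 \<noteq> 1 \<Longrightarrow> z \<in> Ok_span (rect_sub X Y) \<longleftrightarrow>
   (\<exists>u v u' v'. z = pt (X * u - e * Y * v') (Y * v + m * X * u'))"
proof
  assume d: "d mod 4 \<noteq> 1" and "z \<in> Ok_span (rect_sub X Y)"
  then obtain x y where xy: "x \<in> rect_sub X Y" "y \<in> rect_sub X Y" "z = x + theta * y" by (elim extE)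
  obtain u v where uv: "x = pt (X * u) (Y * v)" using xy(1) unfolding in_rect_sub by blast
  obtain u' v' where uv': "y = pt (X * u') (Y * v')" using xy(2) unfolding in_rect_sub by blast
  have "z = pt (X * u) (Y * v) + theta * pt (X * u') (Y * v')" unfolding xy(3) uv uv' ..
  hence "z = pt (X * u - e * Y * v') (Y * v + m * X * u')"
    by (simp add: theta_pt2[OF d] pt_add algebra_simps)
  thus "\<exists>u v u' v'. z = pt (X * u - e * Y * v') (Y * v + m * X * u')" by blast
next
  assume d: "d mod 4 \<noteq> 1" and "\<exists>u v u' v'. z = pt (X * u - e * Y * v') (Y * v + m * X * u')"
  then obtain u v u' v' where "z = pt (X * u - e * Y * v') (Y * v + m * X * u')" by blast
  hence "z = pt (X * u) (Y * v) + theta * pt (X * u') (Y * v')"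
    by (simp add: theta_pt2[OF d] pt_add algebra_simps)
  moreover have "pt (X * u) (Y * v) \<in> rect_sub X Y" "pt (X * u') (Y * v') \<in> rect_sub X Y" unfolding in_rect_sub by blast+
  ultimately show "z \<in> Ok_span (rect_sub X Y)" using extI by metis
qed

lemma Ok_span_QQ2:
  assumes "d mod 4 \<noteq> 1" "z \<in> Ok_span (cent_sub X Y)"
  obtains u v u' v' where "z = pt (X * u - e * Y * v') (Y * v + m * X * u')" "even (u - v)" "even (u' - v')"
proof -
  obtain x y where xy: "x \<in> cent_sub X Y" "y \<in> cent_sub X Y" "z = x + theta * y" using assms(2) by (elim extE)
  obtain u v where uv: "x = pt (X * u) (Y * v)" "even (u - v)" using xy(1) unfolding in_cent_sub by blast
  obtain u' v' where uv': "y = pt (X * u') (Y * v')" "even (u' - v')" using xy(2) unfolding in_cent_sub by blast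
  have "z = pt (X * u - e * Y * v') (Y * v + m * X * u')"
    unfolding xy(3) uv(1) uv'(1) by (simp add: theta_pt2[OF assms(1)] pt_add algebra_simps)
  thus ?thesis using uv(2) uv'(2) that by blast
qed

text \<open>For d = 1 mod 4 theta has denominator 2, so the coordinates are those of 2z.\<close>

lemma Ok_span_1:
  assumes "d mod 4 = 1" "z \<in> Ok_span (rect_sub X Y)"
  obtains u v u' v' where
    "2 * z = pt (2 * (X * u) + (X * u' - e * Y * v')) (2 * (Y * v) + (Y * v' + m * X * u'))"
proof -
  obtain x y where xy: "x \<in> rect_sub X Y" "y \<in> rect_sub X Y" "z = x + theta * y" using assms(2) by (elim extE)
  obtain u v where uv: "x = pt (X * u) (Y * v)" using xy(1) unfolding in_rect_sub by blast
  obtain u' v' where uv': "y = pt (X * u') (Y * v')" using xy(2) unfolding in_rect_sub by blast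
  have z: "z = pt (X * u) (Y * v) + theta * pt (X * u') (Y * v')" unfolding xy(3) uv uv' ..
  have "2 * z = of_int 2 * pt (X * u) (Y * v) + 2 * (theta * pt (X * u') (Y * v'))"
    by (simp add: z algebra_simps)
  also have "\<dots> = pt (2 * (X * u) + (X * u' - e * Y * v')) (2 * (Y * v) + (Y * v' + m * X * u'))"
    unfolding theta_pt1[OF assms(1)] pt_mult pt_add by (simp add: algebra_simps)
  finally show ?thesis by (rule that)
qed

lemma Ok_span_1_cent_sub:
  assumes "d mod 4 = 1" "z \<in> Ok_span (cent_sub X Y)"
  obtains u v u' v' where
    "2 * z = pt (2 * (X * u) + (X * u' - e * Y * v')) (2 * (Y * v) + (Y * v' + m * X * u'))"
    "even (u - v)" "even (u' - v')"
proof -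
  obtain x y where xy: "x \<in> cent_sub X Y" "y \<in> cent_sub X Y" "z = x + theta * y" using assms(2) by (elim extE)
  obtain u v where uv: "x = pt (X * u) (Y * v)" "even (u - v)" using xy(1) unfolding in_cent_sub by blast
  obtain u' v' where uv': "y = pt (X * u') (Y * v')" "even (u' - v')" using xy(2) unfolding in_cent_sub by blast
  have z: "z = pt (X * u) (Y * v) + theta * pt (X * u') (Y * v')" unfolding xy(3) uv(1) uv'(1) ..
  have "2 * z = of_int 2 * pt (X * u) (Y * v) + 2 * (theta * pt (X * u') (Y * v'))"
    by (simp add: z algebra_simps)
  also have "\<dots> = pt (2 * (X * u) + (X * u' - e * Y * v')) (2 * (Y * v) + (Y * v' + m * X * u'))"
    unfolding theta_pt1[OF assms(1)] pt_mult pt_add by (simp add: algebra_simps)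
  finally show ?thesis using uv(2) uv'(2) that by blast
qed

lemma rect_sub_sub_cent_sub: "pt (2 * X) 0 \<in> cent_sub X Y" "pt 0 (2 * Y) \<in> cent_sub X Y" "pt X Y \<in> cent_sub X Y"
proof -
  have "pt (X * 2) (Y * 0) \<in> cent_sub X Y" "pt (X * 0) (Y * 2) \<in> cent_sub X Y" "pt (X * 1) (Y * 1) \<in> cent_sub X Y"
    unfolding in_cent_sub by (intro exI conjI, rule refl, simp)+
  thus "pt (2 * X) 0 \<in> cent_sub X Y" "pt 0 (2 * Y) \<in> cent_sub X Y" "pt X Y \<in> cent_sub X Y" by (simp_all add: mult.commute)
qed

lemma pt_rect_sub: "pt X 0 \<in> rect_sub X Y" "pt 0 Y \<in> rect_sub X Y"
proof -
  have "pt (X * 1) (Y * 0) \<in> rect_sub X Y" "pt (X * 0) (Y * 1) \<in> rect_sub X Y"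
    unfolding in_rect_sub by blast+
  thus "pt X 0 \<in> rect_sub X Y" "pt 0 Y \<in> rect_sub X Y" by simp_all
qed

lemma Ok_span_rect_sub_rect: assumes d: "d mod 4 \<noteq> 1" shows "Ok_span (rect_sub X Y) = rect m \<longleftrightarrow> cop X Y"
proof
  assume "Ok_span (rect_sub X Y) = rect m"
  hence "pt 1 0 \<in> Ok_span (rect_sub X Y)" "pt 0 1 \<in> Ok_span (rect_sub X Y)" by (auto simp: in_rect)
  then obtain u v u' v' p q p' q' where
    "pt 1 0 = pt (X * u - e * Y * v') (Y * v + m * X * u')"
    "pt 0 1 = pt (X * p - e * Y * q') (Y * q + m * X * p')" unfolding Ok_span_LL2[OF d] by blast
  hence "X * u + e * Y * (- v') = 1" "Y * q + m * X * p' = 1" by (simp_all add: pt_eq)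
  thus "cop X Y" by (rule copI)
next
  assume c: "cop X Y"
  have a: "addsub (Ok_span (rect_sub X Y))" by (rule Ok_span_addsub[OF addsub_rect_sub])
  have "pt X 0 \<in> Ok_span (rect_sub X Y)" "pt 0 Y \<in> Ok_span (rect_sub X Y)" using pt_rect_sub Ok_span_base[OF addsub_rect_sub] by blast+
  hence "pt x y \<in> Ok_span (rect_sub X Y)" for x y
    using combine_pt[OF a Ok_span_w[OF addsub_rect_sub], of 1 X Y x y] c by simp
  hence "rect m \<subseteq> Ok_span (rect_sub X Y)" by (auto simp: in_rect)
  moreover have "Ok_span (rect_sub X Y) \<subseteq> rect m" unfolding in_rect subset_iff Ok_span_LL2[OF d] by blast
  ultimately show "Ok_span (rect_sub X Y) = rect m" by blast
qed

lemma Ok_span_cent_sub_fill: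
  assumes "cop X Y" shows "pt (2 * x) (2 * y) \<in> Ok_span (cent_sub X Y)"
  using combine_pt[OF Ok_span_addsub[OF addsub_cent_sub] Ok_span_w[OF addsub_cent_sub]
    subsetD[OF Ok_span_base[OF addsub_cent_sub] rect_sub_sub_cent_sub(1)] subsetD[OF Ok_span_base[OF addsub_cent_sub] rect_sub_sub_cent_sub(2)] assms] .

lemma Ok_span_cent_sub_sub_rect: assumes d: "d mod 4 \<noteq> 1" shows "Ok_span (cent_sub X Y) \<subseteq> rect m"
  unfolding in_rect subset_iff by (blast elim: Ok_span_QQ2[OF d])

lemma Ok_span_cent_sub_cop:
  assumes d: "d mod 4 \<noteq> 1" and "Ok_span (cent_sub X Y) = rect m" shows "cop X Y"
proof -
  have "pt 1 0 \<in> Ok_span (cent_sub X Y)" "pt 0 1 \<in> Ok_span (cent_sub X Y)" using assms(2) by (auto simp: in_rect)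
  then obtain u v u' v' p q p' q' where
    "pt 1 0 = pt (X * u - e * Y * v') (Y * v + m * X * u')"
    "pt 0 1 = pt (X * p - e * Y * q') (Y * q + m * X * p')" using Ok_span_QQ2[OF d] by metis
  hence "X * u + e * Y * (- v') = 1" "Y * q + m * X * p' = 1" by (simp_all add: pt_eq)
  thus ?thesis by (rule copI)
qed

lemma me_parity2: assumes "d mod 4 = 2" shows "even m \<noteq> even e"
proof -
  have "even m \<or> even e"
  proof -
    have "even d" using assms by presburger
    thus ?thesis by (simp add: me)
  qed
  moreover have False if "even m" "even e"
  proof -
    obtain i j where "m = 2 * i" "e = 2 * j" using \<open>even m\<close> \<open>even e\<close> unfolding dvd_def by blast
    hence "d = 4 * (- (i * j))" by (simp add: me)
    thus False using assms by simp
  qed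
  ultimately show ?thesis by blast
qed

lemma me_odd: assumes "d mod 4 = 1 \<or> d mod 4 = 3" shows "odd m" "odd e"
proof -
  have "odd d" using assms by presburger
  thus "odd m" "odd e" by (simp_all add: me)
qed

lemma cop_odd: assumes "cop X Y" "even a" shows "a dvd Y \<Longrightarrow> odd X" "a dvd X \<Longrightarrow> odd Y"
proof -
  show "odd X" if "a dvd Y"
  proof
    assume "even X"
    moreover have "even (e * Y)" using that assms(2) by (simp add: dvd_trans[of 2 a Y])
    ultimately have "is_unit (2::int)" using assms(1) coprime_common_divisor unfolding cop_def by blast
    thus False by simp
  qed
  show "odd Y" if "a dvd X"
  proof
    assume "even Y"
    moreover have "even (m * X)" using that assms(2) by (simp add: dvd_trans[of 2 a X])
    ultimately have "is_unit (2::int)" using assms(1) coprime_common_divisor unfolding cop_def by blast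
    thus False by simp
  qed
qed

lemma cop_not_even: "cop X Y \<Longrightarrow> odd X \<or> odd Y"
  using cop_odd(1)[of X Y 2] by auto

lemma cop_odd_e: "cop X Y \<Longrightarrow> even e \<Longrightarrow> odd X" and cop_odd_m: "cop X Y \<Longrightarrow> even m \<Longrightarrow> odd Y"
proof -
  assume c: "cop X Y" 
  have *: "\<not> is_unit (2::int)" by simp
  show "odd X" if "even e"
    using c that coprime_common_divisor[of X "e * Y" 2] * unfolding cop_def by auto
  show "odd Y" if "even m"
    using c that coprime_common_divisor[of Y "m * X" 2] * unfolding cop_def by auto
qed

text \<open>The vectors (X, Y) and w (X, Y) have determinant N = m X^2 + e Y^2. Elimination gives
  (N, 0) and (0, N); with twice the rectangle already in the span, odd N suffices for the two unit
  vectors.\<close>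

lemma Ok_span_cent_sub_rect_if:
  assumes d: "d mod 4 \<noteq> 1" and c: "cop X Y" and o: "odd (X * (m * X) + Y * (e * Y))"
  shows "Ok_span (cent_sub X Y) = rect m"
proof -
  have a: "addsub (Ok_span (cent_sub X Y))" by (rule Ok_span_addsub[OF addsub_cent_sub])
  have p: "pt X Y \<in> Ok_span (cent_sub X Y)" by (rule subsetD[OF Ok_span_base[OF addsub_cent_sub] rect_sub_sub_cent_sub(3)])
  have p': "pt (- (e * Y)) (m * X) \<in> Ok_span (cent_sub X Y)" using Ok_span_w[OF addsub_cent_sub p] by (simp add: w_pt)
  \<comment> \<open>The combination eliminates the second coordinate; the later one eliminates the
    first.\<close>
  have "of_int (m * X) * pt X Y + of_int (- Y) * pt (- (e * Y)) (m * X) \<in> Ok_span (cent_sub X Y)"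
    by (rule addsub_comb[OF a p p'])
  hence "pt (X * (m * X) + Y * (e * Y)) 0 \<in> Ok_span (cent_sub X Y)"
    unfolding pt_mult pt_add by (simp add: algebra_simps)
  hence 10: "pt 1 0 \<in> Ok_span (cent_sub X Y)" by (rule shift[OF a Ok_span_cent_sub_fill[OF c]]) (use o in simp_all)
  have "of_int (e * Y) * pt X Y + of_int X * pt (- (e * Y)) (m * X) \<in> Ok_span (cent_sub X Y)"
    by (rule addsub_comb[OF a p p'])
  hence "pt 0 (X * (m * X) + Y * (e * Y)) \<in> Ok_span (cent_sub X Y)"
    unfolding pt_mult pt_add by (simp add: algebra_simps)
  hence 01: "pt 0 1 \<in> Ok_span (cent_sub X Y)" by (rule shift[OF a Ok_span_cent_sub_fill[OF c]]) (use o in simp_all)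
  have "rect m \<subseteq> Ok_span (cent_sub X Y)" using rect_subset[OF a Ok_span_cent_sub_fill[OF c] 10 01] .
  thus ?thesis using Ok_span_cent_sub_sub_rect[OF d] by blast
qed

text \<open>Exactly one of m and e is even, and \<open>cop\<close> then makes the other summand of N
  odd.\<close>

lemma Ok_span_cent_sub_rect_2: assumes d: "d mod 4 = 2" shows "Ok_span (cent_sub X Y) = rect m \<longleftrightarrow> cop X Y"
proof
  have d': "d mod 4 \<noteq> 1" using d by simp
  show "Ok_span (cent_sub X Y) = rect m \<Longrightarrow> cop X Y" by (rule Ok_span_cent_sub_cop[OF d'])
  assume c: "cop X Y"
  show "Ok_span (cent_sub X Y) = rect m"
  proof (rule Ok_span_cent_sub_rect_if[OF d' c])
    show "odd (X * (m * X) + Y * (e * Y))"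
      using me_parity2[OF d] cop_odd_e[OF c] cop_odd_m[OF c] by (cases "even m") simp_all
  qed
qed

text \<open>With m and e odd, N has the parity of X + Y. If X and Y have the same parity, all points
  of the span have coordinates of equal parity and (1, 0) is missed.\<close>

lemma Ok_span_cent_sub_rect_3:
  assumes d: "d mod 4 = 3" shows "Ok_span (cent_sub X Y) = rect m \<longleftrightarrow> cop X Y \<and> odd (X + Y)"
proof
  have d': "d mod 4 \<noteq> 1" using d by simp
  have o: "odd m" "odd e" using me_odd d by auto
  {
    assume E: "Ok_span (cent_sub X Y) = rect m"
    have "odd (X + Y)"
    proof
      assume ev: "even (X + Y)"
      have "pt 1 0 \<in> Ok_span (cent_sub X Y)" using E by (auto simp: in_rect)
      then obtain u v u' v' where "pt 1 0 = pt (X * u - e * Y * v') (Y * v + m * X * u')"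
        "even (u - v)" "even (u' - v')" by (rule Ok_span_QQ2[OF d'])
      hence eq: "X * u - e * Y * v' = 1" "Y * v + m * X * u' = 0" "even (u - v)" "even (u' - v')"
        by (simp_all add: pt_eq)
      have "odd (X * u - e * Y * v')" "even (Y * v + m * X * u')" using eq by simp_all
      thus False using ev eq(3,4) o by auto
    qed
    thus "cop X Y \<and> odd (X + Y)" using Ok_span_cent_sub_cop[OF d' E] by blast
  next
    assume c: "cop X Y \<and> odd (X + Y)"
    show "Ok_span (cent_sub X Y) = rect m"
    proof (rule Ok_span_cent_sub_rect_if[OF d'])
      show "odd (X * (m * X) + Y * (e * Y))" using o c by auto
    qed (use c in blast)
  }
qed

lemma Ok_span_rect_sub_cent_3:
  assumes d: "d mod 4 = 3" and XY: "even X" "even Y" shows "Ok_span (rect_sub X Y) \<noteq> cent m"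
proof
  have d': "d mod 4 \<noteq> 1" using d by simp
  assume "Ok_span (rect_sub X Y) = cent m"
  hence "pt 1 1 \<in> Ok_span (rect_sub X Y)" by (simp add: pt11_cent)
  then obtain u v u' v' where "pt 1 1 = pt (X * u - e * Y * v') (Y * v + m * X * u')"
    unfolding Ok_span_LL2[OF d'] by blast
  hence "X * u - e * Y * v' = 1" by (simp add: pt_eq)
  hence "odd (X * u - e * Y * v')" by simp
  thus False using XY by simp
qed

lemma cent_sub_sub_cent: assumes "even (X - Y)" shows "cent_sub X Y \<subseteq> cent m"
proof
  fix z assume "z \<in> cent_sub X Y"
  then obtain u v where z: "z = pt (X * u) (Y * v)" "even (u - v)" unfolding in_cent_sub by blast
  have "even (X * u - Y * v)" using assms z(2) by auto
  thus "z \<in> cent m" unfolding in_cent z(1) by blast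
qed

lemma Ok_span_cent_sub_cent_3:
  assumes d: "d mod 4 = 3" and XY: "even (X - Y)"
  shows "Ok_span (cent_sub X Y) = cent m \<longleftrightarrow> cop X Y \<and> odd X \<and> odd Y"
proof
  have d': "d mod 4 \<noteq> 1" using d by simp
  have o: "odd m" "odd e" using me_odd d by auto
  {
    assume E: "Ok_span (cent_sub X Y) = cent m"
    hence "pt 1 1 \<in> Ok_span (cent_sub X Y)" by (simp add: pt11_cent)
    then obtain u v u' v' where "pt 1 1 = pt (X * u - e * Y * v') (Y * v + m * X * u')"
      by (rule Ok_span_QQ2[OF d'])
    hence eq: "X * u + e * Y * (- v') = 1" "Y * v + m * X * u' = 1" by (simp_all add: pt_eq)
    have c: "cop X Y" by (rule copI[OF eq])
    thus "cop X Y \<and> odd X \<and> odd Y" using cop_not_even[OF c] XY by auto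
  next
    assume c: "cop X Y \<and> odd X \<and> odd Y"
    have a: "addsub (Ok_span (cent_sub X Y))" by (rule Ok_span_addsub[OF addsub_cent_sub])
    have p: "pt X Y \<in> Ok_span (cent_sub X Y)" using rect_sub_sub_cent_sub Ok_span_base[OF addsub_cent_sub] by blast
    have "cent m \<subseteq> Ok_span (cent_sub X Y)" using cent_subset[OF a Ok_span_cent_sub_fill p] c by blast
    moreover have "Ok_span (cent_sub X Y) \<subseteq> cent m"
    proof (rule Ok_span_least[OF addsub_rhomb _ cent_sub_sub_cent[OF XY]])
      fix z assume "z \<in> cent m"
      then obtain x y where z: "z = pt x y" "even (x - y)" by (auto simp: in_cent)
      have "even (- (e * y) - m * x)" using z(2) o by auto
      thus "theta * z \<in> cent m" unfolding z(1) theta_pt2[OF d'] in_cent by blast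
    qed
    ultimately show "Ok_span (cent_sub X Y) = cent m" by blast
  }
qed

lemma theta_half:
  assumes d: "d mod 4 = 1" shows "theta * pt (2 * x) (2 * y) = pt (x - e * y) (y + m * x)"
proof -
  have "theta * pt (2 * x) (2 * y) = 2 * (theta * pt x y)"
    using pt_mult[of 2 x y] by (simp add: algebra_simps)
  thus ?thesis by (simp only: theta_pt1[OF d])
qed

lemma two_pt: "2 * pt x y = pt (2 * x) (2 * y)"
  using pt_mult[of 2 x y] by simp

text \<open>A rectangle inside \<open>cent m\<close> has even sides, whence the parameters 2X and
  2Y. Their factor 2 cancels the denominator of theta, so the conditions on X and Y are again those
  of \<open>cop\<close>.\<close>

lemma Ok_span_rect_sub_cent_1:
  assumes d: "d mod 4 = 1" and frac_ideal: "frac_ideal (cent m)"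
  shows "Ok_span (rect_sub (2 * X) (2 * Y)) = cent m \<longleftrightarrow> cop X Y"
proof
  have o: "odd m" "odd e" using me_odd d by auto
  {
    assume E: "Ok_span (rect_sub (2 * X) (2 * Y)) = cent m"
    hence "pt 1 1 \<in> Ok_span (rect_sub (2 * X) (2 * Y))" by (simp add: pt11_cent)
    then obtain u v u' v' where "2 * pt 1 1 = pt (2 * (2 * X * u) + (2 * X * u' - e * (2 * Y) * v'))
        (2 * (2 * Y * v) + (2 * Y * v' + m * (2 * X) * u'))"
      by (rule Ok_span_1[OF d])
    hence "X * (2 * u + u') + e * Y * (- v') = 1" "Y * (2 * v + v') + m * X * u' = 1"
      unfolding two_pt pt_eq by (simp_all add: algebra_simps)
    thus "cop X Y" by (rule copI)
  next
    assume c: "cop X Y"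
    let ?E = "Ok_span (rect_sub (2 * X) (2 * Y))"
    have a: "addsub ?E" by (rule Ok_span_addsub[OF addsub_rect_sub])
    have p: "pt (2 * X) 0 \<in> ?E" "pt 0 (2 * Y) \<in> ?E" using pt_rect_sub Ok_span_base[OF addsub_rect_sub] by blast+
    have f: "pt (2 * x) (2 * y) \<in> ?E" for x y
      using combine_pt[OF a Ok_span_w[OF addsub_rect_sub] p c] .
    \<comment> \<open>Theta times the two generators. As m and e are odd and X, Y are not both even,
      one of these points has both coordinates odd.\<close>
    have "pt X (m * X) \<in> ?E" "pt (- (e * Y)) Y \<in> ?E"
      using Ok_span_theta[OF addsub_rect_sub p(1)] Ok_span_theta[OF addsub_rect_sub p(2)]
        theta_half[OF d, of X 0] theta_half[OF d, of 0 Y] by simp_all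
    hence "cent m \<subseteq> ?E"
      using cent_subset[OF a f, of X "m * X"] cent_subset[OF a f, of "- (e * Y)" Y] cop_not_even[OF c] o by auto
    moreover have "?E \<subseteq> cent m"
    proof (rule Ok_span_least[OF addsub_rhomb frac_ideal_theta[OF frac_ideal]])
      show "rect_sub (2 * X) (2 * Y) \<subseteq> cent m"
      proof
        fix z assume "z \<in> rect_sub (2 * X) (2 * Y)"
        then obtain u v where z: "z = pt (2 * X * u) (2 * Y * v)" unfolding in_rect_sub by blast
        have "even (2 * X * u - 2 * Y * v)" by simp
        thus "z \<in> cent m" unfolding z in_cent by blast
      qed
    qed
    ultimately show "?E = cent m" by blast
  }
qed

lemma Ok_span_cent_sub_cent_1:
  assumes d: "d mod 4 = 1" and frac_ideal: "frac_ideal (cent m)" and XY: "odd X" "odd Y"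
  shows "Ok_span (cent_sub X Y) = cent m \<longleftrightarrow> cop X Y"
proof
  have o: "odd m" "odd e" using me_odd d by auto
  {
    assume E: "Ok_span (cent_sub X Y) = cent m"
    hence "pt 1 1 \<in> Ok_span (cent_sub X Y)" by (simp add: pt11_cent)
    then obtain u v u' v' where "2 * pt 1 1 = pt (2 * (X * u) + (X * u' - e * Y * v'))
        (2 * (Y * v) + (Y * v' + m * X * u'))"
      by (rule Ok_span_1_cent_sub[OF d])
    \<comment> \<open>Doubling leaves 2 in place of 1 in the Bezout relations; a common divisor must
      divide 2, and oddness of X and Y rules out 2.\<close>
    hence eq: "2 = X * (2 * u + u') + e * Y * (- v')" "2 = Y * (2 * v + v') + m * X * u'"
      unfolding two_pt pt_eq by (simp_all add: algebra_simps)
    have 2: "is_unit c" if "c dvd 2" "c dvd k" "odd k" for c k :: int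
      using that by (metis coprime_common_divisor coprime_left_2_iff_odd)
    have "coprime X (e * Y)"
    proof (rule coprimeI)
      fix c assume c: "c dvd X" "c dvd e * Y"
      hence "c dvd X * (2 * u + u') + e * Y * (- v')" by (intro dvd_add) (simp_all add: dvd_mult2)
      hence "c dvd 2" by (simp only: eq(1)[symmetric])
      thus "is_unit c" using 2[of c X] c XY by blast
    qed
    moreover have "coprime Y (m * X)"
    proof (rule coprimeI)
      fix c assume c: "c dvd Y" "c dvd m * X"
      hence "c dvd Y * (2 * v + v') + m * X * u'" by (intro dvd_add) (simp_all add: dvd_mult2)
      hence "c dvd 2" by (simp only: eq(2)[symmetric])
      thus "is_unit c" using 2[of c Y] c XY by blast
    qed
    ultimately show "cop X Y" by (simp add: cop_def)
  next
    assume c: "cop X Y"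
    have a: "addsub (Ok_span (cent_sub X Y))" by (rule Ok_span_addsub[OF addsub_cent_sub])
    have p: "pt X Y \<in> Ok_span (cent_sub X Y)" using rect_sub_sub_cent_sub Ok_span_base[OF addsub_cent_sub] by blast
    have "cent m \<subseteq> Ok_span (cent_sub X Y)" using cent_subset[OF a Ok_span_cent_sub_fill[OF c] p XY] .
    moreover have "Ok_span (cent_sub X Y) \<subseteq> cent m"
      by (rule Ok_span_least[OF addsub_rhomb frac_ideal_theta[OF frac_ideal] cent_sub_sub_cent]) (use XY in auto)
    ultimately show "Ok_span (cent_sub X Y) = cent m" by blast
  }
qed

text \<open>Parity is forced because \<open>u'\<close> and \<open>v'\<close> agree modulo 2: the
  relation with value 1 reduces to (X + Y) \<open>u'\<close> odd. Conversely the span is filled from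
  four times the rectangle to two times it and then by an odd point.\<close>

lemma Ok_span_QQ2_cent_1:
  assumes d: "d mod 4 = 1" and frac_ideal: "frac_ideal (cent m)"
  shows "Ok_span (cent_sub (2 * X) (2 * Y)) = cent m \<longleftrightarrow> cop X Y \<and> odd (X + Y)"
proof
  have o: "odd m" "odd e" using me_odd d by auto
  let ?E = "Ok_span (cent_sub (2 * X) (2 * Y))"
  {
    assume E: "?E = cent m"
    hence "pt 1 1 \<in> ?E" by (simp add: pt11_cent)
    then obtain u v u' v' where "2 * pt 1 1 = pt (2 * (2 * X * u) + (2 * X * u' - e * (2 * Y) * v'))
        (2 * (2 * Y * v) + (2 * Y * v' + m * (2 * X) * u'))" and ev: "even (u' - v')"
      by (rule Ok_span_1_cent_sub[OF d])
    hence eq: "X * (2 * u + u') + e * Y * (- v') = 1" "Y * (2 * v + v') + m * X * u' = 1"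
      unfolding two_pt pt_eq by (simp_all add: algebra_simps)
    have "odd (X * (2 * u + u') + e * Y * (- v'))" unfolding eq by simp
    hence "odd (X + Y)" using o ev by auto
    thus "cop X Y \<and> odd (X + Y)" using copI[OF eq] by blast
  next
    assume c: "cop X Y \<and> odd (X + Y)"
    have a: "addsub ?E" by (rule Ok_span_addsub[OF addsub_cent_sub])
    have p: "pt (4 * X) 0 \<in> ?E" "pt 0 (4 * Y) \<in> ?E" "pt (2 * X) (2 * Y) \<in> ?E"
      using subsetD[OF Ok_span_base[OF addsub_cent_sub] rect_sub_sub_cent_sub(1)[of "2 * X" "2 * Y"]]
        subsetD[OF Ok_span_base[OF addsub_cent_sub] rect_sub_sub_cent_sub(2)[of "2 * Y" "2 * X"]]
        subsetD[OF Ok_span_base[OF addsub_cent_sub] rect_sub_sub_cent_sub(3)] by simp_all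
    have f4: "pt (4 * x) (4 * y) \<in> ?E" for x y
      using combine_pt[OF a Ok_span_w[OF addsub_cent_sub] p(1,2)] c by blast
    have "pt (2 * X) (2 * (m * X)) \<in> ?E" "pt (- (2 * (e * Y))) (2 * Y) \<in> ?E"
      using Ok_span_theta[OF addsub_cent_sub p(1)] Ok_span_theta[OF addsub_cent_sub p(2)]
        theta_half[OF d, of "2 * X" 0] theta_half[OF d, of 0 "2 * Y"] by (simp_all add: algebra_simps)
    note q = this
    have four: "4 dvd 2 * x - 2" if "odd x" for x :: int
      using that by presburger
    have four': "4 dvd 2 * x - 0" if "even x" for x :: int
      using that by presburger
    have four'': "4 dvd - (2 * x) - 2" if "odd x" for x :: int
      using that by presburger
    \<comment> \<open>Only residues modulo 4 matter, and twice an odd number is 2 modulo 4.\<close>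
    have 22: "pt 2 2 \<in> ?E"
    proof (cases "odd X")
      case True
      thus ?thesis using o by (intro shift[OF a f4 q(1)] four) auto
    next
      case False
      hence "odd Y" using c by simp
      thus ?thesis using o by (intro shift[OF a f4 q(2)] four four'') auto
    qed
    have "pt 2 0 \<in> ?E \<and> pt 0 2 \<in> ?E"
    proof (cases "odd X")
      case True
      hence "pt 2 0 \<in> ?E" using c by (intro shift[OF a f4 p(3)] four four') auto
      moreover have "pt 2 2 - pt 2 0 = pt 0 2" by (simp add: pt_diff)
      ultimately show ?thesis using addsub_diff[OF a 22] by metis
    next
      case False
      hence "pt 0 2 \<in> ?E" using c by (intro shift[OF a f4 p(3)] four four') auto
      moreover have "pt 2 2 - pt 0 2 = pt 2 0" by (simp add: pt_diff)
      ultimately show ?thesis using addsub_diff[OF a 22] by metis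
    qed
    hence f: "pt (2 * x) (2 * y) \<in> ?E" for x y
      using addsub_comb[OF a, of "pt 2 0" "pt 0 2" x y] by (simp add: pt_mult pt_add mult.commute)
    have "pt (X - e * Y) (Y + m * X) \<in> ?E"
      using Ok_span_theta[OF addsub_cent_sub p(3)] theta_half[OF d, of X Y] by simp
    hence "cent m \<subseteq> ?E"
      by (rule cent_subset[OF a f]) (use o c in auto)
    moreover have "?E \<subseteq> cent m"
      by (rule Ok_span_least[OF addsub_rhomb frac_ideal_theta[OF frac_ideal] cent_sub_sub_cent]) auto
    ultimately show "?E = cent m" by blast
  }
qed

end

section \<open>Sums over coprime pairs\<close>

definition neg_pow :: "complex \<Rightarrow> nat \<Rightarrow> complex" where "neg_pow s n = of_nat n powr (- s)"

lemma neg_pow_mult: "neg_pow s (a * b) = neg_pow s a * neg_pow s b"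
  unfolding neg_pow_def of_nat_mult by (rule powr_times_real) auto

lemma neg_pow_1 [simp]: "neg_pow s 1 = 1" "neg_pow s (Suc 0) = 1"
  by (simp_all add: neg_pow_def)

lemma norm_neg_pow: "norm (neg_pow s n) = of_nat n powr (- Re s)"
  unfolding neg_pow_def by (subst norm_powr_real_powr) auto

lemma neg_pow_less_1:
  assumes "Re s > 0" "n \<ge> 2" shows "norm (neg_pow s n) < 1"
  using assms powr_less_mono[of "- Re s" 0 "real n"] by (simp add: norm_neg_pow)

lemma neg_pow_ne_1: assumes "Re s > 0" "n \<ge> 2" shows "1 - neg_pow s n \<noteq> 0" "1 + neg_pow s n \<noteq> 0"
proof -
  show "1 - neg_pow s n \<noteq> 0" using neg_pow_less_1[OF assms] by auto
  show "1 + neg_pow s n \<noteq> 0"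
  proof
    assume "1 + neg_pow s n = 0"
    hence "neg_pow s n = - 1" by (simp add: add_eq_0_iff)
    thus False using neg_pow_less_1[OF assms] by simp
  qed
qed

lemma neg_pow_double: assumes "n > 0" shows "neg_pow (2 * s) n = neg_pow s (n * n)"
proof -
  have "neg_pow (2 * s) n = of_nat n powr (- s + - s)" by (simp add: neg_pow_def)
  also have "\<dots> = neg_pow s n * neg_pow s n" unfolding powr_add neg_pow_def ..
  finally show ?thesis by (simp add: neg_pow_mult)
qed

lemma neg_pow_summable: assumes "Re s > 1" shows "neg_pow s summable_on {1..}"
proof -
  have "summable (\<lambda>n. norm (neg_pow s n))"
    using assms by (simp add: norm_neg_pow summable_real_powr_iff)
  hence "neg_pow s summable_on UNIV" by (rule norm_summable_imp_summable_on)
  thus ?thesis by (rule summable_on_subset_banach) simp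
qed

lemma zeta_neg_pow: "riemann_zeta s = infsum (neg_pow s) {1..}"
  by (simp add: riemann_zeta_def dirichlet_series_def neg_pow_def[abs_def])

definition pos_pairs :: "(nat \<times> nat) set" where "pos_pairs = {1..} \<times> {1..}"

definition pair_term :: "complex \<Rightarrow> nat \<times> nat \<Rightarrow> complex" where "pair_term s z = neg_pow s (fst z * snd z)"

text \<open>For complex families summability is absolute, so Tonelli applies: summable fibres and a
  summable family of fibrewise norms suffice.\<close>

lemma complex_summable_Sigma:
  fixes f :: "'a \<times> 'b \<Rightarrow> complex"
  shows "f summable_on Sigma A B \<longleftrightarrow> (\<forall>x\<in>A. (\<lambda>y. f (x, y)) summable_on B x) \<and>
             (\<lambda>x. infsum (\<lambda>y. norm (f (x, y))) (B x)) summable_on A"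
proof -
  have "(\<lambda>x. infsum (\<lambda>y. norm (f (x, y))) (B x)) abs_summable_on A \<longleftrightarrow>
    (\<lambda>x. infsum (\<lambda>y. norm (f (x, y))) (B x)) summable_on A"
    by (rule summable_on_iff_abs_summable_on_real[symmetric])
  thus ?thesis
    unfolding summable_on_iff_abs_summable_on_complex abs_summable_on_Sigma_iff[of f A B] by blast
qed

lemma summable_prod:
  fixes f :: "'a \<Rightarrow> complex" and g :: "'b \<Rightarrow> complex"
  assumes "f summable_on A" "g summable_on B"
  shows "(\<lambda>(x, y). f x * g y) summable_on A \<times> B"
    "infsum (\<lambda>(x, y). f x * g y) (A \<times> B) = infsum f A * infsum g B"
proof -
  have "(\<lambda>x. norm (f x) * infsum (\<lambda>y. norm (g y)) B) summable_on A"
    using assms(1) unfolding summable_on_iff_abs_summable_on_complex by (rule summable_on_cmult_left)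
  thus s: "(\<lambda>(x, y). f x * g y) summable_on A \<times> B"
    using summable_on_cmult_right[OF assms(2)]
    by (simp add: complex_summable_Sigma norm_mult infsum_cmult_right')
  show "infsum (\<lambda>(x, y). f x * g y) (A \<times> B) = infsum f A * infsum g B"
    using infsum_Sigma_banach[OF s]
    by (simp add: infsum_cmult_right' infsum_cmult_left')
qed

lemma pair_term_summable_pos_pairs: assumes "Re s > 1" shows "pair_term s summable_on pos_pairs"
  and "infsum (pair_term s) pos_pairs = riemann_zeta s ^ 2"
proof -
  have eq: "pair_term s = (\<lambda>(x, y). neg_pow s x * neg_pow s y)" by (auto simp: pair_term_def neg_pow_mult)
  show "pair_term s summable_on pos_pairs" unfolding eq pos_pairs_def
    using neg_pow_summable[OF assms] neg_pow_summable[OF assms] by (rule summable_prod)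
  show "infsum (pair_term s) pos_pairs = riemann_zeta s ^ 2" unfolding eq pos_pairs_def
    using summable_prod(2)[OF neg_pow_summable[OF assms] neg_pow_summable[OF assms]]
    by (simp add: zeta_neg_pow power2_eq_square)
qed

section \<open>Coprime pairs with forbidden primes\<close>

definition coprime_avoiding :: "nat set \<Rightarrow> nat set \<Rightarrow> (nat \<times> nat) set" where
  "coprime_avoiding A B = {(x, y). x > 0 \<and> y > 0 \<and> coprime x y \<and> (\<forall>p\<in>A. \<not> p dvd x) \<and> (\<forall>p\<in>B. \<not> p dvd y)}"

lemma coprime_avoiding_pos_pairs: "coprime_avoiding A B \<subseteq> pos_pairs"
  by (auto simp: coprime_avoiding_def pos_pairs_def)

lemma pair_term_summable: assumes "Re s > 1" "S \<subseteq> pos_pairs" shows "pair_term s summable_on S"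
  using pair_term_summable_pos_pairs(1)[OF assms(1)] assms(2) by (rule summable_on_subset_banach)

definition coprime_sum :: "complex \<Rightarrow> nat set \<Rightarrow> nat set \<Rightarrow> complex" where
  "coprime_sum s A B = infsum (pair_term s) (coprime_avoiding A B)"

lemma infsum_split:
  fixes f :: "'a \<Rightarrow> complex"
  assumes "f summable_on S" "S = S1 \<union> g ` S2" "S1 \<inter> g ` S2 = {}" "inj_on g S2"
    and "\<And>x. x \<in> S2 \<Longrightarrow> f (g x) = t * f x"
  shows "infsum f S = infsum f S1 + t * infsum f S2"
proof -
  have 1: "f summable_on S1" "f summable_on g ` S2"
    using assms(1,2) by (auto intro: summable_on_subset_banach)
  have "infsum f S = infsum f S1 + infsum f (g ` S2)"
    unfolding assms(2) using 1 assms(3) by (rule infsum_Un_disjoint)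
  also have "infsum f (g ` S2) = infsum (\<lambda>x. t * f x) S2"
    unfolding infsum_reindex[OF assms(4)] using assms(5) by (intro infsum_cong) auto
  finally show ?thesis by (simp add: infsum_cmult_right')
qed

lemma prime_dvd_prime: "prime p \<Longrightarrow> prime q \<Longrightarrow> p dvd q \<longleftrightarrow> p = (q::nat)"
  by (metis primes_dvd_imp_eq dvd_refl)

text \<open>If p divides x, one factor p is taken out. Coprimality keeps p from y, whereas x may
  still contain further factors p, so p is then forbidden on the right only.\<close>

lemma coprime_avoiding_split1:
  assumes p: "prime p" "p \<notin> A" and A: "\<And>q. q \<in> A \<Longrightarrow> prime q"
  shows "coprime_avoiding A B = coprime_avoiding (insert p A) B \<union> (\<lambda>(x, y). (p * x, y)) ` coprime_avoiding A (insert p B)"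
proof (intro equalityI subsetI)
  fix z assume z: "z \<in> coprime_avoiding A B"
  obtain x y where xy: "z = (x, y)" by fastforce
  show "z \<in> coprime_avoiding (insert p A) B \<union> (\<lambda>(x, y). (p * x, y)) ` coprime_avoiding A (insert p B)"
  proof (cases "p dvd x")
    case False
    thus ?thesis using z by (auto simp: coprime_avoiding_def xy)
  next
    case True
    then obtain k where k: "x = p * k" by blast
    have "\<not> p dvd y"
      using z True p(1) by (auto simp: coprime_avoiding_def xy) (metis coprime_common_divisor not_prime_unit)
    hence "(k, y) \<in> coprime_avoiding A (insert p B)" using z k by (auto simp: coprime_avoiding_def xy)
    thus ?thesis unfolding xy k by force
  qed
next
  fix z assume z: "z \<in> coprime_avoiding (insert p A) B \<union> (\<lambda>(x, y). (p * x, y)) ` coprime_avoiding A (insert p B)"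
  show "z \<in> coprime_avoiding A B"
  proof (cases "z \<in> coprime_avoiding (insert p A) B")
    case True thus ?thesis by (auto simp: coprime_avoiding_def)
  next
    case False
    then obtain x y where xy: "(x, y) \<in> coprime_avoiding A (insert p B)" "z = (p * x, y)" using z by auto
    have "coprime p y" using xy(1) p(1) by (auto simp: coprime_avoiding_def intro: prime_imp_coprime)
    moreover have "\<not> q dvd p * x" if "q \<in> A" for q
      using that A[OF that] p xy(1) prime_dvd_prime[OF A[OF that] p(1)]
      by (auto simp: coprime_avoiding_def prime_dvd_mult_iff)
    moreover have "p > 0" using p(1) prime_gt_0_nat by blast
    ultimately show ?thesis using xy(1) unfolding xy(2) by (auto simp: coprime_avoiding_def)
  qed
qed

lemma swap_coprime_avoiding: "coprime_avoiding B A = prod.swap ` coprime_avoiding A B"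
  by (force simp: coprime_avoiding_def image_iff coprime_commute)

lemma coprime_sum_swap: "coprime_sum s A B = coprime_sum s B A"
proof -
  have "coprime_sum s B A = infsum (pair_term s \<circ> prod.swap) (coprime_avoiding A B)"
    unfolding coprime_sum_def swap_coprime_avoiding[of B A] by (rule infsum_reindex) (auto simp: inj_on_def)
  also have "pair_term s \<circ> prod.swap = pair_term s" by (auto simp: pair_term_def mult.commute)
  finally show ?thesis by (simp add: coprime_sum_def)
qed

lemma coprime_sum_split:
  assumes s: "Re s > 1" and p: "prime p" "p \<notin> A" and A: "\<And>q. q \<in> A \<Longrightarrow> prime q"
  shows "coprime_sum s A B = coprime_sum s (insert p A) B + neg_pow s p * coprime_sum s A (insert p B)"
  unfolding coprime_sum_def
proof (rule infsum_split[OF pair_term_summable[OF s coprime_avoiding_pos_pairs] coprime_avoiding_split1[OF p A]])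
  show "coprime_avoiding (insert p A) B \<inter> (\<lambda>(x, y). (p * x, y)) ` coprime_avoiding A (insert p B) = {}"
    by (auto simp: coprime_avoiding_def)
  show "inj_on (\<lambda>(x, y). (p * x, y)) (coprime_avoiding A (insert p B))"
    using prime_gt_0_nat[OF p(1)] by (auto simp: inj_on_def)
  show "pair_term s ((\<lambda>(x, y). (p * x, y)) z) = neg_pow s p * pair_term s z" for z
    by (cases z) (simp add: pair_term_def neg_pow_mult)
qed

text \<open>If p is already forbidden on one side, the splitting recursion becomes a linear equation
  with factor 1 - p^-s. The two one-sided sums thus agree, and substituting this into the
  unrestricted recursion yields the factor 1 + p^-s.\<close>

lemma coprime_sum_both:
  assumes s: "Re s > 1" and p: "prime p" "p \<notin> A" "p \<notin> B"
    and AB: "\<And>q. q \<in> A \<union> B \<Longrightarrow> prime q"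
  shows "(1 - neg_pow s p) * coprime_sum s A (insert p B) = coprime_sum s (insert p A) (insert p B)"
    "(1 - neg_pow s p) * coprime_sum s (insert p A) B = coprime_sum s (insert p A) (insert p B)"
    "coprime_sum s A B = (1 + neg_pow s p) * coprime_sum s (insert p A) B"
    "coprime_sum s A B = (1 + neg_pow s p) * coprime_sum s A (insert p B)"
proof -
  have 1: "coprime_sum s A (insert p B) = coprime_sum s (insert p A) (insert p B) + neg_pow s p * coprime_sum s A (insert p B)" if "p \<notin> A" "\<And>q. q \<in> A \<Longrightarrow> prime q" for A B
    using coprime_sum_split[OF s p(1) that, of "insert p B"] by simp
  show a: "(1 - neg_pow s p) * coprime_sum s A (insert p B) = coprime_sum s (insert p A) (insert p B)"
    using 1[OF p(2)] AB by (simp add: algebra_simps)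
  show b: "(1 - neg_pow s p) * coprime_sum s (insert p A) B = coprime_sum s (insert p A) (insert p B)"
    using 1[OF p(3), of A] AB coprime_sum_swap by (simp add: algebra_simps)
  have "p \<ge> 2" using p(1) prime_ge_2_nat by blast
  hence nz: "1 - neg_pow s p \<noteq> 0" using neg_pow_ne_1(1) s by simp
  have eq: "coprime_sum s (insert p A) B = coprime_sum s A (insert p B)"
    using a b nz by (metis mult_left_cancel)
  show "coprime_sum s A B = (1 + neg_pow s p) * coprime_sum s (insert p A) B"
    "coprime_sum s A B = (1 + neg_pow s p) * coprime_sum s A (insert p B)"
    using coprime_sum_split[OF s p(1,2), of B] AB eq by (simp_all add: algebra_simps)
qed

text \<open>Disjointness matters: a prime forbidden on one side costs the factor 1 + p^-s, one
  forbidden on both sides would cost (1 + p^-s)/(1 - p^-s).\<close>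

lemma coprime_sum_prod:
  assumes s: "Re s > 1" and fin: "finite A" "finite B" and disj: "A \<inter> B = {}"
    and AB: "\<And>q. q \<in> A \<union> B \<Longrightarrow> prime q"
  shows "coprime_sum s {} {} = (\<Prod>p\<in>A \<union> B. 1 + neg_pow s p) * coprime_sum s A B"
proof -
  have 1: "coprime_sum s {} {} = (\<Prod>p\<in>A. 1 + neg_pow s p) * coprime_sum s A {}"
    if "finite A" "\<And>q. q \<in> A \<Longrightarrow> prime q" for A using that
  proof (induction A rule: finite_induct)
    case (insert p A)
    have "coprime_sum s A {} = (1 + neg_pow s p) * coprime_sum s (insert p A) {}"
      using insert by (intro coprime_sum_both(3)[OF s]) auto
    thus ?case using insert by (simp add: mult_ac)
  qed simp
  have 2: "coprime_sum s A {} = (\<Prod>p\<in>B. 1 + neg_pow s p) * coprime_sum s A B"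
    if "finite B" "A \<inter> B = {}" "\<And>q. q \<in> A \<union> B \<Longrightarrow> prime q" for B using that
  proof (induction B rule: finite_induct)
    case (insert p B)
    have "coprime_sum s A B = (1 + neg_pow s p) * coprime_sum s A (insert p B)"
      using insert by (intro coprime_sum_both(4)[OF s]) auto
    thus ?case using insert by (simp add: mult_ac)
  qed simp
  show ?thesis using 1[OF fin(1)] 2[OF fin(2) disj] AB fin disj
    by (simp add: prod.union_disjoint mult_ac)
qed

text \<open>Every pair is its gcd g times a coprime pair, and g contributes g^-2s.\<close>

lemma zeta_coprime_sum: assumes s: "Re s > 1" shows "riemann_zeta s ^ 2 = riemann_zeta (2 * s) * coprime_sum s {} {}"
proof -
  let ?h = "\<lambda>(g, x, y). (g * x, g * (y::nat))"
  let ?S = "{1::nat..} \<times> coprime_avoiding {} {}"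
  have bij: "bij_betw ?h ?S pos_pairs"
    unfolding bij_betw_def
  proof
    show "inj_on ?h ?S"
    proof (rule inj_onI)
      fix a b assume a: "a \<in> ?S" and b: "b \<in> ?S" and eq: "?h a = ?h b"
      obtain g x y where ga: "a = (g, x, y)" by (metis prod_cases3)
      obtain g' x' y' where gb: "b = (g', x', y')" by (metis prod_cases3)
      have e: "g * x = g' * x'" "g * y = g' * y'" using eq by (simp_all add: ga gb)
      have "gcd (g * x) (g * y) = g" "gcd (g' * x') (g' * y') = g'"
        using a b by (simp_all add: ga gb coprime_avoiding_def gcd_mult_distrib_nat[symmetric])
      hence "g = g'" using e by simp
      thus "a = b" using e a by (simp add: ga gb)
    qed
    show "?h ` ?S = pos_pairs"
    proof (intro equalityI subsetI)
      fix z assume "z \<in> pos_pairs"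
      then obtain a b where ab: "z = (a, b)" "a > 0" "b > 0" by (auto simp: pos_pairs_def)
      define g where "g = gcd a b"
      have g: "g > 0" using ab by (simp add: g_def)
      have "coprime (a div g) (b div g)" unfolding g_def using ab by (intro div_gcd_coprime) auto
      moreover have "a = g * (a div g)" "b = g * (b div g)" by (simp_all add: g_def)
      moreover have "a div g > 0" "b div g > 0" using ab calculation(2,3) by (metis gr0I mult_0_right)+
      ultimately show "z \<in> ?h ` ?S" using g ab(1)
        by (intro image_eqI[of _ _ "(g, a div g, b div g)"]) (auto simp: coprime_avoiding_def)
    qed (auto simp: coprime_avoiding_def pos_pairs_def)
  qed
  have "riemann_zeta s ^ 2 = infsum (\<lambda>z. pair_term s (?h z)) ?S"
    unfolding pair_term_summable_pos_pairs(2)[OF s, symmetric] by (rule infsum_reindex_bij_betw[OF bij, symmetric])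
  also have "\<dots> = infsum (\<lambda>(g, z). neg_pow (2 * s) g * pair_term s z) ?S"
  proof (rule infsum_cong)
    fix z assume "z \<in> ?S"
    then obtain g x y where z: "z = (g, x, y)" and g: "g > 0" by (cases z) auto
    show "pair_term s (?h z) = (\<lambda>(g, z). neg_pow (2 * s) g * pair_term s z) z"
      unfolding z pair_term_def prod.case fst_conv snd_conv neg_pow_double[OF g] by (simp only: neg_pow_mult mult_ac)
  qed
  also have "\<dots> = infsum (neg_pow (2 * s)) {1..} * coprime_sum s {} {}"
    unfolding coprime_sum_def using s by (intro summable_prod(2) neg_pow_summable pair_term_summable coprime_avoiding_pos_pairs) simp
  finally show ?thesis by (simp add: zeta_neg_pow)
qed

text \<open>The terms with n >= 2 are bounded by 1/n^2, whose sum is at most 3/4, so they cannot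
  cancel the leading 1.\<close>

lemma zeta_double_nonzero: assumes "Re s > 1" shows "riemann_zeta (2 * s) \<noteq> 0"
proof
  assume z: "riemann_zeta (2 * s) = 0"
  have s2: "Re (2 * s) > 1" using assms by simp
  have sum1: "neg_pow (2 * s) summable_on {2..}"
    by (rule summable_on_subset_banach[OF neg_pow_summable[OF s2]]) auto
  have "infsum (neg_pow (2 * s)) {1..} = infsum (neg_pow (2 * s)) ({1} \<union> {2..})"
    by (rule arg_cong[where f = "infsum _"]) auto
  also have "\<dots> = 1 + infsum (neg_pow (2 * s)) {2..}"
    by (subst infsum_Un_disjoint) (auto simp: sum1)
  finally have "infsum (neg_pow (2 * s)) {2..} = - 1" using z by (simp add: zeta_neg_pow add_eq_0_iff)
  hence "1 = norm (infsum (neg_pow (2 * s)) {2..})" by simp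
  also have "\<dots> \<le> infsum (\<lambda>n. norm (neg_pow (2 * s) n)) {2..}"
    using sum1 unfolding summable_on_iff_abs_summable_on_complex by (rule norm_infsum_bound)
  also have "\<dots> \<le> 3 / 4"
  proof (rule infsum_le_finite_sums)
    show "(\<lambda>n. norm (neg_pow (2 * s) n)) summable_on {2..}"
      using sum1 unfolding summable_on_iff_abs_summable_on_complex .
    fix G :: "nat set" assume G: "finite G" "G \<subseteq> {2..}"
    obtain k where k: "\<forall>n\<in>G. n \<le> k" using G(1) finite_nat_set_iff_bounded_le by blast
    define N where "N = max 2 k"
    have N: "N \<ge> 2" "G \<subseteq> {2..N}" using G(2) k by (auto simp: N_def subset_iff le_max_iff_disj)
    have bnd: "norm (neg_pow (2 * s) n) \<le> 1 / real n ^ 2" if "n \<ge> 2" for n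
    proof -
      have "real n powr (- Re (2 * s)) \<le> real n powr (- 2)"
        using that assms by (intro powr_mono) auto
      thus ?thesis using that by (simp add: norm_neg_pow powr_minus powr_numeral divide_simps)
    qed
    \<comment> \<open>Telescoping with 1/n^2 <= 1/(n-1) - 1/n from n = 3 on; at N = 2 the bound is
      the equality 1/4 = 3/4 - 1/2.\<close>
    have tele: "(\<Sum>n\<in>{2..N}. 1 / real n ^ 2) \<le> 3 / 4 - 1 / real N" if "N \<ge> 2" for N
      using that
    proof (induction N rule: dec_induct)
      case (step n)
      have "1 / real (Suc n) ^ 2 \<le> 1 / (real n * real (Suc n))"
        using step(1) by (intro divide_left_mono) (auto simp: power2_eq_square)
      also have "\<dots> = 1 / real n - 1 / real (Suc n)" using step(1) by (simp add: field_simps)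
      finally show ?case using step by (simp add: atLeastAtMostSuc_conv)
    qed simp
    have "sum (\<lambda>n. norm (neg_pow (2 * s) n)) G \<le> sum (\<lambda>n. norm (neg_pow (2 * s) n)) {2..N}"
      using N by (intro sum_mono2) auto
    also have "\<dots> \<le> (\<Sum>n\<in>{2..N}. 1 / real n ^ 2)" by (intro sum_mono bnd) auto
    also have "\<dots> \<le> 3 / 4 - 1 / real N" by (rule tele[OF N(1)])
    also have "\<dots> \<le> 3 / 4" by simp
    finally show "sum (\<lambda>n. norm (neg_pow (2 * s) n)) G \<le> 3 / 4" .
  qed
  finally show False by simp
qed

lemma coprime_sum_zeta:
  assumes s: "Re s > 1" and fin: "finite A" "finite B" and disj: "A \<inter> B = {}"
    and AB: "\<And>q. q \<in> A \<union> B \<Longrightarrow> prime q"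
  shows "coprime_sum s A B = riemann_zeta s ^ 2 / (riemann_zeta (2 * s) * (\<Prod>p\<in>A \<union> B. 1 + neg_pow s p))"
proof -
  have "(\<Prod>p\<in>A \<union> B. 1 + neg_pow s p) \<noteq> 0"
    using fin AB neg_pow_ne_1(2)[of s] s prime_ge_2_nat by (auto simp: prod_zero_iff)
  thus ?thesis
    using zeta_coprime_sum[OF s] coprime_sum_prod[OF assms] zeta_double_nonzero[OF s] by (simp add: field_simps)
qed

lemma coprime_avoiding_parity:
  "coprime_avoiding (insert 2 A) (insert 2 B) = {(x, y) \<in> coprime_avoiding A B. odd x \<and> odd y}"
  "coprime_avoiding A B = coprime_avoiding (insert 2 A) (insert 2 B) \<union> {(x, y) \<in> coprime_avoiding A B. odd (x + y)}"
proof -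
  show a: "coprime_avoiding (insert 2 A) (insert 2 B) = {(x, y) \<in> coprime_avoiding A B. odd x \<and> odd y}"
    by (auto simp: coprime_avoiding_def)
  have "odd x \<and> odd y \<or> odd (x + y)" if "(x, y) \<in> coprime_avoiding A B" for x y
    using that by (auto simp: coprime_avoiding_def)
  thus "coprime_avoiding A B = coprime_avoiding (insert 2 A) (insert 2 B) \<union> {(x, y) \<in> coprime_avoiding A B. odd (x + y)}"
    unfolding a by auto
qed

text \<open>Both entries odd means that 2 is forbidden on both sides. Coprime entries are never both
  even, so the remaining pairs have odd sum and make up the complement 1 - (1 - t)/(1 + t).\<close>

lemma coprime_sum_parity:
  assumes s: "Re s > 1" and 2: "2 \<notin> A" "2 \<notin> B" and AB: "\<And>q. q \<in> A \<union> B \<Longrightarrow> prime q"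
  defines "t \<equiv> neg_pow s 2"
  shows "infsum (pair_term s) {(x, y) \<in> coprime_avoiding A B. odd x \<and> odd y} = (1 - t) / (1 + t) * coprime_sum s A B"
    "infsum (pair_term s) {(x, y) \<in> coprime_avoiding A B. odd (x + y)} = 2 * t / (1 + t) * coprime_sum s A B"
proof -
  have "prime (2::nat)" by simp
  note b = coprime_sum_both[OF s this 2 AB]
  have t: "1 + t \<noteq> 0" using neg_pow_ne_1(2)[of s 2] s by (simp add: t_def)
  have e2: "coprime_sum s (insert 2 A) (insert 2 B) = (1 - t) * coprime_sum s (insert 2 A) B" using b(2) by (simp add: t_def)
  have e3: "coprime_sum s A B = (1 + t) * coprime_sum s (insert 2 A) B" using b(3) by (simp add: t_def)
  have H: "coprime_sum s (insert 2 A) (insert 2 B) = (1 - t) / (1 + t) * coprime_sum s A B"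
    unfolding e2 e3 using t by simp
  thus 1: "infsum (pair_term s) {(x, y) \<in> coprime_avoiding A B. odd x \<and> odd y} = (1 - t) / (1 + t) * coprime_sum s A B"
    by (simp add: coprime_sum_def coprime_avoiding_parity(1))
  have "coprime_sum s A B = coprime_sum s (insert 2 A) (insert 2 B) + infsum (pair_term s) {(x, y) \<in> coprime_avoiding A B. odd (x + y)}"
    unfolding coprime_sum_def
    by (subst coprime_avoiding_parity(2), rule infsum_Un_disjoint)
      (auto intro!: pair_term_summable[OF s] coprime_avoiding_pos_pairs simp: coprime_avoiding_parity(1) intro: subsetD[OF coprime_avoiding_pos_pairs])
  hence "infsum (pair_term s) {(x, y) \<in> coprime_avoiding A B. odd (x + y)} = coprime_sum s A B - coprime_sum s (insert 2 A) (insert 2 B)"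
    by (simp only: eq_diff_eq add.commute)
  hence "infsum (pair_term s) {(x, y) \<in> coprime_avoiding A B. odd (x + y)} = coprime_sum s A B - (1 - t) / (1 + t) * coprime_sum s A B"
    by (simp only: H)
  also have "\<dots> = 2 * t / (1 + t) * coprime_sum s A B" using t by (simp add: field_simps)
  finally show "infsum (pair_term s) {(x, y) \<in> coprime_avoiding A B. odd (x + y)} = 2 * t / (1 + t) * coprime_sum s A B" .
qed

lemma coprime_iff_prime_divisors:
  fixes x n :: nat
  assumes "n > 0"
  shows "coprime x n \<longleftrightarrow> (\<forall>p\<in>{p. prime p \<and> p dvd n}. \<not> p dvd x)"
proof
  assume c: "coprime x n"
  show "\<forall>p\<in>{p. prime p \<and> p dvd n}. \<not> p dvd x"
    using c coprime_common_divisor[OF c] not_prime_unit by blast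
next
  assume p: "\<forall>p\<in>{p. prime p \<and> p dvd n}. \<not> p dvd x"
  show "coprime x n"
  proof (rule ccontr)
    assume "\<not> coprime x n"
    hence "gcd x n \<noteq> 1" by (simp add: coprime_iff_gcd_eq_1)
    then obtain q where "prime q" "q dvd gcd x n" using prime_factor_nat by blast
    thus False using p by auto
  qed
qed

context imag_quad
begin

section \<open>Evaluation of the weights on rectangular and centred ideals\<close>

definition conj_lats :: "complex set \<Rightarrow> complex set set" where
  "conj_lats J = {K. is_lat K \<and> cnj ` K = K \<and> K \<subseteq> J \<and> Ok_span K = J}"

definition primes_d :: "nat set" where "primes_d = {p. prime p \<and> int p dvd d}"

lemma finite_primes_d: "finite primes_d"
proof (rule finite_subset)
  show "primes_d \<subseteq> {..nat (- d)}"
  proof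
    fix p assume "p \<in> primes_d"
    hence "int p dvd - d" by (simp add: primes_d_def)
    hence "int p \<le> - d" using d_neg by (intro zdvd_imp_le) auto
    thus "p \<in> {..nat (- d)}" by simp
  qed
qed simp

text \<open>The product is over the divisors of d, which differ from the ramified primes when d = 3
  mod 4: there 2 is missing and enters through \<open>coprime_sum_parity\<close>.\<close>

definition zeta_factor :: "complex \<Rightarrow> complex" where
  "zeta_factor s = riemann_zeta s ^ 2 / (riemann_zeta (2 * s) * (\<Prod>p\<in>primes_d. 1 + neg_pow s p))"

end

context quad_split
begin

definition primes_e :: "nat set" where "primes_e = {p. prime p \<and> p dvd nat e}"
definition primes_m :: "nat set" where "primes_m = {p. prime p \<and> p dvd nat m}"

lemma dvd_nat: "k > 0 \<Longrightarrow> p dvd nat k \<longleftrightarrow> int p dvd k"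
  by (metis int_dvd_int_iff int_nat_eq less_imp_le)

lemma primes_e_m: "primes_e \<union> primes_m = primes_d" "primes_e \<inter> primes_m = {}" "finite primes_e" "finite primes_m" "\<And>q. q \<in> primes_e \<union> primes_m \<Longrightarrow> prime q"
proof -
  have A: "p \<in> primes_e \<longleftrightarrow> prime p \<and> int p dvd e" and B: "p \<in> primes_m \<longleftrightarrow> prime p \<and> int p dvd m" for p
    using dvd_nat[OF e_pos] dvd_nat[OF m_pos] by (auto simp: primes_e_def primes_m_def)
  have "int p dvd d \<longleftrightarrow> int p dvd m \<or> int p dvd e" if "prime p" for p
  proof -
    have "int p dvd d \<longleftrightarrow> int p dvd m * e" by (subst me) simp
    thus ?thesis using that by (simp add: prime_dvd_mult_iff)
  qed
  thus AB: "primes_e \<union> primes_m = primes_d" using A B by (auto simp: primes_d_def)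
  show "primes_e \<inter> primes_m = {}"
  proof (rule ccontr)
    assume "primes_e \<inter> primes_m \<noteq> {}"
    then obtain p where p: "prime p" "int p dvd e" "int p dvd m" using A B by blast
    hence "int p * int p dvd m * e" by (intro mult_dvd_mono)
    hence "(int p) ^ 2 dvd d" by (subst me) (simp add: power2_eq_square)
    hence "is_unit (int p)" using d_sqf by (rule squarefreeD[rotated])
    thus False using p(1) by simp
  qed
  show "finite primes_e" "finite primes_m" using finite_primes_d unfolding AB[symmetric] by auto
  show "\<And>q. q \<in> primes_e \<union> primes_m \<Longrightarrow> prime q" using A B by blast
qed

lemma cop_coprime_avoiding: assumes "x > 0" "y > 0" shows "cop (int x) (int y) \<longleftrightarrow> (x, y) \<in> coprime_avoiding primes_e primes_m"
proof -
  have "cop (int x) (int y) \<longleftrightarrow> coprime (int x) (int y) \<and> coprime (int x) (int (nat e)) \<and> coprime (int y) (int (nat m))"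
    using e_pos m_pos by (auto simp: cop_def coprime_commute)
  also have "\<dots> \<longleftrightarrow> coprime x y \<and> coprime x (nat e) \<and> coprime y (nat m)"
    by (simp only: coprime_int_iff)
  also have "\<dots> \<longleftrightarrow> (x, y) \<in> coprime_avoiding primes_e primes_m"
    using assms e_pos m_pos by (simp add: coprime_iff_prime_divisors[of "nat e"] coprime_iff_prime_divisors[of "nat m"] coprime_avoiding_def primes_e_def primes_m_def)
  finally show ?thesis .
qed

lemma coprime_sum_zeta_factor: "Re s > 1 \<Longrightarrow> coprime_sum s primes_e primes_m = zeta_factor s"
  using coprime_sum_zeta[OF _ primes_e_m(3,4,2,5)] by (simp add: zeta_factor_def primes_e_m(1))

definition rect_pair :: "nat \<times> nat \<Rightarrow> complex set" where "rect_pair z = rect_sub (int (fst z)) (int (snd z))"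
definition cent_pair :: "nat \<times> nat \<Rightarrow> complex set" where "cent_pair z = cent_sub (int (fst z)) (int (snd z))"

lemma rect_sub_lat: "X > 0 \<Longrightarrow> Y > 0 \<Longrightarrow> is_lat (rect_sub X Y)" and cent_sub_lat: "X > 0 \<Longrightarrow> Y > 0 \<Longrightarrow> is_lat (cent_sub X Y)"
  and covol_rect_sub: "X > 0 \<Longrightarrow> Y > 0 \<Longrightarrow> covol (rect_sub X Y) = of_int (X * Y) * (of_int m * sqrt_abs_d)"
  and covol_cent_sub: "X > 0 \<Longrightarrow> Y > 0 \<Longrightarrow> covol (cent_sub X Y) = 2 * of_int (X * Y) * (of_int m * sqrt_abs_d)"
proof -
  have ar: "area (of_int (X * m)) (of_int Y * w) = of_int (X * Y) * (of_int m * sqrt_abs_d)"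
    by (simp add: area_def)
  assume XY: "X > 0" "Y > 0"
  hence pos: "of_int (X * Y) * (of_int m * sqrt_abs_d) > 0" using m_pos sqrt_abs_d_pos by simp
  show "is_lat (rect_sub X Y)" unfolding rect_sub_def by (rule is_latI) (use pos ar in linarith)
  show "is_lat (cent_sub X Y)" unfolding cent_sub_def by (rule is_lat_rhomb) (use pos ar in linarith)
  show "covol (rect_sub X Y) = of_int (X * Y) * (of_int m * sqrt_abs_d)" unfolding rect_sub_def covol_lat ar using pos by simp
  show "covol (cent_sub X Y) = 2 * of_int (X * Y) * (of_int m * sqrt_abs_d)" unfolding cent_sub_def covol_rhomb ar using pos by simp
qed

lemma rect_lat: "is_lat (rect m)" and cent_lat: "is_lat (cent m)"
  and covol_rect: "covol (rect m) = of_int m * sqrt_abs_d" and covol_cent: "covol (cent m) = 2 * (of_int m * sqrt_abs_d)"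
proof -
  have pos: "of_int m * sqrt_abs_d > 0" using m_pos sqrt_abs_d_pos by simp
  show "is_lat (rect m)" by (rule is_latI) (unfold area_mw, use pos in linarith)
  show "is_lat (cent m)" by (rule is_lat_rhomb) (unfold area_mw, use pos in linarith)
  show "covol (rect m) = of_int m * sqrt_abs_d" unfolding covol_lat area_mw using pos by simp
  show "covol (cent m) = 2 * (of_int m * sqrt_abs_d)" unfolding covol_rhomb area_mw using pos by simp
qed

lemma cnj_pt: "cnj (pt x y) = pt x (- y)"
  by (simp add: pt_def)

lemma cnj_rect_sub: "cnj ` rect_sub X Y = rect_sub X Y"
proof -
  have *: "cnj z \<in> rect_sub X Y" if z: "z \<in> rect_sub X Y" for z
  proof -
    obtain u v where "z = pt (X * u) (Y * v)" using z unfolding in_rect_sub by blast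
    hence "cnj z = pt (X * u) (Y * (- v))" by (simp add: cnj_pt)
    thus ?thesis unfolding in_rect_sub by blast
  qed
  show ?thesis
  proof (intro equalityI subsetI)
    fix z assume "z \<in> rect_sub X Y"
    hence "cnj z \<in> rect_sub X Y" by (rule *)
    thus "z \<in> cnj ` rect_sub X Y" by (intro image_eqI[of _ _ "cnj z"]) simp_all
  qed (use * in blast)
qed

lemma cnj_cent_sub: "cnj ` cent_sub X Y = cent_sub X Y"
proof -
  have *: "cnj z \<in> cent_sub X Y" if z: "z \<in> cent_sub X Y" for z
  proof -
    obtain u v where "z = pt (X * u) (Y * v)" "even (u - v)" using z unfolding in_cent_sub by blast
    hence "cnj z = pt (X * u) (Y * (- v))" "even (u - (- v))" by (simp_all add: cnj_pt)
    thus ?thesis unfolding in_cent_sub by blast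
  qed
  show ?thesis
  proof (intro equalityI subsetI)
    fix z assume "z \<in> cent_sub X Y"
    hence "cnj z \<in> cent_sub X Y" by (rule *)
    thus "z \<in> cnj ` cent_sub X Y" by (intro image_eqI[of _ _ "cnj z"]) simp_all
  qed (use * in blast)
qed

lemma rect_sub_rect: "rect_sub X Y \<subseteq> rect m"
  unfolding subset_iff in_rect_sub in_rect by blast

lemma cent_sub_rect: "cent_sub X Y \<subseteq> rect m"
  unfolding subset_iff in_cent_sub in_rect by blast

lemma rect_sub_cent: "rect_sub X Y \<subseteq> cent m \<longleftrightarrow> even X \<and> even Y"
proof
  assume "rect_sub X Y \<subseteq> cent m"
  hence "pt X 0 \<in> cent m" "pt 0 Y \<in> cent m" using pt_rect_sub by blast+
  thus "even X \<and> even Y" by (auto simp: in_cent pt_eq)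
next
  assume XY: "even X \<and> even Y"
  show "rect_sub X Y \<subseteq> cent m"
  proof
    fix z assume "z \<in> rect_sub X Y"
    then obtain u v where z: "z = pt (X * u) (Y * v)" unfolding in_rect_sub by blast
    have "even (X * u - Y * v)" using XY by simp
    thus "z \<in> cent m" unfolding z in_cent by blast
  qed
qed

lemma cent_sub_cent: "cent_sub X Y \<subseteq> cent m \<longleftrightarrow> even (X - Y)"
proof
  assume "cent_sub X Y \<subseteq> cent m"
  hence "pt X Y \<in> cent m" using rect_sub_sub_cent_sub(3) by blast
  thus "even (X - Y)" by (auto simp: in_cent pt_eq)
qed (rule cent_sub_sub_cent)

lemma cent_rect: "cent m \<subseteq> rect m"
  by (rule rhomb_subset_lat)

text \<open>For K inside \<open>rect m\<close> the semi-axes of K are integer multiples X, Y of the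
  sides m and sqrt(-d); for the centred shape both are read off from its point (1, 1).\<close>

lemma conj_stable_rect_sub_cent_sub:
  assumes K: "is_lat K" "cnj ` K = K" "K \<subseteq> rect m"
  obtains X Y :: nat where "X > 0" "Y > 0" "K = rect_pair (X, Y) \<or> K = cent_pair (X, Y)"
proof -
  obtain a b where ab: "a > 0" "b > 0" and
    c: "K = lat (of_real a) (of_real b * \<i>) \<or> K = rhomb (of_real a) (of_real b * \<i>)"
    using conj_stable_cases[OF K(1,2)] by metis
  have pt_re: "pt x y = of_real (of_int (x * m)) + of_real (of_int y) * w" for x y by (simp add: pt_def)
  have conv: "lat (of_real a) (of_real b * \<i>) = rect_sub x y \<and> rhomb (of_real a) (of_real b * \<i>) = cent_sub x y \<and> x > 0 \<and> y > 0"
    if e: "a = of_int (x * m)" "b / sqrt_abs_d = of_int y" for x y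
  proof -
    have "x * m > 0" using ab(1) e(1) by (simp only: of_int_0_less_iff)
    moreover have "of_int y > (0::real)" using ab(2) sqrt_abs_d_pos unfolding e(2)[symmetric] by simp
    ultimately have "x > 0 \<and> y > 0" using m_pos by (simp add: zero_less_mult_iff)
    moreover have "complex_of_real a = of_int (x * m)" unfolding e(1) by simp
    moreover have "complex_of_real b * \<i> = of_int y * w" unfolding imag_eq_w e(2) by simp
    ultimately show ?thesis by (simp only: rect_sub_def cent_sub_def)
  qed
  have "\<exists>x y. a = of_int (x * m) \<and> b / sqrt_abs_d = of_int y"
    using c
  proof
    assume L: "K = lat (of_real a) (of_real b * \<i>)"
    have "of_real a \<in> rect m" "of_real b * \<i> \<in> rect m" using K(3) lat_gen unfolding L by blast+
    then obtain x y x' y' where "of_real a = pt x y" "of_real b * \<i> = pt x' y'" unfolding in_rect by blast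
    hence "of_real a + of_real 0 * w = of_real (of_int (x * m)) + of_real (of_int y) * w"
      "of_real 0 + of_real (b / sqrt_abs_d) * w = of_real (of_int (x' * m)) + of_real (of_int y') * w"
      unfolding pt_re imag_eq_w by simp_all
    from real_coords(1)[OF this(1)] real_coords(2)[OF this(2)] show ?thesis by blast
  next
    assume L: "K = rhomb (of_real a) (of_real b * \<i>)"
    have "of_int 1 * of_real a + of_int 1 * (of_real b * \<i>) \<in> K" unfolding L by (rule rhombI) simp
    hence "of_real a + of_real b * \<i> \<in> rect m" using K(3) by auto
    then obtain x y where "of_real a + of_real b * \<i> = pt x y" unfolding in_rect by blast
    hence "of_real a + of_real (b / sqrt_abs_d) * w = of_real (of_int (x * m)) + of_real (of_int y) * w"
      unfolding pt_re imag_eq_w .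
    from real_coords[OF this] show ?thesis by blast
  qed
  then obtain x y where "a = of_int (x * m)" "b / sqrt_abs_d = of_int y" by blast
  note cv = conv[OF this]
  have "K = rect_pair (nat x, nat y) \<or> K = cent_pair (nat x, nat y)"
    using c cv by (simp add: rect_pair_def cent_pair_def)
  thus ?thesis using that[of "nat x" "nat y"] cv by simp
qed

lemma rect_sub_dvd: "rect_sub X Y \<subseteq> rect_sub X' Y' \<Longrightarrow> X' dvd X \<and> Y' dvd Y"
proof -
  assume "rect_sub X Y \<subseteq> rect_sub X' Y'"
  hence "pt X 0 \<in> rect_sub X' Y'" "pt 0 Y \<in> rect_sub X' Y'" using pt_rect_sub by blast+
  thus ?thesis by (auto simp: in_rect_sub pt_eq)
qed

lemma cent_sub_dvd: "cent_sub X Y \<subseteq> cent_sub X' Y' \<Longrightarrow> X' dvd X \<and> Y' dvd Y"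
proof -
  assume "cent_sub X Y \<subseteq> cent_sub X' Y'"
  hence "pt X Y \<in> cent_sub X' Y'" using rect_sub_sub_cent_sub(3) by blast
  thus ?thesis by (auto simp: in_cent_sub pt_eq)
qed

text \<open>In a centred lattice a horizontal vector has even coefficient, so X would be an even
  multiple of \<open>X'\<close>, while \<open>X'\<close> is in turn a multiple of X.\<close>

lemma rect_sub_ne_cent_sub: assumes "X > 0" "Y' \<noteq> 0" shows "rect_sub X Y \<noteq> cent_sub X' Y'"
proof
  assume eq: "rect_sub X Y = cent_sub X' Y'"
  have "pt X 0 \<in> cent_sub X' Y'" using pt_rect_sub eq by blast
  then obtain u v where uv: "X = X' * u" "0 = Y' * v" "even (u - v)" by (auto simp: in_cent_sub pt_eq)
  hence u: "even u" using assms(2) by simp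
  have "pt X' Y' \<in> rect_sub X Y" using rect_sub_sub_cent_sub(3) eq by blast
  then obtain k where k: "X' = X * k" by (auto simp: in_rect_sub pt_eq)
  have "X = X * k * u" using uv(1) unfolding k .
  hence "X * 1 = X * (k * u)" by (simp only: mult.assoc mult_1_right)
  hence "1 = k * u" using assms(1) by simp
  hence "even (1::int)" using u by (metis dvd_mult)
  thus False by simp
qed

lemma inj_rect_pair: "inj_on rect_pair pos_pairs" and inj_cent_pair: "inj_on cent_pair pos_pairs"
proof -
  show "inj_on rect_pair pos_pairs"
  proof (rule inj_onI)
    fix z z' assume z: "z \<in> pos_pairs" "z' \<in> pos_pairs" "rect_pair z = rect_pair z'"
    have "int (fst z) dvd int (fst z')" "int (snd z) dvd int (snd z')"
      "int (fst z') dvd int (fst z)" "int (snd z') dvd int (snd z)"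
      using rect_sub_dvd z(3) unfolding rect_pair_def by blast+
    hence "fst z = fst z'" "snd z = snd z'" by (simp_all add: dvd_antisym)
    thus "z = z'" by (rule prod_eqI)
  qed
  show "inj_on cent_pair pos_pairs"
  proof (rule inj_onI)
    fix z z' assume z: "z \<in> pos_pairs" "z' \<in> pos_pairs" "cent_pair z = cent_pair z'"
    have "int (fst z) dvd int (fst z')" "int (snd z) dvd int (snd z')"
      "int (fst z') dvd int (fst z)" "int (snd z') dvd int (snd z)"
      using cent_sub_dvd z(3) unfolding cent_pair_def by blast+
    hence "fst z = fst z'" "snd z = snd z'" by (simp_all add: dvd_antisym)
    thus "z = z'" by (rule prod_eqI)
  qed
qed

lemma rect_pair_cent_pair_disjoint: "S \<subseteq> pos_pairs \<Longrightarrow> S' \<subseteq> pos_pairs \<Longrightarrow> rect_pair ` S \<inter> cent_pair ` S' = {}"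
proof -
  assume S: "S \<subseteq> pos_pairs" "S' \<subseteq> pos_pairs"
  have "rect_pair z \<noteq> cent_pair z'" if "z \<in> S" "z' \<in> S'" for z z'
    unfolding rect_pair_def cent_pair_def by (rule rect_sub_ne_cent_sub) (use S that in \<open>auto simp: pos_pairs_def\<close>)
  thus ?thesis by blast
qed

text \<open>Here c is the covolume of J in units of that of \<open>rect m\<close>, namely 1 for
  \<open>rect m\<close> and 2 for \<open>cent m\<close>.\<close>

lemma index_rect_pair:
  assumes "z \<in> pos_pairs" "is_lat J" "rect_pair z \<subseteq> J" "covol J = c * (of_int m * sqrt_abs_d)" "c > 0" 
    "real k * c = real (fst z * snd z)"
  shows "lattice_index J (rect_pair z) = k"
proof -
  have p: "int (fst z) > 0" "int (snd z) > 0" using assms(1) by (auto simp: pos_pairs_def)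
  have "real (lattice_index J (rect_pair z)) = real (fst z * snd z) * (of_int m * sqrt_abs_d) / (c * (of_int m * sqrt_abs_d))"
    using lattice_index_covol(2)[OF assms(2) _ assms(3)] rect_sub_lat[OF p] covol_rect_sub[OF p] assms(4)
    by (simp add: rect_pair_def)
  also have "\<dots> = real k" unfolding assms(6)[symmetric] using assms(5) m_pos sqrt_abs_d_pos by simp
  finally show ?thesis by simp
qed

lemma index_cent_pair:
  assumes "z \<in> pos_pairs" "is_lat J" "cent_pair z \<subseteq> J" "covol J = c * (of_int m * sqrt_abs_d)" "c > 0" 
    "real k * c = 2 * real (fst z * snd z)"
  shows "lattice_index J (cent_pair z) = k"
proof -
  have p: "int (fst z) > 0" "int (snd z) > 0" using assms(1) by (auto simp: pos_pairs_def)
  have "real (lattice_index J (cent_pair z)) = 2 * real (fst z * snd z) * (of_int m * sqrt_abs_d) / (c * (of_int m * sqrt_abs_d))"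
    using lattice_index_covol(2)[OF assms(2) _ assms(3)] cent_sub_lat[OF p] covol_cent_sub[OF p] assms(4)
    by (simp add: cent_pair_def)
  also have "\<dots> = real k" unfolding assms(6)[symmetric] using assms(5) m_pos sqrt_abs_d_pos by simp
  finally show ?thesis by simp
qed

lemma conj_lats_I:
  assumes "z \<in> pos_pairs"
  shows "rect_pair z \<in> conj_lats J \<longleftrightarrow> rect_pair z \<subseteq> J \<and> Ok_span (rect_pair z) = J" "cent_pair z \<in> conj_lats J \<longleftrightarrow> cent_pair z \<subseteq> J \<and> Ok_span (cent_pair z) = J"
  using assms rect_sub_lat[of "int (fst z)" "int (snd z)"] cent_sub_lat[of "int (fst z)" "int (snd z)"]
  by (auto simp: conj_lats_def rect_pair_def cent_pair_def pos_pairs_def cnj_rect_sub cnj_cent_sub)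

lemma conj_lats_eq:
  assumes "J \<subseteq> rect m"
  shows "conj_lats J = rect_pair ` {z \<in> pos_pairs. rect_pair z \<in> conj_lats J} \<union> cent_pair ` {z \<in> pos_pairs. cent_pair z \<in> conj_lats J}"
proof (intro equalityI subsetI)
  fix K assume K: "K \<in> conj_lats J"
  hence "is_lat K" "cnj ` K = K" "K \<subseteq> rect m" using assms by (auto simp: conj_lats_def)
  then obtain X Y :: nat where "X > 0" "Y > 0" "K = rect_pair (X, Y) \<or> K = cent_pair (X, Y)" by (rule conj_stable_rect_sub_cent_sub)
  moreover from this have "(X, Y) \<in> pos_pairs" by (simp add: pos_pairs_def)
  ultimately show "K \<in> rect_pair ` {z \<in> pos_pairs. rect_pair z \<in> conj_lats J} \<union> cent_pair ` {z \<in> pos_pairs. cent_pair z \<in> conj_lats J}" using K by blast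
qed blast

lemma has_sum_reindex_pair_term:
  assumes s: "Re s > 1" and S: "S \<subseteq> pos_pairs" and g: "inj_on g S"
    and k: "\<And>z. z \<in> S \<Longrightarrow> lattice_index J (g z) = k * (fst z * snd z)"
  shows "((\<lambda>K. neg_pow s (lattice_index J K)) has_sum (neg_pow s k * infsum (pair_term s) S)) (g ` S)"
proof -
  have "((\<lambda>z. neg_pow s k * pair_term s z) has_sum (neg_pow s k * infsum (pair_term s) S)) S"
    by (intro has_sum_cmult_right has_sum_infsum pair_term_summable s S)
  moreover have "neg_pow s (lattice_index J (g z)) = neg_pow s k * pair_term s z" if "z \<in> S" for z
    unfolding k[OF that] neg_pow_mult[of s k] pair_term_def ..
  hence "((\<lambda>z. neg_pow s (lattice_index J (g z))) has_sum c) S \<longleftrightarrow> ((\<lambda>z. neg_pow s k * pair_term s z) has_sum c) S" for c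
    by (rule has_sum_cong)
  ultimately have "((\<lambda>z. neg_pow s (lattice_index J (g z))) has_sum (neg_pow s k * infsum (pair_term s) S)) S" by blast
  thus ?thesis unfolding has_sum_reindex[OF g] by (simp add: o_def)
qed

lemma has_sum_conj_lats:
  assumes s: "Re s > 1" and J: "J \<subseteq> rect m"
    and SL: "SL = {z \<in> pos_pairs. rect_pair z \<in> conj_lats J}" and SQ: "SQ = {z \<in> pos_pairs. cent_pair z \<in> conj_lats J}"
    and "((\<lambda>K. neg_pow s (lattice_index J K)) has_sum x) (rect_pair ` SL)"
    and "((\<lambda>K. neg_pow s (lattice_index J K)) has_sum y) (cent_pair ` SQ)"
  shows "((\<lambda>K. neg_pow s (lattice_index J K)) has_sum (x + y)) (conj_lats J)"
proof -
  have eq: "conj_lats J = rect_pair ` SL \<union> cent_pair ` SQ" unfolding SL SQ by (rule conj_lats_eq[OF J])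
  have "SL \<subseteq> pos_pairs" "SQ \<subseteq> pos_pairs" unfolding SL SQ by blast+
  hence "rect_pair ` SL \<inter> cent_pair ` SQ = {}" by (rule rect_pair_cent_pair_disjoint)
  with assms(5,6) show ?thesis unfolding eq by (rule has_sum_Un_disjoint)
qed

lemma pos_pairs_pos: "z \<in> pos_pairs \<Longrightarrow> 0 < fst z" "z \<in> pos_pairs \<Longrightarrow> 0 < snd z"
  by (auto simp: pos_pairs_def)

lemma coprime_avoiding_z: "z \<in> pos_pairs \<Longrightarrow> cop (int (fst z)) (int (snd z)) \<longleftrightarrow> z \<in> coprime_avoiding primes_e primes_m"
  using cop_coprime_avoiding[of "fst z" "snd z"] pos_pairs_pos by simp

lemma subset_pos_pairs_eq:
  "S \<subseteq> pos_pairs \<Longrightarrow> (\<And>z. z \<in> pos_pairs \<Longrightarrow> z \<in> S \<longleftrightarrow> P z) \<Longrightarrow> S = {z \<in> pos_pairs. P z}"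
  by blast

text \<open>Rectangular and centred lattices range over the same pairs; a centred one has twice the
  index, whence 1 + t.\<close>

lemma has_sum_rect_2:
  assumes d: "d mod 4 = 2" and s: "Re s > 1"
  shows "((\<lambda>K. neg_pow s (lattice_index (rect m) K)) has_sum ((1 + neg_pow s 2) * zeta_factor s)) (conj_lats (rect m))"
proof -
  have d': "d mod 4 \<noteq> 1" using d by simp
  have SL: "coprime_avoiding primes_e primes_m = {z \<in> pos_pairs. rect_pair z \<in> conj_lats (rect m)}"
  proof (rule subset_pos_pairs_eq[OF coprime_avoiding_pos_pairs])
    fix z assume z: "z \<in> pos_pairs"
    show "z \<in> coprime_avoiding primes_e primes_m \<longleftrightarrow> rect_pair z \<in> conj_lats (rect m)"
      unfolding conj_lats_I(1)[OF z] unfolding rect_pair_def Ok_span_rect_sub_rect[OF d'] using rect_sub_rect coprime_avoiding_z[OF z] by blast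
  qed
  have SQ: "coprime_avoiding primes_e primes_m = {z \<in> pos_pairs. cent_pair z \<in> conj_lats (rect m)}"
  proof (rule subset_pos_pairs_eq[OF coprime_avoiding_pos_pairs])
    fix z assume z: "z \<in> pos_pairs"
    show "z \<in> coprime_avoiding primes_e primes_m \<longleftrightarrow> cent_pair z \<in> conj_lats (rect m)"
      unfolding conj_lats_I(2)[OF z] unfolding cent_pair_def Ok_span_cent_sub_rect_2[OF d] using cent_sub_rect coprime_avoiding_z[OF z] by blast
  qed
  have "((\<lambda>K. neg_pow s (lattice_index (rect m) K)) has_sum (neg_pow s 1 * infsum (pair_term s) (coprime_avoiding primes_e primes_m))) (rect_pair ` coprime_avoiding primes_e primes_m)"
  proof (rule has_sum_reindex_pair_term[OF s coprime_avoiding_pos_pairs inj_on_subset[OF inj_rect_pair coprime_avoiding_pos_pairs]])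
    fix z assume z: "z \<in> coprime_avoiding primes_e primes_m"
    show "lattice_index (rect m) (rect_pair z) = 1 * (fst z * snd z)"
      by (rule index_rect_pair[where c = 1, OF subsetD[OF coprime_avoiding_pos_pairs z] rect_lat]) (simp_all add: rect_sub_rect covol_rect rect_pair_def)
  qed
  moreover have "((\<lambda>K. neg_pow s (lattice_index (rect m) K)) has_sum (neg_pow s 2 * infsum (pair_term s) (coprime_avoiding primes_e primes_m))) (cent_pair ` coprime_avoiding primes_e primes_m)"
  proof (rule has_sum_reindex_pair_term[OF s coprime_avoiding_pos_pairs inj_on_subset[OF inj_cent_pair coprime_avoiding_pos_pairs]])
    fix z assume z: "z \<in> coprime_avoiding primes_e primes_m"
    show "lattice_index (rect m) (cent_pair z) = 2 * (fst z * snd z)"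
      by (rule index_cent_pair[where c = 1, OF subsetD[OF coprime_avoiding_pos_pairs z] rect_lat]) (simp_all add: cent_sub_rect covol_rect cent_pair_def)
  qed
  ultimately have "((\<lambda>K. neg_pow s (lattice_index (rect m) K)) has_sum
      (neg_pow s 1 * infsum (pair_term s) (coprime_avoiding primes_e primes_m) + neg_pow s 2 * infsum (pair_term s) (coprime_avoiding primes_e primes_m))) (conj_lats (rect m))"
    by (rule has_sum_conj_lats[OF s order_refl SL SQ])
  thus ?thesis by (simp add: coprime_sum_zeta_factor[OF s, unfolded coprime_sum_def] algebra_simps)
qed

lemma two_notin: "odd d \<Longrightarrow> 2 \<notin> primes_e \<and> 2 \<notin> primes_m"
proof -
  assume "odd d"
  hence "2 \<notin> primes_d" by (simp add: primes_d_def)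
  thus "2 \<notin> primes_e \<and> 2 \<notin> primes_m" using primes_e_m(1) by blast
qed

text \<open>The rectangular lattices give the full coprime sum; the centred ones, of index 2XY, are
  restricted to pairs of opposite parity.\<close>

lemma has_sum_rect_3:
  assumes d: "d mod 4 = 3" and s: "Re s > 1"
  shows "((\<lambda>K. neg_pow s (lattice_index (rect m) K)) has_sum
    ((1 + neg_pow s 2 * (2 * neg_pow s 2 / (1 + neg_pow s 2))) * zeta_factor s)) (conj_lats (rect m))"
proof -
  have d': "d mod 4 \<noteq> 1" "odd d" using d by (simp, presburger)
  let ?O = "{(x, y) \<in> coprime_avoiding primes_e primes_m. odd (x + y)}"
  have O: "?O \<subseteq> pos_pairs" using coprime_avoiding_pos_pairs by auto
  have SL: "coprime_avoiding primes_e primes_m = {z \<in> pos_pairs. rect_pair z \<in> conj_lats (rect m)}"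
  proof (rule subset_pos_pairs_eq[OF coprime_avoiding_pos_pairs])
    fix z assume z: "z \<in> pos_pairs"
    show "z \<in> coprime_avoiding primes_e primes_m \<longleftrightarrow> rect_pair z \<in> conj_lats (rect m)"
      unfolding conj_lats_I(1)[OF z] unfolding rect_pair_def Ok_span_rect_sub_rect[OF d'(1)] using rect_sub_rect coprime_avoiding_z[OF z] by blast
  qed
  have SQ: "?O = {z \<in> pos_pairs. cent_pair z \<in> conj_lats (rect m)}"
  proof (rule subset_pos_pairs_eq[OF O])
    fix z assume z: "z \<in> pos_pairs"
    have "z \<in> ?O \<longleftrightarrow> z \<in> coprime_avoiding primes_e primes_m \<and> odd (int (fst z) + int (snd z))" by (cases z) simp
    thus "z \<in> ?O \<longleftrightarrow> cent_pair z \<in> conj_lats (rect m)"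
      unfolding conj_lats_I(2)[OF z] unfolding cent_pair_def Ok_span_cent_sub_rect_3[OF d] using cent_sub_rect coprime_avoiding_z[OF z] by blast
  qed
  have "((\<lambda>K. neg_pow s (lattice_index (rect m) K)) has_sum (neg_pow s 1 * infsum (pair_term s) (coprime_avoiding primes_e primes_m))) (rect_pair ` coprime_avoiding primes_e primes_m)"
  proof (rule has_sum_reindex_pair_term[OF s coprime_avoiding_pos_pairs inj_on_subset[OF inj_rect_pair coprime_avoiding_pos_pairs]])
    fix z assume z: "z \<in> coprime_avoiding primes_e primes_m"
    show "lattice_index (rect m) (rect_pair z) = 1 * (fst z * snd z)"
      by (rule index_rect_pair[where c = 1, OF subsetD[OF coprime_avoiding_pos_pairs z] rect_lat]) (simp_all add: rect_sub_rect covol_rect rect_pair_def)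
  qed
  moreover have "((\<lambda>K. neg_pow s (lattice_index (rect m) K)) has_sum (neg_pow s 2 * infsum (pair_term s) ?O)) (cent_pair ` ?O)"
  proof (rule has_sum_reindex_pair_term[OF s O inj_on_subset[OF inj_cent_pair O]])
    fix z assume z: "z \<in> ?O"
    show "lattice_index (rect m) (cent_pair z) = 2 * (fst z * snd z)"
      by (rule index_cent_pair[where c = 1, OF subsetD[OF O z] rect_lat]) (simp_all add: cent_sub_rect covol_rect cent_pair_def)
  qed
  ultimately have "((\<lambda>K. neg_pow s (lattice_index (rect m) K)) has_sum
      (neg_pow s 1 * infsum (pair_term s) (coprime_avoiding primes_e primes_m) + neg_pow s 2 * infsum (pair_term s) ?O)) (conj_lats (rect m))"
    by (rule has_sum_conj_lats[OF s order_refl SL SQ])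
  moreover have "infsum (pair_term s) ?O = 2 * neg_pow s 2 / (1 + neg_pow s 2) * zeta_factor s"
    using coprime_sum_parity(2)[OF s _ _ primes_e_m(5)] two_notin[OF d'(2)] coprime_sum_zeta_factor[OF s] by simp
  ultimately show ?thesis by (simp add: coprime_sum_zeta_factor[OF s, unfolded coprime_sum_def] algebra_simps)
qed

text \<open>No rectangle generates \<open>cent m\<close>, since its sides would be even. The centred
  lattices come from odd pairs and have index XY, the two factors 2 cancelling.\<close>

lemma has_sum_cent_3:
  assumes d: "d mod 4 = 3" and s: "Re s > 1"
  shows "((\<lambda>K. neg_pow s (lattice_index (cent m) K)) has_sum ((1 - neg_pow s 2) / (1 + neg_pow s 2) * zeta_factor s)) (conj_lats (cent m))"
proof -
  have d': "d mod 4 \<noteq> 1" "odd d" using d by (simp, presburger)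
  let ?O = "{(x, y) \<in> coprime_avoiding primes_e primes_m. odd x \<and> odd y}"
  have O: "?O \<subseteq> pos_pairs" using coprime_avoiding_pos_pairs by auto
  have "rect_pair z \<notin> conj_lats (cent m)" if "z \<in> pos_pairs" for z
    using conj_lats_I(1)[OF that] Ok_span_rect_sub_cent_3[OF d] rect_sub_cent by (auto simp: rect_pair_def)
  hence SL: "{} = {z \<in> pos_pairs. rect_pair z \<in> conj_lats (cent m)}" by blast
  have SQ: "?O = {z \<in> pos_pairs. cent_pair z \<in> conj_lats (cent m)}"
  proof (intro equalityI subsetI)
    fix z assume z: "z \<in> ?O"
    hence "even (int (fst z) - int (snd z))" "cop (int (fst z)) (int (snd z)) \<and> odd (int (fst z)) \<and> odd (int (snd z))" "z \<in> pos_pairs"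
      using O coprime_avoiding_z by auto
    thus "z \<in> {z \<in> pos_pairs. cent_pair z \<in> conj_lats (cent m)}"
      using conj_lats_I(2)[of z "cent m"] Ok_span_cent_sub_cent_3[OF d, of "int (fst z)" "int (snd z)"] cent_sub_cent by (simp add: cent_pair_def)
  next
    fix z assume z: "z \<in> {z \<in> pos_pairs. cent_pair z \<in> conj_lats (cent m)}"
    hence "cent_pair z \<subseteq> cent m \<and> Ok_span (cent_pair z) = cent m" using conj_lats_I(2) by blast
    hence "even (int (fst z) - int (snd z))" "Ok_span (cent_sub (int (fst z)) (int (snd z))) = cent m"
      using cent_sub_cent unfolding cent_pair_def by blast+
    hence "cop (int (fst z)) (int (snd z)) \<and> odd (int (fst z)) \<and> odd (int (snd z))"
      using Ok_span_cent_sub_cent_3[OF d] by blast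
    thus "z \<in> ?O" using z coprime_avoiding_z[of z] by (cases z) simp
  qed
  have "((\<lambda>K. neg_pow s (lattice_index (cent m) K)) has_sum (neg_pow s 1 * infsum (pair_term s) ?O)) (cent_pair ` ?O)"
  proof (rule has_sum_reindex_pair_term[OF s O inj_on_subset[OF inj_cent_pair O]])
    fix z assume z: "z \<in> ?O"
    hence "cent_pair z \<subseteq> cent m" unfolding SQ conj_lats_def by blast
    thus "lattice_index (cent m) (cent_pair z) = 1 * (fst z * snd z)"
      by (intro index_cent_pair[where c = 2, OF subsetD[OF O z] cent_lat]) (simp_all add: covol_cent)
  qed
  moreover have "((\<lambda>K. neg_pow s (lattice_index (cent m) K)) has_sum 0) (rect_pair ` {})" by simp
  ultimately have "((\<lambda>K. neg_pow s (lattice_index (cent m) K)) has_sum (0 + neg_pow s 1 * infsum (pair_term s) ?O)) (conj_lats (cent m))"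
    using has_sum_conj_lats[OF s cent_rect SL SQ] by blast
  moreover have "infsum (pair_term s) ?O = (1 - neg_pow s 2) / (1 + neg_pow s 2) * zeta_factor s"
    using coprime_sum_parity(1)[OF s _ _ primes_e_m(5)] two_notin[OF d'(2)] coprime_sum_zeta_factor[OF s] by simp
  ultimately show ?thesis by simp
qed

text \<open>Three families contribute: rectangles with sides 2X, 2Y of index 2XY, centred lattices
  with odd parameters of index XY, and centred lattices with parameters 2X, 2Y of opposite parity
  after halving, of index 4XY.\<close>

lemma has_sum_cent_1:
  assumes d: "d mod 4 = 1" and s: "Re s > 1" and frac_ideal: "frac_ideal (cent m)"
  shows "((\<lambda>K. neg_pow s (lattice_index (cent m) K)) has_sum
    ((neg_pow s 2 + (1 - neg_pow s 2) / (1 + neg_pow s 2) + neg_pow s 4 * (2 * neg_pow s 2 / (1 + neg_pow s 2))) * zeta_factor s)) (conj_lats (cent m))"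
proof -
  have d': "odd d" using d by presburger
  let ?OO = "{(x, y) \<in> coprime_avoiding primes_e primes_m. odd x \<and> odd y}"
  let ?O = "{(x, y) \<in> coprime_avoiding primes_e primes_m. odd (x + y)}"
  \<comment> \<open>Doubling of both coordinates, which parametrises the lattices with even
    parameters.\<close>
  let ?ram_root = "\<lambda>z::nat \<times> nat. (2 * fst z, 2 * snd z)"
  have O: "?O \<subseteq> pos_pairs" "?OO \<subseteq> pos_pairs" "?ram_root ` coprime_avoiding primes_e primes_m \<subseteq> pos_pairs" "?ram_root ` ?O \<subseteq> pos_pairs"
    using coprime_avoiding_pos_pairs by (auto simp: pos_pairs_def coprime_avoiding_def)
  have inj: "inj_on ?ram_root S" for S by (auto simp: inj_on_def prod_eq_iff)
  have dblp: "z \<in> pos_pairs" if "?ram_root z \<in> pos_pairs" for z using that by (auto simp: pos_pairs_def mem_Times_iff)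
  have half: "\<exists>z'. z = ?ram_root z'" if "even (fst z)" "even (snd z)" for z
    using that by (metis dvd_def prod.collapse fst_conv snd_conv)
  have SL: "?ram_root ` coprime_avoiding primes_e primes_m = {z \<in> pos_pairs. rect_pair z \<in> conj_lats (cent m)}"
  proof (intro equalityI subsetI)
    fix z assume "z \<in> ?ram_root ` coprime_avoiding primes_e primes_m"
    then obtain y where y: "z = ?ram_root y" "y \<in> coprime_avoiding primes_e primes_m" by blast
    have "y \<in> pos_pairs" using y coprime_avoiding_pos_pairs by blast
    hence "Ok_span (rect_sub (2 * int (fst y)) (2 * int (snd y))) = cent m"
      using Ok_span_rect_sub_cent_1[OF d frac_ideal] coprime_avoiding_z y(2) by blast
    thus "z \<in> {z \<in> pos_pairs. rect_pair z \<in> conj_lats (cent m)}"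
      using conj_lats_I(1)[of z "cent m"] rect_sub_cent[of "int (fst z)" "int (snd z)"] \<open>y \<in> pos_pairs\<close>
      by (simp add: y(1) rect_pair_def pos_pairs_def mem_Times_iff)
  next
    fix z assume z: "z \<in> {z \<in> pos_pairs. rect_pair z \<in> conj_lats (cent m)}"
    hence *: "rect_pair z \<subseteq> cent m" "Ok_span (rect_pair z) = cent m" using conj_lats_I(1) by blast+
    hence "even (int (fst z)) \<and> even (int (snd z))" unfolding rect_pair_def rect_sub_cent by blast
    then obtain y where y: "z = ?ram_root y" using half[of z] by auto
    have "cop (int (fst y)) (int (snd y))"
      using *(2) Ok_span_rect_sub_cent_1[OF d frac_ideal, of "int (fst y)" "int (snd y)"] by (simp add: y rect_pair_def)
    thus "z \<in> ?ram_root ` coprime_avoiding primes_e primes_m" using coprime_avoiding_z dblp z unfolding y by blast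
  qed
  have SQ: "?OO \<union> ?ram_root ` ?O = {z \<in> pos_pairs. cent_pair z \<in> conj_lats (cent m)}"
  proof (intro equalityI subsetI)
    fix z assume "z \<in> ?OO \<union> ?ram_root ` ?O"
    thus "z \<in> {z \<in> pos_pairs. cent_pair z \<in> conj_lats (cent m)}"
    proof
      assume z: "z \<in> ?OO"
      hence zp: "z \<in> pos_pairs" using O by blast
      have "odd (int (fst z))" "odd (int (snd z))" "cop (int (fst z)) (int (snd z))"
        using z coprime_avoiding_z[OF zp] by auto
      thus ?thesis using zp conj_lats_I(2)[OF zp] Ok_span_cent_sub_cent_1[OF d frac_ideal, of "int (fst z)" "int (snd z)"] cent_sub_cent
        by (simp add: cent_pair_def)
    next
      assume "z \<in> ?ram_root ` ?O"
      then obtain y where y: "z = ?ram_root y" "y \<in> ?O" by blast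
      have yp: "y \<in> pos_pairs" and zp: "z \<in> pos_pairs" using y O by blast+
      have "cop (int (fst y)) (int (snd y))" "odd (int (fst y) + int (snd y))" using y coprime_avoiding_z[OF yp] by auto
      thus ?thesis using zp conj_lats_I(2)[OF zp] Ok_span_QQ2_cent_1[OF d frac_ideal, of "int (fst y)" "int (snd y)"] cent_sub_cent
        by (simp add: cent_pair_def y(1))
    qed
  next
    fix z assume z: "z \<in> {z \<in> pos_pairs. cent_pair z \<in> conj_lats (cent m)}"
    hence zp: "z \<in> pos_pairs" and *: "cent_pair z \<subseteq> cent m" "Ok_span (cent_pair z) = cent m" using conj_lats_I(2) by blast+
    have ev: "even (int (fst z) - int (snd z))" using *(1) unfolding cent_pair_def cent_sub_cent .
    show "z \<in> ?OO \<union> ?ram_root ` ?O"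
    proof (cases "even (fst z)")
      case True
      hence "even (snd z)" using ev by simp
      then obtain y where y: "z = ?ram_root y" using half[of z] True by auto
      have yp: "y \<in> pos_pairs" using dblp zp unfolding y by blast
      have "cop (int (fst y)) (int (snd y)) \<and> odd (int (fst y) + int (snd y))"
        using *(2) Ok_span_QQ2_cent_1[OF d frac_ideal, of "int (fst y)" "int (snd y)"] by (simp add: y cent_pair_def)
      hence "y \<in> ?O" using coprime_avoiding_z[OF yp] by (cases y) simp
      thus ?thesis unfolding y by blast
    next
      case False
      hence o: "odd (int (fst z))" "odd (int (snd z))" using ev by simp_all
      hence "cop (int (fst z)) (int (snd z))" using *(2) Ok_span_cent_sub_cent_1[OF d frac_ideal o] by (simp add: cent_pair_def)
      hence "z \<in> ?OO" using coprime_avoiding_z[OF zp] o by (cases z) simp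
      thus ?thesis by blast
    qed
  qed
  let ?f = "\<lambda>K. neg_pow s (lattice_index (cent m) K)"
  have L: "(?f has_sum (neg_pow s 2 * infsum (pair_term s) (coprime_avoiding primes_e primes_m))) ((rect_pair \<circ> ?ram_root) ` coprime_avoiding primes_e primes_m)"
  proof (rule has_sum_reindex_pair_term[OF s coprime_avoiding_pos_pairs])
    show "inj_on (rect_pair \<circ> ?ram_root) (coprime_avoiding primes_e primes_m)" using inj inj_on_subset[OF inj_rect_pair O(3)] by (rule comp_inj_on)
    fix z assume z: "z \<in> coprime_avoiding primes_e primes_m"
    have "rect_pair (?ram_root z) \<subseteq> cent m" unfolding rect_pair_def rect_sub_cent by simp
    thus "lattice_index (cent m) ((rect_pair \<circ> ?ram_root) z) = 2 * (fst z * snd z)"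
      using O(3) z unfolding o_def
      by (intro index_rect_pair[where c = 2, OF subsetD[OF O(3)] cent_lat]) (auto simp: covol_cent)
  qed
  have Q1: "(?f has_sum (neg_pow s 1 * infsum (pair_term s) ?OO)) (cent_pair ` ?OO)"
  proof (rule has_sum_reindex_pair_term[OF s O(2) inj_on_subset[OF inj_cent_pair O(2)]])
    fix z assume z: "z \<in> ?OO"
    hence "z \<in> {z \<in> pos_pairs. cent_pair z \<in> conj_lats (cent m)}" unfolding SQ[symmetric] by blast
    hence "cent_pair z \<subseteq> cent m" unfolding conj_lats_def by blast
    thus "lattice_index (cent m) (cent_pair z) = 1 * (fst z * snd z)"
      by (intro index_cent_pair[where c = 2, OF subsetD[OF O(2) z] cent_lat]) (simp_all add: covol_cent)
  qed
  have Q2: "(?f has_sum (neg_pow s 4 * infsum (pair_term s) ?O)) ((cent_pair \<circ> ?ram_root) ` ?O)"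
  proof (rule has_sum_reindex_pair_term[OF s O(1)])
    show "inj_on (cent_pair \<circ> ?ram_root) ?O" using inj inj_on_subset[OF inj_cent_pair O(4)] by (rule comp_inj_on)
    fix z assume z: "z \<in> ?O"
    have "cent_pair (?ram_root z) \<subseteq> cent m" unfolding cent_pair_def cent_sub_cent by simp
    thus "lattice_index (cent m) ((cent_pair \<circ> ?ram_root) z) = 4 * (fst z * snd z)"
      using O(4) z unfolding o_def
      by (intro index_cent_pair[where c = 2, OF subsetD[OF O(4)] cent_lat]) (auto simp: covol_cent)
  qed
  have "?OO \<inter> ?ram_root ` ?O = {}" by auto
  hence "cent_pair ` ?OO \<inter> (cent_pair \<circ> ?ram_root) ` ?O = {}"
    unfolding image_comp[symmetric] using inj_on_image_Int[OF inj_cent_pair O(2,4)] by simp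
  with Q1 Q2 have "(?f has_sum (neg_pow s 1 * infsum (pair_term s) ?OO + neg_pow s 4 * infsum (pair_term s) ?O)) (cent_pair ` (?OO \<union> ?ram_root ` ?O))"
    unfolding image_Un image_comp by (rule has_sum_Un_disjoint)
  with L have "(?f has_sum (neg_pow s 2 * infsum (pair_term s) (coprime_avoiding primes_e primes_m) +
      (neg_pow s 1 * infsum (pair_term s) ?OO + neg_pow s 4 * infsum (pair_term s) ?O))) (conj_lats (cent m))"
    unfolding image_comp[symmetric] by (rule has_sum_conj_lats[OF s cent_rect SL SQ])
  moreover have "infsum (pair_term s) ?OO = (1 - neg_pow s 2) / (1 + neg_pow s 2) * zeta_factor s"
    "infsum (pair_term s) ?O = 2 * neg_pow s 2 / (1 + neg_pow s 2) * zeta_factor s"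
    using coprime_sum_parity[OF s _ _ primes_e_m(5)] two_notin[OF d'] coprime_sum_zeta_factor[OF s] by simp_all
  ultimately show ?thesis by (simp add: coprime_sum_zeta_factor[OF s, unfolded coprime_sum_def] algebra_simps)
qed

end

context imag_quad
begin

section \<open>Ramified primes and ambiguous classes\<close>

lemma carrier_R [simp]: "carrier (ring_of_ints_ring d) = Ok"
  and mult_R [simp]: "x \<otimes>\<^bsub>ring_of_ints_ring d\<^esub> y = x * y"
  and add_R [simp]: "x \<oplus>\<^bsub>ring_of_ints_ring d\<^esub> y = x + y"
  and zero_R [simp]: "\<zero>\<^bsub>ring_of_ints_ring d\<^esub> = 0"
  and one_R [simp]: "\<one>\<^bsub>ring_of_ints_ring d\<^esub> = 1"
  by (simp_all add: ring_of_ints_ring_def)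

lemma cring_R: "cring (ring_of_ints_ring d)"
proof (rule cringI)
  show "abelian_group (ring_of_ints_ring d)"
  proof (rule abelian_groupI)
    fix x assume "x \<in> carrier (ring_of_ints_ring d)"
    thus "\<exists>y\<in>carrier (ring_of_ints_ring d). y \<oplus>\<^bsub>ring_of_ints_ring d\<^esub> x = \<zero>\<^bsub>ring_of_ints_ring d\<^esub>"
      by (intro bexI[of _ "- x"]) (auto simp: Ok_uminus)
  qed (auto simp: Ok_add)
  show "comm_monoid (ring_of_ints_ring d)"
    by (rule comm_monoidI) (auto simp: Ok_mult)
qed (auto simp: distrib_right)

lemma addsub_Ok: "addsub Ok" by (rule is_lat_addsub[OF is_lat_Ok])

lemma ideal_iff: "ideal A (ring_of_ints_ring d) \<longleftrightarrow> A \<subseteq> Ok \<and> addsub A \<and> (\<forall>a\<in>Ok. \<forall>x\<in>A. a * x \<in> A)"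
proof -
  have am: "add_monoid (ring_of_ints_ring d) = additive_group Ok"
    by (simp add: ring_of_ints_ring_def additive_group_def)
  show ?thesis
  proof
    assume A: "ideal A (ring_of_ints_ring d)"
    hence "subgroup A (additive_group Ok)"
      unfolding am[symmetric] using additive_subgroup.a_subgroup ideal.axioms(1) by blast
    moreover have "a * x \<in> A" if "a \<in> Ok" "x \<in> A" for a x
      using ideal.I_l_closed[OF A that(2)] that(1) by simp
    ultimately show "A \<subseteq> Ok \<and> addsub A \<and> (\<forall>a\<in>Ok. \<forall>x\<in>A. a * x \<in> A)"
      using subgroup_additive[OF addsub_Ok] by blast
  next
    assume A: "A \<subseteq> Ok \<and> addsub A \<and> (\<forall>a\<in>Ok. \<forall>x\<in>A. a * x \<in> A)"
    show "ideal A (ring_of_ints_ring d)"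
    proof (rule idealI)
      show "ring (ring_of_ints_ring d)" using cring_R by (rule cring.axioms(1))
      show "subgroup A (add_monoid (ring_of_ints_ring d))"
        unfolding am subgroup_additive[OF addsub_Ok] using A by blast
      fix a x assume "a \<in> A" "x \<in> carrier (ring_of_ints_ring d)"
      hence xa: "x * a \<in> A" using A by simp
      thus "x \<otimes>\<^bsub>ring_of_ints_ring d\<^esub> a \<in> A" by simp
      have "a * x \<in> A" using xa by (simp only: mult.commute)
      thus "a \<otimes>\<^bsub>ring_of_ints_ring d\<^esub> x \<in> A" by simp
    qed
  qed
qed

section \<open>The prime over a ramified rational prime\<close>

definition disc :: int where "disc = theta_trace * theta_trace - 4 * theta_norm"

lemma four_theta_norm: "d mod 4 = 1 \<Longrightarrow> 4 * theta_norm = 1 - d"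
  unfolding theta_norm_def by presburger

lemma disc_eq: "disc = (if d mod 4 = 1 then d else 4 * d)"
proof (cases "d mod 4 = 1")
  case True
  thus ?thesis using four_theta_norm by (simp add: disc_def theta_trace_def)
qed (simp add: disc_def theta_trace_def theta_norm_def)

text \<open>The minimal polynomial of theta at c; \<open>theta_poly_disc\<close> completes the
  square.\<close>

definition theta_poly :: "int \<Rightarrow> int" where "theta_poly c = c * c - theta_trace * c + theta_norm"

lemma theta_poly_disc: "disc = (2 * c - theta_trace) * (2 * c - theta_trace) - 4 * theta_poly c"
  by (simp add: disc_def theta_poly_def algebra_simps)

text \<open>A prime divisor of the discriminant gives a double root c modulo r. That r^2 does not
  divide the value at c, the Eisenstein condition, comes from d being squarefree, or for r = 2 and d
  = 3 mod 4 from 1 - d being 2 modulo 4.\<close>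

lemma double_root:
  assumes r: "prime (r::nat)" "int r dvd disc"
  obtains c where "int r dvd 2 * c - theta_trace" "int r dvd theta_poly c" "\<not> int r * int r dvd theta_poly c"
proof -
  have sq: "\<not> int r * int r dvd d"
  proof
    assume "int r * int r dvd d"
    hence "int r ^ 2 dvd d" by (simp add: power2_eq_square)
    hence "is_unit (int r)" using d_sqf by (rule squarefreeD[rotated])
    thus False using r(1) by simp
  qed
  have pr: "prime (int r)" using r(1) by simp
  show ?thesis
  proof (cases "d mod 4 = 1")
    case True
    hence sqrt_abs_d: "int r dvd d" using r(2) disc_eq by simp
    have "odd d" using True by presburger
    hence "odd (int r)" using sqrt_abs_d dvd_trans by blast
    \<comment> \<open>The double root of the polynomial with trace 1 is 1/2 modulo r, represented by
      (r + 1)/2.\<close>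
    then obtain c where c: "int r = 2 * c - 1"
      using that by (metis add_diff_cancel_right' oddE odd_even_add even_plus_one_iff dvd_def diff_add_cancel)
    have t: "2 * c - theta_trace = int r" using c True by (simp add: theta_trace_def)
    have f4: "4 * theta_poly c = int r * int r - d" using theta_poly_disc[of c] t True disc_eq by simp
    have cop: "coprime (int r) 4"
    proof -
      have "coprime (int r) 2" using \<open>odd (int r)\<close> by simp
      hence "coprime (int r) (2 * 2)" by (simp only: coprime_mult_right_iff)
      thus ?thesis by simp
    qed
    have "int r dvd 4 * theta_poly c" unfolding f4 using sqrt_abs_d by simp
    hence "int r dvd theta_poly c" using cop by (simp add: coprime_dvd_mult_right_iff)
    moreover have "\<not> int r * int r dvd theta_poly c"
    proof
      assume "int r * int r dvd theta_poly c"
      hence "int r * int r dvd 4 * theta_poly c" by (rule dvd_mult)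
      hence "int r * int r dvd int r * int r - d" by (simp only: f4)
      hence "int r * int r dvd int r * int r - (int r * int r - d)" by (rule dvd_diff[OF dvd_refl])
      hence "int r * int r dvd d" by (simp only: diff_diff_eq2 add_diff_cancel_left')
      thus False using sq by blast
    qed
    ultimately show ?thesis using that[of c] t by simp
  next
    case False
    hence tn: "theta_trace = 0" "theta_norm = - d" by (simp_all add: theta_trace_def theta_norm_def)
    show ?thesis
    proof (cases "int r dvd d")
      case True
      thus ?thesis using that[of 0] sq by (simp add: tn theta_poly_def)
    next
      case nd: False
      have dq: "disc = 2 * (2 * d)" using False by (simp add: disc_eq)
      have "int r dvd 2" using r(2)[unfolded dq prime_dvd_mult_iff[OF pr]] nd by blast
      hence "int r dvd int 2" by simp
      hence "r dvd 2" by (simp only: int_dvd_int_iff)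
      hence r2: "int r = 2" using primes_dvd_imp_eq[OF r(1) two_is_prime_nat] by simp
      hence "odd d" using nd by simp
      hence d3: "d mod 4 = 3" using d_mod4 False by presburger
      have "even (1 - d)" using d3 by presburger
      moreover have "\<not> 4 dvd 1 - d" using d3 by presburger
      ultimately show ?thesis using that[of 1] r2 by (simp add: tn theta_poly_def)
    qed
  qed
qed

text \<open>When \<open>r\<close> divides \<open>theta_poly c\<close>, this is the kernel of the reduction of the ring of integers
  modulo \<open>r\<close> sending \<open>theta\<close> to \<open>c\<close>.\<close>
definition root_ideal :: "nat \<Rightarrow> int \<Rightarrow> complex set" where
  "root_ideal r c = {of_int x + of_int y * theta | x y. int r dvd x + c * y}"

lemma PrI: "int r dvd x + c * y \<Longrightarrow> of_int x + of_int y * theta \<in> root_ideal r c"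
  by (auto simp: root_ideal_def)

lemma in_root_ideal: "of_int x + of_int y * theta \<in> root_ideal r c \<longleftrightarrow> int r dvd x + c * y"
proof
  assume "of_int x + of_int y * theta \<in> root_ideal r c"
  then obtain x' y' where "of_int x + of_int y * theta = of_int x' + of_int y' * theta" "int r dvd x' + c * y'"
    by (auto simp: root_ideal_def)
  thus "int r dvd x + c * y" using coord_theta by metis
qed (rule PrI)

lemma root_ideal_Ok: "root_ideal r c \<subseteq> Ok"
  using OkI by (auto simp: root_ideal_def)

lemma addsub_root_ideal: "addsub (root_ideal r c)"
  unfolding addsub_def
proof (intro conjI ballI)
  show "0 \<in> root_ideal r c" using PrI[of r 0 c 0] by simp
  fix a b assume "a \<in> root_ideal r c" "b \<in> root_ideal r c"
  then obtain x y x' y' where *: "a = of_int x + of_int y * theta" "b = of_int x' + of_int y' * theta"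
    "int r dvd x + c * y" "int r dvd x' + c * y'" by (auto simp: root_ideal_def)
  have "a - b = of_int (x - x') + of_int (y - y') * theta" by (simp add: * algebra_simps)
  moreover have "int r dvd (x - x') + c * (y - y')" using dvd_diff[OF *(3,4)] by (simp add: algebra_simps)
  ultimately show "a - b \<in> root_ideal r c" using PrI by metis
qed

text \<open>Sending x + y theta to x + c y is multiplicative modulo r because c is a root of the
  minimal polynomial modulo r.\<close>

lemma root_ideal_hom:
  assumes "int r dvd theta_poly c"
  shows "(of_int x + of_int y * theta) * (of_int x' + of_int y' * theta) \<in> root_ideal r c \<longleftrightarrow>
    int r dvd (x + c * y) * (x' + c * y')"
proof -
  have e: "(x * x' - y * y' * theta_norm) + c * (x * y' + y * x' + y * y' * theta_trace)
      = (x + c * y) * (x' + c * y') - y * y' * theta_poly c" by (simp add: theta_poly_def algebra_simps)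
  show ?thesis unfolding theta_mult in_root_ideal e using dvd_diff_left_iff[of "int r" "y * y' * theta_poly c"] assms by simp
qed

lemma root_ideal_closed:
  assumes "int r dvd theta_poly c" "a \<in> Ok" "z \<in> root_ideal r c" shows "a * z \<in> root_ideal r c"
proof -
  obtain x y where a: "a = of_int x + of_int y * theta" using assms(2) by (rule OkE)
  obtain x' y' where z: "z = of_int x' + of_int y' * theta" "int r dvd x' + c * y'" using assms(3) by (auto simp: root_ideal_def)
  show ?thesis unfolding a z(1) root_ideal_hom[OF assms(1)] using z(2) by simp
qed

lemma r_root_ideal: "of_nat r \<in> root_ideal r c"
  using PrI[of r "int r" c 0] by simp

lemma frac_ideal_root_ideal: assumes "int r dvd theta_poly c" "r > 0" shows "frac_ideal (root_ideal r c)"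
proof -
  have t: "theta * z \<in> root_ideal r c" if "z \<in> root_ideal r c" for z
    by (rule root_ideal_closed[OF assms(1) Ok_theta that])
  have "is_lat (root_ideal r c)"
    using is_lat_sub[OF addsub_root_ideal root_ideal_Ok is_lat_Ok r_root_ideal t[OF r_root_ideal] area_theta] assms(2) by simp
  moreover have "root_ideal r c \<subseteq> F" using root_ideal_Ok[of r c] Ok_F by blast
  ultimately show ?thesis using t by (simp add: frac_ideal_def)
qed

lemma root_ideal_ideal: "int r dvd theta_poly c \<Longrightarrow> ideal (root_ideal r c) (ring_of_ints_ring d)"
  unfolding ideal_iff using root_ideal_Ok addsub_root_ideal root_ideal_closed by blast

lemma root_ideal_Ints: "root_ideal r c \<inter> \<int> = {of_int (int r * k) | k. True}"
proof (intro equalityI subsetI)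
  fix z assume z: "z \<in> root_ideal r c \<inter> \<int>"
  then obtain x y where xy: "z = of_int x + of_int y * theta" "int r dvd x + c * y" by (auto simp: root_ideal_def)
  obtain k where k: "z = of_int k" using z by (auto elim: Ints_cases)
  have "of_int x + of_int y * theta = of_int k + of_int 0 * theta" using xy k by simp
  hence "x = k \<and> y = 0" by (rule coord_theta)
  hence "int r dvd k" using xy by simp
  thus "z \<in> {of_int (int r * k) | k. True}" using k by (auto elim!: dvdE)
next
  fix z :: complex assume "z \<in> {of_int (int r * k) | k. True}"
  then obtain k where k: "z = of_int (int r * k)" by blast
  have "of_int (int r * k) + of_int 0 * theta \<in> root_ideal r c" by (rule PrI) simp
  thus "z \<in> root_ideal r c \<inter> \<int>" by (simp add: k)
qed

lemma root_ideal_prime: assumes r: "prime r" and c: "int r dvd theta_poly c" shows "prime_ideal_over d r (root_ideal r c)"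
  unfolding prime_ideal_over_def
proof
  show "primeideal (root_ideal r c) (ring_of_ints_ring d)"
  proof (rule primeidealI[OF root_ideal_ideal[OF c] cring_R])
    have "1 \<notin> root_ideal r c" using in_root_ideal[of 1 0 r c] r by (auto simp: prime_nat_iff)
    thus "carrier (ring_of_ints_ring d) \<noteq> root_ideal r c" using Ok_1 by auto
  next
    fix a b assume a: "a \<in> carrier (ring_of_ints_ring d)" and b: "b \<in> carrier (ring_of_ints_ring d)"
      and ab: "a \<otimes>\<^bsub>ring_of_ints_ring d\<^esub> b \<in> root_ideal r c"
    obtain x y where xy: "a = of_int x + of_int y * theta" using a by (auto elim: OkE)
    obtain x' y' where xy': "b = of_int x' + of_int y' * theta" using b by (auto elim: OkE)
    have "int r dvd (x + c * y) * (x' + c * y')" using ab root_ideal_hom[OF c] by (simp add: xy xy')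
    moreover have "prime (int r)" using r by simp
    ultimately have "int r dvd x + c * y \<or> int r dvd x' + c * y'" by (simp add: prime_dvd_mult_iff)
    thus "a \<in> root_ideal r c \<or> b \<in> root_ideal r c" unfolding xy xy' in_root_ideal .
  qed
qed (rule root_ideal_Ints)

text \<open>The Taylor expansion of the minimal polynomial at c, evaluated at theta.\<close>

lemma theta_c_sq: "(theta - of_int c) * (theta - of_int c) = of_int (theta_trace - 2 * c) * (theta - of_int c) - of_int (theta_poly c)"
proof -
  have "(theta - of_int c) * (theta - of_int c) = theta * theta - 2 * of_int c * theta + of_int c * of_int c"
    by (simp add: algebra_simps)
  thus ?thesis unfolding theta_sq by (simp add: theta_poly_def algebra_simps)
qed

lemma in_scl_Ok: assumes "r > 0"
  shows "of_int x + of_int y * theta \<in> scl (of_nat r) Ok \<longleftrightarrow> int r dvd x \<and> int r dvd y"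
proof
  assume "of_int x + of_int y * theta \<in> scl (of_nat r) Ok"
  then obtain z where z: "z \<in> Ok" "of_int x + of_int y * theta = of_nat r * z" by blast
  obtain a b where ab: "z = of_int a + of_int b * theta" using z(1) by (rule OkE)
  have "of_int x + of_int y * theta = of_int (int r * a) + of_int (int r * b) * theta"
    using z(2) by (simp add: ab algebra_simps)
  hence "x = int r * a \<and> y = int r * b" by (rule coord_theta)
  thus "int r dvd x \<and> int r dvd y" by simp
next
  assume "int r dvd x \<and> int r dvd y"
  then obtain a b where ab: "x = int r * a" "y = int r * b" by (auto elim!: dvdE)
  have "of_int x + of_int y * theta = of_nat r * (of_int a + of_int b * theta)"
    by (simp add: ab algebra_simps)
  thus "of_int x + of_int y * theta \<in> scl (of_nat r) Ok" using OkI by blast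
qed

lemma root_ideal_elem:
  assumes "z \<in> root_ideal r c" obtains y k where "z = of_int y * (theta - of_int c) + of_nat r * of_int k"
proof -
  obtain x y where xy: "z = of_int x + of_int y * theta" "int r dvd x + c * y" using assms by (auto simp: root_ideal_def)
  then obtain k where "x + c * y = int r * k" by blast
  hence x: "x = int r * k - c * y" by simp
  have "z = of_int y * (theta - of_int c) + of_nat r * of_int k"
    unfolding xy(1) x by (simp add: algebra_simps)
  thus ?thesis by (rule that)
qed

lemma theta_c_root_ideal: "theta - of_int c \<in> root_ideal r c"
  using PrI[of r "- c" c 1] by simp

text \<open>With u = theta - c, the expansion reads u^2 = -r (k u + g), where
  \<open>theta_poly c\<close> = r g and r does not divide g. Hence the square of (r, u) lies in (r)
  and contains r^2 and r g, so by Bezout also r.\<close>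

lemma root_ideal_square:
  assumes r: "prime r" "int r dvd 2 * c - theta_trace" "int r dvd theta_poly c" "\<not> int r * int r dvd theta_poly c"
  shows "ideal_mult (root_ideal r c) (root_ideal r c) = scl (of_nat r) Ok"
proof
  have r0: "r > 0" using r(1) prime_gt_0_nat by blast
  let ?u = "theta - of_int c"
  obtain k where k: "2 * c - theta_trace = int r * k" using r(2) by blast
  obtain g where g: "theta_poly c = int r * g" using r(3) by blast
  have uu: "?u * ?u = of_nat r * (of_int (- k) * ?u - of_int g)"
  proof -
    have tk: "theta_trace - 2 * c = int r * (- k)" using k by simp
    show ?thesis unfolding theta_c_sq g tk by (simp add: algebra_simps)
  qed
  have uOk: "?u \<in> Ok" by (intro Ok_diff) auto
  show "ideal_mult (root_ideal r c) (root_ideal r c) \<subseteq> scl (of_nat r) Ok"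
  proof (rule ideal_mult_least[OF addsub_image_mult[OF addsub_Ok]])
    fix a b assume a: "a \<in> root_ideal r c" and b: "b \<in> root_ideal r c"
    obtain y l where yl: "a = of_int y * ?u + of_nat r * of_int l" using a by (rule root_ideal_elem)
    obtain y' l' where yl': "b = of_int y' * ?u + of_nat r * of_int l'" using b by (rule root_ideal_elem)
    have "a * b = of_int (y * y') * (?u * ?u) + of_nat r * (of_int (y * l') * ?u + of_int (y' * l) * ?u + of_int (int r * l * l'))"
      unfolding yl yl' by (simp add: algebra_simps)
    also have "\<dots> = of_nat r * (of_int (y * y') * (of_int (- k) * ?u - of_int g) + (of_int (y * l') * ?u + of_int (y' * l) * ?u + of_int (int r * l * l')))"
      unfolding uu by (simp add: algebra_simps)
    finally have e: "a * b = of_nat r * (of_int (y * y') * (of_int (- k) * ?u - of_int g) + (of_int (y * l') * ?u + of_int (y' * l) * ?u + of_int (int r * l * l')))" .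
    show "a * b \<in> scl (of_nat r) Ok"
      unfolding e by (rule imageI) (intro Ok_add Ok_mult Ok_diff uOk Ok_of_int)
  qed
  let ?Q = "ideal_mult (root_ideal r c) (root_ideal r c)"
  have fiQ: "frac_ideal ?Q" using frac_ideal_root_ideal[OF r(3) r0] by (intro frac_ideal_ideal_mult)
  have aQ: "addsub ?Q" by (rule ideal_mult_addsub)
  have 1: "of_nat r * of_nat r \<in> ?Q" by (intro ideal_multI r_root_ideal)
  have 2: "of_nat r * ?u \<in> ?Q" by (intro ideal_multI r_root_ideal theta_c_root_ideal)
  have 3: "?u * ?u \<in> ?Q" by (intro ideal_multI theta_c_root_ideal)
  \<comment> \<open>Solving the expansion of u^2 for r g.\<close>
  have "of_int (- k) * (of_nat r * ?u) - ?u * ?u \<in> ?Q" using 2 3 aQ by (intro addsub_diff addsub_of_int)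
  hence 4: "of_int (int r * g) \<in> ?Q" unfolding uu by (simp add: algebra_simps)
  have ng: "\<not> int r dvd g" using r(4) by (auto simp: g)
  have "prime (int r)" using r(1) by simp
  hence "coprime (int r) g" using ng by (rule prime_imp_coprime)
  then obtain p q where pq: "p * int r + q * g = 1" using bezout_int[of "int r" g] by auto
  have "of_int p * (of_nat r * of_nat r) + of_int q * of_int (int r * g) \<in> ?Q"
    using 1 4 aQ by (rule addsub_comb[rotated])
  moreover have "of_int p * (of_nat r * of_nat r) + of_int q * of_int (int r * g) = (of_int (int r * (p * int r + q * g)) :: complex)"
    by (simp add: algebra_simps)
  ultimately have rQ: "of_nat r \<in> ?Q" by (simp add: pq)
  show "scl (of_nat r) Ok \<subseteq> ?Q"
  proof
    fix z assume "z \<in> scl (of_nat r) Ok"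
    then obtain a where a: "a \<in> Ok" "z = a * of_nat r" by (auto simp: mult.commute)
    show "z \<in> ?Q" unfolding a(2) by (rule frac_ideal_Ok[OF fiQ a(1) rQ])
  qed
qed

lemma principal_nat: "principal_ideal d (of_nat r) = scl (of_nat r) Ok"
  by (simp add: principal_ideal_def)

lemma ramified_if: assumes r: "prime r" "int r dvd disc" shows "ramified d r"
proof -
  have r0: "r > 0" using r(1) prime_gt_0_nat by blast
  obtain c where c: "int r dvd 2 * c - theta_trace" "int r dvd theta_poly c" "\<not> int r * int r dvd theta_poly c"
    using double_root[OF r] .
  have "ideal_mult (ideal_mult (root_ideal r c) (root_ideal r c)) Ok = scl (of_nat r) Ok"
    unfolding root_ideal_square[OF r(1) c] ideal_mult_scale ideal_mult_Ok[OF frac_ideal_OkF] ..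
  moreover have "ideal Ok (ring_of_ints_ring d)" unfolding ideal_iff using addsub_Ok Ok_mult by blast
  ultimately show ?thesis unfolding ramified_def principal_nat using r(1) root_ideal_prime[OF r(1) c(2)] by metis
qed

lemma prime_overD:
  assumes "prime_ideal_over d r P"
  shows "P \<subseteq> Ok" "addsub P" "\<And>a x. a \<in> Ok \<Longrightarrow> x \<in> P \<Longrightarrow> a * x \<in> P" "1 \<notin> P"
    "\<And>a b. a \<in> Ok \<Longrightarrow> b \<in> Ok \<Longrightarrow> a * b \<in> P \<Longrightarrow> a \<in> P \<or> b \<in> P"
    "\<And>k. of_int k \<in> P \<longleftrightarrow> int r dvd k"
proof -
  have p: "primeideal P (ring_of_ints_ring d)" and Z: "P \<inter> \<int> = {of_int (int r * k) | k. True}"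
    using assms by (auto simp: prime_ideal_over_def)
  have i: "ideal P (ring_of_ints_ring d)" using p by (rule primeideal.axioms(1))
  show P: "P \<subseteq> Ok" "addsub P" "\<And>a x. a \<in> Ok \<Longrightarrow> x \<in> P \<Longrightarrow> a * x \<in> P"
    using i unfolding ideal_iff by blast+
  show "1 \<notin> P"
  proof
    assume 1: "1 \<in> P"
    have "Ok \<subseteq> P" using P(3)[OF _ 1] by auto
    hence "carrier (ring_of_ints_ring d) = P" using P(1) by auto
    thus False using primeideal.I_notcarr[OF p] by blast
  qed
  show "a \<in> P \<or> b \<in> P" if "a \<in> Ok" "b \<in> Ok" "a * b \<in> P" for a b
    using primeideal.I_prime[OF p, of a b] that by simp
  show "of_int k \<in> P \<longleftrightarrow> int r dvd k" for k
  proof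
    assume "of_int k \<in> P"
    hence "(of_int k :: complex) \<in> {of_int (int r * k) | k. True}" unfolding Z[symmetric] by simp
    then obtain j where "(of_int k :: complex) = of_int (int r * j)" by blast
    hence "k = int r * j" by (simp only: of_int_eq_iff)
    thus "int r dvd k" by simp
  next
    assume "int r dvd k"
    then obtain j where "k = int r * j" by blast
    hence "(of_int k :: complex) \<in> P \<inter> \<int>" unfolding Z by blast
    thus "of_int k \<in> P" by blast
  qed
qed

text \<open>The element u = theta - c has its square in P, hence lies in P by primality. Modulo u
  every integer of the field is rational, so P is determined by the rational integers it
  contains.\<close>

lemma prime_over_unique:
  assumes P: "prime_ideal_over d r P" and c: "int r dvd 2 * c - theta_trace" "int r dvd theta_poly c"
  shows "P = root_ideal r c"
proof -
  note D = prime_overD[OF P]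
  let ?u = "theta - of_int c"
  have uOk: "?u \<in> Ok" by (intro Ok_diff) auto
  have rP: "of_nat r \<in> P" using D(6)[of "int r"] by simp
  have "int r dvd theta_trace - 2 * c" using c(1) by (metis dvd_minus_iff minus_diff_eq)
  hence "of_int (theta_trace - 2 * c) \<in> P" using D(6) by blast
  hence "?u * of_int (theta_trace - 2 * c) \<in> P" using D(3) uOk by blast
  hence 1: "of_int (theta_trace - 2 * c) * ?u \<in> P" by (simp only: mult.commute)
  have 2: "of_int (theta_poly c) \<in> P" using c(2) D(6) by blast
  have "?u * ?u \<in> P" unfolding theta_c_sq using addsub_diff[OF D(2) 1 2] .
  hence uP: "?u \<in> P" using D(5)[OF uOk uOk] by blast
  show ?thesis
  proof
    show "root_ideal r c \<subseteq> P"
    proof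
      fix z assume "z \<in> root_ideal r c"
      then obtain y k where z: "z = of_int y * ?u + of_nat r * of_int k" by (rule root_ideal_elem)
      have "of_int y * ?u + of_int k * of_nat r \<in> P" using addsub_comb[OF D(2) uP rP] .
      thus "z \<in> P" unfolding z by (simp add: mult.commute)
    qed
    show "P \<subseteq> root_ideal r c"
    proof
      fix z assume z: "z \<in> P"
      then obtain x y where xy: "z = of_int x + of_int y * theta" using D(1) by (meson OkE subsetD)
      have "z - of_int y * ?u \<in> P" using addsub_diff[OF D(2) z addsub_of_int[OF D(2) uP]] .
      moreover have "z - of_int y * ?u = of_int (x + c * y)" unfolding xy by (simp add: algebra_simps)
      ultimately have "of_int (x + c * y) \<in> P" by (simp only:)
      hence "int r dvd x + c * y" using D(6) by blast
      thus "z \<in> root_ideal r c" unfolding xy by (rule PrI)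
    qed
  qed
qed

text \<open>From (r) = P P A the ideal B = P A contains some x outside (r) with x^2 in (r). A
  nonzero nilpotent modulo r forces r to divide the discriminant.\<close>

lemma ramified_only_if: assumes "ramified d r" shows "prime r" "int r dvd disc"
proof -
  show r: "prime r" using assms by (simp add: ramified_def)
  have r0: "r > 0" using r prime_gt_0_nat by blast
  obtain P A where P: "prime_ideal_over d r P" and A: "ideal A (ring_of_ints_ring d)"
    and eq: "scl (of_nat r) Ok = ideal_mult (ideal_mult P P) A"
    using assms by (auto simp: ramified_def principal_nat)
  note D = prime_overD[OF P]
  have A': "A \<subseteq> Ok" "addsub A" using A unfolding ideal_iff by blast+
  define B where "B = ideal_mult P A"
  have eqB: "scl (of_nat r) Ok = ideal_mult P B" unfolding eq B_def ideal_mult_assoc ..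
  have BP: "B \<subseteq> P" unfolding B_def
  proof (rule ideal_mult_least[OF D(2)])
    fix a b assume "a \<in> P" "b \<in> A"
    thus "a * b \<in> P" using D(3)[of b a] A'(1) by (auto simp: mult.commute)
  qed
  have PB: "ideal_mult P B \<subseteq> B"
  proof (rule ideal_mult_least)
    show "addsub B" unfolding B_def by (rule ideal_mult_addsub)
    fix a b assume a: "a \<in> P" and b: "b \<in> B"
    have "B \<subseteq> {b. a * b \<in> B}" unfolding B_def
    proof (rule ideal_mult_least)
      fix x y assume x: "x \<in> P" "y \<in> A"
      have "a * x \<in> P" using D(1,3) a x by blast
      hence "(a * x) * y \<in> ideal_mult P A" using x by (intro ideal_multI)
      thus "x * y \<in> {b. a * b \<in> ideal_mult P A}" by (simp add: mult.assoc)
    qed (intro addsub_vimage_mult ideal_mult_addsub)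
    thus "a * b \<in> B" using b by blast
  qed
  \<comment> \<open>Otherwise B = (r), and cancelling r in (r) = P B would give O_F = P O_F inside
    P.\<close>
  have "\<not> B \<subseteq> scl (of_nat r) Ok"
  proof
    assume "B \<subseteq> scl (of_nat r) Ok"
    hence "B = scl (of_nat r) Ok" using PB eqB by blast
    hence "scl (of_nat r) Ok = scl (of_nat r) (ideal_mult P Ok)"
      using eqB ideal_mult_scale ideal_mult_comm by metis
    hence "Ok = ideal_mult P Ok" by (rule scale_inj[rotated]) (use r0 in simp)
    also have "\<dots> \<subseteq> P"
    proof (rule ideal_mult_least[OF D(2)])
      fix a b assume "a \<in> P" "b \<in> Ok"
      thus "a * b \<in> P" using D(3)[of b a] by (simp add: mult.commute)
    qed
    finally show False using D(4) Ok_1 by blast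
  qed
  then obtain x where x: "x \<in> B" "x \<notin> scl (of_nat r) Ok" by blast
  obtain a b where ab: "x = of_int a + of_int b * theta" using x(1) BP D(1) by (meson OkE subsetD)
  have "x * x \<in> ideal_mult B B" using x(1) by (intro ideal_multI)
  also have "ideal_mult B B = ideal_mult (ideal_mult P B) A"
    unfolding B_def by (metis ideal_mult_assoc ideal_mult_comm)
  also have "\<dots> = scl (of_nat r) (ideal_mult Ok A)" unfolding eqB[symmetric] ideal_mult_scale ..
  also have "\<dots> \<subseteq> scl (of_nat r) Ok"
    using A'(1) by (intro scale_mono ideal_mult_least addsub_Ok Ok_mult) auto
  finally have "int r dvd a * a - b * b * theta_norm" "int r dvd a * b + b * a + b * b * theta_trace"
    unfolding ab theta_mult in_scl_Ok[OF r0] by blast+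
  moreover have "a * b + b * a + b * b * theta_trace = b * (2 * a + b * theta_trace)" by (simp add: algebra_simps)
  ultimately have h: "int r dvd a * a - b * b * theta_norm" "int r dvd b * (2 * a + b * theta_trace)" by simp_all
  have pr: "prime (int r)" using r by simp
  \<comment> \<open>If r divided b, it would divide a^2, hence a, and x would lie in (r).\<close>
  have nb: "\<not> int r dvd b"
  proof
    assume b: "int r dvd b"
    hence "int r dvd b * b * theta_norm" by simp
    hence "int r dvd a * a" using h(1) dvd_diff_left_iff by blast
    hence "int r dvd a" using pr by (simp add: prime_dvd_mult_iff)
    thus False using b x(2) unfolding ab in_scl_Ok[OF r0] by blast
  qed
  have h3: "int r dvd 2 * a + b * theta_trace" using h(2) nb pr by (simp add: prime_dvd_mult_iff)
  \<comment> \<open>The discriminant times b^2 written through the two coordinates of x^2, both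
    divisible by r.\<close>
  have "disc * (b * b) = (2 * a + b * theta_trace) * (b * theta_trace - 2 * a) + 4 * (a * a - b * b * theta_norm)"
    by (simp add: disc_def algebra_simps)
  also have "int r dvd \<dots>" using dvd_add[OF dvd_mult2[OF h3] dvd_mult[OF h(1)]] .
  finally show "int r dvd disc" using nb pr by (simp add: prime_dvd_mult_iff)
qed

lemma ramified_iff: "ramified d r \<longleftrightarrow> prime r \<and> int r dvd disc"
  using ramified_if ramified_only_if by blast

lemma ramified_set: "{r. ramified d r} = (if d mod 4 = 3 then insert 2 primes_d else primes_d)"
proof -
  have primes_d: "r \<in> primes_d \<longleftrightarrow> prime r \<and> int r dvd d" for r by (simp add: primes_d_def)
  have "int r dvd disc \<longleftrightarrow> int r dvd d \<or> (d mod 4 = 3 \<and> r = 2)" if r: "prime r" for r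
  proof (cases "d mod 4 = 1")
    case True thus ?thesis by (simp add: disc_eq)
  next
    case False
    have pr: "prime (int r)" using r by simp
    have "disc = 2 * (2 * d)" using False by (simp add: disc_eq)
    hence "int r dvd disc \<longleftrightarrow> int r dvd 2 \<or> int r dvd d"
      by (simp only: prime_dvd_mult_iff[OF pr]) blast
    also have "int r dvd 2 \<longleftrightarrow> r = 2"
    proof
      assume "int r dvd 2"
      hence "int r dvd int 2" by simp
      hence "r dvd 2" by (simp only: int_dvd_int_iff)
      thus "r = 2" using r primes_dvd_imp_eq two_is_prime_nat by blast
    qed simp
    finally have *: "int r dvd disc \<longleftrightarrow> r = 2 \<or> int r dvd d" .
    have "int 2 dvd d" if "d mod 4 \<noteq> 3"
    proof -
      have "d mod 4 = 2" using that False d_mod4 by blast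
      thus ?thesis by presburger
    qed
    thus ?thesis using * by blast
  qed
  moreover have "even disc" if "d mod 4 = 3" using that by (simp add: disc_eq)
  ultimately show ?thesis by (auto simp: ramified_iff primes_d)
qed

lemma ram_prod_eq:
  "ram_prod d s = (if d mod 4 = 3 then 1 + neg_pow s 2 else 1) * (\<Prod>p\<in>primes_d. 1 + neg_pow s p)"
proof -
  have "2 \<notin> primes_d" if "d mod 4 = 3"
  proof -
    have "odd d" using that by presburger
    thus ?thesis by (simp add: primes_d_def)
  qed
  thus ?thesis using finite_primes_d unfolding ram_prod_def ramified_set by (simp add: neg_pow_def)
qed

text \<open>By Cayley-Hamilton an element that stabilises a lattice is integral. The equation for
  norm 1, multiplied by 4, is a sum of a square and -disc y^2; here d different from -1 and -3 gives
  disc < -4, so y = 0.\<close>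

lemma units:
  assumes d: "d \<noteq> -1" "d \<noteq> -3" and u: "u \<in> U1" and J: "frac_ideal J" "scl u J \<subseteq> J"
  shows "u = 1 \<or> u = - 1"
proof -
  obtain a b where ab: "J = lat a b" "area a b \<noteq> 0" using frac_ideal_lat[OF J(1)] by (auto simp: is_lat_def)
  have "u * a \<in> J" "u * b \<in> J" using J(2) lat_gen unfolding ab(1) by blast+
  then obtain p q p' q' where e: "u * a = of_int p * a + of_int q * b" "u * b = of_int p' * a + of_int q' * b"
    unfolding ab(1) by (meson latE)
  have nz: "a \<noteq> 0" "b \<noteq> 0" using ab(2) by (auto simp: area_def)
  have e': "(u - of_int p) * a = of_int q * b" "(u - of_int q') * b = of_int p' * a"
    using e by (simp_all add: left_diff_distrib)
  have "((u - of_int p) * (u - of_int q') - of_int (q * p')) * (a * b)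
      = ((u - of_int p) * a) * ((u - of_int q') * b) - of_int (q * p') * (a * b)" by (simp add: algebra_simps)
  also have "\<dots> = 0" unfolding e' by (simp add: algebra_simps)
  finally have "(u - of_int p) * (u - of_int q') - of_int (q * p') = 0" using nz by simp
  hence "poly [:of_int (p * q' - q * p'), - of_int (p + q'), 1:] u = 0" by (simp add: algebra_simps)
  moreover have "\<forall>i. coeff [:of_int (p * q' - q * p'), - of_int (p + q'), 1 :: complex:] i \<in> \<int>"
    by (auto simp: coeff_pCons split: nat.split)
  ultimately have "algebraic_int u"
    by (intro algebraic_int.intros[of "[:of_int (p * q' - q * p'), - of_int (p + q'), 1:]"]) auto
  hence "u \<in> Ok" using U1_F[OF u] by (simp add: ring_of_ints_def)
  then obtain x y where xy: "u = of_int x + of_int y * theta" by (rule OkE)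
  have cu: "cnj u = of_int (x + y * theta_trace) + of_int (- y) * theta" by (simp add: xy cnj_theta algebra_simps)
  have "u * cnj u = of_int (x * (x + y * theta_trace) - y * (- y) * theta_norm) + of_int (x * (- y) + y * (x + y * theta_trace) + y * (- y) * theta_trace) * theta"
    unfolding cu unfolding xy by (rule theta_mult)
  hence "of_int (x * (x + y * theta_trace) - y * (- y) * theta_norm) + of_int (x * (- y) + y * (x + y * theta_trace) + y * (- y) * theta_trace) * theta = of_int 1 + of_int 0 * theta"
    using U1_cnj[OF u] by simp
  hence n1: "x * (x + y * theta_trace) - y * (- y) * theta_norm = 1" using coord_theta by blast
  have eq4: "(2 * x + y * theta_trace) * (2 * x + y * theta_trace) - disc * (y * y) = 4"
    using n1 by (simp add: disc_def algebra_simps)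
  have "disc < - 4"
  proof (cases "d mod 4 = 1")
    case True
    hence "d \<le> - 5" using d_neg d by presburger
    thus ?thesis using True by (simp add: disc_eq)
  next
    case False thus ?thesis using d_neg d by (simp add: disc_eq)
  qed
  have y0: "y = 0"
  proof (rule ccontr)
    assume "y \<noteq> 0"
    hence "0 < y * y" by (simp add: zero_less_mult_iff, linarith)
    hence "1 \<le> y * y" by simp
    have "5 * 1 \<le> (- disc) * (y * y)" using \<open>disc < - 4\<close> \<open>1 \<le> y * y\<close> by (intro mult_mono) auto
    moreover have "0 \<le> (2 * x + y * theta_trace) * (2 * x + y * theta_trace)" by simp
    ultimately show False using eq4 by simp
  qed
  hence "x * x = 1" using n1 by simp
  hence "x = 1 \<or> x = - 1" using zmult_eq_1_iff by auto
  thus ?thesis using xy y0 by auto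
qed

text \<open>Conjugation replaces the root c by trace - c, which is congruent to c for a double
  root.\<close>

lemma cnj_root_ideal: assumes "int r dvd 2 * c - theta_trace" shows "cnj ` root_ideal r c = root_ideal r c"
proof -
  have *: "cnj z \<in> root_ideal r c" if z: "z \<in> root_ideal r c" for z
  proof -
    obtain x y where xy: "z = of_int x + of_int y * theta" "int r dvd x + c * y" using z by (auto simp: root_ideal_def)
    have "cnj z = of_int (x + y * theta_trace) + of_int (- y) * theta" by (simp add: xy cnj_theta algebra_simps)
    moreover have "int r dvd (x + y * theta_trace) + c * (- y)"
    proof -
      have e: "(x + y * theta_trace) + c * (- y) = (x + c * y) - y * (2 * c - theta_trace)" by (simp add: algebra_simps)
      show ?thesis unfolding e by (rule dvd_diff[OF xy(2) dvd_mult[OF assms]])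
    qed
    ultimately show ?thesis using PrI by metis
  qed
  show ?thesis
  proof (intro equalityI subsetI)
    fix z assume "z \<in> root_ideal r c"
    hence "cnj z \<in> root_ideal r c" by (rule *)
    thus "z \<in> cnj ` root_ideal r c" by (intro image_eqI[of _ _ "cnj z"]) simp_all
  qed (use * in blast)
qed

text \<open>The minimal polynomial of \<open>theta\<close> is Eisenstein at \<open>r\<close> after the shift by \<open>c\<close>, so that the
  prime \<open>root_ideal r c\<close> squares to \<open>(r)\<close>.\<close>
definition ram_root :: "nat \<Rightarrow> int \<Rightarrow> bool" where
  "ram_root r c \<longleftrightarrow> prime r \<and> int r dvd 2 * c - theta_trace \<and> int r dvd theta_poly c \<and> \<not> int r * int r dvd theta_poly c"

lemma ram_root_frac_ideal: "ram_root r c \<Longrightarrow> frac_ideal (root_ideal r c)"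
  using frac_ideal_root_ideal prime_gt_0_nat by (auto simp: ram_root_def)

lemma ram_root_square: "ram_root r c \<Longrightarrow> ideal_mult (root_ideal r c) (root_ideal r c) = scl (of_nat r) Ok"
  unfolding ram_root_def using root_ideal_square by blast

lemma ram_root_prime_over: "ram_root r c \<Longrightarrow> prime_ideal_over d r (root_ideal r c)"
  unfolding ram_root_def using root_ideal_prime by blast

lemma ram_root_ramified: assumes "ram_root r c" shows "ramified d r"
proof -
  have "int r dvd (2 * c - theta_trace) * (2 * c - theta_trace) - 4 * theta_poly c"
    using assms unfolding ram_root_def by (intro dvd_diff[OF dvd_mult2 dvd_mult]) blast+
  thus ?thesis using assms by (simp add: ramified_iff theta_poly_disc[of c] ram_root_def)
qed

lemma ramified_prime_form:
  assumes "ramified d r" "prime_ideal_over d r P" obtains c where "ram_root r c" "P = root_ideal r c"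
proof -
  have r: "prime r" "int r dvd disc" using ramified_only_if[OF assms(1)] by blast+
  obtain c where c: "int r dvd 2 * c - theta_trace" "int r dvd theta_poly c" "\<not> int r * int r dvd theta_poly c"
    using double_root[OF r] .
  thus ?thesis using that[of c] prime_over_unique[OF assms(2) c(1,2)] r(1) by (simp add: ram_root_def)
qed

section \<open>Classes generated by ramified primes and ambiguous classes\<close>

abbreviation CG where "CG \<equiv> class_group d"

text \<open>The ideal squares to the principal ideal (r), so its class is its own inverse; the
  associative law makes the inverse unique.\<close>

lemma class_inv:
  assumes "ram_root r c" shows "inv\<^bsub>CG\<^esub> (ideal_class d (root_ideal r c)) = ideal_class d (root_ideal r c)"
proof -
  let ?x = "ideal_class d (root_ideal r c)"
  interpret G: comm_monoid CG by (rule comm_monoid_class_group)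
  have f: "frac_ideal (root_ideal r c)" by (rule ram_root_frac_ideal[OF assms])
  have x: "?x \<in> carrier CG" using f carrier_class_group by blast
  have r0: "of_nat r \<noteq> (0::complex)" using assms prime_gt_0_nat by (auto simp: ram_root_def)
  have xx: "?x \<otimes>\<^bsub>CG\<^esub> ?x = \<one>\<^bsub>CG\<^esub>"
    unfolding mult_class_group[OF f f] ram_root_square[OF assms] one_class_group
    using ideal_class_scale[OF frac_ideal_OkF F_of_nat r0] .
  show ?thesis
    unfolding m_inv_def
  proof (rule the_equality)
    fix y assume "y \<in> carrier CG \<and> ?x \<otimes>\<^bsub>CG\<^esub> y = \<one>\<^bsub>CG\<^esub> \<and> y \<otimes>\<^bsub>CG\<^esub> ?x = \<one>\<^bsub>CG\<^esub>"
    hence y: "y \<in> carrier CG" "?x \<otimes>\<^bsub>CG\<^esub> y = \<one>\<^bsub>CG\<^esub>" by blast+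
    have "y = (?x \<otimes>\<^bsub>CG\<^esub> ?x) \<otimes>\<^bsub>CG\<^esub> y" unfolding xx using y(1) by simp
    also have "\<dots> = ?x \<otimes>\<^bsub>CG\<^esub> (?x \<otimes>\<^bsub>CG\<^esub> y)" by (rule G.m_assoc[OF x x y(1)])
    also have "\<dots> = ?x" unfolding y(2) using x by simp
    finally show "y = ?x" .
  qed (use x xx in blast)
qed

text \<open>P is a property of one representative of each class and need not be invariant under
  scaling; this is essential for \<open>real_closed\<close>. Inverses cause no trouble because the
  generators are their own inverses.\<close>

lemma generate_subset:
  assumes gens: "\<And>g. g \<in> G \<Longrightarrow> \<exists>r c. g = ideal_class d (root_ideal r c) \<and> ram_root r c \<and> P (root_ideal r c)"
    and one: "P Ok" and mult: "\<And>A B. frac_ideal A \<Longrightarrow> frac_ideal B \<Longrightarrow> P A \<Longrightarrow> P B \<Longrightarrow> P (ideal_mult A B)"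
    and x: "x \<in> generate CG G"
  shows "\<exists>J. x = ideal_class d J \<and> frac_ideal J \<and> P J"
  using x
proof induction
  case one
  thus ?case using one_class_group frac_ideal_OkF \<open>P Ok\<close> by blast
next
  case (incl h)
  thus ?case using gens ram_root_frac_ideal by blast
next
  case (inv h)
  then obtain r c where rc: "h = ideal_class d (root_ideal r c)" "ram_root r c" "P (root_ideal r c)" using gens by blast
  have "inv\<^bsub>CG\<^esub> h = ideal_class d (root_ideal r c)" unfolding rc(1) by (rule class_inv[OF rc(2)])
  thus ?case using rc ram_root_frac_ideal by blast
next
  case (eng h1 h2)
  then obtain A B where AB: "h1 = ideal_class d A" "frac_ideal A" "P A" "h2 = ideal_class d B" "frac_ideal B" "P B" by blast
  have "h1 \<otimes>\<^bsub>CG\<^esub> h2 = ideal_class d (ideal_mult A B)" unfolding AB(1,4) by (rule mult_class_group[OF AB(2,5)])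
  thus ?case using frac_ideal_ideal_mult[OF AB(2,5)] mult[OF AB(2,5,3,6)] by blast
qed

definition ambiguous :: "complex set \<Rightarrow> bool" where "ambiguous J \<longleftrightarrow> (\<exists>a\<in>F. a \<noteq> 0 \<and> cnj ` J = scl a J)"

lemma ambiguous_iff: "frac_ideal J \<Longrightarrow> ambiguous J \<longleftrightarrow> ideal_class d J = ideal_class d (cnj ` J)"
  unfolding ambiguous_def by (rule ideal_class_eq_iff[symmetric]) (auto intro: frac_ideal_cnj)

lemma ambiguous_mult: assumes "ambiguous A" "ambiguous B" shows "ambiguous (ideal_mult A B)"
proof -
  obtain a b where a: "a \<in> F" "a \<noteq> 0" "cnj ` A = scl a A" and b: "b \<in> F" "b \<noteq> 0" "cnj ` B = scl b B"
    using assms by (auto simp: ambiguous_def)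
  have "cnj ` ideal_mult A B = scl (a * b) (ideal_mult A B)"
    unfolding ideal_mult_cnj a(3) b(3) by (rule ideal_mult_scale2)
  moreover have "a * b \<in> F" "a * b \<noteq> 0" using a b by auto
  ultimately show ?thesis unfolding ambiguous_def by blast
qed

lemma ambiguous_cnj: "cnj ` J = J \<Longrightarrow> ambiguous J"
  unfolding ambiguous_def by (intro bexI[of _ 1]) auto

lemma cnj_Ok: "cnj ` Ok = Ok"
proof (intro equalityI subsetI)
  fix z assume "z \<in> Ok"
  thus "z \<in> cnj ` Ok" by (intro image_eqI[of _ _ "cnj z"]) (simp_all add: Ok_cnj)
qed (auto intro: Ok_cnj)

lemma generate_ambiguous:
  assumes "G \<subseteq> {ideal_class d \<pp> | \<pp> r. ramified d r \<and> prime_ideal_over d r \<pp>}" "x \<in> generate CG G"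
  obtains J where "x = ideal_class d J" "frac_ideal J" "ambiguous J"
proof -
  have "\<exists>J. x = ideal_class d J \<and> frac_ideal J \<and> ambiguous J"
  proof (rule generate_subset[OF _ _ _ assms(2)])
    fix g assume "g \<in> G"
    then obtain P r where P: "g = ideal_class d P" "ramified d r" "prime_ideal_over d r P" using assms(1) by blast
    obtain c where "ram_root r c" "P = root_ideal r c" using ramified_prime_form[OF P(2,3)] .
    moreover from this have "ambiguous (root_ideal r c)" by (intro ambiguous_cnj cnj_root_ideal) (simp add: ram_root_def)
    ultimately show "\<exists>r c. g = ideal_class d (root_ideal r c) \<and> ram_root r c \<and> ambiguous (root_ideal r c)" using P(1) by blast
  qed (auto intro: ambiguous_mult ambiguous_cnj[OF cnj_Ok])
  thus ?thesis using that by blast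
qed

text \<open>Comparing covolumes shows that the factor between J and its conjugate has absolute value
  1, so Hilbert 90 applies.\<close>

lemma ambiguous_straight:
  assumes J: "frac_ideal J" "ambiguous J"
  obtains a J' where "a \<in> F" "a \<noteq> 0" "frac_ideal J'" "cnj ` J' = J'" "J = scl a J'"
proof -
  obtain b where b: "b \<in> F" "b \<noteq> 0" "cnj ` J = scl b J" using J(2) by (auto simp: ambiguous_def)
  have "covol J = (cmod b)\<^sup>2 * covol J"
    using covol_cnj[OF frac_ideal_lat[OF J(1)]] covol_mult[OF frac_ideal_lat[OF J(1)], of b] b(3) by simp
  hence "(cmod b)\<^sup>2 = 1" using covol_pos[OF frac_ideal_lat[OF J(1)]] by simp
  hence "cmod b = 1" by (simp add: power2_eq_1_iff) (use norm_ge_zero[of b] in linarith)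
  hence u: "inverse b \<in> U1" using b(1) by (intro U1I) (auto simp: norm_inverse)
  obtain a where a: "a \<in> F" "a \<noteq> 0" "inverse b * cnj a = a" using hilbert90[OF u] .
  have "scl (inverse b) (cnj ` J) = J" unfolding b(3) scale_scale using b(2) by simp
  hence c: "cnj ` scl (inverse a) J = scl (inverse a) J" by (rule reflective_straighten[OF a(3,2)])
  have "J = scl a (scl (inverse a) J)" unfolding scale_scale using a(2) by simp
  moreover have "frac_ideal (scl (inverse a) J)" using a J by (intro frac_ideal_scale) auto
  ultimately show ?thesis using that[OF a(1,2) _ c] by blast
qed

lemma frac_ideal_scale_iff: "a \<in> F \<Longrightarrow> a \<noteq> 0 \<Longrightarrow> frac_ideal (scl a J) \<longleftrightarrow> frac_ideal J"
proof
  assume a: "a \<in> F" "a \<noteq> 0" and J: "frac_ideal (scl a J)"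
  have e: "scl (inverse a) (scl a J) = J" unfolding scale_scale using a by simp
  have "frac_ideal (scl (inverse a) (scl a J))" using a by (intro frac_ideal_scale[OF J]) auto
  thus "frac_ideal J" unfolding e .
qed (rule frac_ideal_scale)

lemma ambiguous_types:
  assumes J: "frac_ideal J" "ambiguous J"
  obtains a m where "a \<in> F" "a \<noteq> 0" "m > 0" "m dvd d"
    "J = scl a (rect m) \<and> frac_ideal (rect m) \<and> d mod 4 \<noteq> 1 \<or> J = scl a (cent m) \<and> frac_ideal (cent m) \<and> d mod 4 \<noteq> 2"
proof -
  obtain a J' where a: "a \<in> F" "a \<noteq> 0" "frac_ideal J'" "cnj ` J' = J'" "J = scl a J'" using ambiguous_straight[OF J] .
  obtain b m where b: "b \<in> F" "b \<noteq> 0" "m > 0" "m dvd d" and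
    c: "J' = scl b (rect m) \<and> d mod 4 \<noteq> 1 \<or> J' = scl b (cent m) \<and> d mod 4 \<noteq> 2"
    using conj_stable_ideal[OF a(3,4)] by metis
  have ab: "a * b \<in> F" "a * b \<noteq> 0" using a b by auto
  have "J = scl (a * b) (rect m) \<and> frac_ideal (rect m) \<and> d mod 4 \<noteq> 1 \<or> J = scl (a * b) (cent m) \<and> frac_ideal (cent m) \<and> d mod 4 \<noteq> 2"
    using c
  proof
    assume "J' = scl b (rect m) \<and> d mod 4 \<noteq> 1"
    thus ?thesis using a(3,5) frac_ideal_scale_iff[OF b(1,2)] scale_scale by metis
  next
    assume "J' = scl b (cent m) \<and> d mod 4 \<noteq> 2"
    thus ?thesis using a(3,5) frac_ideal_scale_iff[OF b(1,2)] scale_scale by metis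
  qed
  thus ?thesis using that[OF ab b(3,4)] by blast
qed

text \<open>Coprime integers a in A and b in B give x = p a x + q b x, where each summand is a
  product once x lies in both ideals.\<close>

lemma coprime_ideal_mult:
  assumes A: "frac_ideal A" "A \<subseteq> Ok" "of_int a \<in> A" and B: "frac_ideal B" "B \<subseteq> Ok" "of_int b \<in> B" and ab: "coprime a b"
  shows "ideal_mult A B = A \<inter> B"
proof
  show "ideal_mult A B \<subseteq> A \<inter> B"
  proof (rule ideal_mult_least)
    show "addsub (A \<inter> B)" using frac_ideal_addsub[OF A(1)] frac_ideal_addsub[OF B(1)] by (auto simp: addsub_def)
    fix x y assume x: "x \<in> A" and y: "y \<in> B"
    have "y * x \<in> A" using frac_ideal_Ok[OF A(1) _ x] y B(2) by blast
    moreover have "x * y \<in> B" using frac_ideal_Ok[OF B(1) _ y] x A(2) by blast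
    ultimately show "x * y \<in> A \<inter> B" by (simp add: mult.commute)
  qed
  show "A \<inter> B \<subseteq> ideal_mult A B"
  proof
    fix x assume x: "x \<in> A \<inter> B"
    obtain p q where pq: "p * a + q * b = 1" using bezout_int[of a b] ab by auto
    have 1: "of_int a * x \<in> ideal_mult A B" using x A(3) by (intro ideal_multI) auto
    have "x * of_int b \<in> ideal_mult A B" using x B(3) by (intro ideal_multI) auto
    hence 2: "of_int b * x \<in> ideal_mult A B" by (simp only: mult.commute)
    have "of_int p * (of_int a * x) + of_int q * (of_int b * x) \<in> ideal_mult A B"
      by (rule addsub_comb[OF ideal_mult_addsub 1 2])
    moreover have "of_int p * (of_int a * x) + of_int q * (of_int b * x) = of_int (p * a + q * b) * x"
      by (simp add: algebra_simps)
    ultimately show "x \<in> ideal_mult A B" by (simp add: pq)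
  qed
qed

text \<open>For \<open>m\<close> dividing \<open>d\<close> this is the product of the ramified primes over the prime factors of \<open>m\<close>.\<close>
definition ram_ideal :: "nat \<Rightarrow> complex set" where
  "ram_ideal m = {of_int x + of_int y * theta | x y. int m dvd (1 + theta_trace) * x + theta_trace * y}"

lemma in_ram_ideal: "of_int x + of_int y * theta \<in> ram_ideal m \<longleftrightarrow> int m dvd (1 + theta_trace) * x + theta_trace * y"
proof
  assume "of_int x + of_int y * theta \<in> ram_ideal m"
  then obtain x' y' where "of_int x + of_int y * theta = of_int x' + of_int y' * theta"
    "int m dvd (1 + theta_trace) * x' + theta_trace * y'" by (auto simp: ram_ideal_def)
  thus "int m dvd (1 + theta_trace) * x + theta_trace * y" using coord_theta by metis
qed (auto simp: ram_ideal_def)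

lemma ram_ideal_Ok: "ram_ideal m \<subseteq> Ok"
  using OkI by (auto simp: ram_ideal_def)

lemma Ok_set_eq:
  assumes "A \<subseteq> Ok" "B \<subseteq> Ok" "\<And>x y. of_int x + of_int y * theta \<in> A \<longleftrightarrow> of_int x + of_int y * theta \<in> B"
  shows "A = B"
proof -
  have "z \<in> A \<longleftrightarrow> z \<in> B" if z: "z \<in> Ok" for z
  proof -
    obtain x y where "z = of_int x + of_int y * theta" using z by (rule OkE)
    thus ?thesis using assms(3) by simp
  qed
  thus ?thesis using assms(1,2) by blast
qed

lemma ram_ideal_1: "ram_ideal 1 = Ok"
  by (rule Ok_set_eq[OF ram_ideal_Ok order_refl]) (auto simp: in_ram_ideal OkI)

lemma ram_ideal_mult: assumes "coprime p q" shows "ram_ideal (p * q) = ram_ideal p \<inter> ram_ideal q"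
proof (rule Ok_set_eq[OF ram_ideal_Ok])
  show "ram_ideal p \<inter> ram_ideal q \<subseteq> Ok" using ram_ideal_Ok by blast
  fix x y
  have "coprime (int p) (int q)" using assms by simp
  hence "int p * int q dvd k \<longleftrightarrow> int p dvd k \<and> int q dvd k" for k
    by (auto intro: divides_mult dvd_mult_left dvd_mult_right)
  thus "of_int x + of_int y * theta \<in> ram_ideal (p * q) \<longleftrightarrow> of_int x + of_int y * theta \<in> ram_ideal p \<inter> ram_ideal q"
    by (simp add: in_ram_ideal)
qed

lemma nat_in_ram_ideal: "of_int (int m) \<in> ram_ideal m"
  using in_ram_ideal[of "int m" 0 m] by simp

text \<open>The linear forms (1 + trace) x + trace y and x + c y are proportional modulo p, with
  unit factor 1 + trace.\<close>

lemma ram_ideal_prime: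
  assumes c: "ram_root p c" and p: "int p dvd d" shows "ram_ideal p = root_ideal p c"
proof (rule Ok_set_eq[OF ram_ideal_Ok root_ideal_Ok])
  fix x y
  have pr: "prime (int p)" using c by (simp add: ram_root_def)
  have 1: "int p dvd (1 + theta_trace) * c - theta_trace \<and> \<not> int p dvd 1 + theta_trace"
  proof (cases "d mod 4 = 1")
    case True
    hence "theta_trace = 1" by (simp add: theta_trace_def)
    moreover have "odd d" using True by presburger
    hence "\<not> int p dvd 2"
      using pr p primes_dvd_imp_eq[of "int p" 2] by (metis dvd_trans two_is_prime_nat int_dvd_int_iff of_nat_numeral primes_dvd_imp_eq c ram_root_def)
    ultimately show ?thesis using c by (simp add: ram_root_def)
  next
    case False
    hence t: "theta_trace = 0" "theta_norm = - d" by (simp_all add: theta_trace_def theta_norm_def)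
    have "int p dvd c * c - d" using c by (simp add: ram_root_def theta_poly_def t)
    hence "int p dvd (c * c - d) + d" using p by (rule dvd_add)
    hence "int p dvd c" using pr by (simp add: prime_dvd_mult_iff)
    moreover have "\<not> int p dvd 1" using pr by (simp add: prime_int_iff)
    ultimately show ?thesis by (simp add: t)
  qed
  have "(1 + theta_trace) * x + theta_trace * y = (1 + theta_trace) * (x + c * y) - y * ((1 + theta_trace) * c - theta_trace)" by (simp add: algebra_simps)
  hence "int p dvd (1 + theta_trace) * x + theta_trace * y \<longleftrightarrow> int p dvd (1 + theta_trace) * (x + c * y)"
    using 1 dvd_diff_left_iff[of "int p" "y * ((1 + theta_trace) * c - theta_trace)"] by simp
  also have "\<dots> \<longleftrightarrow> int p dvd x + c * y" using 1 pr by (simp add: prime_dvd_mult_iff)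
  finally show "of_int x + of_int y * theta \<in> ram_ideal p \<longleftrightarrow> of_int x + of_int y * theta \<in> root_ideal p c"
    unfolding in_ram_ideal in_root_ideal .
qed

lemma prime_ram_root: assumes "prime p" "int p dvd d" obtains c where "ram_root p c"
proof -
  have "int p dvd disc" using assms(2) by (simp add: disc_eq)
  thus ?thesis using double_root[OF assms(1)] that assms(1) unfolding ram_root_def by metis
qed

text \<open>Split off one prime p from m; the cofactor is prime to p since d is squarefree. The
  generating set G is kept general and needed only at primes dividing m, so the lemma serves both
  subgroups.\<close>

lemma class_ram_ideal:
  assumes "m > 0" "int m dvd d"
    and G: "\<And>p c. ram_root p c \<Longrightarrow> p dvd m \<Longrightarrow> ideal_class d (root_ideal p c) \<in> G"
  shows "frac_ideal (ram_ideal m) \<and> ideal_class d (ram_ideal m) \<in> generate CG G"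
  using assms
proof (induction m rule: less_induct)
  case (less m)
  show ?case
  proof (cases "m = 1")
    case True
    thus ?thesis using frac_ideal_OkF generate.one[of CG G] by (simp add: ram_ideal_1[unfolded One_nat_def] one_class_group)
  next
    case False
    then obtain p where p: "prime p" "p dvd m" using prime_factor_nat by blast
    then obtain q where q: "m = p * q" by blast
    have q0: "q > 0" "q < m" using less.prems(1) p(1) prime_gt_1_nat by (auto simp: q)
    have "\<not> p dvd q"
    proof
      assume "p dvd q"
      hence "p * p dvd m" unfolding q by (intro mult_dvd_mono) auto
      hence "int (p * p) dvd int m" by (simp only: int_dvd_int_iff)
      hence "int p ^ 2 dvd d" using less.prems(2) dvd_trans by (simp add: power2_eq_square) blast
      hence "is_unit (int p)" using d_sqf by (rule squarefreeD[rotated])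
      thus False using p(1) by simp
    qed
    hence cop: "coprime p q" using p(1) prime_imp_coprime by blast
    have primes_d: "int p dvd d" "int q dvd d"
      using less.prems(2) unfolding q of_nat_mult by (rule dvd_mult_left, rule dvd_mult_right)
    obtain c where c: "ram_root p c" using prime_ram_root[OF p(1) primes_d(1)] .
    have IH: "frac_ideal (ram_ideal q)" "ideal_class d (ram_ideal q) \<in> generate CG G"
      using less.IH[OF q0(2,1) primes_d(2)] less.prems(3) by (auto simp: q)
    have pair_term: "frac_ideal (ram_ideal p)" unfolding ram_ideal_prime[OF c primes_d(1)] by (rule ram_root_frac_ideal[OF c])
    have e: "ram_ideal m = ideal_mult (ram_ideal p) (ram_ideal q)"
      unfolding q ram_ideal_mult[OF cop]
      by (rule coprime_ideal_mult[OF pair_term ram_ideal_Ok nat_in_ram_ideal IH(1) ram_ideal_Ok nat_in_ram_ideal, symmetric]) (simp add: cop)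
    have "ideal_class d (ram_ideal p) \<in> generate CG G"
      unfolding ram_ideal_prime[OF c primes_d(1)] by (rule generate.incl) (rule less.prems(3)[OF c p(2)])
    hence "ideal_class d (ram_ideal p) \<otimes>\<^bsub>CG\<^esub> ideal_class d (ram_ideal q) \<in> generate CG G"
      using IH(2) by (rule generate.eng)
    thus ?thesis unfolding e mult_class_group[OF pair_term IH(1)] using frac_ideal_ideal_mult[OF pair_term IH(1)] by blast
  qed
qed

section \<open>Rectangular and centred ideals as products of ramified primes\<close>

lemma rect_ram_ideal: assumes "d mod 4 \<noteq> 1" "m > 0" shows "rect m = ram_ideal (nat m)"
proof -
  have t: "theta = w" "theta_trace = 0" using assms by (simp_all add: theta_def theta_trace_def)
  show ?thesis
  proof (intro equalityI subsetI)
    fix z assume "z \<in> rect m"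
    then obtain x y where "z = of_int x * of_int m + of_int y * w" by (rule latE)
    hence z: "z = of_int (x * m) + of_int y * theta" by (simp add: t)
    show "z \<in> ram_ideal (nat m)" unfolding z in_ram_ideal using assms by (simp add: t)
  next
    fix z assume z: "z \<in> ram_ideal (nat m)"
    then obtain x y where xy: "z = of_int x + of_int y * theta" using ram_ideal_Ok by (meson OkE subsetD)
    have "m dvd x" using z assms unfolding xy in_ram_ideal by (simp add: t)
    then obtain k where "x = m * k" by blast
    hence "z = of_int k * of_int m + of_int y * w" by (simp add: xy t mult.commute)
    thus "z \<in> rect m" by (metis latI)
  qed
qed

lemma cent_ram_ideal: assumes "d mod 4 = 1" "m > 0" "m dvd d" shows "cent m = scl 2 (ram_ideal (nat m))"
proof -
  have t: "2 * theta = 1 + w" "theta_trace = 1" using assms by (simp_all add: theta_def theta_trace_def)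
  have "odd d" using assms(1) by presburger
  hence om: "odd m" using assms(3) dvd_trans by blast
  show ?thesis
  proof (intro equalityI subsetI)
    fix z assume "z \<in> cent m"
    then obtain u v where uv: "z = of_int u * of_int m + of_int v * w" "even (u - v)" by (rule rhombE)
    have "even (u * m - v)" using uv(2) om by auto
    then obtain x where x: "u * m - v = 2 * x" by blast
    have "z = of_int (u * m - v) + of_int v * (1 + w)" by (simp add: uv(1) algebra_simps)
    hence z: "z = 2 * (of_int x + of_int v * theta)" unfolding x t(1)[symmetric] by (simp add: algebra_simps)
    have "(1 + theta_trace) * x + theta_trace * v = u * m" using x by (simp add: t)
    hence "of_int x + of_int v * theta \<in> ram_ideal (nat m)" unfolding in_ram_ideal using assms(2) by simp
    thus "z \<in> scl 2 (ram_ideal (nat m))" unfolding z by blast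
  next
    fix z assume "z \<in> scl 2 (ram_ideal (nat m))"
    then obtain j where j: "j \<in> ram_ideal (nat m)" "z = 2 * j" by blast
    then obtain x y where xy: "j = of_int x + of_int y * theta" using ram_ideal_Ok by (meson OkE subsetD)
    have "m dvd 2 * x + y" using j(1) assms unfolding xy in_ram_ideal by (simp add: t)
    then obtain u where u: "2 * x + y = m * u" by blast
    have "z = of_int (2 * x) + of_int y * (2 * theta)" by (simp add: j(2) xy algebra_simps)
    also have "\<dots> = of_int (2 * x + y) + of_int y * w" unfolding t(1) by (simp add: algebra_simps)
    finally have z: "z = of_int u * of_int m + of_int y * w" unfolding u by (simp add: mult.commute)
    have "even (m * u) = even y" unfolding u[symmetric] by simp
    hence "even (u - y)" using om by auto
    thus "z \<in> cent m" unfolding z by (rule rhombI)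
  qed
qed

text \<open>The parity condition of the centred shape is the congruence of the prime above 2, as m
  and c are odd. By coprimality the intersection is a product, so centred ideals carry exactly this
  one extra prime.\<close>

lemma cent_3: assumes "d mod 4 = 3" "m > 0" "m dvd d" "ram_root 2 c" shows "cent m = ram_ideal (nat m) \<inter> root_ideal 2 c"
proof -
  have t: "theta = w" "theta_trace = 0" "theta_norm = - d" using assms by (simp_all add: theta_def theta_trace_def theta_norm_def)
  have od: "odd d" using assms(1) by presburger
  hence om: "odd m" using assms(3) dvd_trans by blast
  have "even (c * c - d)" using assms(4) by (simp add: ram_root_def theta_poly_def t)
  hence oc: "odd c" using od by simp
  show ?thesis
  proof (rule Ok_set_eq)
    show "cent m \<subseteq> Ok"
    proof
      fix z assume "z \<in> cent m"
      then obtain u v where "z = of_int u * of_int m + of_int v * w" by (rule rhombE)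
      hence "z = of_int (u * m) + of_int v * theta" by (simp add: t)
      thus "z \<in> Ok" using OkI by blast
    qed
    show "ram_ideal (nat m) \<inter> root_ideal 2 c \<subseteq> Ok" using ram_ideal_Ok by blast
    fix x y
    show "of_int x + of_int y * theta \<in> cent m \<longleftrightarrow> of_int x + of_int y * theta \<in> ram_ideal (nat m) \<inter> root_ideal 2 c"
    proof
      assume "of_int x + of_int y * theta \<in> cent m"
      then obtain u v where uv: "of_int x + of_int y * theta = of_int u * of_int m + of_int v * w" "even (u - v)" by (rule rhombE)
      hence "of_int x + of_int y * theta = of_int (u * m) + of_int v * theta" by (simp add: t)
      hence "x = u * m \<and> y = v" by (rule coord_theta)
      thus "of_int x + of_int y * theta \<in> ram_ideal (nat m) \<inter> root_ideal 2 c"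
        unfolding Int_iff in_ram_ideal in_root_ideal using assms(2) uv(2) om oc by (auto simp: t)
    next
      assume "of_int x + of_int y * theta \<in> ram_ideal (nat m) \<inter> root_ideal 2 c"
      hence *: "m dvd x" "even (x + c * y)" unfolding Int_iff in_ram_ideal in_root_ideal using assms(2) by (simp_all add: t)
      then obtain u where u: "x = m * u" by blast
      have "even (u - y)" using *(2) om oc unfolding u by auto
      hence "of_int u * of_int m + of_int y * w \<in> cent m" by (rule rhombI)
      thus "of_int x + of_int y * theta \<in> cent m" by (simp add: u t mult.commute)
    qed
  qed
qed

lemma ram_root_gen: "ram_root p c \<Longrightarrow> ideal_class d (root_ideal p c) \<in> {ideal_class d \<pp> | \<pp> r. ramified d r \<and> prime_ideal_over d r \<pp>}"
  using ram_root_ramified ram_root_prime_over by blast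

lemma ram_root_gen_ortho: "ram_root p c \<Longrightarrow> p \<noteq> 2 \<Longrightarrow>
    ideal_class d (root_ideal p c) \<in> {ideal_class d \<pp> | \<pp> r. ramified d r \<and> r \<noteq> 2 \<and> prime_ideal_over d r \<pp>}"
  using ram_root_ramified ram_root_prime_over by blast

lemma ram_ideal_ram:
  assumes "m > 0" "m dvd d"
  shows "frac_ideal (ram_ideal (nat m)) \<and> ideal_class d (ram_ideal (nat m)) \<in> ram_classes d"
  unfolding ram_classes_def
proof (rule class_ram_ideal)
  show "0 < nat m" "int (nat m) dvd d" using assms by simp_all
qed (rule ram_root_gen)

lemma ram_ideal_ortho:
  assumes "m > 0" "m dvd d" "odd m"
  shows "ideal_class d (ram_ideal (nat m)) \<in> ortho_classes d"
proof -
  have "frac_ideal (ram_ideal (nat m)) \<and> ideal_class d (ram_ideal (nat m)) \<in> ortho_classes d"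
    unfolding ortho_classes_def
  proof (rule class_ram_ideal)
    show "0 < nat m" "int (nat m) dvd d" using assms by simp_all
    fix p c assume p: "ram_root p c" "p dvd nat m"
    have "odd (nat m)" using assms by (simp add: even_nat_iff)
    hence "p \<noteq> 2" using p(2) by auto
    thus "ideal_class d (root_ideal p c) \<in> {ideal_class d \<pp> | \<pp> r. ramified d r \<and> r \<noteq> 2 \<and> prime_ideal_over d r \<pp>}"
      by (rule ram_root_gen_ortho[OF p(1)])
  qed
  thus ?thesis by blast
qed

lemma class_rect_ram: assumes "d mod 4 \<noteq> 1" "m > 0" "m dvd d" shows "ideal_class d (rect m) \<in> ram_classes d"
  unfolding rect_ram_ideal[OF assms(1,2)] using ram_ideal_ram[OF assms(2,3)] by blast

lemma class_rect_ortho: assumes "d mod 4 = 3" "m > 0" "m dvd d" shows "ideal_class d (rect m) \<in> ortho_classes d"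
proof -
  have d1: "d mod 4 \<noteq> 1" using assms(1) by simp
  have "odd d" using assms(1) by presburger
  hence "odd m" using assms(3) dvd_trans by blast
  thus ?thesis unfolding rect_ram_ideal[OF d1 assms(2)] by (rule ram_ideal_ortho[OF assms(2,3)])
qed

lemma class_cent_ram: assumes "d mod 4 \<noteq> 2" "m > 0" "m dvd d" shows "ideal_class d (cent m) \<in> ram_classes d"
proof -
  have "frac_ideal (ram_ideal (nat m)) \<and> ideal_class d (ram_ideal (nat m)) \<in> ram_classes d" by (rule ram_ideal_ram[OF assms(2,3)])
  hence J: "frac_ideal (ram_ideal (nat m))" "ideal_class d (ram_ideal (nat m)) \<in> ram_classes d" by blast+
  show ?thesis
  proof (cases "d mod 4 = 1")
    case True
    show ?thesis unfolding cent_ram_ideal[OF True assms(2,3)] using J ideal_class_scale[OF J(1), of 2] by simp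
  next
    case False
    hence d3: "d mod 4 = 3" using assms(1) d_mod4 by blast
    have "int 2 dvd disc" using d3 by (simp add: disc_eq)
    then obtain c where c: "ram_root 2 c" using double_root[OF two_is_prime_nat] two_is_prime_nat unfolding ram_root_def by metis
    have "odd d" using d3 by presburger
    hence "odd m" using assms(3) dvd_trans by blast
    hence cop: "coprime (int (nat m)) (int 2)" using assms(2) by simp
    have n2: "of_int (int 2) \<in> root_ideal 2 c" using r_root_ideal[of 2 c] by simp
    have "cent m = ideal_mult (ram_ideal (nat m)) (root_ideal 2 c)"
      unfolding cent_3[OF d3 assms(2,3) c]
      by (rule coprime_ideal_mult[OF J(1) ram_ideal_Ok nat_in_ram_ideal ram_root_frac_ideal[OF c] root_ideal_Ok n2 cop, symmetric])
    hence "ideal_class d (cent m) = ideal_class d (ram_ideal (nat m)) \<otimes>\<^bsub>CG\<^esub> ideal_class d (root_ideal 2 c)"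
      using mult_class_group[OF J(1) ram_root_frac_ideal[OF c]] by simp
    moreover have "ideal_class d (root_ideal 2 c) \<in> ram_classes d"
      unfolding ram_classes_def by (rule generate.incl[OF ram_root_gen[OF c]])
    ultimately show ?thesis using J(2) unfolding ram_classes_def by (simp add: generate.eng)
  qed
qed

text \<open>Ramified primes are stable under conjugation, so the generated classes are ambiguous;
  conversely an ambiguous ideal is a multiple of some \<open>rect m\<close> or
  \<open>cent m\<close>, which are products of ramified primes up to scaling.\<close>

lemma ram_classes_iff: assumes "frac_ideal J" shows "ideal_class d J \<in> ram_classes d \<longleftrightarrow> ambiguous J"
proof
  assume "ideal_class d J \<in> ram_classes d"
  then obtain J' where J': "ideal_class d J = ideal_class d J'" "frac_ideal J'" "ambiguous J'"
    using generate_ambiguous[OF order_refl] unfolding ram_classes_def by blast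
  obtain a where a: "a \<in> F" "a \<noteq> 0" "J = scl a J'" using J'(1) ideal_class_eq_iff[OF J'(2) assms] by metis
  have "ideal_class d (cnj ` J) = ideal_class d (cnj ` J')"
    unfolding a(3) cnj_scale using ideal_class_scale[OF frac_ideal_cnj[OF J'(2)]] a by simp
  thus "ambiguous J" using J' ambiguous_iff[OF assms] ambiguous_iff[OF J'(2)] by simp
next
  assume "ambiguous J"
  then obtain a m where a: "a \<in> F" "a \<noteq> 0" "m > 0" "m dvd d"
    "J = scl a (rect m) \<and> frac_ideal (rect m) \<and> d mod 4 \<noteq> 1 \<or> J = scl a (cent m) \<and> frac_ideal (cent m) \<and> d mod 4 \<noteq> 2"
    using ambiguous_types[OF assms] by metis
  from a(5) show "ideal_class d J \<in> ram_classes d"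
    using ideal_class_scale[OF _ a(1,2)] class_rect_ram[OF _ a(3,4)] class_cent_ram[OF _ a(3,4)] by auto
qed

lemma ortho_subset_ram: "ortho_classes d \<subseteq> ram_classes d"
proof
  fix x assume "x \<in> ortho_classes d"
  then obtain J where "x = ideal_class d J" "frac_ideal J" "ambiguous J"
    unfolding ortho_classes_def using generate_ambiguous[of "{ideal_class d \<pp> | \<pp> r. ramified d r \<and> r \<noteq> 2 \<and> prime_ideal_over d r \<pp>}"]
    by blast
  thus "x \<in> ram_classes d" using ram_classes_iff by blast
qed

lemma ram_classes_form: assumes "x \<in> ram_classes d" obtains J where "x = ideal_class d J" "frac_ideal J" "ambiguous J"
  using generate_ambiguous[OF order_refl] assms unfolding ram_classes_def by blast

text \<open>There is one candidate of each shape per divisor of d. The bound is uniform in the index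
  and makes the class counts bounded coefficients.\<close>

lemma finite_ram_classes: "finite (ram_classes d)"
proof (rule finite_subset)
  let ?D = "{m. m dvd d}"
  show "ram_classes d \<subseteq> (\<lambda>m. ideal_class d (rect m)) ` ?D \<union> (\<lambda>m. ideal_class d (cent m)) ` ?D"
  proof
    fix x assume "x \<in> ram_classes d"
    then obtain J where J: "x = ideal_class d J" "frac_ideal J" "ambiguous J" by (rule ram_classes_form)
    obtain a m where a: "a \<in> F" "a \<noteq> 0" "m > 0" "m dvd d"
      "J = scl a (rect m) \<and> frac_ideal (rect m) \<and> d mod 4 \<noteq> 1 \<or> J = scl a (cent m) \<and> frac_ideal (cent m) \<and> d mod 4 \<noteq> 2"
      using ambiguous_types[OF J(2,3)] by metis
    from a(5) have "x = ideal_class d (rect m) \<or> x = ideal_class d (cent m)"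
      using ideal_class_scale[OF _ a(1,2)] J(1) by auto
    thus "x \<in> (\<lambda>m. ideal_class d (rect m)) ` ?D \<union> (\<lambda>m. ideal_class d (cent m)) ` ?D" using a(4) by blast
  qed
  have "d \<noteq> 0" using d_neg by simp
  hence "finite ?D" by (rule finite_divisors_int)
  thus "finite ((\<lambda>m. ideal_class d (rect m)) ` ?D \<union> (\<lambda>m. ideal_class d (cent m)) ` ?D)" by blast
qed

text \<open>For \<open>d \<equiv> 3\<close> modulo 4, products of ramified primes away from 2 are closed under taking
  real parts, while no ideal \<open>cent m\<close> is; this separates the two kinds of ambiguous classes.\<close>
definition real_closed :: "complex set \<Rightarrow> bool" where "real_closed J \<longleftrightarrow> (\<forall>z\<in>J. of_real (Re z) \<in> J)"

text \<open>The real part of a b is Re a Re b + (i Im a)(i Im b), and a real-closed ideal contains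
  real and imaginary parts separately.\<close>

lemma real_closed_mult:
  assumes A: "frac_ideal A" "real_closed A" and B: "frac_ideal B" "real_closed B" shows "real_closed (ideal_mult A B)"
proof -
  have aM: "addsub (ideal_mult A B)" by (rule ideal_mult_addsub)
  have im: "\<i> * of_real (Im z) \<in> J" if "addsub J" "real_closed J" "z \<in> J" for z J
  proof -
    have "z - of_real (Re z) \<in> J" using that addsub_diff by (auto simp: real_closed_def)
    moreover have "z - of_real (Re z) = \<i> * of_real (Im z)" by (simp add: complex_eq_iff)
    ultimately show ?thesis by simp
  qed
  have "ideal_mult A B \<subseteq> {z. of_real (Re z) \<in> ideal_mult A B}"
  proof (rule ideal_mult_least)
    show "addsub {z. of_real (Re z) \<in> ideal_mult A B}"
      using addsub_0[OF aM] addsub_diff[OF aM] by (auto simp: addsub_def)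
    fix a b assume a: "a \<in> A" and b: "b \<in> B"
    have 1: "of_real (Re a) * of_real (Re b) \<in> ideal_mult A B"
      using a b A(2) B(2) by (intro ideal_multI) (auto simp: real_closed_def)
    have 2: "(\<i> * of_real (Im a)) * (\<i> * of_real (Im b)) \<in> ideal_mult A B"
      using im[OF frac_ideal_addsub[OF A(1)] A(2) a] im[OF frac_ideal_addsub[OF B(1)] B(2) b] by (rule ideal_multI)
    have e: "of_real (Re (a * b)) = of_real (Re a) * of_real (Re b) + (\<i> * of_real (Im a)) * (\<i> * of_real (Im b))"
      by (simp add: complex_eq_iff)
    show "a * b \<in> {z. of_real (Re z) \<in> ideal_mult A B}"
      unfolding mem_Collect_eq e by (rule addsub_add[OF aM 1 2])
  qed
  thus ?thesis by (auto simp: real_closed_def)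
qed

text \<open>For odd r the double root is c = 0 modulo r, so the congruence involves only the real
  coordinate.\<close>

lemma real_closed_root_ideal: assumes "d mod 4 = 3" "ram_root r c" "r \<noteq> 2" shows "real_closed (root_ideal r c)"
  unfolding real_closed_def
proof
  have t: "theta = w" "theta_trace = 0" using assms by (simp_all add: theta_def theta_trace_def)
  have pr: "prime (int r)" using assms by (simp add: ram_root_def)
  have "\<not> int r dvd int 2"
    using assms(2,3) primes_dvd_imp_eq[of r 2] by (auto simp: ram_root_def simp del: of_nat_numeral)
  hence "\<not> int r dvd 2" by simp
  moreover have "int r dvd 2 * c" using assms(2) by (simp add: ram_root_def t)
  ultimately have rc: "int r dvd c" using pr by (simp add: prime_dvd_mult_iff)
  fix z assume "z \<in> root_ideal r c"
  then obtain x y where xy: "z = of_int x + of_int y * theta" "int r dvd x + c * y" by (auto simp: root_ideal_def)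
  have "int r dvd x + c * y - c * y" using xy(2) rc by (intro dvd_diff dvd_mult2)
  hence "of_int x + of_int 0 * theta \<in> root_ideal r c" by (intro PrI) simp
  moreover have "of_real (Re z) = of_int x + of_int 0 * theta" by (simp add: xy t complex_eq_iff)
  ultimately show "of_real (Re z) \<in> root_ideal r c" by simp
qed

lemma real_closed_Ok: assumes "d mod 4 = 3" shows "real_closed Ok"
  unfolding real_closed_def
proof
  have t: "theta = w" using assms by (simp add: theta_def)
  fix z assume "z \<in> Ok"
  then obtain x y where "z = of_int x + of_int y * theta" by (rule OkE)
  hence "of_real (Re z) = (of_int x :: complex)" by (simp add: t complex_eq_iff)
  thus "of_real (Re z) \<in> Ok" by simp
qed

lemma ortho_real_closed:
  assumes "d mod 4 = 3" "x \<in> ortho_classes d" obtains J where "x = ideal_class d J" "frac_ideal J" "real_closed J"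
proof -
  have "\<exists>J. x = ideal_class d J \<and> frac_ideal J \<and> real_closed J"
  proof (rule generate_subset[where P = real_closed, OF _ real_closed_Ok[OF assms(1)] _ assms(2)[unfolded ortho_classes_def]])
    fix g assume "g \<in> {ideal_class d \<pp> | \<pp> r. ramified d r \<and> r \<noteq> 2 \<and> prime_ideal_over d r \<pp>}"
    then obtain P r where P: "g = ideal_class d P" "ramified d r" "r \<noteq> 2" "prime_ideal_over d r P" by blast
    obtain c where "ram_root r c" "P = root_ideal r c" using ramified_prime_form[OF P(2,4)] .
    thus "\<exists>r c. g = ideal_class d (root_ideal r c) \<and> ram_root r c \<and> real_closed (root_ideal r c)"
      using P(1) real_closed_root_ideal[OF assms(1) _ P(3)] by blast
  qed (rule real_closed_mult)
  thus ?thesis using that by blast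
qed

text \<open>Suppose a multiple l of \<open>cent m\<close> is closed under real parts. It is then
  closed under conjugation, so conj(l)/l stabilises \<open>cent m\<close> and is 1 or -1; thus l is
  real or imaginary. The real part of l (m + w) is l m or l w, which would put m or w itself into
  the centred lattice.\<close>

lemma class_cent_not_ortho:
  assumes d: "d \<noteq> -1" "d mod 4 = 3" and m: "m > 0" "m dvd d" and frac_ideal: "frac_ideal (cent m)"
  shows "ideal_class d (cent m) \<notin> ortho_classes d"
proof
  assume "ideal_class d (cent m) \<in> ortho_classes d"
  then obtain J where J: "ideal_class d (cent m) = ideal_class d J" "frac_ideal J" "real_closed J"
    using ortho_real_closed[OF d(2)] by blast
  obtain l where l: "l \<in> F" "l \<noteq> 0" "J = scl l (cent m)" using J(1) ideal_class_eq_iff[OF frac_ideal J(2)] by metis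
  obtain e where "d = m * e" using m(2) by blast
  hence "d = - (m * (- e))" by simp
  then interpret q: quad_split d m "- e" by unfold_locales (use m in auto)
  have mw: "of_int m + w \<in> cent m" using q.pt11_cent by (simp add: q.pt_def)
  have cJ: "cnj z \<in> J" if z: "z \<in> J" for z
  proof -
    have "of_int 2 * of_real (Re z) - z \<in> J"
      using J z frac_ideal_addsub[OF J(2)] by (intro addsub_diff addsub_of_int) (auto simp: real_closed_def)
    moreover have "of_int 2 * of_real (Re z) - z = cnj z" by (simp add: complex_eq_iff)
    ultimately show ?thesis by simp
  qed
  have "d \<noteq> -3" using d(2) by auto
  have u: "cnj l / l \<in> U1" using l by (intro U1I) (auto simp: norm_divide)
  have "scl (cnj l / l) (cent m) \<subseteq> cent m"
  proof
    fix z assume "z \<in> scl (cnj l / l) (cent m)"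
    then obtain y where y: "y \<in> cent m" "z = cnj l / l * y" by blast
    have "y \<in> cnj ` cent m" using y(1) q.cnj_cent_sub[of 1 1] by (simp add: q.cent_sub_def)
    then obtain y' where y': "y' \<in> cent m" "y = cnj y'" by blast
    have "cnj (l * y') \<in> J" using y'(1) l(3) by (intro cJ) blast
    then obtain v where v: "v \<in> cent m" "cnj (l * y') = l * v" using l(3) by blast
    have "z = v" using v(2) l(2) unfolding y(2) y'(2) by (simp add: field_simps)
    thus "z \<in> cent m" using v(1) by simp
  qed
  hence "cnj l / l = 1 \<or> cnj l / l = - 1" using units[OF d(1) \<open>d \<noteq> -3\<close> u frac_ideal] by blast
  moreover have lw: "of_real (Re (l * (of_int m + w))) \<in> J"
  proof -
    have "l * (of_int m + w) \<in> J" using mw l(3) by blast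
    thus ?thesis using J(3) unfolding real_closed_def by blast
  qed
  moreover have False if "cnj l / l = 1"
  proof -
    have "cnj l = l" using that l(2) by simp
    hence "Im l = 0" by (simp add: complex_eq_iff)
    hence "of_real (Re (l * (of_int m + w))) = l * of_int m" by (simp add: complex_eq_iff)
    hence "l * of_int m \<in> J" using lw by (simp only:)
    then obtain v where "v \<in> cent m" "l * of_int m = l * v" using l(3) by blast
    hence "of_int m \<in> cent m" using l(2) by simp
    then obtain x y where xy: "of_int m = q.pt x y" "even (x - y)" using q.in_cent by blast
    have "q.pt 1 0 = q.pt x y" using xy(1) by (simp add: q.pt_def)
    hence "x = 1 \<and> y = 0" using q.pt_eq by metis
    thus False using xy(2) by simp
  qed
  moreover have False if "cnj l / l = - 1"
  proof -
    have "cnj l = - l" using that l(2) by (simp add: field_simps)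
    hence "Re l = 0" by (simp add: complex_eq_iff)
    hence "of_real (Re (l * (of_int m + w))) = l * w" by (simp add: complex_eq_iff)
    hence "l * w \<in> J" using lw by (simp only:)
    then obtain v where "v \<in> cent m" "l * w = l * v" using l(3) by blast
    hence "w \<in> cent m" using l(2) by simp
    then obtain x y where xy: "w = q.pt x y" "even (x - y)" using q.in_cent by blast
    have "q.pt 0 1 = q.pt x y" using xy(1) by (simp add: q.pt_def)
    hence "x = 0 \<and> y = 1" using q.pt_eq by metis
    thus False using xy(2) by simp
  qed
  ultimately show False by blast
qed

end

section \<open>The reflection zeta function\<close>

locale quad_ideal = imag_quad +
  fixes I :: "complex set"
  assumes I_fi: "frac_ideal I" and d1: "d \<noteq> -1" and d3: "d \<noteq> -3"
begin

definition ideal_refls :: "complex set \<Rightarrow> complex set" where "ideal_refls J = {u \<in> U1. scl u (cnj ` J) = J}"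
definition unit_maps :: "complex set \<Rightarrow> complex set" where "unit_maps J = {u \<in> U1. scl u J \<subseteq> I}"
definition map_count :: "complex set \<Rightarrow> nat" where "map_count K = card {\<sigma> \<in> O_field d. \<sigma> ` K \<subseteq> I}"
definition amb_ideals :: "complex set set" where "amb_ideals = {J. frac_ideal J \<and> J \<subseteq> I \<and> ambiguous J}"
text \<open>The counterpart of \<open>conj_lats\<close> for the reflection of u; for u = 1 the two
  agree.\<close>

definition refl_lats :: "complex set \<Rightarrow> complex \<Rightarrow> complex set set" where
  "refl_lats J u = {K. is_lat K \<and> scl u (cnj ` K) = K \<and> K \<subseteq> J \<and> Ok_span K = J}"
definition idx :: "complex set \<Rightarrow> nat" where "idx J = lattice_index I J"

lemma I_F: "I \<subseteq> F" and I_lat: "is_lat I" and I_addsub: "addsub I"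
  using I_fi frac_ideal_F frac_ideal_lat frac_ideal_addsub by blast+

lemma amb_ideals_D: "J \<in> amb_ideals \<Longrightarrow> frac_ideal J" "J \<in> amb_ideals \<Longrightarrow> J \<subseteq> I" "J \<in> amb_ideals \<Longrightarrow> ambiguous J"
  by (auto simp: amb_ideals_def)

lemma scl_sub_self: "u \<in> U1 \<Longrightarrow> frac_ideal J \<Longrightarrow> scl u J \<subseteq> J \<Longrightarrow> u = 1 \<or> u = - 1"
  using units[OF d1 d3] by blast

lemma scl_neg: assumes "addsub K" shows "scl (- u) K = scl u K"
proof -
  have "scl (- 1) K = K"
  proof (intro equalityI subsetI)
    fix z assume "z \<in> scl (- 1) K" thus "z \<in> K" using addsub_uminus[OF assms] by auto
  next
    fix z assume "z \<in> K"
    hence "- z \<in> K" by (rule addsub_uminus[OF assms])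
    thus "z \<in> scl (- 1) K" by (intro image_eqI[of _ _ "- z"]) simp_all
  qed
  hence "scl u K = scl u (scl (- 1) K)" by simp
  thus ?thesis unfolding scale_scale by simp
qed

text \<open>Two reflections preserving J differ by a rotation preserving J, that is, by 1 or
  -1.\<close>

lemma ideal_refls_pm: assumes J: "frac_ideal J" and u: "u \<in> ideal_refls J" shows "ideal_refls J = {u, - u}" "u \<noteq> - u"
proof -
  have u': "u \<in> U1" "scl u (cnj ` J) = J" using u by (auto simp: ideal_refls_def)
  show "u \<noteq> - u" using U1_nz[OF u'(1)] by simp
  show "ideal_refls J = {u, - u}"
  proof
    have "scl (- u) (cnj ` J) = J"
      using scl_neg[OF addsub_image_cnj[OF frac_ideal_addsub[OF J]]] u'(2) by simp
    thus "{u, - u} \<subseteq> ideal_refls J" using u U1_uminus[OF u'(1)] by (auto simp: ideal_refls_def)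
    show "ideal_refls J \<subseteq> {u, - u}"
    proof
      fix v assume "v \<in> ideal_refls J"
      hence v: "v \<in> U1" "scl v (cnj ` J) = J" by (auto simp: ideal_refls_def)
      have "scl (v * cnj u) J = scl (v * cnj u) (scl u (cnj ` J))" by (simp only: u'(2))
      also have "\<dots> = scl (v * (u * cnj u)) (cnj ` J)" unfolding scale_scale
        by (rule arg_cong[where f = "\<lambda>c. scl c (cnj ` J)"]) (simp add: mult_ac)
      also have "\<dots> = J" using v(2) U1_cnj[OF u'(1)] by simp
      finally have "v * cnj u = 1 \<or> v * cnj u = - 1"
        using scl_sub_self[OF U1_mult[OF v(1) U1_conj[OF u'(1)]] J] by simp
      moreover have "v = (v * cnj u) * u" using U1_cnj[OF u'(1)] by (simp add: mult.assoc mult.commute[of "cnj u"])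
      ultimately have "v = 1 * u \<or> v = - 1 * u" by metis
      thus "v \<in> {u, - u}" by auto
    qed
  qed
qed

section \<open>Counting the isometries into I\<close>

lemma O_field_image_sub:
  assumes "K \<subseteq> F"
  shows "{\<sigma> \<in> O_field d. \<sigma> ` K \<subseteq> I} = rot ` {u \<in> U1. scl u K \<subseteq> I} \<union> refl ` {u \<in> U1. scl u (cnj ` K) \<subseteq> I}"
proof -
  have R: "rot u ` K = scl u K" "refl u ` K = scl u (cnj ` K)" for u
    using rot_image[OF assms] refl_image[OF assms] by (simp_all only: image_image)
  show ?thesis
  proof (intro equalityI subsetI)
    fix \<sigma> assume "\<sigma> \<in> {\<sigma> \<in> O_field d. \<sigma> ` K \<subseteq> I}"
    hence h: "\<sigma> \<in> rot ` U1 \<union> refl ` U1" "\<sigma> ` K \<subseteq> I" unfolding O_field_eq by blast+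
    from h(1) show "\<sigma> \<in> rot ` {u \<in> U1. scl u K \<subseteq> I} \<union> refl ` {u \<in> U1. scl u (cnj ` K) \<subseteq> I}"
    proof
      assume "\<sigma> \<in> rot ` U1"
      then obtain u where u: "u \<in> U1" "\<sigma> = rot u" by blast
      have "scl u K \<subseteq> I" using h(2) unfolding u(2) R .
      thus ?thesis using u by blast
    next
      assume "\<sigma> \<in> refl ` U1"
      then obtain u where u: "u \<in> U1" "\<sigma> = refl u" by blast
      have "scl u (cnj ` K) \<subseteq> I" using h(2) unfolding u(2) R .
      thus ?thesis using u by blast
    qed
  next
    fix \<sigma> assume "\<sigma> \<in> rot ` {u \<in> U1. scl u K \<subseteq> I} \<union> refl ` {u \<in> U1. scl u (cnj ` K) \<subseteq> I}"
    thus "\<sigma> \<in> {\<sigma> \<in> O_field d. \<sigma> ` K \<subseteq> I}"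
    proof
      assume "\<sigma> \<in> rot ` {u \<in> U1. scl u K \<subseteq> I}"
      then obtain u where u: "u \<in> U1" "scl u K \<subseteq> I" "\<sigma> = rot u" by blast
      have "\<sigma> ` K \<subseteq> I" unfolding u(3) R by (rule u(2))
      thus ?thesis using u(1,3) rot_O by blast
    next
      assume "\<sigma> \<in> refl ` {u \<in> U1. scl u (cnj ` K) \<subseteq> I}"
      then obtain u where u: "u \<in> U1" "scl u (cnj ` K) \<subseteq> I" "\<sigma> = refl u" by blast
      have "\<sigma> ` K \<subseteq> I" unfolding u(3) R by (rule u(2))
      thus ?thesis using u(1,3) refl_O by blast
    qed
  qed
qed

lemma scl_Ok_span_sub: assumes "is_lat K" shows "scl u K \<subseteq> I \<longleftrightarrow> scl u (Ok_span K) \<subseteq> I"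
proof
  assume "scl u K \<subseteq> I"
  thus "scl u (Ok_span K) \<subseteq> I" unfolding Ok_span_scale[symmetric]
    by (rule Ok_span_least[OF I_addsub, rotated]) (rule frac_ideal_theta[OF I_fi])
next
  assume "scl u (Ok_span K) \<subseteq> I"
  thus "scl u K \<subseteq> I" using Ok_span_base[OF is_lat_addsub[OF assms]] by blast
qed

text \<open>As I is an ideal, a rotation or reflection carries K into I if and only if it carries
  the generated ideal into I.\<close>

lemma map_count_Ok_span: assumes "is_lat K" "K \<subseteq> I" shows "map_count K = map_count (Ok_span K)"
proof -
  have "Ok_span K \<subseteq> F" using Ok_span_frac_ideal(2)[OF assms I_fi] I_F by blast
  moreover have "scl u (cnj ` K) \<subseteq> I \<longleftrightarrow> scl u (cnj ` Ok_span K) \<subseteq> I" for u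
    using scl_Ok_span_sub[OF is_lat_cnj[OF assms(1)], of u] Ok_span_cnj[OF is_lat_addsub[OF assms(1)]] by simp
  moreover have "K \<subseteq> F" using assms(2) I_F by blast
  ultimately show ?thesis unfolding map_count_def using scl_Ok_span_sub[OF assms(1)] by (simp add: O_field_image_sub)
qed

text \<open>A rotation is determined by the image of one nonzero x, a point of I of the same
  length.\<close>

lemma finite_unit_maps: assumes "frac_ideal J" shows "finite (unit_maps J)"
proof -
  obtain x where x: "x \<in> J" "x \<noteq> 0" using frac_ideal_nonzero[OF assms] .
  have "(\<lambda>u. u * x) ` unit_maps J \<subseteq> {z \<in> I. cmod z \<le> cmod x}"
    using x(1) U1_norm by (auto simp: unit_maps_def norm_mult)
  hence "finite ((\<lambda>u. u * x) ` unit_maps J)" using finite_lat_ball[OF I_lat] finite_subset by blast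
  moreover have "inj_on (\<lambda>u. u * x) (unit_maps J)" using x(2) by (auto simp: inj_on_def)
  ultimately show ?thesis by (rule finite_imageD)
qed

text \<open>Composition with a reflection that preserves J matches the rotations of J into I with
  the reflections of J into I.\<close>

lemma map_count_unit_maps: assumes J: "frac_ideal J" and u: "u \<in> ideal_refls J" shows "map_count J = 2 * card (unit_maps J)"
proof -
  have u': "u \<in> U1" "scl u (cnj ` J) = J" using u by (auto simp: ideal_refls_def)
  have c: "scl v (cnj ` J) = scl (v * cnj u) J" for v
  proof -
    have "scl (v * cnj u) J = scl (v * cnj u) (scl u (cnj ` J))" by (simp only: u'(2))
    also have "\<dots> = scl (v * (u * cnj u)) (cnj ` J)" unfolding scale_scale
      by (rule arg_cong[where f = "\<lambda>c. scl c (cnj ` J)"]) (simp add: mult_ac)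
    finally show ?thesis using U1_cnj[OF u'(1)] by simp
  qed
  have bij: "bij_betw (\<lambda>v. v * u) (unit_maps J) {v \<in> U1. scl v (cnj ` J) \<subseteq> I}"
  proof (rule bij_betwI[where g = "\<lambda>v. v * cnj u"])
    have uc: "v * u * cnj u = v" "v * cnj u * u = v" for v
      using U1_cnj[OF u'(1)] by (simp_all add: mult.assoc mult.commute[of "cnj u"])
    show "(\<lambda>v. v * u) \<in> unit_maps J \<rightarrow> {v \<in> U1. scl v (cnj ` J) \<subseteq> I}"
      unfolding c by (auto simp: unit_maps_def uc U1_mult[OF _ u'(1)])
    show "(\<lambda>v. v * cnj u) \<in> {v \<in> U1. scl v (cnj ` J) \<subseteq> I} \<rightarrow> unit_maps J"
      unfolding c by (auto simp: unit_maps_def U1_mult[OF _ U1_conj[OF u'(1)]])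
  qed (simp_all add: U1_cnj[OF u'(1)] mult.assoc mult.commute[of "cnj u"])
  have card: "card {v \<in> U1. scl v (cnj ` J) \<subseteq> I} = card (unit_maps J)"
    by (rule bij_betw_same_card[OF bij, symmetric])
  have fin: "finite {v \<in> U1. scl v (cnj ` J) \<subseteq> I}"
    using bij_betw_finite[OF bij] finite_unit_maps[OF J] by blast
  have unit_maps: "unit_maps J = {u \<in> U1. scl u J \<subseteq> I}" by (simp add: unit_maps_def)
  have "map_count J = card (rot ` unit_maps J) + card (refl ` {u \<in> U1. scl u (cnj ` J) \<subseteq> I})"
    unfolding map_count_def O_field_image_sub[OF frac_ideal_F[OF J]] unit_maps[symmetric]
  proof (rule card_Un_disjoint)
    show "finite (rot ` unit_maps J)" "finite (refl ` {u \<in> U1. scl u (cnj ` J) \<subseteq> I})"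
      using finite_unit_maps[OF J] fin by blast+
    show "rot ` unit_maps J \<inter> refl ` {u \<in> U1. scl u (cnj ` J) \<subseteq> I} = {}"
      using rot_ne_refl by (auto simp: unit_maps_def)
  qed
  also have "card (rot ` unit_maps J) = card (unit_maps J)"
    by (rule card_image) (auto simp: inj_on_def dest: rot_inj)
  also have "card (refl ` {u \<in> U1. scl u (cnj ` J) \<subseteq> I}) = card (unit_maps J)"
    unfolding card[symmetric] by (rule card_image) (auto simp: inj_on_def dest: refl_inj)
  finally show ?thesis by simp
qed

text \<open>Conjugation preserves the straightened ideal; scaling by a turns it into the reflection
  of a / conj(a).\<close>

lemma ideal_refls_nonempty: assumes "frac_ideal J" "ambiguous J" obtains u where "u \<in> ideal_refls J"
proof -
  obtain a J' where a: "a \<in> F" "a \<noteq> 0" "frac_ideal J'" "cnj ` J' = J'" "J = scl a J'" using ambiguous_straight[OF assms] .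
  have "a / cnj a \<in> U1" using a by (intro U1I) (auto simp: norm_divide)
  moreover have "scl (a / cnj a) (cnj ` J) = J"
    unfolding a(5) cnj_scale a(4) scale_scale using a(2) by simp
  ultimately show ?thesis using that[of "a / cnj a"] unfolding ideal_refls_def by blast
qed

definition class_fiber :: "nat \<Rightarrow> complex set set \<Rightarrow> complex set set" where
  "class_fiber n C = {J \<in> amb_ideals. idx J = n \<and> ideal_class d J = C}"

lemma ambiguous_scale: assumes "ambiguous J" "a \<in> F" "a \<noteq> 0" shows "ambiguous (scl a J)"
proof -
  obtain b where b: "b \<in> F" "b \<noteq> 0" "cnj ` J = scl b J" using assms(1) by (auto simp: ambiguous_def)
  have "cnj ` scl a J = scl (cnj a * b / a) (scl a J)"
    unfolding cnj_scale b(3) scale_scale using assms(3) by simp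
  moreover have "cnj a * b / a \<in> F" "cnj a * b / a \<noteq> 0" using assms b by auto
  ultimately show ?thesis unfolding ambiguous_def by blast
qed

lemma idx_covol: assumes "is_lat J" "J \<subseteq> I" shows "real (idx J) = covol J / covol I"
  unfolding idx_def by (rule lattice_index_covol(2)[OF I_lat assms])

text \<open>Two ideals of one class differ by a factor a, and equal index in I means |a| = 1, so a
  is a rotation into I.\<close>

lemma class_fiber_eq: assumes J: "J \<in> class_fiber n C" shows "class_fiber n C = (\<lambda>u. scl u J) ` unit_maps J"
proof
  have J': "J \<in> amb_ideals" "idx J = n" "ideal_class d J = C" using J by (auto simp: class_fiber_def)
  note f = amb_ideals_D[OF J'(1)]
  have cI: "covol I > 0" by (rule covol_pos[OF I_lat])
  show "class_fiber n C \<subseteq> (\<lambda>u. scl u J) ` unit_maps J"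
  proof
    fix L assume "L \<in> class_fiber n C"
    hence L: "L \<in> amb_ideals" "idx L = n" "ideal_class d L = C" by (auto simp: class_fiber_def)
    note g = amb_ideals_D[OF L(1)]
    have "ideal_class d J = ideal_class d L" using J'(3) L(3) by simp
    then obtain a where a: "a \<in> F" "a \<noteq> 0" "L = scl a J"
      unfolding ideal_class_eq_iff[OF f(1) g(1)] by blast
    have "covol L / covol I = covol J / covol I"
      unfolding idx_covol[OF frac_ideal_lat[OF f(1)] f(2), symmetric] idx_covol[OF frac_ideal_lat[OF g(1)] g(2), symmetric]
      using J'(2) L(2) by simp
    hence "(cmod a)\<^sup>2 * covol J = covol J" using covol_mult[OF frac_ideal_lat[OF f(1)], of a] a(3) cI by simp
    hence "(cmod a)\<^sup>2 = 1" using covol_pos[OF frac_ideal_lat[OF f(1)]] by simp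
    hence "cmod a = 1" by (simp add: power2_eq_1_iff) (use norm_ge_zero[of a] in linarith)
    hence "a \<in> unit_maps J" using a g(2) by (auto simp: unit_maps_def intro!: U1I)
    thus "L \<in> (\<lambda>u. scl u J) ` unit_maps J" using a(3) by blast
  qed
  show "(\<lambda>u. scl u J) ` unit_maps J \<subseteq> class_fiber n C"
  proof
    fix L assume "L \<in> (\<lambda>u. scl u J) ` unit_maps J"
    then obtain u where u: "u \<in> U1" "scl u J \<subseteq> I" "L = scl u J" by (auto simp: unit_maps_def)
    note uF = U1_F[OF u(1)] U1_nz[OF u(1)]
    have fL: "frac_ideal L" unfolding u(3) by (rule frac_ideal_scale[OF f(1) uF])
    have "real (idx L) = real (idx J)"
      using idx_covol[OF frac_ideal_lat[OF f(1)] f(2)] idx_covol[OF frac_ideal_lat[OF fL]] u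
        covol_mult[OF frac_ideal_lat[OF f(1)], of u] U1_norm[OF u(1)] by simp
    moreover have "ideal_class d L = ideal_class d J" unfolding u(3) by (rule ideal_class_scale[OF f(1) uF])
    moreover have "L \<in> amb_ideals" using fL u(2,3) ambiguous_scale[OF f(3) uF] by (simp add: amb_ideals_def)
    ultimately show "L \<in> class_fiber n C" using J' by (simp add: class_fiber_def)
  qed
qed

lemma card_two_to_one:
  assumes "finite A" "\<And>x. x \<in> A \<Longrightarrow> \<exists>y\<in>A. y \<noteq> x \<and> (\<forall>z\<in>A. g z = g x \<longleftrightarrow> z = x \<or> z = y)"
  shows "card A = 2 * card (g ` A)"
proof -
  have "card A = (\<Sum>b\<in>g ` A. card {a \<in> A. g a = b})"
    using sum.image_gen[OF assms(1), of "\<lambda>_. 1::nat" g] by simp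
  also have "\<dots> = (\<Sum>b\<in>g ` A. 2)"
  proof (rule sum.cong)
    fix b assume "b \<in> g ` A"
    then obtain x where x: "x \<in> A" "b = g x" by blast
    obtain y where y: "y \<in> A" "y \<noteq> x" "\<forall>z\<in>A. g z = g x \<longleftrightarrow> z = x \<or> z = y" using assms(2)[OF x(1)] by blast
    have "{a \<in> A. g a = b} = {x, y}" unfolding x(2) using x(1) y(1,3) by blast
    thus "card {a \<in> A. g a = b} = 2" using y(2) by simp
  qed simp
  finally show ?thesis by simp
qed

text \<open>Rotations give the same image of J exactly when they agree up to sign.\<close>

lemma card_unit_maps: assumes J: "J \<in> class_fiber n C" shows "card (unit_maps J) = 2 * card (class_fiber n C)"
  unfolding class_fiber_eq[OF J]
proof (rule card_two_to_one)
  have J': "J \<in> amb_ideals" using J by (auto simp: class_fiber_def)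
  note f = amb_ideals_D[OF J']
  show "finite (unit_maps J)" by (rule finite_unit_maps[OF f(1)])
  fix u assume u: "u \<in> unit_maps J"
  hence u': "u \<in> U1" "scl u J \<subseteq> I" by (auto simp: unit_maps_def)
  have n: "scl (- u) J = scl u J" by (rule scl_neg[OF frac_ideal_addsub[OF f(1)]])
  show "\<exists>y\<in>unit_maps J. y \<noteq> u \<and> (\<forall>z\<in>unit_maps J. scl z J = scl u J \<longleftrightarrow> z = u \<or> z = y)"
  proof (intro bexI[of _ "- u"] conjI ballI)
    show "- u \<in> unit_maps J" using u' n U1_uminus by (simp add: unit_maps_def)
    show "- u \<noteq> u" using U1_nz[OF u'(1)] by simp
    fix z assume "z \<in> unit_maps J"
    hence z: "z \<in> U1" by (simp add: unit_maps_def)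
    show "scl z J = scl u J \<longleftrightarrow> z = u \<or> z = - u"
    proof
      assume eq: "scl z J = scl u J"
      have "scl (z * cnj u) J = scl (cnj u) (scl z J)" unfolding scale_scale
        by (rule arg_cong[where f = "\<lambda>c. scl c J"]) (rule mult.commute)
      also have "\<dots> = scl (u * cnj u) J" unfolding eq scale_scale
        by (rule arg_cong[where f = "\<lambda>c. scl c J"]) (rule mult.commute)
      finally have "scl (z * cnj u) J = J" using U1_cnj[OF u'(1)] by simp
      hence "z * cnj u = 1 \<or> z * cnj u = - 1"
        using scl_sub_self[OF U1_mult[OF z U1_conj[OF u'(1)]] f(1)] by simp
      moreover have "z = (z * cnj u) * u" using U1_cnj[OF u'(1)] by (simp add: mult.assoc mult.commute[of "cnj u"])
      ultimately have "z = 1 * u \<or> z = - 1 * u" by metis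
      thus "z = u \<or> z = - u" by auto
    next
      assume "z = u \<or> z = - u"
      thus "scl z J = scl u J" using n by (elim disjE) (simp_all only:)
    qed
  qed
qed

lemma map_count_class_fiber: assumes J: "J \<in> class_fiber n C" shows "map_count J = 4 * card (class_fiber n C)" "card (class_fiber n C) > 0" "finite (class_fiber n C)"
proof -
  have J': "J \<in> amb_ideals" using J by (auto simp: class_fiber_def)
  note f = amb_ideals_D[OF J']
  obtain u where u: "u \<in> ideal_refls J" using ideal_refls_nonempty[OF f(1,3)] .
  show "map_count J = 4 * card (class_fiber n C)" using map_count_unit_maps[OF f(1) u] card_unit_maps[OF J] by simp
  show fin: "finite (class_fiber n C)" unfolding class_fiber_eq[OF J] using finite_unit_maps[OF f(1)] by blast
  show "card (class_fiber n C) > 0" using fin J by (auto simp: card_gt_0_iff)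
qed

definition amb_classes :: "nat \<Rightarrow> complex set set set" where "amb_classes n = ideal_class d ` {J \<in> amb_ideals. idx J = n}"

lemma class_fiber_nonempty: "C \<in> amb_classes n \<longleftrightarrow> class_fiber n C \<noteq> {}"
  by (auto simp: amb_classes_def class_fiber_def)

lemma amb_classes_ram: "amb_classes n \<subseteq> ram_classes d"
  using ram_classes_iff amb_ideals_D by (auto simp: amb_classes_def)

lemma finite_amb_classes: "finite (amb_classes n)"
  using amb_classes_ram finite_ram_classes by (rule finite_subset)

definition class_index where "class_index = Sigma {1..} amb_classes"

lemma idx_pos: "J \<in> amb_ideals \<Longrightarrow> idx J \<ge> 1"
  using lattice_index_pos[OF I_lat frac_ideal_lat[OF amb_ideals_D(1)] amb_ideals_D(2)] by (fastforce simp: idx_def)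

text \<open>A fibre with N ideals has N equal terms with denominator 4N and contributes h/4,
  whatever N is.\<close>

lemma sum_amb_ideals:
  fixes h :: "nat \<times> complex set set \<Rightarrow> complex"
  assumes h: "h summable_on class_index"
  shows "(\<lambda>J. h (idx J, ideal_class d J) / of_nat (map_count J)) summable_on amb_ideals"
    "infsum (\<lambda>J. h (idx J, ideal_class d J) / of_nat (map_count J)) amb_ideals = infsum h class_index / 4"
proof -
  let ?f = "\<lambda>J. h (idx J, ideal_class d J) / of_nat (map_count J)"
  let ?S = "Sigma class_index (\<lambda>(n, C). class_fiber n C)"
  have bij: "bij_betw snd ?S amb_ideals"
    unfolding bij_betw_def
  proof
    show "inj_on snd ?S" by (auto simp: inj_on_def class_fiber_def)
    show "snd ` ?S = amb_ideals"
    proof (intro equalityI subsetI)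
      fix J assume J: "J \<in> amb_ideals"
      have "((idx J, ideal_class d J), J) \<in> ?S"
        using J idx_pos[OF J] by (auto simp: class_index_def class_fiber_def amb_classes_def)
      thus "J \<in> snd ` ?S" by (rule image_eqI[rotated]) simp
    qed (auto simp: class_fiber_def)
  qed
  have val: "?f J = h x / of_nat (4 * card (class_fiber (fst x) (snd x)))" if "x \<in> class_index" "J \<in> (\<lambda>(n, C). class_fiber n C) x" for x J
  proof -
    obtain n C where x: "x = (n, C)" by fastforce
    have J: "J \<in> class_fiber n C" using that(2) by (simp add: x)
    have "idx J = n" "ideal_class d J = C" using J by (auto simp: class_fiber_def)
    thus ?thesis using map_count_class_fiber(1)[OF J] by (simp add: x)
  qed
  have fin: "finite ((\<lambda>(n, C). class_fiber n C) x)" "card (class_fiber (fst x) (snd x)) > 0" if x: "x \<in> class_index" for x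
  proof -
    obtain n C where nC: "x = (n, C)" by fastforce
    hence "C \<in> amb_classes n" using x by (auto simp: class_index_def)
    then obtain J where "J \<in> class_fiber n C" using class_fiber_nonempty by blast
    thus "finite ((\<lambda>(n, C). class_fiber n C) x)" "card (class_fiber (fst x) (snd x)) > 0" using map_count_class_fiber nC by auto
  qed
  have s1: "infsum (\<lambda>J. norm (?f J)) ((\<lambda>(n, C). class_fiber n C) x) = norm (h x) / 4" if x: "x \<in> class_index" for x
  proof -
    have "infsum (\<lambda>J. norm (?f J)) ((\<lambda>(n, C). class_fiber n C) x) = (\<Sum>J\<in>(\<lambda>(n, C). class_fiber n C) x. norm (h x) / (4 * real (card (class_fiber (fst x) (snd x)))))"
      unfolding infsum_finite[OF fin(1)[OF x]] by (rule sum.cong) (simp_all add: val[OF x] norm_divide)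
    also have "\<dots> = norm (h x) / 4" using fin(2)[OF x] by (simp add: case_prod_beta)
    finally show ?thesis .
  qed
  have s2: "infsum ?f ((\<lambda>(n, C). class_fiber n C) x) = h x / 4" if x: "x \<in> class_index" for x
  proof -
    have "infsum ?f ((\<lambda>(n, C). class_fiber n C) x) = (\<Sum>J\<in>(\<lambda>(n, C). class_fiber n C) x. h x / of_nat (4 * card (class_fiber (fst x) (snd x))))"
      unfolding infsum_finite[OF fin(1)[OF x]] by (rule sum.cong) (simp_all only: val[OF x])
    also have "\<dots> = h x / 4" using fin(2)[OF x] by (simp add: case_prod_beta)
    finally show ?thesis .
  qed
  have hn: "(\<lambda>x. norm (h x) / 4) summable_on class_index"
    using summable_on_cmult_left[of "\<lambda>x. norm (h x)" class_index "1 / 4"] h[unfolded summable_on_iff_abs_summable_on_complex] by simp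
  have sS: "(\<lambda>z. ?f (snd z)) summable_on ?S"
    unfolding complex_summable_Sigma
  proof
    show "\<forall>x\<in>class_index. (\<lambda>y. ?f (snd (x, y))) summable_on (\<lambda>(n, C). class_fiber n C) x"
      using fin(1) by (auto intro: summable_on_finite)
    have "(\<lambda>x. infsum (\<lambda>y. norm (?f (snd (x, y)))) ((\<lambda>(n, C). class_fiber n C) x)) summable_on class_index \<longleftrightarrow> (\<lambda>x. norm (h x) / 4) summable_on class_index"
      by (rule summable_on_cong) (simp only: snd_conv s1)
    thus "(\<lambda>x. infsum (\<lambda>y. norm (?f (snd (x, y)))) ((\<lambda>(n, C). class_fiber n C) x)) summable_on class_index" using hn by blast
  qed
  show "?f summable_on amb_ideals" using sS summable_on_reindex_bij_betw[OF bij, of ?f] by blast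
  have "infsum ?f amb_ideals = infsum (\<lambda>z. ?f (snd z)) ?S" by (rule infsum_reindex_bij_betw[OF bij, symmetric])
  also have "\<dots> = infsum (\<lambda>x. infsum (\<lambda>y. ?f (snd (x, y))) ((\<lambda>(n, C). class_fiber n C) x)) class_index"
    by (rule infsum_Sigma_banach[OF sS, symmetric])
  also have "\<dots> = infsum (\<lambda>x. h x / 4) class_index" by (rule infsum_cong) (simp only: snd_conv s2)
  also have "\<dots> = infsum h class_index / 4" using infsum_cmult_left'[of h "1 / 4" class_index] by simp
  finally show "infsum ?f amb_ideals = infsum h class_index / 4" .
qed

text \<open>The value W(C) as the parity sums deliver it, before simplification. It depends on C
  only for d = 3 mod 4, through the shape of the ideal.\<close>

definition class_weight :: "complex \<Rightarrow> complex set set \<Rightarrow> complex" where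
  "class_weight s C = zeta_factor s * (if d mod 4 = 1 then neg_pow s 2 + (1 - neg_pow s 2) / (1 + neg_pow s 2) + neg_pow s 4 * (2 * neg_pow s 2 / (1 + neg_pow s 2))
     else if d mod 4 = 2 then 1 + neg_pow s 2
     else if C \<in> ortho_classes d then 1 + neg_pow s 2 * (2 * neg_pow s 2 / (1 + neg_pow s 2))
     else (1 - neg_pow s 2) / (1 + neg_pow s 2))"

text \<open>Conjugating complex conjugation by multiplication with a yields the reflection of a /
  conj(a).\<close>

lemma conj_lats_scale:
  assumes a: "a \<noteq> 0" shows "refl_lats (scl a J) (a / cnj a) = scl a ` conj_lats J"
proof -
  have eq: "scl a K \<in> refl_lats (scl a J) (a / cnj a) \<longleftrightarrow> K \<in> conj_lats J" for K
  proof -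
    have 1: "is_lat (scl a K) \<longleftrightarrow> is_lat K"
    proof
      assume "is_lat (scl a K)"
      hence *: "is_lat (scl (inverse a) (scl a K))" using a by (intro is_lat_mult[of "inverse a" "scl a K"]) simp_all
      have e: "scl (inverse a) (scl a K) = K" unfolding scale_scale using a by simp
      show "is_lat K" using * unfolding e .
    qed (rule is_lat_mult[OF a])
    have 2: "scl (a / cnj a) (cnj ` scl a K) = scl a (cnj ` K)"
      unfolding cnj_scale scale_scale using a by simp
    have 3: "scl a A = scl a B \<longleftrightarrow> A = B" for A B using scale_inj[OF a] by blast
    have 4: "scl a A \<subseteq> scl a B \<longleftrightarrow> A \<subseteq> B" for A B
      using a by (intro inj_image_subset_iff) (auto simp: inj_def)
    show ?thesis unfolding refl_lats_def conj_lats_def mem_Collect_eq 1 2 3 4 Ok_span_scale by blast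
  qed
  have "K \<in> scl a ` conj_lats J" if "K \<in> refl_lats (scl a J) (a / cnj a)" for K
  proof -
    have e: "scl a (scl (inverse a) K) = K" unfolding scale_scale using a by simp
    have "scl (inverse a) K \<in> conj_lats J" using that eq[of "scl (inverse a) K"] unfolding e by blast
    hence "scl a (scl (inverse a) K) \<in> scl a ` conj_lats J" by (rule imageI)
    thus ?thesis unfolding e .
  qed
  thus ?thesis using eq by blast
qed

lemma has_sum_scale:
  assumes a: "a \<noteq> 0" and J: "is_lat J" and s: "((\<lambda>K. neg_pow s (lattice_index J K)) has_sum x) (conj_lats J)"
  shows "((\<lambda>K. neg_pow s (lattice_index (scl a J) K)) has_sum x) (refl_lats (scl a J) (a / cnj a))"
proof -
  have inj: "inj_on (scl a) (conj_lats J)" by (rule inj_onI) (rule scale_inj[OF a])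
  have "neg_pow s (lattice_index (scl a J) (scl a K)) = neg_pow s (lattice_index J K)" if "K \<in> conj_lats J" for K
  proof -
    have K: "is_lat K" "K \<subseteq> J" using that by (auto simp: conj_lats_def)
    have "real (lattice_index (scl a J) (scl a K)) = real (lattice_index J K)"
      using lattice_index_covol(2)[OF J K] lattice_index_covol(2)[OF is_lat_mult[OF a J] is_lat_mult[OF a K(1)] scale_mono[OF K(2)]]
      by (simp add: covol_mult[OF J] covol_mult[OF K(1)] a)
    thus ?thesis by (simp only: of_nat_eq_iff)
  qed
  hence "((\<lambda>K. neg_pow s (lattice_index (scl a J) (scl a K))) has_sum x) (conj_lats J) \<longleftrightarrow> ((\<lambda>K. neg_pow s (lattice_index J K)) has_sum x) (conj_lats J)"
    by (rule has_sum_cong)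
  hence "(((\<lambda>K. neg_pow s (lattice_index (scl a J) K)) \<circ> scl a) has_sum x) (conj_lats J)" using s by (simp add: o_def)
  thus ?thesis unfolding conj_lats_scale[OF a] has_sum_reindex[OF inj] .
qed

lemma refl_lats_neg: assumes "u \<in> U1" shows "refl_lats J (- u) = refl_lats J u"
  unfolding refl_lats_def
proof (rule Collect_cong)
  fix K
  show "is_lat K \<and> scl (- u) (cnj ` K) = K \<and> K \<subseteq> J \<and> Ok_span K = J \<longleftrightarrow>
    is_lat K \<and> scl u (cnj ` K) = K \<and> K \<subseteq> J \<and> Ok_span K = J"
  proof (cases "is_lat K")
    case True
    show ?thesis unfolding scl_neg[OF addsub_image_cnj[OF is_lat_addsub[OF True]]] ..
  qed blast
qed

lemma has_sum_refl_lats: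
  assumes J: "frac_ideal J" "ambiguous J" and u: "u \<in> ideal_refls J" and s: "Re s > 1"
  shows "((\<lambda>K. neg_pow s (lattice_index J K)) has_sum class_weight s (ideal_class d J)) (refl_lats J u)"
proof -
  obtain a m where a: "a \<in> F" "a \<noteq> 0" "m > 0" "m dvd d" and
    c: "J = scl a (rect m) \<and> frac_ideal (rect m) \<and> d mod 4 \<noteq> 1 \<or> J = scl a (cent m) \<and> frac_ideal (cent m) \<and> d mod 4 \<noteq> 2"
    using ambiguous_types[OF J] by metis
  obtain e where "d = m * e" using a(4) by blast
  hence "d = - (m * (- e))" by simp
  then interpret q: quad_split d m "- e" by unfold_locales (use a in auto)
  have u0: "a / cnj a \<in> U1" using a by (intro U1I) (auto simp: norm_divide)
  have cRR: "cnj ` rect m = rect m" using q.cnj_rect_sub[of 1 1] by (simp add: q.rect_sub_def)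
  have cCC: "cnj ` cent m = cent m" using q.cnj_cent_sub[of 1 1] by (simp add: q.cent_sub_def)
  have main: "((\<lambda>K. neg_pow s (lattice_index J K)) has_sum class_weight s (ideal_class d J)) (refl_lats J (a / cnj a)) \<and> a / cnj a \<in> ideal_refls J"
    using c
  proof
    assume R: "J = scl a (rect m) \<and> frac_ideal (rect m) \<and> d mod 4 \<noteq> 1"
    hence cl: "ideal_class d J = ideal_class d (rect m)" using ideal_class_scale a by blast
    have "((\<lambda>K. neg_pow s (lattice_index (rect m) K)) has_sum class_weight s (ideal_class d J)) (conj_lats (rect m))"
    proof (cases "d mod 4 = 2")
      case True thus ?thesis using q.has_sum_rect_2[OF True s] by (simp add: class_weight_def mult.commute)
    next
      case False
      hence d3: "d mod 4 = 3" using R d_mod4 by blast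
      thus ?thesis using q.has_sum_rect_3[OF d3 s] class_rect_ortho[OF d3 a(3,4)] by (simp add: class_weight_def mult.commute cl)
    qed
    hence "((\<lambda>K. neg_pow s (lattice_index J K)) has_sum class_weight s (ideal_class d J)) (refl_lats J (a / cnj a))"
      using has_sum_scale[OF a(2) q.rect_lat] R by blast
    moreover have "scl (a / cnj a) (cnj ` scl a (rect m)) = scl a (rect m)"
      unfolding cnj_scale cRR scale_scale using a(2) by simp
    ultimately show ?thesis using u0 R by (simp add: ideal_refls_def)
  next
    assume R: "J = scl a (cent m) \<and> frac_ideal (cent m) \<and> d mod 4 \<noteq> 2"
    hence cl: "ideal_class d J = ideal_class d (cent m)" using ideal_class_scale a by blast
    have "((\<lambda>K. neg_pow s (lattice_index (cent m) K)) has_sum class_weight s (ideal_class d J)) (conj_lats (cent m))"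
    proof (cases "d mod 4 = 1")
      case True
      have "frac_ideal (cent m)" using R by blast
      thus ?thesis using q.has_sum_cent_1[OF True s] True by (simp add: class_weight_def mult.commute)
    next
      case False
      hence d3: "d mod 4 = 3" using R d_mod4 by blast
      have "frac_ideal (cent m)" using R by blast
      hence "ideal_class d J \<notin> ortho_classes d"
        unfolding cl by (rule class_cent_not_ortho[OF d1 d3 a(3,4)])
      thus ?thesis using q.has_sum_cent_3[OF d3 s] d3 by (simp add: class_weight_def mult.commute)
    qed
    hence "((\<lambda>K. neg_pow s (lattice_index J K)) has_sum class_weight s (ideal_class d J)) (refl_lats J (a / cnj a))"
      using has_sum_scale[OF a(2) q.cent_lat] R by blast
    moreover have "scl (a / cnj a) (cnj ` scl a (cent m)) = scl a (cent m)"
      unfolding cnj_scale cCC scale_scale using a(2) by simp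
    ultimately show ?thesis using u0 R by (simp add: ideal_refls_def)
  qed
  have "u = a / cnj a \<or> u = - (a / cnj a)" using ideal_refls_pm(1)[OF J(1)] main u by blast
  thus ?thesis
  proof
    assume e: "u = a / cnj a"
    show ?thesis unfolding e using main by blast
  next
    assume e: "u = - (a / cnj a)"
    show ?thesis unfolding e refl_lats_neg[OF u0] using main by blast
  qed
qed

text \<open>J is determined by K, but carrying it along allows summation over J first. The component
  u is the parameter of the reflection.\<close>

definition refl_triples where "refl_triples = Sigma amb_ideals (\<lambda>J. Sigma (ideal_refls J) (refl_lats J))"

definition triple_term :: "complex \<Rightarrow> complex set \<times> complex \<times> complex set \<Rightarrow> complex" where
  "triple_term s = (\<lambda>(J, u, K). neg_pow s (idx J) * neg_pow s (lattice_index J K) / of_nat (map_count J))"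

text \<open>Reduces absolute summability at s to summability at the real point Re s, where the sums
  are already evaluated.\<close>

lemma norm_triple_term: "complex_of_real (norm (triple_term s y)) = triple_term (of_real (Re s)) y"
proof -
  obtain J u K where y: "y = (J, u, K)" by (metis prod_cases3)
  have r: "complex_of_real (norm (neg_pow s n)) = neg_pow (of_real (Re s)) n" for n
    unfolding norm_neg_pow unfolding neg_pow_def using powr_of_real[of "real n" "- Re s"] by simp
  show ?thesis by (simp add: y triple_term_def norm_mult norm_divide r)
qed

lemma fiber_sum:
  assumes J: "J \<in> amb_ideals" and s: "Re s > 1"
  shows "((\<lambda>z. triple_term s (J, z)) has_sum (2 * neg_pow s (idx J) * class_weight s (ideal_class d J) / of_nat (map_count J))) (Sigma (ideal_refls J) (refl_lats J))"
proof -
  note f = amb_ideals_D[OF J]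
  obtain u where u: "u \<in> ideal_refls J" using ideal_refls_nonempty[OF f(1,3)] .
  note R = ideal_refls_pm[OF f(1) u]
  let ?c = "neg_pow s (idx J) / of_nat (map_count J)"
  let ?x = "?c * class_weight s (ideal_class d J)"
  have 1: "((\<lambda>z. triple_term s (J, z)) has_sum ?x) (Pair v ` refl_lats J v)" if v: "v \<in> ideal_refls J" for v
  proof -
    have "((\<lambda>K. ?c * neg_pow s (lattice_index J K)) has_sum ?x) (refl_lats J v)"
      by (rule has_sum_cmult_right[OF has_sum_refl_lats[OF f(1,3) v s]])
    hence "(((\<lambda>z. triple_term s (J, z)) \<circ> Pair v) has_sum ?x) (refl_lats J v)" by (simp add: triple_term_def o_def)
    thus ?thesis by (subst has_sum_reindex) (auto simp: inj_on_def)
  qed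
  \<comment> \<open>The two reflections u and -u have the same stable lattices, which accounts for
    the factor 2.\<close>
  have "- u \<in> ideal_refls J" using R by simp
  hence "((\<lambda>z. triple_term s (J, z)) has_sum (?x + ?x)) (Pair u ` refl_lats J u \<union> Pair (- u) ` refl_lats J (- u))"
    using R(2) by (intro has_sum_Un_disjoint 1 u) auto
  moreover have "Pair u ` refl_lats J u \<union> Pair (- u) ` refl_lats J (- u) = Sigma (ideal_refls J) (refl_lats J)"
    unfolding R(1) by auto
  moreover have "?x + ?x = 2 * neg_pow s (idx J) * class_weight s (ideal_class d J) / of_nat (map_count J)" by simp
  ultimately show ?thesis by (simp only:)
qed

definition class_term :: "complex \<Rightarrow> nat \<times> complex set set \<Rightarrow> complex" where
  "class_term s = (\<lambda>(n, C). 2 * neg_pow s n * class_weight s C)"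

lemma class_term_summable: assumes "Re s > 1" shows "class_term s summable_on class_index"
proof -
  have "(\<lambda>(n, C). neg_pow s n * (2 * class_weight s C)) summable_on {1..} \<times> ram_classes d"
    using neg_pow_summable[OF assms] finite_ram_classes by (intro summable_prod(1)) simp_all
  moreover have "(\<lambda>(n, C). neg_pow s n * (2 * class_weight s C)) = class_term s" by (auto simp: class_term_def)
  moreover have "class_index \<subseteq> {1..} \<times> ram_classes d" using amb_classes_ram by (auto simp: class_index_def)
  ultimately show ?thesis using summable_on_subset_banach by metis
qed

lemma triple_term_summable: assumes s: "Re s > 1"
  shows "triple_term s summable_on refl_triples" "infsum (triple_term s) refl_triples = infsum (class_term s) class_index / 4"
proof -
  let ?r = "complex_of_real (Re s)"
  have r: "Re ?r > 1" using s by simp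
  \<comment> \<open>The fibrewise sums of norms are the closed form of \<open>fiber_sum\<close> at
    the real point.\<close>
  have nrm: "infsum (\<lambda>y. norm (triple_term s (J, y))) (Sigma (ideal_refls J) (refl_lats J)) = Re (class_term ?r (idx J, ideal_class d J) / of_nat (map_count J))"
    if "J \<in> amb_ideals" for J
  proof -
    have "((\<lambda>z. Re (triple_term ?r (J, z))) has_sum Re (2 * neg_pow ?r (idx J) * class_weight ?r (ideal_class d J) / of_nat (map_count J))) (Sigma (ideal_refls J) (refl_lats J))"
      by (rule has_sum_Re[OF fiber_sum[OF that r]])
    moreover have "Re (triple_term ?r (J, z)) = norm (triple_term s (J, z))" for z unfolding norm_triple_term[symmetric] by simp
    ultimately show ?thesis by (simp add: infsumI class_term_def)
  qed
  have "(\<lambda>J. Re (class_term ?r (idx J, ideal_class d J) / of_nat (map_count J))) summable_on amb_ideals"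
    by (rule summable_on_Re[OF sum_amb_ideals(1)[OF class_term_summable[OF r]]])
  hence n: "(\<lambda>J. infsum (\<lambda>y. norm (triple_term s (J, y))) (Sigma (ideal_refls J) (refl_lats J))) summable_on amb_ideals"
    using summable_on_cong[of amb_ideals "\<lambda>J. infsum (\<lambda>y. norm (triple_term s (J, y))) (Sigma (ideal_refls J) (refl_lats J))", OF nrm] by blast
  have fs: "\<forall>J\<in>amb_ideals. (\<lambda>y. triple_term s (J, y)) summable_on Sigma (ideal_refls J) (refl_lats J)"
    using fiber_sum[OF _ s] by (auto simp: summable_on_def)
  show g: "triple_term s summable_on refl_triples" unfolding refl_triples_def
    by (rule complex_summable_Sigma[THEN iffD2, OF conjI]) (rule fs, rule n)
  have "infsum (triple_term s) refl_triples = infsum (\<lambda>J. infsum (\<lambda>y. triple_term s (J, y)) (Sigma (ideal_refls J) (refl_lats J))) amb_ideals"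
    using g unfolding refl_triples_def by (rule infsum_Sigma_banach[symmetric])
  also have "\<dots> = infsum (\<lambda>J. class_term s (idx J, ideal_class d J) / of_nat (map_count J)) amb_ideals"
    by (rule infsum_cong) (simp add: infsumI[OF fiber_sum[OF _ s]] class_term_def)
  also have "\<dots> = infsum (class_term s) class_index / 4" by (rule sum_amb_ideals(2)[OF class_term_summable[OF s]])
  finally show "infsum (triple_term s) refl_triples = infsum (class_term s) class_index / 4" .
qed

section \<open>Passage to the reflection zeta function\<close>

definition refl_pairs where "refl_pairs = Sigma (O_minus d) (stable_sublattices I)"

definition to_pair :: "complex set \<times> complex \<times> complex set \<Rightarrow> (complex \<Rightarrow> complex) \<times> complex set" where
  "to_pair = (\<lambda>(J, u, K). (refl u, K))"

lemma stable_iff: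
  assumes "u \<in> U1"
  shows "K \<in> stable_sublattices I (refl u) \<longleftrightarrow> is_lat K \<and> K \<subseteq> I \<and> scl u (cnj ` K) = K"
proof -
  have 1: "finite_index_sublattice I K \<longleftrightarrow> is_lat K \<and> K \<subseteq> I"
    using finite_index_is_lat[OF I_lat] lattice_index_covol(1)[OF I_lat] by blast
  show ?thesis
  proof (cases "K \<subseteq> I")
    case True
    hence "refl u ` K = scl u (cnj ` K)"
      using refl_image[of K u] I_F by (simp add: image_image order_trans[OF True])
    thus ?thesis unfolding stable_sublattices_def mem_Collect_eq 1 by simp
  qed (use 1 in \<open>auto simp: stable_sublattices_def\<close>)
qed

text \<open>The ideal is recovered as \<open>Ok_span K\<close> and u as the value of the reflection
  at 1. Every stable lattice occurs, because the ideal it generates is stable under the same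
  reflection and hence ambiguous.\<close>

lemma to_pair_bij: "bij_betw to_pair refl_triples refl_pairs"
  unfolding bij_betw_def
proof
  show "inj_on to_pair refl_triples"
  proof (rule inj_onI)
    fix y y' assume y: "y \<in> refl_triples" and y': "y' \<in> refl_triples" and eq: "to_pair y = to_pair y'"
    obtain J u K where 1: "y = (J, u, K)" by (metis prod_cases3)
    obtain J' u' K' where 2: "y' = (J', u', K')" by (metis prod_cases3)
    have "refl u = refl u'" "K = K'" using eq by (simp_all add: to_pair_def 1 2)
    moreover have "Ok_span K = J" "Ok_span K' = J'" using y y' by (simp_all add: 1 2 refl_triples_def refl_lats_def)
    ultimately show "y = y'" using refl_inj 1 2 by blast
  qed
  show "to_pair ` refl_triples = refl_pairs"
  proof (intro equalityI subsetI)
    fix x assume "x \<in> to_pair ` refl_triples"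
    then obtain J u K where y: "(J, u, K) \<in> refl_triples" "x = (refl u, K)" by (auto simp: to_pair_def)
    have "J \<subseteq> I" "u \<in> U1" "is_lat K" "scl u (cnj ` K) = K" "K \<subseteq> J"
      using y(1) by (auto simp: refl_triples_def amb_ideals_def ideal_refls_def refl_lats_def)
    thus "x \<in> refl_pairs" unfolding y(2) refl_pairs_def O_minus_eq using stable_iff by blast
  next
    fix x assume "x \<in> refl_pairs"
    then obtain u K where x: "x = (refl u, K)" "u \<in> U1" "K \<in> stable_sublattices I (refl u)"
      by (auto simp: refl_pairs_def O_minus_eq)
    hence K: "is_lat K" "K \<subseteq> I" "scl u (cnj ` K) = K" using stable_iff by blast+
    note f = Ok_span_frac_ideal[OF K(1,2) I_fi]
    have e: "scl u (cnj ` Ok_span K) = Ok_span K"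
      unfolding Ok_span_cnj[OF is_lat_addsub[OF K(1)], symmetric] Ok_span_scale[symmetric] K(3) ..
    have u0: "u \<noteq> 0" "u \<in> F" using x(2) U1_nz U1_F by auto
    have "scl (inverse u) (Ok_span K) = scl (inverse u) (scl u (cnj ` Ok_span K))" unfolding e ..
    also have "\<dots> = cnj ` Ok_span K" unfolding scale_scale using u0 by simp
    finally have "ambiguous (Ok_span K)" unfolding ambiguous_def using u0 by (intro bexI[of _ "inverse u"]) auto
    hence "(Ok_span K, u, K) \<in> refl_triples"
      using f e x(2) K Ok_span_base[OF is_lat_addsub[OF K(1)]] by (auto simp: refl_triples_def amb_ideals_def ideal_refls_def refl_lats_def)
    thus "x \<in> to_pair ` refl_triples" unfolding x(1) by (intro image_eqI[of _ _ "(Ok_span K, u, K)"]) (simp_all add: to_pair_def)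
  qed
qed

lemma term_triple_term: assumes "y \<in> refl_triples" shows "lattice_zeta_term d I s (snd (to_pair y)) = triple_term s y"
proof -
  obtain J u K where y: "y = (J, u, K)" by (metis prod_cases3)
  have *: "frac_ideal J" "J \<subseteq> I" "is_lat K" "K \<subseteq> J" "Ok_span K = J" using assms by (auto simp: y refl_triples_def amb_ideals_def refl_lats_def)
  have ix: "lattice_index I K = idx J * lattice_index J K"
    unfolding idx_def by (rule lattice_index_mult[OF I_lat frac_ideal_lat[OF *(1)] *(3,4,2)])
  have "of_nat (lattice_index I K) powr (- s) = neg_pow s (idx J) * neg_pow s (lattice_index J K)"
    unfolding neg_pow_def[symmetric] ix neg_pow_mult ..
  moreover have "card {\<sigma> \<in> O_field d. \<sigma> ` K \<subseteq> I} = map_count J"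
    using map_count_Ok_span[OF *(3)] * by (auto simp: map_count_def)
  ultimately show ?thesis
    unfolding y to_pair_def lattice_zeta_term_def triple_term_def by (simp only: prod.case snd_conv)
qed

lemma Refl_sum:
  assumes s: "Re s > 1" shows "Refl_converges d I s" "Refl_zeta d I s = infsum (class_term s) class_index / 4"
proof -
  let ?t = "\<lambda>x. lattice_zeta_term d I s (snd x)"
  have "(\<lambda>y. ?t (to_pair y)) summable_on refl_triples \<longleftrightarrow> triple_term s summable_on refl_triples"
    by (rule summable_on_cong) (rule term_triple_term)
  hence "(\<lambda>y. ?t (to_pair y)) summable_on refl_triples" using triple_term_summable(1)[OF s] by blast
  hence t: "?t summable_on refl_pairs" using summable_on_reindex_bij_betw[OF to_pair_bij, of ?t] by blast
  have eq: "(\<lambda>(\<rho>, K). lattice_zeta_term d I s K) = ?t" by (auto simp: fun_eq_iff)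
  have t': "(\<lambda>(\<rho>, K). lattice_zeta_term d I s K) summable_on Sigma (O_minus d) (stable_sublattices I)"
    using t unfolding refl_pairs_def eq .
  have "(\<forall>\<rho>\<in>O_minus d. (\<lambda>K. ?t (\<rho>, K)) summable_on stable_sublattices I \<rho>) \<and>
      (\<lambda>\<rho>. infsum (\<lambda>K. norm (?t (\<rho>, K))) (stable_sublattices I \<rho>)) summable_on O_minus d"
    using t unfolding refl_pairs_def by (rule complex_summable_Sigma[THEN iffD1])
  hence "\<forall>\<rho>\<in>O_minus d. lattice_zeta_term d I s summable_on stable_sublattices I \<rho>" by simp
  moreover have "(\<lambda>\<rho>. lattice_zeta d I \<rho> s) summable_on O_minus d"
    unfolding lattice_zeta_def using summable_on_Sigma_banach[OF t'] by simp
  ultimately show "Refl_converges d I s" by (simp add: Refl_converges_def)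
  have "Refl_zeta d I s = infsum ?t refl_pairs"
    unfolding Refl_zeta_def lattice_zeta_def refl_pairs_def
    using infsum_Sigma'_banach[OF t'] unfolding eq .
  also have "\<dots> = infsum (\<lambda>y. ?t (to_pair y)) refl_triples" by (rule infsum_reindex_bij_betw[OF to_pair_bij, symmetric])
  also have "\<dots> = infsum (triple_term s) refl_triples" by (rule infsum_cong) (rule term_triple_term)
  also have "\<dots> = infsum (class_term s) class_index / 4" by (rule triple_term_summable(2)[OF s])
  finally show "Refl_zeta d I s = infsum (class_term s) class_index / 4" .
qed

section \<open>The Dirichlet series of the class counts\<close>

lemma class_count_amb_classes: assumes "S \<subseteq> ram_classes d" shows "class_count d I S n = card (amb_classes n \<inter> S)"
proof -
  have "{ideal_class d J | J. frac_ideal J \<and> J \<subseteq> I \<and> lattice_index I J = n \<and> ideal_class d J \<in> S} = amb_classes n \<inter> S"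
    using ram_classes_iff assms by (auto simp: amb_classes_def amb_ideals_def idx_def)
  thus ?thesis by (simp add: class_count_def fractional_ideal_iff_frac_ideal)
qed

lemma ambiguous_amb_classes: "ambiguous_class_count d I n = card (amb_classes n)"
proof -
  have "{ideal_class d J | J. frac_ideal J \<and> J \<subseteq> I \<and> lattice_index I J = n \<and> ideal_class d J = ideal_class d (cnj ` J)} = amb_classes n"
    using ambiguous_iff by (auto simp: amb_classes_def amb_ideals_def idx_def)
  thus ?thesis by (simp add: ambiguous_class_count_def fractional_ideal_iff_frac_ideal)
qed

lemma count_converges:
  assumes s: "Re s > 1" shows "(\<lambda>n. of_nat (card (amb_classes n \<inter> S)) * neg_pow s n) summable_on {1..}"
proof -
  let ?M = "of_nat (card (ram_classes d)) :: complex"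
  have "(\<lambda>n. ?M * neg_pow s n) summable_on {1..}"
    by (intro summable_on_cmult_right neg_pow_summable s)
  hence "(\<lambda>n. ?M * neg_pow s n) abs_summable_on {1..}" by (simp only: summable_on_iff_abs_summable_on_complex)
  hence "(\<lambda>n. of_nat (card (amb_classes n \<inter> S)) * neg_pow s n) abs_summable_on {1..}"
  proof (rule abs_summable_on_comparison_test)
    fix n :: nat
    have "card (amb_classes n \<inter> S) \<le> card (ram_classes d)"
      using amb_classes_ram by (intro card_mono finite_ram_classes) blast
    thus "norm (of_nat (card (amb_classes n \<inter> S)) * neg_pow s n) \<le> norm (?M * neg_pow s n)"
      by (simp add: norm_mult mult_right_mono)
  qed
  thus ?thesis by (simp only: summable_on_iff_abs_summable_on_complex)
qed

text \<open>Two values of the weight are enough: constant weights are the case x = y, and for d = 3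
  mod 4 the set S is \<open>ortho_classes d\<close>.\<close>

lemma infsum_class_term:
  assumes s: "Re s > 1" and V: "\<And>C. C \<in> ram_classes d \<Longrightarrow> class_weight s C = (if C \<in> S then x else y)"
  shows "infsum (class_term s) class_index = 2 * x * infsum (\<lambda>n. of_nat (card (amb_classes n \<inter> S)) * neg_pow s n) {1..}
      + 2 * y * infsum (\<lambda>n. of_nat (card (amb_classes n \<inter> - S)) * neg_pow s n) {1..}"
proof -
  have inner: "infsum (\<lambda>C. class_term s (n, C)) (amb_classes n) =
      2 * x * (of_nat (card (amb_classes n \<inter> S)) * neg_pow s n) + 2 * y * (of_nat (card (amb_classes n \<inter> - S)) * neg_pow s n)" for n
  proof -
    have "infsum (\<lambda>C. class_term s (n, C)) (amb_classes n) = (\<Sum>C\<in>amb_classes n. if C \<in> S then 2 * neg_pow s n * x else 2 * neg_pow s n * y)"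
      unfolding infsum_finite[OF finite_amb_classes]
    proof (rule sum.cong)
      fix C assume "C \<in> amb_classes n"
      hence "C \<in> ram_classes d" using amb_classes_ram by blast
      thus "class_term s (n, C) = (if C \<in> S then 2 * neg_pow s n * x else 2 * neg_pow s n * y)" using V by (simp add: class_term_def)
    qed simp
    also have "\<dots> = (\<Sum>C\<in>amb_classes n \<inter> S. 2 * neg_pow s n * x) + (\<Sum>C\<in>amb_classes n \<inter> - S. 2 * neg_pow s n * y)"
      using sum.If_cases[OF finite_amb_classes, of "\<lambda>C. C \<in> S" "\<lambda>_. 2 * neg_pow s n * x" "\<lambda>_. 2 * neg_pow s n * y" n] by simp
    finally show ?thesis by (simp add: algebra_simps)
  qed
  have "infsum (class_term s) class_index = infsum (\<lambda>n. infsum (\<lambda>C. class_term s (n, C)) (amb_classes n)) {1..}"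
    using class_term_summable[OF s] unfolding class_index_def by (rule infsum_Sigma_banach[symmetric])
  also have "\<dots> = infsum (\<lambda>n. 2 * x * (of_nat (card (amb_classes n \<inter> S)) * neg_pow s n)) {1..}
      + infsum (\<lambda>n. 2 * y * (of_nat (card (amb_classes n \<inter> - S)) * neg_pow s n)) {1..}"
    unfolding inner by (intro infsum_add summable_on_cmult_right count_converges s)
  finally show ?thesis by (simp only: infsum_cmult_right')
qed

lemma two_powr: "2 powr (- s) = neg_pow s 2" "2 powr (- 2 * s) = neg_pow s 2 * neg_pow s 2"
proof -
  show "2 powr (- s) = neg_pow s 2" by (simp add: neg_pow_def)
  have "(2::complex) powr (- 2 * s) = 2 powr (- s + - s)" by simp
  also have "\<dots> = neg_pow s 2 * neg_pow s 2" unfolding powr_add by (simp add: neg_pow_def)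
  finally show "2 powr (- 2 * s) = neg_pow s 2 * neg_pow s 2" .
qed

lemma dirichlet_amb_classes:
  assumes "\<And>n. c n = card (amb_classes n \<inter> S)"
  shows "dirichlet_series c s = infsum (\<lambda>n. of_nat (card (amb_classes n \<inter> S)) * neg_pow s n) {1..}"
    "dirichlet_converges c s \<longleftrightarrow> (\<lambda>n. of_nat (card (amb_classes n \<inter> S)) * neg_pow s n) summable_on {1..}"
  unfolding dirichlet_series_def dirichlet_converges_def neg_pow_def assms by (rule refl)+

lemma neg_pow_4: "neg_pow s 4 = neg_pow s 2 * neg_pow s 2"
  using neg_pow_mult[of s 2 2] by simp

theorem Refl_formulas:
  assumes s: "Re s > 1"
  shows
    "Refl_converges d I s \<and>
     dirichlet_converges (ambiguous_class_count d I) s \<and>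
     dirichlet_converges (class_count d I (ram_classes d)) s \<and>
     dirichlet_converges (class_count d I (ortho_classes d)) s \<and>
     dirichlet_converges (class_count d I (ram_classes d - ortho_classes d)) s \<and>
     (d mod 4 = 1 \<longrightarrow>
        Refl_zeta d I s =
          (1 - 2 powr (- s) + 2 * 2 powr (- 2 * s)) * riemann_zeta s ^ 2
            / (2 * riemann_zeta (2 * s) * ram_prod d s)
            * dirichlet_series (ambiguous_class_count d I) s) \<and>
     (d mod 4 = 2 \<longrightarrow>
        Refl_zeta d I s =
          (1 - 2 powr (- s) + 2 * 2 powr (- 2 * s)) * riemann_zeta s ^ 2
            / (2 * riemann_zeta (2 * s) * ram_prod d s)
            * dirichlet_series (ambiguous_class_count d I) s
          + (2 powr (- s) - 2 powr (- 2 * s)) * riemann_zeta s ^ 2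
            / (riemann_zeta (2 * s) * ram_prod d s)
            * dirichlet_series (class_count d I (ram_classes d)) s) \<and>
     (d mod 4 = 3 \<longrightarrow>
        Refl_zeta d I s =
          (1 - 2 powr (- s) + 2 * 2 powr (- 2 * s)) * riemann_zeta s ^ 2
            / (2 * riemann_zeta (2 * s) * ram_prod d s)
            * dirichlet_series (ambiguous_class_count d I) s
          + 2 powr (- s) * riemann_zeta s ^ 2
            / (riemann_zeta (2 * s) * ram_prod d s)
            * dirichlet_series (class_count d I (ortho_classes d)) s
          - 2 powr (- 2 * s) * riemann_zeta s ^ 2
            / (riemann_zeta (2 * s) * ram_prod d s)
            * dirichlet_series (class_count d I (ram_classes d - ortho_classes d)) s)"
proof -
  let ?D = "\<lambda>S. infsum (\<lambda>n. of_nat (card (amb_classes n \<inter> S)) * neg_pow s n) {1..}"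
  let ?S = "ortho_classes d"
  \<comment> \<open>All four counts take the form card (\<open>amb_classes n\<close> \<inter> S).
    The first two both have S = \<open>UNIV\<close>, since ambiguous classes are those generated by
    ramified primes.\<close>
  have c1: "\<And>n. ambiguous_class_count d I n = card (amb_classes n \<inter> UNIV)" by (simp add: ambiguous_amb_classes)
  have c2: "\<And>n. class_count d I (ram_classes d) n = card (amb_classes n \<inter> UNIV)"
    using amb_classes_ram by (simp add: class_count_amb_classes inf_absorb1)
  have c3: "\<And>n. class_count d I ?S n = card (amb_classes n \<inter> ?S)"
    by (rule class_count_amb_classes[OF ortho_subset_ram])
  have c4: "\<And>n. class_count d I (ram_classes d - ?S) n = card (amb_classes n \<inter> - ?S)"
  proof -
    fix n
    have "amb_classes n \<inter> (ram_classes d - ?S) = amb_classes n \<inter> - ?S" using amb_classes_ram by blast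
    thus "class_count d I (ram_classes d - ?S) n = card (amb_classes n \<inter> - ?S)" by (simp add: class_count_amb_classes)
  qed
  note D = dirichlet_amb_classes(1)[OF c1] dirichlet_amb_classes(1)[OF c2] dirichlet_amb_classes(1)[OF c3] dirichlet_amb_classes(1)[OF c4]
  note E = dirichlet_amb_classes(2)[OF c1] dirichlet_amb_classes(2)[OF c2] dirichlet_amb_classes(2)[OF c3] dirichlet_amb_classes(2)[OF c4]
  note conv = count_converges[OF s]
  define t where "t = neg_pow s 2"
  have t1: "1 + t \<noteq> 0" using neg_pow_ne_1(2)[of s 2] s by (simp add: t_def)
  define Z where "Z = riemann_zeta s ^ 2 / riemann_zeta (2 * s)"
  define Q where "Q = (\<Prod>p\<in>primes_d. 1 + neg_pow s p)"
  have zeta_factor: "zeta_factor s = Z / Q" by (simp add: zeta_factor_def Z_def Q_def)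
  have rp: "ram_prod d s = (if d mod 4 = 3 then (1 + t) * Q else Q)"
    unfolding ram_prod_eq by (simp add: Q_def t_def)
  have Dsplit: "?D UNIV = ?D ?S + ?D (- ?S)"
  proof -
    have "card (amb_classes n) = card (amb_classes n \<inter> ?S) + card (amb_classes n \<inter> - ?S)" for n
    proof -
      have "card (amb_classes n \<inter> ?S \<union> amb_classes n \<inter> - ?S) = card (amb_classes n \<inter> ?S) + card (amb_classes n \<inter> - ?S)"
        using finite_amb_classes by (intro card_Un_disjoint) auto
      moreover have "amb_classes n \<inter> ?S \<union> amb_classes n \<inter> - ?S = amb_classes n" by blast
      ultimately show ?thesis by simp
    qed
    hence "?D UNIV = infsum (\<lambda>n. of_nat (card (amb_classes n \<inter> ?S)) * neg_pow s n + of_nat (card (amb_classes n \<inter> - ?S)) * neg_pow s n) {1..}"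
      by (simp add: distrib_right)
    also have "\<dots> = ?D ?S + ?D (- ?S)" by (intro infsum_add conv)
    finally show ?thesis .
  qed
  have R0: "Refl_zeta d I s = x / 2 * ?D UNIV" if "\<And>C. class_weight s C = x" for x
    unfolding Refl_sum(2)[OF s] using infsum_class_term[OF s, of UNIV x x] that by simp
  have A1: "Refl_zeta d I s = (1 - t + 2 * (t * t)) * riemann_zeta s ^ 2
            / (2 * riemann_zeta (2 * s) * ram_prod d s) * ?D UNIV" if d: "d mod 4 = 1"
  proof -
    have "(1 - t) / (1 + t) + t * t * (2 * t / (1 + t)) = (1 - t + t * t * (2 * t)) / (1 + t)"
      by (simp add: add_divide_distrib)
    also have "1 - t + t * t * (2 * t) = (1 + t) * (1 - 2 * t + 2 * (t * t))" by (simp add: algebra_simps)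
    also have "\<dots> / (1 + t) = 1 - 2 * t + 2 * (t * t)" using t1 by simp
    finally have "t + ((1 - t) / (1 + t) + t * t * (2 * t / (1 + t))) = 1 - t + 2 * (t * t)" by simp
    hence "t + (1 - t) / (1 + t) + t * t * (2 * t / (1 + t)) = 1 - t + 2 * (t * t)" by (simp only: add.assoc)
    hence "class_weight s C = zeta_factor s * (1 - t + 2 * (t * t))" for C
      using d by (simp add: class_weight_def neg_pow_4 t_def)
    from R0[OF this] show ?thesis using d by (simp add: rp zeta_factor Z_def mult_ac)
  qed
  have A2: "Refl_zeta d I s = (1 - t + 2 * (t * t)) * riemann_zeta s ^ 2
            / (2 * riemann_zeta (2 * s) * ram_prod d s) * ?D UNIV
          + (t - t * t) * riemann_zeta s ^ 2 / (riemann_zeta (2 * s) * ram_prod d s) * ?D UNIV"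
    if d: "d mod 4 = 2"
  proof -
    have "class_weight s C = zeta_factor s * (1 + t)" for C
      using d by (simp add: class_weight_def t_def)
    from R0[OF this] have "Refl_zeta d I s = zeta_factor s * (1 + t) / 2 * ?D UNIV" .
    \<comment> \<open>This is 1 + t = (1 - t + 2t^2) + 2(t - t^2).\<close>
    also have "zeta_factor s * (1 + t) / 2 = (1 - t + 2 * (t * t)) * (Z / (2 * Q)) + (t - t * t) * (Z / Q)"
      by (simp add: zeta_factor algebra_simps add_divide_distrib)
    finally show ?thesis using d by (simp add: rp Z_def distrib_right)
  qed
  have A3: "Refl_zeta d I s = (1 - t + 2 * (t * t)) * riemann_zeta s ^ 2
            / (2 * riemann_zeta (2 * s) * ram_prod d s) * ?D UNIV
          + t * riemann_zeta s ^ 2 / (riemann_zeta (2 * s) * ram_prod d s) * ?D ?S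
          - t * t * riemann_zeta s ^ 2 / (riemann_zeta (2 * s) * ram_prod d s) * ?D (- ?S)"
    if d: "d mod 4 = 3"
  proof -
    let ?P = "Z / ((1 + t) * Q)"
    \<comment> \<open>The factor 1 + t of the ramified prime 2 clears the denominators left by the
      parity sums.\<close>
    have P: "zeta_factor s = ?P * (1 + t)" unfolding zeta_factor using t1 by simp
    have w: "class_weight s C = (if C \<in> ?S then ?P * (1 + t + 2 * (t * t)) else ?P * (1 - t))" for C
    proof -
      have "(1 + t) * (t * (2 * t / (1 + t))) = t * (2 * t)" using t1 by simp
      hence "(1 + t) * (1 + t * (2 * t / (1 + t))) = (1 + t) + t * (2 * t)"
        by (simp only: distrib_left[of "1 + t" 1] mult_1_right)
      hence "(1 + t) * (1 + t * (2 * t / (1 + t))) = 1 + t + 2 * (t * t)" by simp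
      moreover have "(1 + t) * ((1 - t) / (1 + t)) = 1 - t" using t1 by simp
      moreover have "class_weight s C = ?P * ((1 + t) * (if C \<in> ?S then 1 + t * (2 * t / (1 + t)) else (1 - t) / (1 + t)))"
        unfolding class_weight_def t_def[symmetric] P mult.assoc using d by simp
      ultimately show ?thesis by (cases "C \<in> ?S") (simp_all only: if_True if_False)
    qed
    have g: "(2 * x * u + 2 * y * v) / 4 = x / 2 * u + y / 2 * v" for x y u v :: complex
      by (simp add: add_divide_distrib mult_ac)
    \<comment> \<open>Relative to 1 - t + 2t^2 the weights 1 + t + 2t^2 and 1 - t differ by 2t and
      -2t^2, the two corrections in the third formula.\<close>
    have g2: "p * (1 + t + 2 * (t * t)) / 2 * u + p * (1 - t) / 2 * v
        = p * (1 - t + 2 * (t * t)) / 2 * (u + v) + p * t * u - p * (t * t) * v" for p u v :: complex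
      by (simp add: field_simps)
    have "Refl_zeta d I s = ?P * (1 + t + 2 * (t * t)) / 2 * ?D ?S + ?P * (1 - t) / 2 * ?D (- ?S)"
      unfolding Refl_sum(2)[OF s] infsum_class_term[OF s w] by (rule g)
    also have "\<dots> = ?P * (1 - t + 2 * (t * t)) / 2 * (?D ?S + ?D (- ?S)) + ?P * t * ?D ?S - ?P * (t * t) * ?D (- ?S)"
      by (rule g2)
    finally show ?thesis using d unfolding Dsplit by (simp add: rp Z_def mult_ac)
  qed
  show ?thesis
    unfolding D E two_powr t_def[symmetric] using Refl_sum(1)[OF s] conv A1 A2 A3 by blast
qed

end

theorem theorem5p9:
  fixes d :: int and I :: "complex set" and s :: complex
  assumes "d < 0" and "squarefree d" and "d \<noteq> -1" and "d \<noteq> -3"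
    and "fractional_ideal d I"
    and "Re s > 1"
  shows
    "Refl_converges d I s \<and>
     dirichlet_converges (ambiguous_class_count d I) s \<and>
     dirichlet_converges (class_count d I (ram_classes d)) s \<and>
     dirichlet_converges (class_count d I (ortho_classes d)) s \<and>
     dirichlet_converges (class_count d I (ram_classes d - ortho_classes d)) s \<and>
     (d mod 4 = 1 \<longrightarrow>
        Refl_zeta d I s =
          (1 - 2 powr (- s) + 2 * 2 powr (- 2 * s)) * riemann_zeta s ^ 2
            / (2 * riemann_zeta (2 * s) * ram_prod d s)
            * dirichlet_series (ambiguous_class_count d I) s) \<and>
     (d mod 4 = 2 \<longrightarrow>
        Refl_zeta d I s =
          (1 - 2 powr (- s) + 2 * 2 powr (- 2 * s)) * riemann_zeta s ^ 2
            / (2 * riemann_zeta (2 * s) * ram_prod d s)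
            * dirichlet_series (ambiguous_class_count d I) s
          + (2 powr (- s) - 2 powr (- 2 * s)) * riemann_zeta s ^ 2
            / (riemann_zeta (2 * s) * ram_prod d s)
            * dirichlet_series (class_count d I (ram_classes d)) s) \<and>
     (d mod 4 = 3 \<longrightarrow>
        Refl_zeta d I s =
          (1 - 2 powr (- s) + 2 * 2 powr (- 2 * s)) * riemann_zeta s ^ 2
            / (2 * riemann_zeta (2 * s) * ram_prod d s)
            * dirichlet_series (ambiguous_class_count d I) s
          + 2 powr (- s) * riemann_zeta s ^ 2
            / (riemann_zeta (2 * s) * ram_prod d s)
            * dirichlet_series (class_count d I (ortho_classes d)) s
          - 2 powr (- 2 * s) * riemann_zeta s ^ 2
            / (riemann_zeta (2 * s) * ram_prod d s)
            * dirichlet_series (class_count d I (ram_classes d - ortho_classes d)) s)"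
proof -
  interpret imag_quad d by unfold_locales (use assms in auto)
  interpret quad_ideal d I by unfold_locales (use assms fractional_ideal_iff_frac_ideal in auto)
  show ?thesis by (rule Refl_formulas[OF assms(6)])
qed

end
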